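(* Let $\Sigma$ be a non-degenerate even lattice over $\mathbb{Z}$ and let $\Lambda=\mathrm{U}\oplus\Sigma$. For a prime $p$ put $\Lambda_p=\Lambda\otimes\mathbb{Z}_p$. Then: (1') if $\Sigma$ is indefinite, then $\mathrm{W}^\pm(\Lambda)=\bigcap_p\big(\mathrm{W}^\pm(\Lambda_p)\cap\mathrm{SO}(\Lambda)\big)$ when $\mathrm{W}^\pm(\Lambda)$ is a congruence subgroup; (2') $\mathrm{W}(\Lambda_p)=\widetilde{\mathrm{O}}(\Lambda_p)$ for all primes $p$; (3') $\mathrm{W}^\pm(\Lambda_p)=\widetilde{\mathrm{SO}}^\dagger(\Lambda_p)$ for all primes $p$.
   Context: Let $A=\mathbb{Z}$ or $\mathbb{Z}_p$ with fraction field $B$, and let $\Lambda$ be an even lattice over $A$ with bilinear form $(-,-)$ and $q(x)=\frac12(x,x)$. $\mathrm{O}(\Lambda)$ is the orthogonal group, $\mathrm{SO}(\Lambda)$ the special orthogonal group, $\widetilde{\mathrm{O}}(\Lambda)\subseteq\mathrm{O}(\Lambda)$ the subgroup acting trivially on the discriminant group $\Lambda^\vee/\Lambda$. For $b\in\Lambda$ with $q(b)\in A^\times$, $s_b(x)=x-(x,b)q(b)^{-1}b$. The spinor norm $\mathrm{O}(\Lambda)\to B^\times/(B^\times)^2$ sends $s_b$ to $q(b)$; $\mathrm{O}^\dagger(\Lambda)$ is the subgroup of elements of spinor norm $1$, and $\widetilde{\mathrm{SO}}^\dagger(\Lambda)=\mathrm{SO}(\Lambda)\cap\widetilde{\mathrm{O}}(\Lambda)\cap\mathrm{O}^\dagger(\Lambda)$.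 $\mathrm{R}(\Lambda)$ is the group generated by all $s_v$ with $q(v)\in A^\times$; $\mathrm{R}^\pm(\Lambda)$ is the group generated by the products $s_a\circ s_b$ with $q(a)=q(b)=1$ or $q(a)=q(b)=-1$. $\mathrm{U}$ is the hyperbolic plane with standard basis $e,f$ ($e^2=f^2=0$, $(e,f)=1$). For $\Lambda=\mathrm{U}\oplus\Sigma$ and $b\in\Sigma$ define $\psi_b\in\mathrm{O}(\Lambda)$ by $\psi_b(re+sf+z)=((b,z)-r+q(b)s)e-sf+z+sb$ ($r,s\in A$, $z\in\Sigma$), and for $a\in\Lambda$ with $q(a)=\pm1$ put $\psi_{b,a}=s_a\circ\psi_b\circ s_a$. $\mathrm{W}(\Lambda)\subseteq\mathrm{O}(\Lambda)$ is the subgroup generated by $\mathrm{R}(\Lambda)$ and all $\psi_{b,a}$; $\mathrm{W}^\pm(\Lambda)\subseteq\mathrm{SO}(\Lambda)$ is the subgroup generated by $\mathrm{R}^\pm(\Lambda)$ and all products of an even number of elements $\psi_{b,a}$. (The same definitions apply to $\Lambda_p=\mathrm{U}\oplus\Sigma_p$ over $\mathbb{Z}_p$.) A subgroup of $\mathrm{SO}(\Lambda)$ is a congruence subgroup if it contains the principal congruence subgroup $\{g\in\mathrm{SO}(\Lambda): g\equiv\mathrm{id}\bmod m\}$ for some $m\ge1$. *)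

theory Defs
  imports
    "HOL-Computational_Algebra.Primes"
    "HOL-Combinatorics.Permutations"
    "HOL-Algebra.Module"
    "HOL-Algebra.IntRing"
    "HOL-Algebra.Bij"
    "HOL-Algebra.Coset"
    "HOL-Algebra.Generated_Groups"
begin

section \<open>The $p$-adic integers and fraction fields\<close>

text \<open>An element of $\mathbf{Z}_p$ is the sequence of its reduced residues modulo $p^k$, so that
  equality of elements is equality of sequences.\<close>

definition padic_int :: "nat \<Rightarrow> (nat \<Rightarrow> int) ring" where
  "padic_int p =
     \<lparr>carrier = {x. \<forall>k. x k \<in> {0..<int p ^ k} \<and> x (Suc k) mod int p ^ k = x k},
      mult = (\<lambda>x y k. (x k * y k) mod int p ^ k),
      one = (\<lambda>k. 1 mod int p ^ k),
      zero = (\<lambda>k. 0),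
      add = (\<lambda>x y k. (x k + y k) mod int p ^ k)\<rparr>"

definition padic_of_int :: "nat \<Rightarrow> int \<Rightarrow> (nat \<Rightarrow> int)" where
  "padic_of_int p m = (\<lambda>k. m mod int p ^ k)"

definition frac_rel :: "('a, 'm) ring_scheme \<Rightarrow> (('a \<times> 'a) \<times> ('a \<times> 'a)) set" where
  "frac_rel R = {((a, b), (c, d)) | a b c d.
     a \<in> carrier R \<and> b \<in> carrier R - {\<zero>\<^bsub>R\<^esub>} \<and> c \<in> carrier R \<and> d \<in> carrier R - {\<zero>\<^bsub>R\<^esub>} \<and>
     a \<otimes>\<^bsub>R\<^esub> d = c \<otimes>\<^bsub>R\<^esub> b}"

definition frac :: "('a, 'm) ring_scheme \<Rightarrow> 'a \<Rightarrow> 'a \<Rightarrow> ('a \<times> 'a) set" where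
  "frac R a b = frac_rel R `` {(a, b)}"

definition fraction_field :: "('a, 'm) ring_scheme \<Rightarrow> ('a \<times> 'a) set ring" where
  "fraction_field R =
     \<lparr>carrier = (carrier R \<times> (carrier R - {\<zero>\<^bsub>R\<^esub>})) // frac_rel R,
      mult = (\<lambda>X Y. \<Union>(a, b)\<in>X. \<Union>(c, d)\<in>Y. frac R (a \<otimes>\<^bsub>R\<^esub> c) (b \<otimes>\<^bsub>R\<^esub> d)),
      one = frac R \<one>\<^bsub>R\<^esub> \<one>\<^bsub>R\<^esub>,
      zero = frac R \<zero>\<^bsub>R\<^esub> \<one>\<^bsub>R\<^esub>,
      add = (\<lambda>X Y. \<Union>(a, b)\<in>X. \<Union>(c, d)\<in>Y.
               frac R ((a \<otimes>\<^bsub>R\<^esub> d) \<oplus>\<^bsub>R\<^esub> (c \<otimes>\<^bsub>R\<^esub> b)) (b \<otimes>\<^bsub>R\<^esub> d))\<rparr>"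

definition to_frac :: "('a, 'm) ring_scheme \<Rightarrow> 'a \<Rightarrow> ('a \<times> 'a) set" where
  "to_frac R a = frac R a \<one>\<^bsub>R\<^esub>"


section \<open>Lattices in coordinates\<close>

text \<open>A lattice of rank $n$ over $R$ is $R^n$ together with the bilinear form given by a Gram matrix
  $G$ with entries in $R$; only the entries of $G$ with indices below $n$ matter. Base change along
  a ring homomorphism $\iota$ keeps $n$ and applies $\iota$ to the entries of $G$.\<close>

definition coord_module :: "('a, 'm) ring_scheme \<Rightarrow> nat \<Rightarrow> ('a, nat \<Rightarrow> 'a) module" where
  "coord_module R n =
     \<lparr>carrier = {..<n} \<rightarrow>\<^sub>E carrier R, mult = undefined, one = undefined,
      zero = (\<lambda>i\<in>{..<n}. \<zero>\<^bsub>R\<^esub>),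
      add = (\<lambda>x y. \<lambda>i\<in>{..<n}. x i \<oplus>\<^bsub>R\<^esub> y i),
      smult = (\<lambda>a x. \<lambda>i\<in>{..<n}. a \<otimes>\<^bsub>R\<^esub> x i)\<rparr>"

definition unit_vec :: "('a, 'm) ring_scheme \<Rightarrow> nat \<Rightarrow> nat \<Rightarrow> (nat \<Rightarrow> 'a)" where
  "unit_vec R n j = (\<lambda>i\<in>{..<n}. if i = j then \<one>\<^bsub>R\<^esub> else \<zero>\<^bsub>R\<^esub>)"

definition map_vec :: "('a \<Rightarrow> 'b) \<Rightarrow> nat \<Rightarrow> (nat \<Rightarrow> 'a) \<Rightarrow> (nat \<Rightarrow> 'b)" where
  "map_vec \<iota> n x = (\<lambda>i\<in>{..<n}. \<iota> (x i))"

definition map_gram :: "('a \<Rightarrow> 'b) \<Rightarrow> (nat \<Rightarrow> nat \<Rightarrow> 'a) \<Rightarrow> (nat \<Rightarrow> nat \<Rightarrow> 'b)" where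
  "map_gram \<iota> G = (\<lambda>i j. \<iota> (G i j))"

definition bform ::
  "('a, 'm) ring_scheme \<Rightarrow> nat \<Rightarrow> (nat \<Rightarrow> nat \<Rightarrow> 'a) \<Rightarrow> (nat \<Rightarrow> 'a) \<Rightarrow> (nat \<Rightarrow> 'a) \<Rightarrow> 'a" where
  "bform R n G x y =
     (\<Oplus>\<^bsub>R\<^esub>i\<in>{..<n}. \<Oplus>\<^bsub>R\<^esub>j\<in>{..<n}. (x i \<otimes>\<^bsub>R\<^esub> G i j) \<otimes>\<^bsub>R\<^esub> y j)"

text \<open>$q(x) = \frac12 (x,x)$; the half is unique because the rings used here are domains of
  characteristic $0$, and it exists in $R$ because the lattices are even.\<close>

definition qform ::
  "('a, 'm) ring_scheme \<Rightarrow> nat \<Rightarrow> (nat \<Rightarrow> nat \<Rightarrow> 'a) \<Rightarrow> (nat \<Rightarrow> 'a) \<Rightarrow> 'a" where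
  "qform R n G x = (THE a. a \<in> carrier R \<and> a \<oplus>\<^bsub>R\<^esub> a = bform R n G x x)"

definition even_lattice :: "('a, 'm) ring_scheme \<Rightarrow> nat \<Rightarrow> (nat \<Rightarrow> nat \<Rightarrow> 'a) \<Rightarrow> bool" where
  "even_lattice R n G \<longleftrightarrow>
     (\<forall>i<n. \<forall>j<n. G i j \<in> carrier R \<and> G i j = G j i) \<and>
     (\<forall>x\<in>carrier (coord_module R n). \<exists>a\<in>carrier R. bform R n G x x = a \<oplus>\<^bsub>R\<^esub> a)"

definition nondegenerate :: "('a, 'm) ring_scheme \<Rightarrow> nat \<Rightarrow> (nat \<Rightarrow> nat \<Rightarrow> 'a) \<Rightarrow> bool" where
  "nondegenerate R n G \<longleftrightarrow>
     (\<forall>x\<in>carrier (coord_module R n).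
        (\<forall>y\<in>carrier (coord_module R n). bform R n G x y = \<zero>\<^bsub>R\<^esub>) \<longrightarrow>
        x = \<zero>\<^bsub>coord_module R n\<^esub>)"

definition indefinite :: "nat \<Rightarrow> (nat \<Rightarrow> nat \<Rightarrow> int) \<Rightarrow> bool" where
  "indefinite n G \<longleftrightarrow>
     (\<exists>x\<in>carrier (coord_module \<Z> n). bform \<Z> n G x x > 0) \<and>
     (\<exists>x\<in>carrier (coord_module \<Z> n). bform \<Z> n G x x < 0)"


section \<open>Orthogonal groups\<close>

text \<open>All groups are subgroups of \<^term>\<open>BijGroup (carrier (coord_module R n))\<close>, so their
  elements are functions that are \<^const>\<open>undefined\<close> outside the lattice.\<close>

definition orth :: "('a, 'm) ring_scheme \<Rightarrow> nat \<Rightarrow> (nat \<Rightarrow> nat \<Rightarrow> 'a) \<Rightarrow> ((nat \<Rightarrow> 'a) \<Rightarrow> (nat \<Rightarrow> 'a)) set"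
  where
  "orth R n G = (let V = coord_module R n in
     {g \<in> Bij (carrier V).
        (\<forall>x\<in>carrier V. \<forall>y\<in>carrier V. g (x \<oplus>\<^bsub>V\<^esub> y) = g x \<oplus>\<^bsub>V\<^esub> g y) \<and>
        (\<forall>a\<in>carrier R. \<forall>x\<in>carrier V. g (a \<odot>\<^bsub>V\<^esub> x) = a \<odot>\<^bsub>V\<^esub> g x) \<and>
        (\<forall>x\<in>carrier V. \<forall>y\<in>carrier V. bform R n G (g x) (g y) = bform R n G x y)})"

definition matrix_of :: "('a, 'm) ring_scheme \<Rightarrow> nat \<Rightarrow> ((nat \<Rightarrow> 'a) \<Rightarrow> (nat \<Rightarrow> 'a)) \<Rightarrow> nat \<Rightarrow> nat \<Rightarrow> 'a"
  where
  "matrix_of R n g i j = g (unit_vec R n j) i"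

definition det_endo :: "('a, 'm) ring_scheme \<Rightarrow> nat \<Rightarrow> ((nat \<Rightarrow> 'a) \<Rightarrow> (nat \<Rightarrow> 'a)) \<Rightarrow> 'a" where
  "det_endo R n g =
     (\<Oplus>\<^bsub>R\<^esub>\<sigma>\<in>{\<sigma>. \<sigma> permutes {..<n}}.
        [sign \<sigma>] \<cdot>\<^bsub>R\<^esub> (\<Otimes>\<^bsub>R\<^esub>i\<in>{..<n}. matrix_of R n g i (\<sigma> i)))"

definition special_orth ::
  "('a, 'm) ring_scheme \<Rightarrow> nat \<Rightarrow> (nat \<Rightarrow> nat \<Rightarrow> 'a) \<Rightarrow> ((nat \<Rightarrow> 'a) \<Rightarrow> (nat \<Rightarrow> 'a)) set" where
  "special_orth R n G = {g \<in> orth R n G. det_endo R n g = \<one>\<^bsub>R\<^esub>}"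

text \<open>The base change $g \otimes_R S$ of a linear endomorphism $g$ of $R^n$ along
  $\iota : R \to S$.\<close>

definition base_change ::
  "('a, 'm) ring_scheme \<Rightarrow> ('b, 'k) ring_scheme \<Rightarrow> ('a \<Rightarrow> 'b) \<Rightarrow> nat \<Rightarrow>
     ((nat \<Rightarrow> 'a) \<Rightarrow> (nat \<Rightarrow> 'a)) \<Rightarrow> ((nat \<Rightarrow> 'b) \<Rightarrow> (nat \<Rightarrow> 'b))" where
  "base_change R S \<iota> n g =
     (\<lambda>x\<in>carrier (coord_module S n). \<lambda>i\<in>{..<n}.
        \<Oplus>\<^bsub>S\<^esub>j\<in>{..<n}. \<iota> (matrix_of R n g i j) \<otimes>\<^bsub>S\<^esub> x j)"

definition dual_lattice ::
  "('a, 'm) ring_scheme \<Rightarrow> nat \<Rightarrow> (nat \<Rightarrow> nat \<Rightarrow> 'a) \<Rightarrow> (nat \<Rightarrow> ('a \<times> 'a) set) set" where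
  "dual_lattice R n G = (let B = fraction_field R in
     {x \<in> carrier (coord_module B n). \<forall>y\<in>carrier (coord_module R n).
        bform B n (map_gram (to_frac R) G) x (map_vec (to_frac R) n y) \<in> to_frac R ` carrier R})"

definition discr_orth ::
  "('a, 'm) ring_scheme \<Rightarrow> nat \<Rightarrow> (nat \<Rightarrow> nat \<Rightarrow> 'a) \<Rightarrow> ((nat \<Rightarrow> 'a) \<Rightarrow> (nat \<Rightarrow> 'a)) set" where
  "discr_orth R n G = (let B = fraction_field R in
     {g \<in> orth R n G. \<forall>x\<in>dual_lattice R n G. \<exists>y\<in>carrier (coord_module R n).
        base_change R B (to_frac R) n g x = x \<oplus>\<^bsub>coord_module B n\<^esub> map_vec (to_frac R) n y})"

text \<open>$s_b(x) = x - (x,b)\,q(b)^{-1}\,b$, meant for $q(b)$ a unit of $R$.\<close>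

definition reflection ::
  "('a, 'm) ring_scheme \<Rightarrow> nat \<Rightarrow> (nat \<Rightarrow> nat \<Rightarrow> 'a) \<Rightarrow> (nat \<Rightarrow> 'a) \<Rightarrow> ((nat \<Rightarrow> 'a) \<Rightarrow> (nat \<Rightarrow> 'a))" where
  "reflection R n G b =
     (\<lambda>x\<in>carrier (coord_module R n). \<lambda>i\<in>{..<n}.
        x i \<ominus>\<^bsub>R\<^esub> (bform R n G x b \<otimes>\<^bsub>R\<^esub> inv\<^bsub>R\<^esub> (qform R n G b)) \<otimes>\<^bsub>R\<^esub> b i)"

definition unit_norm_vectors ::
  "('a, 'm) ring_scheme \<Rightarrow> nat \<Rightarrow> (nat \<Rightarrow> nat \<Rightarrow> 'a) \<Rightarrow> (nat \<Rightarrow> 'a) set" where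
  "unit_norm_vectors R n G = {v \<in> carrier (coord_module R n). qform R n G v \<in> Units R}"

definition prod_of :: "('g, 'm) monoid_scheme \<Rightarrow> 'g list \<Rightarrow> 'g" where
  "prod_of M xs = foldr (\<lambda>x y. x \<otimes>\<^bsub>M\<^esub> y) xs \<one>\<^bsub>M\<^esub>"

text \<open>The class of $a$ in $K^\times/(K^\times)^2$.\<close>

definition square_class :: "('a, 'm) ring_scheme \<Rightarrow> 'a \<Rightarrow> 'a set" where
  "square_class K a = {c \<otimes>\<^bsub>K\<^esub> c | c. c \<in> Units K} #>\<^bsub>units_of K\<^esub> a"

text \<open>The spinor norm is the homomorphism sending a reflection $s_v$ in an anisotropic vector $v$ of
  the quadratic space over the fraction field $B$ to the class of $q(v)$. By Cartan and
  Dieudonne every isometry of a non-degenerate space is a product of such reflections (which may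
  involve vectors whose reflections do not preserve the lattice), and the resulting class does not
  depend on the factorization.\<close>

definition spinor_norm ::
  "('a, 'm) ring_scheme \<Rightarrow> nat \<Rightarrow> (nat \<Rightarrow> nat \<Rightarrow> 'a) \<Rightarrow> ((nat \<Rightarrow> 'a) \<Rightarrow> (nat \<Rightarrow> 'a)) \<Rightarrow>
     ('a \<times> 'a) set set" where
  "spinor_norm R n G g =
     (let B = fraction_field R; G\<^sub>B = map_gram (to_frac R) G in
      THE c. \<exists>vs. set vs \<subseteq> unit_norm_vectors B n G\<^sub>B \<and>
        base_change R B (to_frac R) n g =
          prod_of (BijGroup (carrier (coord_module B n))) (map (reflection B n G\<^sub>B) vs) \<and>
        c = square_class B (prod_of B (map (qform B n G\<^sub>B) vs)))"

definition orth_dagger ::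
  "('a, 'm) ring_scheme \<Rightarrow> nat \<Rightarrow> (nat \<Rightarrow> nat \<Rightarrow> 'a) \<Rightarrow> ((nat \<Rightarrow> 'a) \<Rightarrow> (nat \<Rightarrow> 'a)) set" where
  "orth_dagger R n G =
     {g \<in> orth R n G.
        spinor_norm R n G g = square_class (fraction_field R) \<one>\<^bsub>fraction_field R\<^esub>}"

definition discr_special_orth_dagger ::
  "('a, 'm) ring_scheme \<Rightarrow> nat \<Rightarrow> (nat \<Rightarrow> nat \<Rightarrow> 'a) \<Rightarrow> ((nat \<Rightarrow> 'a) \<Rightarrow> (nat \<Rightarrow> 'a)) set" where
  "discr_special_orth_dagger R n G =
     special_orth R n G \<inter> discr_orth R n G \<inter> orth_dagger R n G"

text \<open>$\mathrm{R}(\Lambda)$ and $\mathrm{R}^\pm(\Lambda)$.\<close>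

definition refl_group ::
  "('a, 'm) ring_scheme \<Rightarrow> nat \<Rightarrow> (nat \<Rightarrow> nat \<Rightarrow> 'a) \<Rightarrow> ((nat \<Rightarrow> 'a) \<Rightarrow> (nat \<Rightarrow> 'a)) set" where
  "refl_group R n G =
     generate (BijGroup (carrier (coord_module R n))) (reflection R n G ` unit_norm_vectors R n G)"

definition refl_group_pm ::
  "('a, 'm) ring_scheme \<Rightarrow> nat \<Rightarrow> (nat \<Rightarrow> nat \<Rightarrow> 'a) \<Rightarrow> ((nat \<Rightarrow> 'a) \<Rightarrow> (nat \<Rightarrow> 'a)) set" where
  "refl_group_pm R n G =
     generate (BijGroup (carrier (coord_module R n)))
       {reflection R n G a \<otimes>\<^bsub>BijGroup (carrier (coord_module R n))\<^esub> reflection R n G b | a b.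
          a \<in> carrier (coord_module R n) \<and> b \<in> carrier (coord_module R n) \<and>
          (qform R n G a = \<one>\<^bsub>R\<^esub> \<and> qform R n G b = \<one>\<^bsub>R\<^esub> \<or>
           qform R n G a = \<ominus>\<^bsub>R\<^esub> \<one>\<^bsub>R\<^esub> \<and> qform R n G b = \<ominus>\<^bsub>R\<^esub> \<one>\<^bsub>R\<^esub>)}"


section \<open>The lattice $\mathrm{U} \oplus \Sigma$\<close>

text \<open>If $\Sigma$ has rank $n$ and Gram matrix $G$, then $\mathrm{U} \oplus \Sigma$ is $R^{n+2}$ with
  Gram matrix \<open>hyp_gram R G\<close>, and $re + sf + z$ is the vector \<open>hyp_vec n r s z\<close>.\<close>

definition hyp_gram :: "('a, 'm) ring_scheme \<Rightarrow> (nat \<Rightarrow> nat \<Rightarrow> 'a) \<Rightarrow> (nat \<Rightarrow> nat \<Rightarrow> 'a)" where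
  "hyp_gram R G i j =
     (if i < 2 \<and> j < 2 then (if i = j then \<zero>\<^bsub>R\<^esub> else \<one>\<^bsub>R\<^esub>)
      else if 2 \<le> i \<and> 2 \<le> j then G (i - 2) (j - 2)
      else \<zero>\<^bsub>R\<^esub>)"

definition hyp_vec :: "nat \<Rightarrow> 'a \<Rightarrow> 'a \<Rightarrow> (nat \<Rightarrow> 'a) \<Rightarrow> (nat \<Rightarrow> 'a)" where
  "hyp_vec n r s z = (\<lambda>i\<in>{..<n + 2}. if i = 0 then r else if i = 1 then s else z (i - 2))"

definition sigma_part :: "nat \<Rightarrow> (nat \<Rightarrow> 'a) \<Rightarrow> (nat \<Rightarrow> 'a)" where
  "sigma_part n x = (\<lambda>i\<in>{..<n}. x (i + 2))"

text \<open>$\psi_b(re + sf + z) = ((b,z) - r + q(b)s)e - sf + z + sb$. In this and the following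
  definitions \<open>n\<close> and \<open>G\<close> describe $\Sigma$.\<close>

definition psi ::
  "('a, 'm) ring_scheme \<Rightarrow> nat \<Rightarrow> (nat \<Rightarrow> nat \<Rightarrow> 'a) \<Rightarrow> (nat \<Rightarrow> 'a) \<Rightarrow> ((nat \<Rightarrow> 'a) \<Rightarrow> (nat \<Rightarrow> 'a))" where
  "psi R n G b =
     (\<lambda>x\<in>carrier (coord_module R (n + 2)).
        let r = x 0; s = x 1; z = sigma_part n x in
        hyp_vec n ((bform R n G b z \<ominus>\<^bsub>R\<^esub> r) \<oplus>\<^bsub>R\<^esub> (qform R n G b \<otimes>\<^bsub>R\<^esub> s))
          (\<ominus>\<^bsub>R\<^esub> s)
          (z \<oplus>\<^bsub>coord_module R n\<^esub> (s \<odot>\<^bsub>coord_module R n\<^esub> b)))"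

definition psi_conj ::
  "('a, 'm) ring_scheme \<Rightarrow> nat \<Rightarrow> (nat \<Rightarrow> nat \<Rightarrow> 'a) \<Rightarrow> (nat \<Rightarrow> 'a) \<Rightarrow> (nat \<Rightarrow> 'a) \<Rightarrow>
     ((nat \<Rightarrow> 'a) \<Rightarrow> (nat \<Rightarrow> 'a))" where
  "psi_conj R n G b a =
     (let M = BijGroup (carrier (coord_module R (n + 2)));
          s\<^sub>a = reflection R (n + 2) (hyp_gram R G) a
      in s\<^sub>a \<otimes>\<^bsub>M\<^esub> psi R n G b \<otimes>\<^bsub>M\<^esub> s\<^sub>a)"

definition psi_conjs ::
  "('a, 'm) ring_scheme \<Rightarrow> nat \<Rightarrow> (nat \<Rightarrow> nat \<Rightarrow> 'a) \<Rightarrow> ((nat \<Rightarrow> 'a) \<Rightarrow> (nat \<Rightarrow> 'a)) set" where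
  "psi_conjs R n G =
     {psi_conj R n G b a | b a.
        b \<in> carrier (coord_module R n) \<and> a \<in> carrier (coord_module R (n + 2)) \<and>
        (qform R (n + 2) (hyp_gram R G) a = \<one>\<^bsub>R\<^esub> \<or>
         qform R (n + 2) (hyp_gram R G) a = \<ominus>\<^bsub>R\<^esub> \<one>\<^bsub>R\<^esub>)}"

definition even_products :: "('g, 'm) monoid_scheme \<Rightarrow> 'g set \<Rightarrow> 'g set" where
  "even_products M S = {prod_of M xs | xs. set xs \<subseteq> S \<and> even (length xs)}"

definition W_group ::
  "('a, 'm) ring_scheme \<Rightarrow> nat \<Rightarrow> (nat \<Rightarrow> nat \<Rightarrow> 'a) \<Rightarrow> ((nat \<Rightarrow> 'a) \<Rightarrow> (nat \<Rightarrow> 'a)) set" where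
  "W_group R n G =
     generate (BijGroup (carrier (coord_module R (n + 2))))
       (refl_group R (n + 2) (hyp_gram R G) \<union> psi_conjs R n G)"

definition W_pm ::
  "('a, 'm) ring_scheme \<Rightarrow> nat \<Rightarrow> (nat \<Rightarrow> nat \<Rightarrow> 'a) \<Rightarrow> ((nat \<Rightarrow> 'a) \<Rightarrow> (nat \<Rightarrow> 'a)) set" where
  "W_pm R n G =
     (let M = BijGroup (carrier (coord_module R (n + 2))) in
      generate M (refl_group_pm R (n + 2) (hyp_gram R G) \<union> even_products M (psi_conjs R n G)))"


section \<open>Congruence subgroups\<close>

definition principal_congruence ::
  "nat \<Rightarrow> (nat \<Rightarrow> nat \<Rightarrow> int) \<Rightarrow> nat \<Rightarrow> ((nat \<Rightarrow> int) \<Rightarrow> (nat \<Rightarrow> int)) set" where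
  "principal_congruence n G m =
     {g \<in> special_orth \<Z> n G. \<forall>x\<in>carrier (coord_module \<Z> n). \<forall>i<n. g x i mod int m = x i mod int m}"

definition congruence_subgroup ::
  "nat \<Rightarrow> (nat \<Rightarrow> nat \<Rightarrow> int) \<Rightarrow> ((nat \<Rightarrow> int) \<Rightarrow> (nat \<Rightarrow> int)) set \<Rightarrow> bool" where
  "congruence_subgroup n G H \<longleftrightarrow>
     subgroup H (BijGroup (carrier (coord_module \<Z> n))) \<and> H \<subseteq> special_orth \<Z> n G \<and>
     (\<exists>m\<ge>1. principal_congruence n G m \<subseteq> H)"

end

theory Submission
  imports Defs "Jordan_Normal_Form.Determinant" "HOL-Number_Theory.Cong"
begin

text \<open>The theorem combines two computations over the $p$-adic integers with an approximation argument
over the integers. Two families of isometries of $\mathrm{U} \oplus \Sigma$ carry all of it: the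
Eichler transvections \<open>eichler_e b\<close> and \<open>eichler_f b\<close> along the two isotropic basis vectors, with
$b \in \Sigma$, and the rescalings \<open>hyp_scale u\<close>, which send $e$ to $ue$ and $f$ to $u^{-1}f$. Over
every domain without 2-torsion, $\mathrm{W}^\pm$ contains all transvections, because $\psi_{-b,a} \circ \psi_{0,a}$ with
$a = e - f$ is a transvection along $f$ and two reflections in vectors of norm $-1$ turn it into one
along $e$ (lemmas \<open>eichler_f_W_pm\<close>, \<open>eichler_e_W_pm\<close>). It also contains the rescalings by squares of
units (lemma \<open>hyp_scale_square_W_pm\<close>).

For the local groups, let $d$ be the determinant of the Gram matrix and let $X_k$ be the $k$-th row
of its adjugate, so that $(X_k, y) = d y_k$ and the vectors $d^{-1} X_k$ form a basis of
$\Sigma^\vee$. An isometry that acts trivially on the discriminant group moves each $X_k$ by an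
element of $d\Lambda$. Over a local ring, transvections undo this displacement for one $k$ after the
other without disturbing the vectors that are already in place (lemma \<open>fix_next\<close>). What remains
fixes all $X_k$, hence acts on $\mathrm{U}$ alone, and is a rescaling or the reflection in some
$e - uf$. As the converse inclusion is checked on generators, this decomposition determines
$\mathrm{W}(\Lambda_p)$. For $\mathrm{W}^\pm(\Lambda_p)$, the determinant excludes the reflection, and the
spinor norm of \<open>hyp_scale u\<close> is the class of $u$, which is trivial only if $u$ is the square of a
unit, because the $p$-adic integers are a valuation ring (lemma \<open>unit_square\<close>). Since the spinor norm
is the class of $\prod q(v_i)$ for an arbitrary factorization into reflections, one also needs that
this class is well defined (lemma \<open>refls_eq_norm\<close>). A product of reflections equal to the identity
yields an alternating matrix whose determinant is, up to squares, that product of norms, and the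
determinant of an alternating matrix is a square.

In the passage from local to global, every element of $\mathrm{W}^\pm(\Lambda_p)$ is a product of
transvections and one rescaling by a square. Modulo $p^k$, and keeping congruent to the identity
modulo a prescribed integer prime to $p$, transvections can be lifted to $\Lambda$ by the Chinese
remainder theorem. To lift rescalings, indefiniteness provides two orthogonal vectors of $\Sigma$
with non-zero norms. If $m$ is even and divisible by these norms, $m$ times their span represents
everything modulo any prime $l$ that does not divide $m$, so that there is a vector $le + \beta f + mz$ of norm one, and the product of its reflection with the one in
$e + f$ is congruent modulo $m$ to the rescaling by $l^2$ (lemmas \<open>diag_approx_prime\<close> and
\<open>local_approx\<close>). Gluing over the primes dividing $m$ shows that an isometry $g$ that is locally in
$\mathrm{W}^\pm$ is congruent modulo $m$ to an element $w$ of $\mathrm{W}^\pm(\Lambda)$ (lemma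
\<open>global_approx\<close>). If $\mathrm{W}^\pm(\Lambda)$ contains the principal congruence subgroup of some
level dividing $m$, then it contains $w^{-1} g$, and therefore $g$.\<close>

section \<open>Ring identities in the carrier of a commutative ring\<close>

text \<open>A commutative ring given as a record is not a type, whereas normalization of ring expressions and
determinants of matrices are matters of type classes. All commutative rings with elements in
\<open>'a\<close> are therefore put into one type: the product of all of them, with one factor of integers in
front, which makes the type a non-trivial ring whatever \<open>'a\<close> is.\<close>

typedef 'a cring_product =
  "UNIV \<times> (\<Pi>\<^sub>E R\<in>Collect cring. carrier R) :: (int \<times> ('a ring \<Rightarrow> 'a)) set"
proof (rule exI)
  show "(0, \<lambda>R\<in>Collect cring. \<zero>\<^bsub>R\<^esub>) \<in>
      UNIV \<times> (\<Pi>\<^sub>E R\<in>Collect cring. carrier R :: 'a set)"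
    by (intro SigmaI UNIV_I restrict_PiE_iff[THEN iffD2] ballI)
       (simp add: cring.cring_simprules(2))
qed

definition comp_at :: "'a ring \<Rightarrow> 'a cring_product \<Rightarrow> 'a" where
  "comp_at R t = snd (Rep_cring_product t) R"

definition int_comp :: "'a cring_product \<Rightarrow> int" where
  "int_comp t = fst (Rep_cring_product t)"

definition family :: "int \<Rightarrow> ('a ring \<Rightarrow> 'a) \<Rightarrow> 'a cring_product" where
  "family k x = Abs_cring_product (k, restrict x (Collect cring))"

lemma comp_at_closed [simp]: "cring R \<Longrightarrow> comp_at R t \<in> carrier R"
  using Rep_cring_product[of t] by (auto simp: comp_at_def PiE_iff mem_Times_iff)

lemma comp_at_family [simp]:
  assumes "\<And>S. cring S \<Longrightarrow> x S \<in> carrier S" and "cring R"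
  shows "comp_at R (family k x) = x R"
  using assms by (simp add: comp_at_def family_def Abs_cring_product_inverse)

lemma int_comp_family [simp]:
  assumes "\<And>S. cring S \<Longrightarrow> x S \<in> carrier S"
  shows "int_comp (family k x) = k"
  using assms by (simp add: int_comp_def family_def Abs_cring_product_inverse)

lemma cring_product_eqI:
  assumes "int_comp s = int_comp t" and "\<And>R. cring R \<Longrightarrow> comp_at R s = comp_at R t"
  shows "s = t"
proof -
  have "snd (Rep_cring_product s) = snd (Rep_cring_product t)"
    using Rep_cring_product[of s] Rep_cring_product[of t] assms(2)
    by (intro PiE_ext[of _ "Collect cring" carrier])
       (auto simp: comp_at_def mem_Times_iff)
  then show ?thesis
    using assms(1) by (metis Rep_cring_product_inject int_comp_def prod.expand)
qed

instantiation cring_product :: (type) comm_ring_1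
begin

definition "0 = family 0 (\<lambda>R. \<zero>\<^bsub>R\<^esub>)"
definition "1 = family 1 (\<lambda>R. \<one>\<^bsub>R\<^esub>)"
definition "s + t = family (int_comp s + int_comp t) (\<lambda>R. comp_at R s \<oplus>\<^bsub>R\<^esub> comp_at R t)"
definition "s * t = family (int_comp s * int_comp t) (\<lambda>R. comp_at R s \<otimes>\<^bsub>R\<^esub> comp_at R t)"
definition "- t = family (- int_comp t) (\<lambda>R. \<ominus>\<^bsub>R\<^esub> comp_at R t)"
definition "s - t = s + - (t :: 'a cring_product)"

lemma cring_simps:
  assumes "cring R"
  shows "\<zero>\<^bsub>R\<^esub> \<in> carrier R" "\<one>\<^bsub>R\<^esub> \<in> carrier R"
    "\<And>x y. x \<in> carrier R \<Longrightarrow> y \<in> carrier R \<Longrightarrow> x \<oplus>\<^bsub>R\<^esub> y \<in> carrier R"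
    "\<And>x y. x \<in> carrier R \<Longrightarrow> y \<in> carrier R \<Longrightarrow> x \<otimes>\<^bsub>R\<^esub> y \<in> carrier R"
    "\<And>x. x \<in> carrier R \<Longrightarrow> \<ominus>\<^bsub>R\<^esub> x \<in> carrier R"
proof -
  interpret cring R by fact
  show "\<zero>\<^bsub>R\<^esub> \<in> carrier R" "\<one>\<^bsub>R\<^esub> \<in> carrier R"
    "\<And>x y. x \<in> carrier R \<Longrightarrow> y \<in> carrier R \<Longrightarrow> x \<oplus>\<^bsub>R\<^esub> y \<in> carrier R"
    "\<And>x y. x \<in> carrier R \<Longrightarrow> y \<in> carrier R \<Longrightarrow> x \<otimes>\<^bsub>R\<^esub> y \<in> carrier R"
    "\<And>x. x \<in> carrier R \<Longrightarrow> \<ominus>\<^bsub>R\<^esub> x \<in> carrier R"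
    by simp_all
qed

lemma int_comp_simps [simp]:
  "int_comp 0 = 0" "int_comp 1 = 1" "int_comp (s + t) = int_comp s + int_comp t"
  "int_comp (s * t) = int_comp s * int_comp t" "int_comp (- t) = - int_comp t"
  by (simp_all add: zero_cring_product_def one_cring_product_def plus_cring_product_def
      times_cring_product_def uminus_cring_product_def cring_simps)

lemma comp_at_simps [simp]:
  assumes "cring R"
  shows "comp_at R 0 = \<zero>\<^bsub>R\<^esub>" "comp_at R 1 = \<one>\<^bsub>R\<^esub>"
    "comp_at R (s + t) = comp_at R s \<oplus>\<^bsub>R\<^esub> comp_at R t"
    "comp_at R (s * t) = comp_at R s \<otimes>\<^bsub>R\<^esub> comp_at R t"
    "comp_at R (- t) = \<ominus>\<^bsub>R\<^esub> comp_at R t"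
  using assms
  by (simp_all add: zero_cring_product_def one_cring_product_def plus_cring_product_def
      times_cring_product_def uminus_cring_product_def cring_simps)

instance
proof
  fix a b c :: "'a cring_product"
  show "a + b + c = a + (b + c)"
    by (rule cring_product_eqI) (simp_all add: ring.ring_simprules cring.axioms(1))
  show "a + b = b + a"
    by (rule cring_product_eqI) (simp_all add: cring.cring_simprules cring.axioms(1))
  show "0 + a = a"
    by (rule cring_product_eqI) (simp_all add: cring.cring_simprules)
  show "- a + a = 0"
    by (rule cring_product_eqI) (simp_all add: cring.cring_simprules)
  show "a - b = a + - b"
    by (simp add: minus_cring_product_def)
  show "a * b * c = a * (b * c)"
    by (rule cring_product_eqI) (simp_all add: cring.cring_simprules)
  show "a * b = b * a"
    by (rule cring_product_eqI) (simp_all add: cring.cring_simprules)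
  show "1 * a = a"
    by (rule cring_product_eqI) (simp_all add: cring.cring_simprules)
  show "(a + b) * c = a * c + b * c"
    by (rule cring_product_eqI) (simp_all add: cring.cring_simprules distrib_right)
  show "(0 :: 'a cring_product) \<noteq> 1"
    by (metis int_comp_simps(1,2) zero_neq_one)
qed

end

text \<open>The inclusion of one factor respects addition and multiplication but sends the unit to the
idempotent \<open>emb R \<one>\<close>. Statements about determinants below are therefore made relative to an
idempotent \<open>e\<close> that acts as the identity on all entries.\<close>

definition emb :: "'a ring \<Rightarrow> 'a \<Rightarrow> 'a cring_product" where
  "emb R x = family 0 (\<lambda>S. if S = R then x else \<zero>\<^bsub>S\<^esub>)"

context
  fixes R :: "'a ring" (structure)
  assumes R: "cring R"
begin

interpretation cring R by (fact R)

lemma int_comp_emb [simp]: "x \<in> carrier R \<Longrightarrow> int_comp (emb R x) = 0"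
  unfolding emb_def by (rule int_comp_family) (auto simp: cring_simps)

lemma comp_at_emb:
  "x \<in> carrier R \<Longrightarrow> cring S \<Longrightarrow> comp_at S (emb R x) = (if S = R then x else \<zero>\<^bsub>S\<^esub>)"
  unfolding emb_def by (rule comp_at_family) (auto simp: cring_simps)

lemma comp_at_emb_same [simp]: "x \<in> carrier R \<Longrightarrow> comp_at R (emb R x) = x"
  by (simp add: comp_at_emb R)

lemma emb_eq_iff: "x \<in> carrier R \<Longrightarrow> y \<in> carrier R \<Longrightarrow> emb R x = emb R y \<longleftrightarrow> x = y"
  by (metis comp_at_emb_same)

lemma emb_eqD: "emb R x = emb R y \<Longrightarrow> x \<in> carrier R \<Longrightarrow> y \<in> carrier R \<Longrightarrow> x = y"
  by (metis comp_at_emb_same)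

lemma emb_add: "x \<in> carrier R \<Longrightarrow> y \<in> carrier R \<Longrightarrow> emb R (x \<oplus> y) = emb R x + emb R y"
  by (rule cring_product_eqI) (auto simp: comp_at_emb cring.cring_simprules)

lemma emb_mult: "x \<in> carrier R \<Longrightarrow> y \<in> carrier R \<Longrightarrow> emb R (x \<otimes> y) = emb R x * emb R y"
  by (rule cring_product_eqI) (auto simp: comp_at_emb cring.cring_simprules)

lemma emb_uminus: "x \<in> carrier R \<Longrightarrow> emb R (\<ominus> x) = - emb R x"
  by (rule cring_product_eqI)
     (auto simp: comp_at_emb cring.cring_simprules ring.minus_zero cring.axioms(1))

lemma emb_minus: "x \<in> carrier R \<Longrightarrow> y \<in> carrier R \<Longrightarrow> emb R (x \<ominus> y) = emb R x - emb R y"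
  by (simp add: a_minus_def emb_add emb_uminus)

lemma emb_zero: "emb R \<zero> = 0"
  by (rule cring_product_eqI) (auto simp: comp_at_emb)

lemma emb_one_mult: "emb R \<one> * t = emb R (comp_at R t)"
  by (rule cring_product_eqI) (auto simp: comp_at_emb R cring.cring_simprules)

lemma emb_one_emb: "x \<in> carrier R \<Longrightarrow> emb R \<one> * emb R x = emb R x"
  by (simp flip: emb_mult)

lemma emb_one_emb2: "x \<in> carrier R \<Longrightarrow> emb R \<one> * (emb R x * t) = emb R x * t"
  by (simp add: emb_one_emb flip: mult.assoc)

lemma emb_finsum:
  "finite I \<Longrightarrow> (\<And>i. i \<in> I \<Longrightarrow> f i \<in> carrier R) \<Longrightarrow> emb R (finsum R f I) = (\<Sum>i\<in>I. emb R (f i))"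
proof (induction I rule: finite_induct)
  case empty
  then show ?case by (simp add: emb_zero)
next
  case (insert j I)
  then have "finsum R f (insert j I) = f j \<oplus> finsum R f I" "finsum R f I \<in> carrier R"
    by (auto intro!: finsum_insert finsum_closed)
  with insert show ?case by (simp add: emb_add)
qed

lemma emb_finprod:
  "finite I \<Longrightarrow> (\<And>i. i \<in> I \<Longrightarrow> f i \<in> carrier R) \<Longrightarrow>
     emb R (finprod R f I) = emb R \<one> * (\<Prod>i\<in>I. emb R (f i))"
proof (induction I rule: finite_induct)
  case empty
  then show ?case by simp
next
  case (insert j I)
  then have "finprod R f (insert j I) = f j \<otimes> finprod R f I" "finprod R f I \<in> carrier R"
    by (auto intro!: finprod_insert finprod_closed)
  with insert show ?case by (simp add: emb_mult mult_ac emb_one_emb)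
qed

lemma emb_add_pow: "x \<in> carrier R \<Longrightarrow> emb R ([(k::int)] \<cdot> x) = of_int k * emb R x"
proof -
  assume x: "x \<in> carrier R"
  have nat: "emb R ([(m::nat)] \<cdot> x) = of_nat m * emb R x" for m
    using x by (induction m) (simp_all add: emb_zero emb_add algebra_simps)
  show ?thesis
  proof (cases "k \<ge> 0")
    case True
    then have "[k] \<cdot> x = [nat k] \<cdot> x"
      by (simp add: add_pow_int_ge)
    with True show ?thesis by (simp add: nat)
  next
    case False
    then have "[k] \<cdot> x = \<ominus> ([nat (- k)] \<cdot> x)"
      by (simp add: add_pow_int_lt)
    with False x show ?thesis by (simp add: nat emb_uminus)
  qed
qed

lemmas emb_simps = emb_add emb_mult emb_uminus emb_minus emb_zero emb_one_emb emb_one_emb2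

end

section \<open>Alternating determinants and relations between reflections\<close>

text \<open>Both products of the block matrix \<open>B\<close> with the unipotent block matrix \<open>L\<close> are block triangular, one
with the rank one perturbation as a diagonal block and the other with the scalar.\<close>

lemma det_one_plus_rank_one:
  fixes u w :: "nat \<Rightarrow> 'a :: comm_ring_1"
  shows "det (mat n n (\<lambda>(i, j). (if i = j then 1 else 0) + u i * w j)) = 1 + (\<Sum>i<n. u i * w i)"
proof -
  define U where "U = mat n 1 (\<lambda>(i, j). u i)"
  define W where "W = mat 1 n (\<lambda>(i, j). w j)"
  have U: "U \<in> carrier_mat n 1" and W: "W \<in> carrier_mat 1 n"
    by (simp_all add: U_def W_def)
  define B where "B = four_block_mat (1\<^sub>m 1) W (- U) (1\<^sub>m n)"
  define L where "L = four_block_mat (1\<^sub>m 1) (0\<^sub>m 1 n) U (1\<^sub>m n)"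
  have B: "B \<in> carrier_mat (1 + n) (1 + n)" and L: "L \<in> carrier_mat (1 + n) (1 + n)"
    unfolding B_def L_def using U W by (auto intro: four_block_carrier_mat)
  have LB: "L * B = four_block_mat (1\<^sub>m 1) W (0\<^sub>m n 1) (U * W + 1\<^sub>m n)"
    unfolding L_def B_def
    by (subst mult_four_block_mat[where ?nr1.0 = 1 and ?n1.0 = 1 and ?n2.0 = n and ?nr2.0 = n
          and ?nc1.0 = 1 and ?nc2.0 = n]) (use U W in auto)
  have BL: "B * L = four_block_mat (1\<^sub>m 1 + W * U) W (0\<^sub>m n 1) (1\<^sub>m n)"
    unfolding L_def B_def
    by (subst mult_four_block_mat[where ?nr1.0 = 1 and ?n1.0 = 1 and ?n2.0 = n and ?nr2.0 = n
          and ?nc1.0 = 1 and ?nc2.0 = n]) (use U W in auto)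
  have "det (U * W + 1\<^sub>m n) = det (L * B)"
    unfolding LB using U W by (subst det_four_block_mat_lower_left_zero_col[where n = n]) auto
  also have "\<dots> = det (B * L)"
    by (simp add: det_mult[OF B L] det_mult[OF L B] mult.commute)
  also have "\<dots> = det (1\<^sub>m 1 + W * U)"
    unfolding BL using U W by (subst det_four_block_mat_lower_left_zero_col[where n = n]) auto
  also have "\<dots> = (1\<^sub>m 1 + W * U) $$ (0, 0)"
    using U W by (intro det_single) auto
  also have "\<dots> = 1 + (\<Sum>i<n. u i * w i)"
    using U W by (simp add: U_def W_def scalar_prod_def mult.commute atLeast0LessThan)
  also have "U * W + 1\<^sub>m n = mat n n (\<lambda>(i, j). (if i = j then 1 else 0) + u i * w j)"
    by (rule eq_matI) (auto simp: U_def W_def scalar_prod_def)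
  finally show ?thesis .
qed

text \<open>Elimination of the first two rows of an alternating matrix with the pivot \<open>A $$ (0, 1)\<close>: the
complement \<open>D\<close> is again alternating, and the pivot contributes its square.\<close>

lemma det_alternating_step:
  fixes A :: "'a :: comm_ring_1 mat"
  assumes A: "A \<in> carrier_mat (Suc (Suc m)) (Suc (Suc m))"
    and alt: "\<And>i j. i < Suc (Suc m) \<Longrightarrow> j < Suc (Suc m) \<Longrightarrow> A $$ (j, i) = - A $$ (i, j)"
    and diag: "\<And>i. i < Suc (Suc m) \<Longrightarrow> A $$ (i, i) = 0"
    and e: "\<And>i j. i < Suc (Suc m) \<Longrightarrow> j < Suc (Suc m) \<Longrightarrow> e * A $$ (i, j) = A $$ (i, j)"
    and b: "A $$ (0, 1) * b = e"
  defines "D \<equiv> mat m m (\<lambda>(i, j). A $$ (i + 2, j + 2) + A $$ (i + 2, 0) * b * A $$ (1, j + 2)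
              - A $$ (i + 2, 1) * b * A $$ (0, j + 2))"
  shows "det A = A $$ (0, 1) * A $$ (0, 1) * det D"
proof -
  define A1 A2 A3 A4 where
    "A1 = mat 2 2 (\<lambda>(i, j). A $$ (i, j))" "A2 = mat 2 m (\<lambda>(i, j). A $$ (i, j + 2))"
    "A3 = mat m 2 (\<lambda>(i, j). A $$ (i + 2, j))" "A4 = mat m m (\<lambda>(i, j). A $$ (i + 2, j + 2))"
  define Y where "Y = mat m 2 (\<lambda>(i, j). if j = 0 then - A $$ (i + 2, 1) * b else A $$ (i + 2, 0) * b)"
  define L where "L = four_block_mat (1\<^sub>m 2) (0\<^sub>m 2 m) Y (1\<^sub>m m)"
  note defs = A1_A2_A3_A4_def
  have car: "A1 \<in> carrier_mat 2 2" "A2 \<in> carrier_mat 2 m" "A3 \<in> carrier_mat m 2"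
    "A4 \<in> carrier_mat m m" "Y \<in> carrier_mat m 2" "D \<in> carrier_mat m m"
    by (simp_all add: defs Y_def D_def)
  have shift: "Suc (Suc (i - 2)) = i" if "\<not> i < 2" for i
    using that by simp
  have AB: "A = four_block_mat A1 A2 A3 A4"
    using A by (intro eq_matI) (auto simp: defs shift)
  have L: "L \<in> carrier_mat (Suc (Suc m)) (Suc (Suc m))"
    unfolding L_def using four_block_carrier_mat[of "1\<^sub>m 2" 2 2 "1\<^sub>m m" m m] by (simp add: numeral_2_eq_2)
  have "det L = prod_list (diag_mat L)"
    by (rule det_lower_triangular[OF _ L]) (use L car in \<open>auto simp: L_def\<close>)
  also have "diag_mat L = map (\<lambda>_. 1) [0..<dim_row L]"
    unfolding diag_mat_def using car by (intro map_cong) (auto simp: L_def)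
  also have "prod_list \<dots> = 1"
    by (simp add: map_replicate_const)
  finally have detL: "det L = 1" .
  have two: "{0..<2::nat} = {0, 1}" by auto
  have a01: "A $$ (Suc 0, 0) = - A $$ (0, 1)" using alt[of 0 1] by simp
  have YA: "Y * A1 + A3 = 0\<^sub>m m 2"
  proof (rule eq_matI)
    fix i j assume ij: "i < dim_row (0\<^sub>m m 2 :: 'a mat)" "j < dim_col (0\<^sub>m m 2 :: 'a mat)"
    have ba: "b * A $$ (0, 1) = e" using b by (simp add: mult.commute)
    have ea: "A $$ (Suc (Suc i), jj) * e = A $$ (Suc (Suc i), jj)" if "jj < 2" for jj
      using e[of "Suc (Suc i)" jj] ij that by (simp add: mult.commute)
    from ij consider "j = 0" | "j = 1" by fastforce
    then show "(Y * A1 + A3) $$ (i, j) = 0\<^sub>m m 2 $$ (i, j)"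
    proof cases
      case 1
      then show ?thesis
        using ij car ea[of 0] ba diag[of 0] a01
        by (simp add: Y_def defs scalar_prod_def two mult.assoc)
    next
      case 2
      then show ?thesis
        using ij car ea[of 1] ba diag[of 1] a01
        by (simp add: Y_def defs scalar_prod_def two mult.assoc)
    qed
  qed (use car in auto)
  have YD: "Y * A2 + A4 = D"
    using car by (intro eq_matI) (auto simp: Y_def defs D_def scalar_prod_def two)
  have "L * A = four_block_mat A1 A2 (0\<^sub>m m 2) D"
    unfolding L_def AB
    by (subst mult_four_block_mat[where ?nr1.0 = 2 and ?n1.0 = 2 and ?n2.0 = m and ?nr2.0 = m
          and ?nc1.0 = 2 and ?nc2.0 = m]) (use car YA YD in auto)
  then have "det A = det (four_block_mat A1 A2 (0\<^sub>m m 2) D)" (is "_ = det ?M")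
    using det_mult[OF L A] detL by simp
  also have M: "?M \<in> carrier_mat (Suc (Suc m)) (Suc (Suc m))"
    using four_block_carrier_mat[OF car(1,6)] by simp
  have "det ?M = (\<Sum>i<Suc (Suc m). ?M $$ (i, 0) * cofactor ?M i 0)"
    by (rule laplace_expansion_column[OF M]) simp
  also have "\<dots> = (\<Sum>i\<in>{1}. ?M $$ (i, 0) * cofactor ?M i 0)"
  proof (rule sum.mono_neutral_right)
    show "\<forall>i\<in>{..<Suc (Suc m)} - {1}. ?M $$ (i, 0) * cofactor ?M i 0 = 0"
    proof
      fix i assume i: "i \<in> {..<Suc (Suc m)} - {1}"
      have "?M $$ (i, 0) = 0"
      proof (cases "i = 0")
        case True
        then show ?thesis using car diag[of 0] by (simp add: defs)
      next
        case False
        then have "\<not> i < 2" "i < 2 + m" using i by auto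
        then show ?thesis using car by (simp add: defs)
      qed
      then show "?M $$ (i, 0) * cofactor ?M i 0 = 0" by simp
    qed
  qed auto
  also have "\<dots> = A $$ (0, 1) * det (mat_delete ?M 1 0)"
    using car a01 by (simp add: defs cofactor_def)
  also have "mat_delete ?M 1 0 =
      four_block_mat (mat 1 1 (\<lambda>_. A $$ (0, 1))) (mat 1 m (\<lambda>(i, j). A $$ (0, j + 2))) (0\<^sub>m m 1) D"
    using car by (intro eq_matI) (auto simp: mat_delete_def defs numeral_2_eq_2)
  also have "det \<dots> = det (mat 1 1 (\<lambda>_. A $$ (0, 1))) * det D"
    using car by (intro det_four_block_mat_lower_left_zero_col[where n = m]) auto
  also have "det (mat 1 1 (\<lambda>_. A $$ (0, 1))) = A $$ (0, 1)"
    by (subst det_single) auto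
  finally show ?thesis by (simp add: mult.assoc)
qed

text \<open>The field with unit \<open>e\<close> is a factor of the ambient ring, which is why invertibility is stated
relative to \<open>e\<close>. Induction on the size: either the first row vanishes, or two rows and
columns can be eliminated.\<close>

lemma det_alternating_square:
  fixes A :: "'a :: comm_ring_1 mat" and e :: 'a
  assumes ee: "e * e = e" and inv: "\<And>a. e * a = a \<Longrightarrow> a \<noteq> 0 \<Longrightarrow> \<exists>b. e * b = b \<and> a * b = e"
  assumes "A \<in> carrier_mat k k"
    and "\<And>i j. i < k \<Longrightarrow> j < k \<Longrightarrow> A $$ (j, i) = - A $$ (i, j)"
    and "\<And>i. i < k \<Longrightarrow> A $$ (i, i) = 0"
    and "\<And>i j. i < k \<Longrightarrow> j < k \<Longrightarrow> e * A $$ (i, j) = A $$ (i, j)"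
  shows "\<exists>r. e * r = r \<and> e * det A = r * r \<and> (odd k \<longrightarrow> r = 0)"
  using assms(3-)
proof (induction k arbitrary: A rule: less_induct)
  case (less k A)
  note A = less.prems(1) and alt = less.prems(2) and diag = less.prems(3) and eA = less.prems(4)
  consider "k = 0" | "k = 1" | m where "k = Suc (Suc m)"
    by (metis One_nat_def not0_implies_Suc)
  then show ?case
  proof cases
    case 1
    then show ?thesis using A ee by (auto intro!: exI[of _ e])
  next
    case 2
    then show ?thesis using A diag[of 0] det_single[of A] by (auto intro!: exI[of _ 0])
  next
    case 3
    \<comment> \<open>The pivot can be moved to the second column by a simultaneous swap of rows and columns,
      which preserves the determinant.\<close>
    have pivot: "\<exists>r. e * r = r \<and> e * det B = r * r \<and> (odd k \<longrightarrow> r = 0)"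
      if B: "B \<in> carrier_mat k k"
        and altB: "\<And>i j. i < k \<Longrightarrow> j < k \<Longrightarrow> B $$ (j, i) = - B $$ (i, j)"
        and diagB: "\<And>i. i < k \<Longrightarrow> B $$ (i, i) = 0"
        and eB: "\<And>i j. i < k \<Longrightarrow> j < k \<Longrightarrow> e * B $$ (i, j) = B $$ (i, j)"
        and nz: "B $$ (0, 1) \<noteq> 0" for B
    proof -
      have "e * B $$ (0, 1) = B $$ (0, 1)" using eB 3 by simp
      from inv[OF this nz] obtain b where b: "e * b = b" "B $$ (0, 1) * b = e"
        by (elim exE conjE) (rule that)
      define D where "D = mat m m (\<lambda>(i, j). B $$ (i + 2, j + 2) + B $$ (i + 2, 0) * b * B $$ (1, j + 2)
              - B $$ (i + 2, 1) * b * B $$ (0, j + 2))"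
      have det: "det B = B $$ (0, 1) * B $$ (0, 1) * det D"
        unfolding D_def
        by (rule det_alternating_step[where e = e, OF B[unfolded 3] altB[unfolded 3]
              diagB[unfolded 3] eB[unfolded 3] b(2)])
      have "\<exists>r. e * r = r \<and> e * det D = r * r \<and> (odd m \<longrightarrow> r = 0)"
      proof (rule less.IH)
        show "m < k" using 3 by simp
        show "D \<in> carrier_mat m m" by (simp add: D_def)
        fix i j assume ij: "i < m" "j < m"
        have *: "B $$ (j + 2, i + 2) = - B $$ (i + 2, j + 2)" "B $$ (j + 2, 0) = - B $$ (0, j + 2)"
          "B $$ (1, i + 2) = - B $$ (i + 2, 1)" "B $$ (j + 2, 1) = - B $$ (1, j + 2)"
          "B $$ (0, i + 2) = - B $$ (i + 2, 0)"
          using ij 3 by (auto intro!: altB)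
        show "D $$ (j, i) = - D $$ (i, j)"
          using ij * by (simp add: D_def algebra_simps)
        show "e * D $$ (i, j) = D $$ (i, j)"
          using ij 3 eB by (simp add: D_def distrib_left right_diff_distrib flip: mult.assoc)
      next
        fix i assume i: "i < m"
        have *: "B $$ (1, i + 2) = - B $$ (i + 2, 1)" "B $$ (0, i + 2) = - B $$ (i + 2, 0)"
          "B $$ (i + 2, i + 2) = 0"
          using i 3 by (auto intro!: altB diagB)
        show "D $$ (i, i) = 0"
          using i * by (simp add: D_def algebra_simps)
      qed
      then obtain r where r: "e * r = r" "e * det D = r * r" "odd m \<Longrightarrow> r = 0" by blast
      show ?thesis
      proof (intro exI[of _ "B $$ (0, 1) * r"] conjI impI)
        show "e * (B $$ (0, 1) * r) = B $$ (0, 1) * r"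
          using r(1) by (metis mult.left_commute)
        have "e * det B = B $$ (0, 1) * B $$ (0, 1) * (e * det D)"
          by (simp add: det mult_ac)
        then show "e * det B = B $$ (0, 1) * r * (B $$ (0, 1) * r)"
          by (simp add: r mult_ac)
        show "odd k \<Longrightarrow> B $$ (0, 1) * r = 0"
          using r(3) 3 by simp
      qed
    qed
    show ?thesis
    proof (cases "\<exists>j<k. A $$ (0, j) \<noteq> 0")
      case False
      have "A = mat\<^sub>r k k (\<lambda>i. if i = 0 then 0\<^sub>v k else row A i)"
        using A False by (intro eq_matI) auto
      also have "det \<dots> = 0"
        using A 3 by (intro det_row_0) auto
      finally show ?thesis by (auto intro!: exI[of _ 0])
    next
      case True
      then obtain j where j: "j < k" "A $$ (0, j) \<noteq> 0" by blast
      have j0: "j \<noteq> 0" using diag[of 0] j 3 by (auto intro: ccontr)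
      show ?thesis
      proof (cases "j = 1")
        case True
        then show ?thesis using pivot[OF A alt diag eA] j by auto
      next
        case False
        define \<tau> where "\<tau> i = (if i = 1 then j else if i = j then 1 else i)" for i
        have \<tau>: "\<tau> i < k" if "i < k" for i using that j 3 by (auto simp: \<tau>_def)
        define B where "B = swapcols 1 j (swaprows 1 j A)"
        have C: "swaprows 1 j A \<in> carrier_mat k k" using A by simp
        have B: "B \<in> carrier_mat k k" unfolding B_def using A by simp
        have Bij: "B $$ (i, l) = A $$ (\<tau> i, \<tau> l)" if "i < k" "l < k" for i l
          using that A j 3 by (auto simp: B_def \<tau>_def)
        have k1: "1 < k" using 3 by simp
        have det: "det B = det A"
          unfolding B_def
          by (simp only: det_swapcols[OF k1 j(1) False[symmetric] C]
              det_swaprows[OF k1 j(1) False[symmetric] A] minus_minus)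
        have "\<exists>r. e * r = r \<and> e * det B = r * r \<and> (odd k \<longrightarrow> r = 0)"
        proof (rule pivot)
          show "B \<in> carrier_mat k k" by (fact B)
        next
          fix i l assume il: "i < k" "l < k"
          show "B $$ (l, i) = - B $$ (i, l)"
            unfolding Bij[OF il] Bij[OF il(2,1)] by (rule alt[OF \<tau>[OF il(1)] \<tau>[OF il(2)]])
        next
          fix i assume "i < k"
          then show "B $$ (i, i) = 0"
            using diag[OF \<tau>] by (simp add: Bij)
        next
          fix i l assume "i < k" "l < k"
          then show "e * B $$ (i, l) = B $$ (i, l)"
            using eA[OF \<tau> \<tau>] by (simp add: Bij)
        next
          have "B $$ (0, 1) = A $$ (\<tau> 0, \<tau> 1)" using 3 by (intro Bij) simp_all
          moreover have "\<tau> 0 = 0" "\<tau> 1 = j" using j0 by (simp_all add: \<tau>_def)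
          ultimately show "B $$ (0, 1) \<noteq> 0" using j(2) by simp
        qed
        then show ?thesis unfolding det .
      qed
    qed
  qed
qed

lemma absorb_right: "e * b = b \<Longrightarrow> e * (a * b) = a * b" for e :: "'a :: comm_ring_1"
  by (simp add: mult.left_commute)

text \<open>If $\Gamma$ is the Gram matrix of $v_0, \dots, v_{k-1}$ and $c_j = q(v_j)^{-1}$, this is the inverse
of the upper triangular matrix with diagonal entries $q(v_j)$ and entries $\Gamma_{ij}$ above the
diagonal. It is the matrix of the Wall form of the product of the reflections in the $v_j$.\<close>

function (sequential) wall_inv :: "(nat \<Rightarrow> nat \<Rightarrow> 'a :: comm_ring_1) \<Rightarrow> (nat \<Rightarrow> 'a) \<Rightarrow> nat \<Rightarrow> nat \<Rightarrow> 'a"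
  where
  "wall_inv \<Gamma> c i j =
     (if i < j then - (\<Sum>l<j. wall_inv \<Gamma> c i l * \<Gamma> l j) * c j else if i = j then c j else 0)"
  by pat_completeness auto
termination by (relation "measure (\<lambda>(\<Gamma>, c, i, j). j)") auto

declare wall_inv.simps [simp del]

lemma wall_inv_eq:
  "i < j \<Longrightarrow> wall_inv \<Gamma> c i j = - (\<Sum>l<j. wall_inv \<Gamma> c i l * \<Gamma> l j) * c j"
  "wall_inv \<Gamma> c i i = c i"
  "j < i \<Longrightarrow> wall_inv \<Gamma> c i j = 0"
  by (simp_all add: wall_inv.simps)

text \<open>Multiplying by one more reflection on the right adds one column to the triangular matrix, which is
exactly the recursion that defines \<open>wall_inv\<close>.\<close>

lemma reflections_eq_wall_inv:
  fixes B :: "(nat \<Rightarrow> 'a :: comm_ring_1) \<Rightarrow> (nat \<Rightarrow> 'a) \<Rightarrow> 'a"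
  assumes lin: "\<And>x y z a. B (\<lambda>t. x t - a * y t) z = B x z - a * B y z"
    and sym: "\<And>i j. B (v i) (v j) = B (v j) (v i)"
  defines "\<Gamma> \<equiv> \<lambda>i j. B (v i) (v j)"
  shows "foldr (\<lambda>m x t. x t - B x (v m) * c m * v m t) [0..<k] x =
    (\<lambda>t. x t - (\<Sum>i<k. \<Sum>j<k. wall_inv \<Gamma> c i j * B x (v j) * v i t))"
proof (induction k arbitrary: x)
  case 0
  then show ?case by simp
next
  case (Suc k x)
  define y where "y = (\<lambda>t. x t - B x (v k) * c k * v k t)"
  have By: "B y (v j) = B x (v j) - B x (v k) * c k * \<Gamma> j k" for j
    unfolding y_def lin \<Gamma>_def by (simp add: sym)
  have col: "wall_inv \<Gamma> c i k = - (\<Sum>j<k. wall_inv \<Gamma> c i j * \<Gamma> j k) * c k" if "i < k" for i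
    using that by (simp add: wall_inv_eq)
  have "foldr (\<lambda>m x t. x t - B x (v m) * c m * v m t) [0..<Suc k] x =
      foldr (\<lambda>m x t. x t - B x (v m) * c m * v m t) [0..<k] y"
    by (simp add: y_def)
  also have "\<dots> = (\<lambda>t. y t - (\<Sum>i<k. \<Sum>j<k. wall_inv \<Gamma> c i j * B y (v j) * v i t))"
    by (rule Suc.IH)
  also have "\<dots> = (\<lambda>t. x t - (\<Sum>i<Suc k. \<Sum>j<Suc k. wall_inv \<Gamma> c i j * B x (v j) * v i t))"
  proof
    fix t
    have "(\<Sum>i<k. \<Sum>j<k. wall_inv \<Gamma> c i j * B y (v j) * v i t) =
        (\<Sum>i<k. \<Sum>j<k. wall_inv \<Gamma> c i j * B x (v j) * v i t)
        - (\<Sum>i<k. \<Sum>j<k. wall_inv \<Gamma> c i j * (B x (v k) * c k * \<Gamma> j k) * v i t)"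
      by (simp add: By algebra_simps sum_subtractf)
    also have "(\<Sum>i<k. \<Sum>j<k. wall_inv \<Gamma> c i j * (B x (v k) * c k * \<Gamma> j k) * v i t) =
        (\<Sum>i<k. - wall_inv \<Gamma> c i k * B x (v k) * v i t)"
      by (intro sum.cong refl) (simp add: col sum_distrib_left sum_distrib_right mult_ac)
    finally have 1: "(\<Sum>i<k. \<Sum>j<k. wall_inv \<Gamma> c i j * B y (v j) * v i t) =
        (\<Sum>i<k. \<Sum>j<k. wall_inv \<Gamma> c i j * B x (v j) * v i t)
        + (\<Sum>i<k. wall_inv \<Gamma> c i k * B x (v k) * v i t)"
      by (simp add: sum_negf)
    have 2: "(\<Sum>j<k. wall_inv \<Gamma> c k j * B x (v j) * v k t) = 0"
      by (intro sum.neutral) (simp add: wall_inv_eq)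
    show "y t - (\<Sum>i<k. \<Sum>j<k. wall_inv \<Gamma> c i j * B y (v j) * v i t) =
        x t - (\<Sum>i<Suc k. \<Sum>j<Suc k. wall_inv \<Gamma> c i j * B x (v j) * v i t)"
      unfolding 1 sum.lessThan_Suc sum.distrib 2 wall_inv_eq(2) by (simp add: y_def algebra_simps)
  qed
  finally show ?case .
qed

text \<open>Let $X$ be the triangular matrix \<open>wall_inv\<close>, so that $\Gamma = X^{-1} + X^{-T}$ and
$K = X\Gamma$ satisfies $K X^T = X + X^T$. The hypothesis \<open>nil\<close> says $\Gamma X \Gamma = 0$, hence
$K^2 = 0$. Then $X - X^T = -2 (1 - K/4)^2 X^T$, and $1 - K/4$ is invertible because $K$ is
nilpotent, so the determinant of the alternating matrix $X - X^T$ is $(-2)^k \prod c_j$ times the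
square of an invertible element.\<close>

lemma det_wall_alternating:
  fixes e :: "'a :: comm_ring_1" and \<Gamma> :: "nat \<Rightarrow> nat \<Rightarrow> 'a" and c q :: "nat \<Rightarrow> 'a"
  assumes ee: "e * e = e"
    and e\<Gamma>: "\<And>i j. e * \<Gamma> i j = \<Gamma> i j" and ec: "\<And>i. e * c i = c i"
    and cq: "\<And>i. c i * q i = e"
    and sym: "\<And>i j. \<Gamma> i j = \<Gamma> j i" and diag: "\<And>i. \<Gamma> i i = q i + q i"
    and h: "4 * h = e" "e * h = h"
    and nil: "\<And>i m. i < k \<Longrightarrow> m < k \<Longrightarrow>
      (\<Sum>s<k. \<Sum>j<k. \<Gamma> i s * wall_inv \<Gamma> c s j * \<Gamma> j m) = 0"
  defines "X \<equiv> wall_inv \<Gamma> c"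
  shows "\<exists>d d'. d * d' = 1 \<and>
    det (mat k k (\<lambda>(i, j). X i j - X j i)) = (- 2) ^ k * d * d * (\<Prod>j<k. c j)"
proof -
  have eX: "e * X i j = X i j" for i j
  proof (cases i j rule: linorder_cases)
    case less
    then show ?thesis
      by (simp add: X_def wall_inv_eq absorb_right[OF ec])
  qed (simp_all add: X_def wall_inv_eq ec)
  define Xm Gm Mm where "Xm = mat k k (\<lambda>(i, j). X i j)" "Gm = mat k k (\<lambda>(i, j). \<Gamma> i j)"
    "Mm = mat k k (\<lambda>(l, j). if l < j then \<Gamma> l j else if l = j then q j else 0)"
  note defs = Xm_Gm_Mm_def
  define T where "T = transpose_mat Xm"
  have car [simp]: "Xm \<in> carrier_mat k k" "Gm \<in> carrier_mat k k" "Mm \<in> carrier_mat k k"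
    "T \<in> carrier_mat k k" "transpose_mat Mm \<in> carrier_mat k k"
    by (simp_all add: defs T_def)
  have XM: "Xm * Mm = e \<cdot>\<^sub>m 1\<^sub>m k"
  proof (rule eq_matI)
    fix i j assume "i < dim_row (e \<cdot>\<^sub>m 1\<^sub>m k)" "j < dim_col (e \<cdot>\<^sub>m 1\<^sub>m k)"
    then have ij: "i < k" "j < k" by simp_all
    have "(Xm * Mm) $$ (i, j) = (\<Sum>l<k. X i l * (if l < j then \<Gamma> l j else if l = j then q j else 0))"
      using ij by (simp add: defs scalar_prod_def atLeast0LessThan)
    also have "\<dots> = (\<Sum>l\<in>insert j {..<j}. X i l * (if l < j then \<Gamma> l j else if l = j then q j else 0))"
      using ij by (intro sum.mono_neutral_right) auto
    also have "\<dots> = X i j * q j + (\<Sum>l<j. X i l * \<Gamma> l j)"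
      by (subst sum.insert) auto
    also have "\<dots> = (e \<cdot>\<^sub>m 1\<^sub>m k) $$ (i, j)"
    proof (cases i j rule: linorder_cases)
      case less
      have "(\<Sum>l<j. X i l * \<Gamma> l j) * (c j * q j) = (\<Sum>l<j. X i l * \<Gamma> l j)"
        unfolding cq mult.commute[of _ e] by (simp add: sum_distrib_left absorb_right[OF e\<Gamma>])
      then show ?thesis
        using less ij by (simp add: X_def wall_inv_eq mult.assoc)
    next
      case equal
      then show ?thesis
        using ij cq by (simp add: X_def wall_inv_eq)
    next
      case greater
      then show ?thesis
        using ij by (simp add: X_def wall_inv_eq)
    qed
    finally show "(Xm * Mm) $$ (i, j) = (e \<cdot>\<^sub>m 1\<^sub>m k) $$ (i, j)" .
  qed (simp_all add: defs)
  have GM: "Gm = Mm + transpose_mat Mm"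
    using sym diag by (intro eq_matI) (auto simp: defs)
  have eXm: "e \<cdot>\<^sub>m Xm = Xm" and eT: "e \<cdot>\<^sub>m T = T"
    using eX by (auto intro!: eq_matI simp: defs T_def)
  define K where "K = Xm * Gm"
  have K [simp]: "K \<in> carrier_mat k k" unfolding K_def by (rule mult_carrier_mat[OF car(1,2)])
  have "transpose_mat Mm * T = transpose_mat (Xm * Mm)"
    unfolding T_def by (simp add: transpose_mult[of _ k k _ k])
  also have "\<dots> = e \<cdot>\<^sub>m 1\<^sub>m k"
    unfolding XM by (rule eq_matI) auto
  finally have MT: "transpose_mat Mm * T = e \<cdot>\<^sub>m 1\<^sub>m k" .
  have "K * T = (Xm * Mm + Xm * transpose_mat Mm) * T"
    unfolding K_def GM by (simp add: mult_add_distrib_mat[of _ k k _ k])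
  also have "\<dots> = Xm * Mm * T + Xm * (transpose_mat Mm * T)"
    by (subst add_mult_distrib_mat[of _ k k _ _ k]) (simp_all add: assoc_mult_mat[of _ k k _ k _ k] mult_carrier_mat[OF car(1,3)] mult_carrier_mat[OF car(1,5)])
  also have "\<dots> = T + Xm"
    unfolding XM MT using eXm eT
    by (simp add: mult_smult_assoc_mat[of _ k k _ k] mult_smult_distrib[of _ k k _ k]
        left_mult_one_mat[OF car(4)] right_mult_one_mat[OF car(1)])
  finally have KT: "K * T = T + Xm" .
  have KK: "K * K = 0\<^sub>m k k"
  proof -
    have "Gm * K = 0\<^sub>m k k"
    proof (rule eq_matI)
      fix i m assume "i < dim_row (0\<^sub>m k k :: 'a mat)" "m < dim_col (0\<^sub>m k k :: 'a mat)"
      then have im: "i < k" "m < k" by simp_all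
      have "(Gm * K) $$ (i, m) = (\<Sum>s<k. \<Gamma> i s * (\<Sum>j<k. X s j * \<Gamma> j m))"
        using im by (simp add: K_def defs scalar_prod_def atLeast0LessThan)
      also have "\<dots> = 0"
        using nil[OF im] by (simp add: X_def sum_distrib_left mult.assoc)
      finally show "(Gm * K) $$ (i, m) = 0\<^sub>m k k $$ (i, m)" using im by simp
    qed (simp_all add: K_def defs)
    moreover have "K * K = Xm * (Gm * K)"
      using assoc_mult_mat[OF car(1,2) K] by (fold K_def)
    ultimately show ?thesis by (simp only: right_mult_zero_mat[OF car(1)])
  qed
  define H where "H = h \<cdot>\<^sub>m K"
  have H [simp]: "H \<in> carrier_mat k k" by (simp add: H_def)
  have "H * H = h \<cdot>\<^sub>m (h \<cdot>\<^sub>m (K * K))"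
    unfolding H_def by (subst mult_smult_assoc_mat[of _ k k _ k], simp, simp,
        subst mult_smult_distrib[of _ k k _ k], simp_all)
  then have HH: "H * H = 0\<^sub>m k k" unfolding KK by (auto intro: eq_matI)
  have HT: "H * T = h \<cdot>\<^sub>m (T + Xm)"
    unfolding H_def by (subst mult_smult_assoc_mat[of _ k k _ k]) (simp_all add: KT)
  define S S' where "S = 1\<^sub>m k - H" "S' = 1\<^sub>m k + H"
  have S [simp]: "S \<in> carrier_mat k k" "S' \<in> carrier_mat k k"
    by (simp_all add: S_S'_def minus_carrier_mat)
  have "H * S' = H * 1\<^sub>m k + H * H"
    unfolding S_S'_def by (rule mult_add_distrib_mat[of _ k k _ k]) simp_all
  then have HS': "H * S' = H" by (simp add: HH right_mult_one_mat[OF H] right_add_zero_mat[OF H])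
  have "H * S = H * 1\<^sub>m k - H * H"
    unfolding S_S'_def by (rule mult_minus_distrib_mat[of _ k k _ k]) simp_all
  then have HS: "H * S = H" unfolding HH right_mult_one_mat[OF H] using carrier_matD[OF H] by (auto intro!: eq_matI)
  have "S * S' = 1\<^sub>m k * S' - H * S'"
    unfolding S_S'_def(1) by (rule minus_mult_distrib_mat[of _ k k _ _ k]) simp_all
  also have "\<dots> = 1\<^sub>m k"
    unfolding HS' left_mult_one_mat[OF S(2)] unfolding S_S'_def using carrier_matD[OF H] by (auto intro!: eq_matI)
  finally have "det S * det S' = 1"
    by (metis S det_mult det_one)
  note detS = this
  have SS: "S * S = S - H"
  proof -
    have "S * S = 1\<^sub>m k * S - H * S"
      by (subst (1) S_S'_def(1)) (rule minus_mult_distrib_mat[of _ k k _ _ k], simp_all)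
    then show ?thesis by (simp only: HS left_mult_one_mat[OF S(1)])
  qed
  have "S * T = 1\<^sub>m k * T - H * T"
    unfolding S_S'_def(1) by (rule minus_mult_distrib_mat[of _ k k _ _ k]) simp_all
  then have ST: "S * T = T - h \<cdot>\<^sub>m (T + Xm)" by (simp only: HT left_mult_one_mat[OF car(4)])
  have "S * S * T = S * T - H * T"
    unfolding SS by (rule minus_mult_distrib_mat[of _ k k _ _ k]) simp_all
  then have SST: "S * S * T = T - h \<cdot>\<^sub>m (T + Xm) - h \<cdot>\<^sub>m (T + Xm)"
    by (simp only: ST HT)
  have A: "mat k k (\<lambda>(i, j). X i j - X j i) = (- 2) \<cdot>\<^sub>m (S * S * T)"
  proof (rule eq_matI)
    fix i j assume "i < dim_row ((- 2) \<cdot>\<^sub>m (S * S * T))" "j < dim_col ((- 2) \<cdot>\<^sub>m (S * S * T))"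
    then have ij: "i < k" "j < k"
      using carrier_matD[OF S(1)] carrier_matD[OF car(4)] by simp_all
    have TX: "T $$ (i, j) = X j i" "Xm $$ (i, j) = X i j" using ij by (simp_all add: defs T_def)
    have "(- 2) * (X j i - h * (X j i + X i j) - h * (X j i + X i j)) =
        (4 * h) * (X j i + X i j) - 2 * X j i"
      by (simp add: algebra_simps)
    also have "\<dots> = X i j - X j i"
      unfolding h(1) distrib_left eX by simp
    finally show "mat k k (\<lambda>(i, j). X i j - X j i) $$ (i, j) = ((- 2) \<cdot>\<^sub>m (S * S * T)) $$ (i, j)"
      using ij carrier_matD[OF car(4)] carrier_matD[OF car(1)] by (simp add: SST TX)
  qed (use carrier_matD[OF S(1)] carrier_matD[OF car(4)] in simp_all)
  have "det T = det Xm"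
    unfolding T_def by (rule det_transpose[OF car(1)])
  also have "\<dots> = prod_list (diag_mat Xm)"
    by (rule det_upper_triangular[of _ k]) (auto simp: defs X_def wall_inv_eq)
  also have "\<dots> = (\<Prod>j<k. c j)"
    by (simp add: diag_mat_def defs X_def wall_inv_eq prod.list_conv_set_nth atLeast0LessThan)
  finally have "det T = (\<Prod>j<k. c j)" .
  then have "det ((- 2) \<cdot>\<^sub>m (S * S * T)) = (- 2) ^ k * det S * det S * (\<Prod>j<k. c j)"
    using det_mult[OF S(1) S(1)] det_mult[OF mult_carrier_mat[OF S(1) S(1)] car(4)] carrier_matD[OF car(4)] carrier_matD[OF S(1)]
    by (simp add: mult.assoc)
  then show ?thesis
    unfolding A using detS by blast
qed

text \<open>If the product of the reflections fixes all $v_m$, then $\Gamma X \Gamma = 0$ for the matrix $X$ of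
the Wall form, and \<open>det_wall_alternating\<close> applies. The determinant of the alternating matrix
$X - X^T$ is a square, and it vanishes if $k$ is odd. As it is a unit times
$\prod q(v_j)^{-1} \neq 0$, the number $k$ is even; the factor $(-2)^k$ is then a square, and so
is $\prod q(v_j)$.\<close>

lemma reflections_identity_square:
  fixes e :: "'a :: comm_ring_1" and B :: "(nat \<Rightarrow> 'a) \<Rightarrow> (nat \<Rightarrow> 'a) \<Rightarrow> 'a"
  assumes ee: "e * e = e" "e \<noteq> 0"
    and inv: "\<And>a. e * a = a \<Longrightarrow> a \<noteq> 0 \<Longrightarrow> \<exists>b. e * b = b \<and> a * b = e"
    and h: "4 * h = e" "e * h = h"
    and lin: "\<And>x y z a. B (\<lambda>t. x t - a * y t) z = B x z - a * B y z"
    and zero: "\<And>y. B (\<lambda>t. 0) y = 0"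
    and sym: "\<And>x y. B x y = B y x"
    and eB: "\<And>x y. e * B x y = B x y"
    and c: "\<And>i. e * c i = c i" "\<And>i. e * q i = q i" "\<And>i. c i * q i = e"
    and diag: "\<And>i. B (v i) (v i) = q i + q i"
    and id: "\<And>m. m < k \<Longrightarrow> foldr (\<lambda>m x t. x t - B x (v m) * c m * v m t) [0..<k] (v m) = v m"
  shows "even k \<and> (\<exists>r. e * r = r \<and> e * (\<Prod>j<k. q j) = r * r)"
proof -
  define \<Gamma> where "\<Gamma> = (\<lambda>i j. B (v i) (v j))"
  define X where "X = wall_inv \<Gamma> c"
  have Bsum: "B (\<lambda>t. \<Sum>i\<in>I. a i * v i t) y = (\<Sum>i\<in>I. a i * B (v i) y)" if "finite I" for I a y
    using that
  proof (induction I rule: finite_induct)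
    case empty
    then show ?case by (simp add: zero)
  next
    case (insert j I)
    have "(\<lambda>t. \<Sum>i\<in>insert j I. a i * v i t) = (\<lambda>t. (\<Sum>i\<in>I. a i * v i t) - (- a j) * v j t)"
      using insert.hyps by (auto simp: add.commute)
    then show ?case using insert by (simp only: lin) simp
  qed
  have nil: "(\<Sum>s<k. \<Sum>j<k. \<Gamma> i s * X s j * \<Gamma> j m) = 0" if "i < k" "m < k" for i m
  proof -
    have "(\<lambda>t. v m t - (\<Sum>s<k. \<Sum>j<k. X s j * B (v m) (v j) * v s t)) = v m"
      unfolding X_def \<Gamma>_def
      by (subst reflections_eq_wall_inv[symmetric]) (auto simp: id[OF \<open>m < k\<close>] lin sym)
    then have "(\<Sum>s<k. (\<Sum>j<k. X s j * B (v m) (v j)) * v s t) = 0" for t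
      by (auto simp: fun_eq_iff sum_distrib_right)
    then have "B (\<lambda>t. \<Sum>s<k. (\<Sum>j<k. X s j * B (v m) (v j)) * v s t) (v i) = 0"
      by (simp add: zero)
    then have "(\<Sum>s<k. (\<Sum>j<k. X s j * B (v m) (v j)) * B (v s) (v i)) = 0"
      by (simp add: Bsum)
    then show ?thesis
      unfolding \<Gamma>_def by (simp add: sum_distrib_left sum_distrib_right sym mult_ac)
  qed
  obtain d d' where d: "d * d' = 1"
    and det: "det (mat k k (\<lambda>(i, j). X i j - X j i)) = (- 2) ^ k * d * d * (\<Prod>j<k. c j)"
    using det_wall_alternating[OF ee(1), of \<Gamma> c q h k] nil c h eB sym diag
    unfolding \<Gamma>_def X_def by blast
  have eX: "e * X i j = X i j" for i j
  proof (cases i j rule: linorder_cases)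
    case less
    then show ?thesis
      by (simp add: X_def wall_inv_eq absorb_right[OF c(1)])
  qed (simp_all add: X_def wall_inv_eq c)
  let ?A = "mat k k (\<lambda>(i, j). X i j - X j i)"
  have "\<exists>r. e * r = r \<and> e * det ?A = r * r \<and> (odd k \<longrightarrow> r = 0)"
    by (rule det_alternating_square[OF ee(1) inv]) (simp_all add: right_diff_distrib eX)
  then obtain r where r: "e * r = r" "odd k \<Longrightarrow> r = 0"
    and rr: "r * r = e * ((- 2) ^ k * d * d * (\<Prod>j<k. c j))"
    unfolding det by metis
  define g where "g = h + h"
  have g2: "g * 2 = e" using h(1) by (simp add: g_def)
  have pow_e: "e * e ^ m = e" for m by (induction m) (use ee in \<open>simp_all add: mult.assoc[symmetric]\<close>)
  have cq: "e * ((\<Prod>j<k. c j) * (\<Prod>j<k. q j)) = e"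
    by (simp add: c(3) pow_e flip: prod.distrib)
  have "even k"
  proof (rule ccontr)
    assume "odd k"
    then have "0 = (e * ((- 2) ^ k * d * d * (\<Prod>j<k. c j))) * ((- g) ^ k * d' * d' * (\<Prod>j<k. q j))"
      using r rr by simp
    also have "\<dots> = (e * ((\<Prod>j<k. c j) * (\<Prod>j<k. q j))) * ((- 2) * (- g)) ^ k * (d * d') * (d * d')"
      by (simp only: power_mult_distrib mult_ac)
    also have "(- 2) * (- g) = e"
      using g2 by (simp add: mult.commute)
    also have "(e * ((\<Prod>j<k. c j) * (\<Prod>j<k. q j))) * e ^ k * (d * d') * (d * d') = e"
      unfolding cq d by (simp add: pow_e)
    finally show False using ee by simp
  qed
  then obtain m where m: "k = 2 * m" by (elim evenE)
  \<comment> \<open>Here \<open>g\<close> is one half, so \<open>g ^ m\<close> removes the square root $2^m$ of $(-2)^k$ from \<open>r\<close>,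
    \<open>d'\<close> removes \<open>d\<close>, and the product of the \<open>q j\<close> turns the product of the \<open>c j\<close> into its inverse.\<close>
  define s where "s = (\<Prod>j<k. q j) * r * g ^ m * d'"
  have "s * s = (\<Prod>j<k. q j) * (\<Prod>j<k. q j) * (r * r) * (g * g) ^ m * d' * d'"
    by (simp add: s_def power_mult_distrib mult_ac)
  also have "\<dots> = (e * ((\<Prod>j<k. c j) * (\<Prod>j<k. q j))) * (\<Prod>j<k. q j) * ((- 2) * (- 2) * (g * g)) ^ m
      * (d * d') * (d * d')"
    unfolding rr m power_mult power2_eq_square by (simp only: power_mult_distrib mult_ac)
  also have "(- 2) * (- 2) * (g * g) = (g * 2) * (g * 2)"
    by (simp add: algebra_simps)
  also have "(e * ((\<Prod>j<k. c j) * (\<Prod>j<k. q j))) * (\<Prod>j<k. q j) * ((g * 2) * (g * 2)) ^ m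
      * (d * d') * (d * d') = (e * e ^ m) * (\<Prod>j<k. q j)"
    unfolding cq d g2 ee(1) by (simp add: mult_ac)
  finally have "s * s = e * (\<Prod>j<k. q j)"
    by (simp only: pow_e)
  moreover have "e * s = s"
  proof -
    have "e * s = (\<Prod>j<k. q j) * (e * r) * g ^ m * d'"
      by (simp only: s_def mult_ac)
    then show ?thesis unfolding r(1) s_def .
  qed
  ultimately show ?thesis using \<open>even k\<close> by metis
qed

section \<open>Even lattices over a domain\<close>

text \<open>Evenness is required on the basis only; lemma \<open>qform_exists\<close> extends it to all vectors.\<close>

locale quadratic_lattice = "domain" R for R :: "'a ring" (structure) +
  fixes N :: nat and G :: "nat \<Rightarrow> nat \<Rightarrow> 'a"
  assumes two_torsion_free: "x \<in> carrier R \<Longrightarrow> x \<oplus> x = \<zero> \<Longrightarrow> x = \<zero>"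
    and gram_closed [simp]: "i < N \<Longrightarrow> j < N \<Longrightarrow> G i j \<in> carrier R"
    and gram_sym: "i < N \<Longrightarrow> j < N \<Longrightarrow> G i j = G j i"
    and gram_even: "i < N \<Longrightarrow> \<exists>h\<in>carrier R. G i i = h \<oplus> h"
begin

abbreviation V where "V \<equiv> carrier (coord_module R N)"
abbreviation vadd (infixl \<open>\<boxplus>\<close> 65) where "x \<boxplus> y \<equiv> x \<oplus>\<^bsub>coord_module R N\<^esub> y"
abbreviation vsmult (infixr \<open>\<boxdot>\<close> 70) where "a \<boxdot> x \<equiv> a \<odot>\<^bsub>coord_module R N\<^esub> x"
abbreviation vzero where "vzero \<equiv> \<zero>\<^bsub>coord_module R N\<^esub>"
abbreviation uvec where "uvec \<equiv> Defs.unit_vec R N"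
abbreviation B where "B \<equiv> bform R N G"
abbreviation Q where "Q \<equiv> qform R N G"
abbreviation refl where "refl \<equiv> reflection R N G"
abbreviation M where "M \<equiv> BijGroup (carrier (coord_module R N))"
abbreviation Og where "Og \<equiv> orth R N G"
abbreviation anis where "anis \<equiv> unit_norm_vectors R N G"

lemmas emb_rules = emb_simps[OF is_cring] emb_finsum[OF is_cring]

lemma ring_eqI: "emb R x = emb R y \<Longrightarrow> x \<in> carrier R \<Longrightarrow> y \<in> carrier R \<Longrightarrow> x = y"
  by (rule emb_eqD[OF is_cring])

lemma vec_carrier: "V = ({..<N} \<rightarrow>\<^sub>E carrier R)"
  by (simp add: coord_module_def)

lemma vec_comp_closed [simp]: "x \<in> V \<Longrightarrow> i < N \<Longrightarrow> x i \<in> carrier R"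
  by (auto simp: vec_carrier)

lemma vec_ext: "x \<in> V \<Longrightarrow> y \<in> V \<Longrightarrow> (\<And>i. i < N \<Longrightarrow> x i = y i) \<Longrightarrow> x = y"
  unfolding vec_carrier by (rule PiE_ext) auto

lemma vadd_comp [simp]: "i < N \<Longrightarrow> (x \<boxplus> y) i = x i \<oplus> y i"
  and vsmult_comp [simp]: "i < N \<Longrightarrow> (a \<boxdot> x) i = a \<otimes> x i"
  and vzero_comp [simp]: "i < N \<Longrightarrow> vzero i = \<zero>"
  and uvec_comp [simp]: "i < N \<Longrightarrow> uvec j i = (if i = j then \<one> else \<zero>)"
  by (simp_all add: coord_module_def Defs.unit_vec_def)

lemma restrict_vec: "(\<And>i. i < N \<Longrightarrow> f i \<in> carrier R) \<Longrightarrow> (\<lambda>i\<in>{..<N}. f i) \<in> V"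
  by (auto simp: vec_carrier)

lemma vadd_closed [simp]: "x \<in> V \<Longrightarrow> y \<in> V \<Longrightarrow> x \<boxplus> y \<in> V"
  and vsmult_closed [simp]: "a \<in> carrier R \<Longrightarrow> x \<in> V \<Longrightarrow> a \<boxdot> x \<in> V"
  and vzero_closed [simp]: "vzero \<in> V"
  and uvec_closed [simp]: "uvec j \<in> V"
  by (auto simp: coord_module_def Defs.unit_vec_def)

text \<open>Vectors are built one coordinate at a time, so that facts about the forms reduce to unit vectors.\<close>

lemma vec_induct [consumes 1, case_names zero step]:
  assumes x: "x \<in> V" and zero: "P vzero"
    and step: "\<And>y a j. y \<in> V \<Longrightarrow> P y \<Longrightarrow> a \<in> carrier R \<Longrightarrow> j < N \<Longrightarrow> P (y \<boxplus> a \<boxdot> uvec j)"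
  shows "P x"
proof -
  define t where "t m = (\<lambda>i\<in>{..<N}. if i < m then x i else \<zero>)" for m
  have t: "t m \<in> V" for m
    unfolding t_def using x by (intro restrict_vec) auto
  have "m \<le> N \<Longrightarrow> P (t m)" for m
  proof (induction m)
    case 0
    have "t 0 = vzero"
    proof (rule vec_ext[OF t vzero_closed])
      show "t 0 i = vzero i" if "i < N" for i using that by (simp add: t_def)
    qed
    then show ?case using zero by simp
  next
    case (Suc m)
    have "t (Suc m) = t m \<boxplus> x m \<boxdot> uvec m"
    proof (rule vec_ext)
      fix i assume "i < N"
      with Suc.prems show "t (Suc m) i = (t m \<boxplus> x m \<boxdot> uvec m) i"
        using x by (auto simp: t_def less_Suc_eq)
    qed (use Suc.prems x t in auto)
    then show ?case using Suc step[OF t] x by simp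
  qed
  moreover have "t N = x"
  proof (rule vec_ext[OF t x])
    show "t N i = x i" if "i < N" for i using that by (simp add: t_def)
  qed
  ultimately show ?thesis by (metis order_refl)
qed

lemma bform_closed [simp]: "x \<in> V \<Longrightarrow> y \<in> V \<Longrightarrow> B x y \<in> carrier R"
  unfolding bform_def by (intro finsum_closed) auto

lemma emb_bform:
  assumes "x \<in> V" "y \<in> V"
  shows "emb R (B x y) = (\<Sum>i<N. \<Sum>j<N. emb R (x i) * emb R (G i j) * emb R (y j))"
proof -
  have "emb R (B x y) = (\<Sum>i<N. emb R (\<Oplus>j\<in>{..<N}. x i \<otimes> G i j \<otimes> y j))"
    unfolding bform_def using assms by (intro emb_finsum[OF is_cring]) (auto intro!: finsum_closed)
  also have "\<dots> = (\<Sum>i<N. \<Sum>j<N. emb R (x i \<otimes> G i j \<otimes> y j))"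
    using assms by (intro sum.cong emb_finsum[OF is_cring]) auto
  also have "\<dots> = (\<Sum>i<N. \<Sum>j<N. emb R (x i) * emb R (G i j) * emb R (y j))"
    using assms by (intro sum.cong) (auto simp: emb_rules)
  finally show ?thesis .
qed

lemma bform_sym: "x \<in> V \<Longrightarrow> y \<in> V \<Longrightarrow> B x y = B y x"
proof (rule ring_eqI)
  assume xy: "x \<in> V" "y \<in> V"
  have "emb R (B x y) = (\<Sum>i<N. \<Sum>j<N. emb R (x i) * emb R (G i j) * emb R (y j))"
    by (rule emb_bform[OF xy])
  also have "\<dots> = (\<Sum>j<N. \<Sum>i<N. emb R (x i) * emb R (G i j) * emb R (y j))"
    by (rule sum.swap)
  also have "\<dots> = emb R (B y x)"
    unfolding emb_bform[OF xy(2,1)] by (intro sum.cong refl) (simp add: gram_sym mult_ac)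
  finally show "emb R (B x y) = emb R (B y x)" .
qed auto

lemma bform_add_left [simp]: "x \<in> V \<Longrightarrow> y \<in> V \<Longrightarrow> z \<in> V \<Longrightarrow> B (x \<boxplus> y) z = B x z \<oplus> B y z"
  by (rule ring_eqI) (simp_all add: emb_bform emb_rules algebra_simps sum.distrib)

lemma bform_smult_left [simp]: "a \<in> carrier R \<Longrightarrow> x \<in> V \<Longrightarrow> z \<in> V \<Longrightarrow> B (a \<boxdot> x) z = a \<otimes> B x z"
  by (rule ring_eqI) (simp_all add: emb_bform emb_rules sum_distrib_left mult_ac)

lemma bform_add_right [simp]: "x \<in> V \<Longrightarrow> y \<in> V \<Longrightarrow> z \<in> V \<Longrightarrow> B z (x \<boxplus> y) = B z x \<oplus> B z y"
  by (simp add: bform_sym[of z])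

lemma bform_smult_right [simp]: "a \<in> carrier R \<Longrightarrow> x \<in> V \<Longrightarrow> z \<in> V \<Longrightarrow> B z (a \<boxdot> x) = a \<otimes> B z x"
  by (simp add: bform_sym[of z])

lemma bform_zero_left [simp]: "x \<in> V \<Longrightarrow> B vzero x = \<zero>"
  by (rule ring_eqI) (simp_all add: emb_bform emb_rules)

lemma bform_uvec_uvec: "i < N \<Longrightarrow> j < N \<Longrightarrow> B (uvec i) (uvec j) = G i j"
proof (rule ring_eqI)
  assume ij: "i < N" "j < N"
  have "emb R (B (uvec i) (uvec j)) =
      (\<Sum>k<N. \<Sum>l<N. emb R (uvec i k) * emb R (G k l) * emb R (uvec j l))"
    by (simp add: emb_bform)
  also have "\<dots> = (\<Sum>k<N. \<Sum>l<N. if k = i then if l = j then emb R (G i j) else 0 else 0)"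
    using ij by (intro sum.cong refl) (auto simp: emb_rules mult.commute[of _ "emb R \<one>"])
  also have "\<dots> = (\<Sum>k<N. if k = i then emb R (G i j) else 0)"
    using ij by (intro sum.cong refl) simp
  also have "\<dots> = emb R (G i j)"
    using ij by simp
  finally show "emb R (B (uvec i) (uvec j)) = emb R (G i j)" .
qed auto

lemma double_inj: assumes "a \<in> carrier R" "b \<in> carrier R" "a \<oplus> a = b \<oplus> b" shows "a = b"
proof -
  have "(a \<ominus> b) \<oplus> (a \<ominus> b) = (a \<oplus> a) \<oplus> \<ominus> (b \<oplus> b)"
    by (rule ring_eqI) (simp_all add: emb_rules assms(1,2))
  also have "\<dots> = \<zero>" unfolding assms(3) using assms(2) by (intro r_neg) simp
  finally have "(a \<ominus> b) \<oplus> (a \<ominus> b) = \<zero>" .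
  then have "a \<ominus> b = \<zero>" by (rule two_torsion_free[OF minus_closed[OF assms(1,2)]])
  then have "emb R (a \<ominus> b) = emb R \<zero>" by (rule arg_cong)
  then have "emb R a = emb R b"
    unfolding emb_minus[OF is_cring assms(1,2)] emb_zero[OF is_cring] by simp
  then show ?thesis using assms(1,2) by (rule ring_eqI)
qed

lemma qform_exists: "x \<in> V \<Longrightarrow> \<exists>a\<in>carrier R. a \<oplus> a = B x x"
proof (induction rule: vec_induct)
  case zero
  then show ?case by (intro bexI[of _ \<zero>]) auto
next
  case (step y a j)
  obtain c where c: "c \<in> carrier R" "c \<oplus> c = B y y" using step.IH by blast
  obtain h where h: "h \<in> carrier R" "G j j = h \<oplus> h" using gram_even[OF step.hyps(3)] by blast
  note [simp] = step.hyps c(1) h(1)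
  define d where "d = B y (uvec j)"
  have d [simp]: "d \<in> carrier R" by (simp add: d_def)
  have "B (y \<boxplus> a \<boxdot> uvec j) (y \<boxplus> a \<boxdot> uvec j) =
      (B y y \<oplus> a \<otimes> B (uvec j) y) \<oplus> a \<otimes> (B y (uvec j) \<oplus> a \<otimes> B (uvec j) (uvec j))"
    by simp
  also have "\<dots> = (c \<oplus> c \<oplus> a \<otimes> d) \<oplus> a \<otimes> (d \<oplus> a \<otimes> (h \<oplus> h))"
    unfolding bform_sym[OF uvec_closed \<open>y \<in> V\<close>] bform_uvec_uvec[OF step.hyps(3,3)] d_def[symmetric]
      h(2) c(2)[symmetric] ..
  also have "\<dots> = (c \<oplus> a \<otimes> a \<otimes> h \<oplus> a \<otimes> d) \<oplus> (c \<oplus> a \<otimes> a \<otimes> h \<oplus> a \<otimes> d)"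
    by (intro ring_eqI) (simp_all add: emb_rules algebra_simps)
  finally show ?case by (intro bexI[of _ "c \<oplus> a \<otimes> a \<otimes> h \<oplus> a \<otimes> d"]) auto
qed

lemma qform_unique: "x \<in> V \<Longrightarrow> a \<in> carrier R \<Longrightarrow> a \<oplus> a = B x x \<Longrightarrow> Q x = a"
  unfolding qform_def by (rule the_equality) (auto intro: double_inj)

lemma qform_closed [simp]: "x \<in> V \<Longrightarrow> Q x \<in> carrier R"
  and qform_double: "x \<in> V \<Longrightarrow> Q x \<oplus> Q x = B x x"
  using qform_exists[of x] qform_unique[of x] by auto

lemma emb_bform_self: "x \<in> V \<Longrightarrow> emb R (B x x) = 2 * emb R (Q x)"
  by (simp add: emb_rules flip: qform_double)

lemma qform_add: "x \<in> V \<Longrightarrow> y \<in> V \<Longrightarrow> Q (x \<boxplus> y) = Q x \<oplus> Q y \<oplus> B x y"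
  by (rule qform_unique, simp, simp, rule ring_eqI)
     (simp_all add: emb_rules emb_bform_self bform_sym[of y x])

lemma qform_smult: "a \<in> carrier R \<Longrightarrow> x \<in> V \<Longrightarrow> Q (a \<boxdot> x) = a \<otimes> a \<otimes> Q x"
  by (rule qform_unique, simp, simp, rule ring_eqI)
     (simp_all add: emb_rules emb_bform_self)

lemma qform_zero [simp]: "Q vzero = \<zero>"
  by (rule qform_unique) auto

text \<open>Only the values on the lattice matter, so this predicate is separate from membership in the group
of bijections, whose elements are undefined elsewhere.\<close>

definition lin :: "((nat \<Rightarrow> 'a) \<Rightarrow> (nat \<Rightarrow> 'a)) \<Rightarrow> bool" where
  "lin g \<longleftrightarrow> g \<in> V \<rightarrow> V \<and> (\<forall>x\<in>V. \<forall>y\<in>V. g (x \<boxplus> y) = g x \<boxplus> g y) \<and>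
     (\<forall>a\<in>carrier R. \<forall>x\<in>V. g (a \<boxdot> x) = a \<boxdot> g x)"

lemma lin_closed: "lin g \<Longrightarrow> x \<in> V \<Longrightarrow> g x \<in> V"
  by (auto simp: lin_def)

lemma lin_zero: assumes "lin g" shows "g vzero = vzero"
proof -
  have z: "\<zero> \<boxdot> vzero = vzero" by (rule vec_ext) auto
  have "g (\<zero> \<boxdot> vzero) = \<zero> \<boxdot> g vzero"
    using assms by (simp add: lin_def)
  also have "\<dots> = vzero" using assms by (intro vec_ext) (auto simp: lin_closed)
  finally show ?thesis by (simp only: z)
qed

lemma lin_eqI:
  assumes "lin g" "lin h" "\<And>j. j < N \<Longrightarrow> g (uvec j) = h (uvec j)" "x \<in> V"
  shows "g x = h x"
  using assms(4)
proof (induction rule: vec_induct)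
  case zero
  then show ?case using assms by (simp add: lin_zero)
next
  case (step y a j)
  then show ?case using assms by (simp add: lin_def)
qed

lemma lin_expand:
  assumes "lin g" "x \<in> V" "i < N"
  shows "emb R (g x i) = (\<Sum>j<N. emb R (g (uvec j) i) * emb R (x j))"
  using assms(2)
proof (induction rule: vec_induct)
  case zero
  then show ?case using assms by (simp add: lin_zero emb_rules)
next
  case (step y a k)
  have "emb R (g (y \<boxplus> a \<boxdot> uvec k) i) = emb R (g y i) + emb R (g (uvec k) i) * emb R a"
    using step assms lin_closed[OF assms(1)] by (simp add: lin_def emb_rules mult.commute)
  also have "emb R (g (uvec k) i) * emb R a =
      (\<Sum>j<N. if j = k then emb R (g (uvec j) i) * emb R a else 0)"
    using step by simp
  also have "emb R (g y i) + \<dots> = (\<Sum>j<N. emb R (g (uvec j) i) * emb R ((y \<boxplus> a \<boxdot> uvec k) j))"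
    unfolding step.IH sum.distrib[symmetric] using step assms lin_closed[OF assms(1)]
    by (intro sum.cong refl) (auto simp: emb_rules algebra_simps)
  finally show ?case .
qed

lemma lin_comp: "lin g \<Longrightarrow> lin h \<Longrightarrow> lin (\<lambda>x. g (h x))"
  by (auto simp: lin_def Pi_iff)

lemma group_M: "group M"
  by (rule group_BijGroup)

lemma carrier_M [simp]: "carrier M = Bij V"
  by (simp add: BijGroup_def)

lemma one_M: "\<one>\<^bsub>M\<^esub> = (\<lambda>x\<in>V. x)"
  by (simp add: BijGroup_def)

lemma Bij_closed: "g \<in> Bij V \<Longrightarrow> x \<in> V \<Longrightarrow> g x \<in> V"
  using Bij_imp_funcset by blast

lemma mult_M: "g \<in> Bij V \<Longrightarrow> h \<in> Bij V \<Longrightarrow> x \<in> V \<Longrightarrow> (g \<otimes>\<^bsub>M\<^esub> h) x = g (h x)"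
  by (simp add: BijGroup_def compose_def)

lemma mult_M_closed [simp]: "g \<in> Bij V \<Longrightarrow> h \<in> Bij V \<Longrightarrow> g \<otimes>\<^bsub>M\<^esub> h \<in> Bij V"
  using group.is_monoid[OF group_M] monoid.m_closed by fastforce

lemma Bij_eqI: "g \<in> Bij V \<Longrightarrow> h \<in> Bij V \<Longrightarrow> (\<And>x. x \<in> V \<Longrightarrow> g x = h x) \<Longrightarrow> g = h"
  by (rule extensionalityI[of _ V]) (auto simp: Bij_imp_extensional)

lemma BijI:
  assumes "g \<in> extensional V" "\<And>x. x \<in> V \<Longrightarrow> g x \<in> V" "\<And>x. x \<in> V \<Longrightarrow> h x \<in> V"
    "\<And>x. x \<in> V \<Longrightarrow> g (h x) = x" "\<And>x. x \<in> V \<Longrightarrow> h (g x) = x"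
  shows "g \<in> Bij V"
  unfolding Bij_def using assms by (auto intro!: bij_betw_byWitness[of _ h])

lemma orth_iff: "g \<in> Og \<longleftrightarrow> g \<in> Bij V \<and> lin g \<and> (\<forall>x\<in>V. \<forall>y\<in>V. B (g x) (g y) = B x y)"
  by (auto simp: orth_def Let_def lin_def Bij_closed)

lemma orthD:
  assumes "g \<in> Og"
  shows "g \<in> Bij V" "lin g" "\<And>x. x \<in> V \<Longrightarrow> g x \<in> V"
    "\<And>x y. x \<in> V \<Longrightarrow> y \<in> V \<Longrightarrow> g (x \<boxplus> y) = g x \<boxplus> g y"
    "\<And>a x. a \<in> carrier R \<Longrightarrow> x \<in> V \<Longrightarrow> g (a \<boxdot> x) = a \<boxdot> g x"
    "\<And>x y. x \<in> V \<Longrightarrow> y \<in> V \<Longrightarrow> B (g x) (g y) = B x y"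
    "\<And>x. x \<in> V \<Longrightarrow> Q (g x) = Q x"
proof -
  show *: "g \<in> Bij V" "lin g" "\<And>x. x \<in> V \<Longrightarrow> g x \<in> V"
    "\<And>x y. x \<in> V \<Longrightarrow> y \<in> V \<Longrightarrow> g (x \<boxplus> y) = g x \<boxplus> g y"
    "\<And>a x. a \<in> carrier R \<Longrightarrow> x \<in> V \<Longrightarrow> g (a \<boxdot> x) = a \<boxdot> g x"
    "\<And>x y. x \<in> V \<Longrightarrow> y \<in> V \<Longrightarrow> B (g x) (g y) = B x y"
    using assms by (auto simp: orth_iff lin_def Pi_iff)
  show "Q (g x) = Q x" if "x \<in> V" for x
    using that * by (intro qform_unique) (auto simp: qform_double)
qed

lemma orth_mult: "g \<in> Og \<Longrightarrow> h \<in> Og \<Longrightarrow> g \<otimes>\<^bsub>M\<^esub> h \<in> Og"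
  unfolding orth_iff lin_def by (simp add: mult_M Bij_closed Pi_iff)

lemma one_orth: "\<one>\<^bsub>M\<^esub> \<in> Og"
  unfolding orth_iff lin_def one_M by (simp add: id_Bij Pi_iff)

lemma inv_M: "g \<in> Bij V \<Longrightarrow> inv\<^bsub>M\<^esub> g \<in> Bij V"
  "g \<in> Bij V \<Longrightarrow> x \<in> V \<Longrightarrow> (inv\<^bsub>M\<^esub> g) (g x) = x"
  "g \<in> Bij V \<Longrightarrow> x \<in> V \<Longrightarrow> g ((inv\<^bsub>M\<^esub> g) x) = x"
proof -
  assume g: "g \<in> Bij V"
  interpret grp: group M by (rule group_M)
  show i: "inv\<^bsub>M\<^esub> g \<in> Bij V" using grp.inv_closed[of g] g by simp
  assume x: "x \<in> V"
  have "inv\<^bsub>M\<^esub> g \<otimes>\<^bsub>M\<^esub> g = \<one>\<^bsub>M\<^esub>" using g by (intro grp.l_inv) simp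
  then show "(inv\<^bsub>M\<^esub> g) (g x) = x" using mult_M[OF i g x] x by (simp add: one_M)
  have "g \<otimes>\<^bsub>M\<^esub> inv\<^bsub>M\<^esub> g = \<one>\<^bsub>M\<^esub>" using g by (intro grp.r_inv) simp
  then show "g ((inv\<^bsub>M\<^esub> g) x) = x" using mult_M[OF g i x] x by (simp add: one_M)
qed

lemma inv_orth: assumes g: "g \<in> Og" shows "inv\<^bsub>M\<^esub> g \<in> Og"
proof -
  note gB = orthD(1)[OF g]
  let ?i = "inv\<^bsub>M\<^esub> g"
  have i: "?i x \<in> V" if "x \<in> V" for x using Bij_closed[OF inv_M(1)[OF gB] that] .
  have inj: "u = w" if "g u = g w" "u \<in> V" "w \<in> V" for u w
    using that inv_M(2)[OF gB] by metis
  show ?thesis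
    unfolding orth_iff lin_def
  proof (intro conjI ballI)
    fix x y assume xy: "x \<in> V" "y \<in> V"
    show "?i (x \<boxplus> y) = ?i x \<boxplus> ?i y"
      by (rule inj) (use xy i g in \<open>simp_all add: orthD(4) inv_M(3)[OF gB]\<close>)
    show "B (?i x) (?i y) = B x y"
      using orthD(6)[OF g i i, of x y] xy by (simp add: inv_M(3)[OF gB])
  next
    fix a x assume ax: "a \<in> carrier R" "x \<in> V"
    show "?i (a \<boxdot> x) = a \<boxdot> ?i x"
      by (rule inj) (use ax i g in \<open>simp_all add: orthD(5) inv_M(3)[OF gB]\<close>)
  qed (use i inv_M(1)[OF gB] in auto)
qed

lemma orth_subgroup: "subgroup Og M"
  by (rule subgroup.intro) (auto simp: orth_mult one_orth inv_orth orthD(1))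

lemma anis_iff: "v \<in> anis \<longleftrightarrow> v \<in> V \<and> Q v \<in> Units R"
  by (auto simp: unit_norm_vectors_def)

lemma refl_eq:
  assumes "v \<in> anis" "x \<in> V"
  shows "refl v x = x \<boxplus> (\<ominus> (B x v \<otimes> inv Q v)) \<boxdot> v"
proof (rule vec_ext)
  note v = assms(1)[unfolded anis_iff]
  show "refl v x \<in> V"
    unfolding reflection_def using assms v by (auto intro!: restrict_vec)
  fix i assume "i < N"
  then show "refl v x i = (x \<boxplus> (\<ominus> (B x v \<otimes> inv Q v)) \<boxdot> v) i"
    unfolding reflection_def using assms v by (simp add: a_minus_def l_minus)
qed (use assms in \<open>auto simp: anis_iff\<close>)

lemma emb_inv: "u \<in> Units R \<Longrightarrow> emb R u * emb R (inv u) = emb R \<one>"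
  by (metis Units_closed Units_inv_closed Units_r_inv emb_mult[OF is_cring])

lemma emb_inv2: "u \<in> Units R \<Longrightarrow> emb R u * (emb R (inv u) * t) = emb R \<one> * t"
  by (simp add: emb_inv flip: mult.assoc)

lemma bform_refl:
  assumes "v \<in> anis" "x \<in> V" "y \<in> V"
  shows "B (refl v x) (refl v y) = B x y"
proof (rule ring_eqI)
  note v = assms(1)[unfolded anis_iff]
  have "emb R (B (refl v x) (refl v y)) = emb R (B x y)
     - 2 * (emb R (B x v) * (emb R (inv Q v) * emb R (B y v)))
     + 2 * (emb R (Q v) * (emb R (inv Q v) * (emb R (inv Q v) * (emb R (B x v) * emb R (B y v)))))"
    using assms v
    by (simp add: refl_eq emb_rules emb_bform_self bform_sym[of v y] algebra_simps)
  also have "\<dots> = emb R (B x y)"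
    using v assms by (simp only: emb_inv2) (simp add: emb_rules algebra_simps)
  finally show "emb R (B (refl v x) (refl v y)) = emb R (B x y)" .
qed (use assms in \<open>auto simp: anis_iff refl_eq\<close>)

lemma refl_refl:
  assumes "v \<in> anis" "x \<in> V"
  shows "refl v (refl v x) = x"
proof (rule vec_ext)
  note v = assms(1)[unfolded anis_iff]
  fix i assume i: "i < N"
  have "emb R (refl v (refl v x) i) = emb R (x i)
     - 2 * (emb R (B x v) * (emb R (inv Q v) * emb R (v i)))
     + 2 * (emb R (Q v) * (emb R (inv Q v) * (emb R (inv Q v) * (emb R (B x v) * emb R (v i)))))"
    using assms v i
    by (simp add: refl_eq emb_rules emb_bform_self algebra_simps)
  also have "\<dots> = emb R (x i)"
    using v assms i by (simp only: emb_inv2) (simp add: emb_rules algebra_simps)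
  finally show "refl v (refl v x) i = x i"
    using v assms i by (intro ring_eqI) (auto simp: refl_eq)
qed (use assms in \<open>auto simp: anis_iff refl_eq\<close>)

lemma refl_orth: assumes v: "v \<in> anis" shows "refl v \<in> Og"
  unfolding orth_iff lin_def
proof (intro conjI ballI)
  note v' = v[unfolded anis_iff]
  have cl: "refl v x \<in> V" if "x \<in> V" for x using v' v that by (simp add: refl_eq)
  then show "refl v \<in> V \<rightarrow> V" by auto
  have ext: "refl v \<in> extensional V" by (simp add: reflection_def)
  show "refl v \<in> Bij V"
    by (rule BijI[OF ext cl cl refl_refl[OF v] refl_refl[OF v]])
  fix x y assume xy: "x \<in> V" "y \<in> V"
  show "refl v (x \<boxplus> y) = refl v x \<boxplus> refl v y"
    by (rule vec_ext, use xy cl in simp, use xy cl in simp, rule ring_eqI)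
       (use xy v v' in \<open>simp_all add: refl_eq emb_rules algebra_simps\<close>)
  show "B (refl v x) (refl v y) = B x y" using v xy by (rule bform_refl)
next
  note v' = v[unfolded anis_iff]
  have cl: "refl v x \<in> V" if "x \<in> V" for x using v' v that by (simp add: refl_eq)
  fix a x assume ax: "a \<in> carrier R" "x \<in> V"
  show "refl v (a \<boxdot> x) = a \<boxdot> refl v x"
    by (rule vec_ext, use ax cl in simp, use ax cl in simp, rule ring_eqI)
       (use ax v v' in \<open>simp_all add: refl_eq emb_rules algebra_simps\<close>)
qed

lemma orth_anis: "g \<in> Og \<Longrightarrow> v \<in> anis \<Longrightarrow> g v \<in> anis"
  by (simp add: anis_iff orthD)

lemma orth_refl:
  assumes g: "g \<in> Og" and v: "v \<in> anis" and x: "x \<in> V"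
  shows "g (refl v x) = refl (g v) (g x)"
  using assms orth_anis[OF g v] by (simp add: refl_eq orthD anis_iff)

end

section \<open>Eichler transvections\<close>

(* The rank of U + Sigma is kept in the form n + 2, in which the locale below is instantiated. *)
declare add_2_eq_Suc [simp del] add_2_eq_Suc' [simp del]

text \<open>The locale describes $\Sigma$; its sublocale \<open>L\<close> is $\mathrm{U} \oplus \Sigma$.\<close>

locale hyp_lattice = quadratic_lattice R n G for R :: "'a ring" (structure) and n G

context quadratic_lattice
begin

lemma sum_shift2: "(\<Sum>i<k + 2. f i) = f 0 + f (Suc 0) + (\<Sum>i<k. f (Suc (Suc i)))"
  for f :: "nat \<Rightarrow> 'b :: comm_monoid_add"
  by (induction k) (simp_all add: add_ac numeral_2_eq_2)

lemma emb_one_right: "x \<in> carrier R \<Longrightarrow> emb R x * emb R \<one> = emb R x"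
  by (metis emb_one_emb[OF is_cring] mult.commute)

lemma uminus_Units [simp]: assumes "u \<in> Units R" shows "\<ominus> u \<in> Units R"
proof -
  have "(\<ominus> (inv u)) \<otimes> (\<ominus> u) = \<one>" "(\<ominus> u) \<otimes> (\<ominus> (inv u)) = \<one>"
    using assms by (simp_all add: l_minus r_minus Units_closed)
  then show ?thesis
    unfolding Units_def using assms by (auto simp: Units_closed intro!: bexI[of _ "\<ominus> (inv u)"])
qed

lemma inv_uminus: "u \<in> Units R \<Longrightarrow> inv (\<ominus> u) = \<ominus> (inv u)"
  by (rule comm_inv_char) (simp_all add: l_minus r_minus Units_closed)

lemma hyp_gram_quadratic_lattice: "quadratic_lattice R (N + 2) (hyp_gram R G)"
proof unfold_locales
  show "hyp_gram R G i j \<in> carrier R" if "i < N + 2" "j < N + 2" for i j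
    using that by (auto simp: hyp_gram_def)
  show "hyp_gram R G i j = hyp_gram R G j i" if "i < N + 2" "j < N + 2" for i j
    using that by (auto simp: hyp_gram_def intro: gram_sym)
  show "\<exists>h\<in>carrier R. hyp_gram R G i i = h \<oplus> h" if "i < N + 2" for i
    using that gram_even[of "i - 2"] by (auto simp: hyp_gram_def intro!: bexI[of _ \<zero>])
  show "x = \<zero>" if "x \<in> carrier R" "x \<oplus> x = \<zero>" for x
    using that by (rule two_torsion_free)
qed

end

sublocale hyp_lattice \<subseteq> L: quadratic_lattice R "n + 2" "hyp_gram R G"
  by (rule hyp_gram_quadratic_lattice)

context hyp_lattice
begin

notation vadd (infixl \<open>\<boxplus>\<close> 65) and vsmult (infixr \<open>\<boxdot>\<close> 70)

abbreviation hv where "hv \<equiv> hyp_vec n"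
abbreviation sig where "sig \<equiv> sigma_part n"
abbreviation neg where "neg z \<equiv> (\<ominus> \<one>) \<boxdot> z"

lemma hv_comp [simp]: "hv r s z 0 = r" "hv r s z (Suc 0) = s" "i < n \<Longrightarrow> hv r s z (Suc (Suc i)) = z i"
  by (simp_all add: hyp_vec_def)

lemma hv_closed [simp]: "r \<in> carrier R \<Longrightarrow> s \<in> carrier R \<Longrightarrow> z \<in> V \<Longrightarrow> hv r s z \<in> L.V"
  unfolding hyp_vec_def by (intro L.restrict_vec) auto

lemma sig_closed [simp]: "x \<in> L.V \<Longrightarrow> sig x \<in> V"
  unfolding sigma_part_def by (intro restrict_vec) simp

lemma sig_hv [simp]: "z \<in> V \<Longrightarrow> r \<in> carrier R \<Longrightarrow> s \<in> carrier R \<Longrightarrow> sig (hv r s z) = z"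
  by (rule vec_ext) (simp_all, simp add: sigma_part_def add_2_eq_Suc')

lemma hv_eta: "x \<in> L.V \<Longrightarrow> hv (x 0) (x 1) (sig x) = x"
proof (rule L.vec_ext)
  assume x: "x \<in> L.V"
  fix i assume "i < n + 2"
  then consider "i = 0" | "i = 1" | j where "i = Suc (Suc j)" "j < n"
    by (metis One_nat_def add_2_eq_Suc' not0_implies_Suc not_less_eq)
  then show "hv (x 0) (x 1) (sig x) i = x i"
    by cases (simp_all, simp add: sigma_part_def add_2_eq_Suc')
qed auto

lemma hv_cases:
  assumes "x \<in> L.V"
  obtains r s z where "r \<in> carrier R" "s \<in> carrier R" "z \<in> V" "x = hv r s z"
  by (rule that[of "x 0" "x 1" "sig x"]) (use assms hv_eta in simp_all)

lemma hv_add [simp]: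
  assumes "r \<in> carrier R" "s \<in> carrier R" "z \<in> V" "r' \<in> carrier R" "s' \<in> carrier R" "z' \<in> V"
  shows "L.vadd (hv r s z) (hv r' s' z') = hv (r \<oplus> r') (s \<oplus> s') (z \<boxplus> z')"
proof (rule L.vec_ext)
  fix i assume "i < n + 2"
  then consider "i = 0" | "i = 1" | j where "i = Suc (Suc j)" "j < n"
    by (metis One_nat_def add_2_eq_Suc' not0_implies_Suc not_less_eq)
  then show "L.vadd (hv r s z) (hv r' s' z') i = hv (r \<oplus> r') (s \<oplus> s') (z \<boxplus> z') i"
    by cases simp_all
qed (use assms in auto)

lemma hv_smult [simp]:
  assumes "a \<in> carrier R" "r \<in> carrier R" "s \<in> carrier R" "z \<in> V"
  shows "L.vsmult a (hv r s z) = hv (a \<otimes> r) (a \<otimes> s) (a \<boxdot> z)"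
proof (rule L.vec_ext)
  fix i assume "i < n + 2"
  then consider "i = 0" | "i = 1" | j where "i = Suc (Suc j)" "j < n"
    by (metis One_nat_def add_2_eq_Suc' not0_implies_Suc not_less_eq)
  then show "L.vsmult a (hv r s z) i = hv (a \<otimes> r) (a \<otimes> s) (a \<boxdot> z) i"
    by cases simp_all
qed (use assms in auto)

lemma bform_hv [simp]:
  assumes "r \<in> carrier R" "s \<in> carrier R" "z \<in> V" "r' \<in> carrier R" "s' \<in> carrier R" "z' \<in> V"
  shows "L.B (hv r s z) (hv r' s' z') = r \<otimes> s' \<oplus> s \<otimes> r' \<oplus> B z z'"
proof (rule ring_eqI)
  have "emb R (L.B (hv r s z) (hv r' s' z')) =
      (\<Sum>i<n + 2. \<Sum>j<n + 2. emb R (hv r s z i) * emb R (hyp_gram R G i j) * emb R (hv r' s' z' j))"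
    using assms by (intro L.emb_bform) auto
  also have "\<dots> = emb R (r \<otimes> s' \<oplus> s \<otimes> r' \<oplus> B z z')"
    unfolding sum_shift2 using assms by (simp add: hyp_gram_def emb_rules emb_bform mult.assoc)
  finally show "emb R (L.B (hv r s z) (hv r' s' z')) = emb R (r \<otimes> s' \<oplus> s \<otimes> r' \<oplus> B z z')" .
qed (use assms in auto)

lemma qform_hv [simp]:
  assumes "r \<in> carrier R" "s \<in> carrier R" "z \<in> V"
  shows "L.Q (hv r s z) = r \<otimes> s \<oplus> Q z"
  by (rule L.qform_unique)
     (use assms in \<open>auto intro!: ring_eqI simp: emb_rules emb_bform_self algebra_simps\<close>)

text \<open>These are the transvections of the isotropic vectors $e$ and $f$ in the direction $b \in \Sigma$,
written in the coordinates of $re + sf + z$.\<close>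

definition eichler_e :: "(nat \<Rightarrow> 'a) \<Rightarrow> (nat \<Rightarrow> 'a) \<Rightarrow> (nat \<Rightarrow> 'a)" where
  "eichler_e b = (\<lambda>x\<in>L.V. hv (x 0 \<ominus> B (sig x) b \<ominus> Q b \<otimes> x 1) (x 1) (sig x \<boxplus> x 1 \<boxdot> b))"

definition eichler_f :: "(nat \<Rightarrow> 'a) \<Rightarrow> (nat \<Rightarrow> 'a) \<Rightarrow> (nat \<Rightarrow> 'a)" where
  "eichler_f b = (\<lambda>x\<in>L.V. hv (x 0) (x 1 \<ominus> B (sig x) b \<ominus> Q b \<otimes> x 0) (sig x \<boxplus> x 0 \<boxdot> b))"

text \<open>In terms of reflections this is $s_{e - f} \circ s_{e - uf}$, see \<open>hyp_scale_eq\<close>.\<close>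

definition hyp_scale :: "'a \<Rightarrow> (nat \<Rightarrow> 'a) \<Rightarrow> (nat \<Rightarrow> 'a)" where
  "hyp_scale u = (\<lambda>x\<in>L.V. hv (u \<otimes> x 0) (inv u \<otimes> x 1) (sig x))"

text \<open>The vector $e - uf$ of norm $-u$. Its reflection exchanges $e$ and $f$ up to the factors $u$ and
$u^{-1}$.\<close>

definition e_sub_f :: "'a \<Rightarrow> nat \<Rightarrow> 'a" where
  "e_sub_f u = hv \<one> (\<ominus> u) vzero"

context
  fixes r s z
  assumes rsz [simp]: "r \<in> carrier R" "s \<in> carrier R" "z \<in> V"
begin

lemma eichler_e_hv [simp]: "b \<in> V \<Longrightarrow> eichler_e b (hv r s z) = hv (r \<ominus> B z b \<ominus> Q b \<otimes> s) s (z \<boxplus> s \<boxdot> b)"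
  by (simp add: eichler_e_def)

lemma eichler_f_hv [simp]: "b \<in> V \<Longrightarrow> eichler_f b (hv r s z) = hv r (s \<ominus> B z b \<ominus> Q b \<otimes> r) (z \<boxplus> r \<boxdot> b)"
  by (simp add: eichler_f_def)

lemma hyp_scale_hv [simp]: "hyp_scale u (hv r s z) = hv (u \<otimes> r) (inv u \<otimes> s) z"
  by (simp add: hyp_scale_def)

lemma psi_hv [simp]:
  "b \<in> V \<Longrightarrow> psi R n G b (hv r s z) = hv (B b z \<ominus> r \<oplus> Q b \<otimes> s) (\<ominus> s) (z \<boxplus> s \<boxdot> b)"
  by (simp add: psi_def Let_def)

end

lemma e_sub_f_closed [simp]: "u \<in> carrier R \<Longrightarrow> e_sub_f u \<in> L.V"
  by (simp add: e_sub_f_def)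

lemma qform_e_sub_f [simp]: "u \<in> carrier R \<Longrightarrow> L.Q (e_sub_f u) = \<ominus> u"
  by (simp add: e_sub_f_def)

lemma e_sub_f_anis [simp]: "u \<in> Units R \<Longrightarrow> e_sub_f u \<in> L.anis"
  by (simp add: L.anis_iff Units_closed)

lemma refl_e_sub_f [simp]:
  assumes u: "u \<in> Units R" and [simp]: "r \<in> carrier R" "s \<in> carrier R" "z \<in> V"
  shows "L.refl (e_sub_f u) (hv r s z) = hv (inv u \<otimes> s) (u \<otimes> r) z"
proof -
  have [simp]: "u \<in> carrier R" using u by (rule Units_closed)
  define c where "c = \<ominus> (L.B (hv r s z) (e_sub_f u) \<otimes> inv L.Q (e_sub_f u))"
  have cV: "c = (s \<ominus> r \<otimes> u) \<otimes> inv u"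
    using u unfolding c_def
    by (intro ring_eqI) (simp_all add: e_sub_f_def emb_rules inv_uminus bform_sym[of z] algebra_simps)
  have c [simp]: "c \<in> carrier R" using u by (simp add: cV)
  have z: "z \<boxplus> c \<boxdot> vzero = z" by (rule vec_ext) simp_all
  have 1: "r \<oplus> c \<otimes> \<one> = inv u \<otimes> s"
    using u by (intro ring_eqI) (simp_all add: cV emb_rules algebra_simps emb_inv emb_one_right)
  have 2: "s \<oplus> c \<otimes> (\<ominus> u) = u \<otimes> r"
    using u by (intro ring_eqI)
      (simp_all add: cV emb_rules algebra_simps emb_inv emb_one_right)
  have "L.refl (e_sub_f u) (hv r s z) = L.vadd (hv r s z) (L.vsmult c (e_sub_f u))"
    unfolding c_def using u by (intro L.refl_eq) simp_all
  also have "\<dots> = hv (r \<oplus> c \<otimes> \<one>) (s \<oplus> c \<otimes> (\<ominus> u)) (z \<boxplus> c \<boxdot> vzero)"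
    by (simp add: e_sub_f_def)
  finally show ?thesis by (simp only: 1 2 z)
qed

lemma neg_neg [simp]: "b \<in> V \<Longrightarrow> neg (neg b) = b"
  by (rule vec_ext) (simp_all add: l_minus)

lemma neg_closed [simp]: "b \<in> V \<Longrightarrow> neg b \<in> V"
  by simp

lemma qform_neg [simp]: "b \<in> V \<Longrightarrow> Q (neg b) = Q b"
  by (simp add: qform_smult l_minus)

lemma eichler_e_neg:
  assumes [simp]: "x \<in> L.V" "b \<in> V" shows "eichler_e (neg b) (eichler_e b x) = x"
proof (rule hv_cases[OF assms(1)])
  fix r s z assume [simp]: "r \<in> carrier R" "s \<in> carrier R" "z \<in> V" and x: "x = hv r s z"
  have "r \<ominus> B z b \<ominus> Q b \<otimes> s \<ominus> B (z \<boxplus> s \<boxdot> b) (neg b) \<ominus> Q (neg b) \<otimes> s = r"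
    by (rule ring_eqI) (simp_all add: emb_rules emb_bform_self algebra_simps)
  moreover have "(z \<boxplus> s \<boxdot> b) \<boxplus> s \<boxdot> neg b = z"
    by (rule vec_ext, simp, simp, rule ring_eqI) (simp_all add: emb_rules algebra_simps)
  ultimately show ?thesis by (simp add: x)
qed

lemma eichler_e_orth [simp]: assumes b [simp]: "b \<in> V" shows "eichler_e b \<in> L.Og"
proof -
  have cl: "eichler_e c x \<in> L.V" if "x \<in> L.V" "c \<in> V" for x c
    by (rule hv_cases[OF that(1)]) (use that in simp)
  have inv1: "eichler_e b (eichler_e (neg b) x) = x" if "x \<in> L.V" for x
    using eichler_e_neg[of x "neg b"] that by simp
  have ext: "eichler_e b \<in> extensional L.V"
    unfolding eichler_e_def by (rule restrict_extensional)
  show ?thesis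
    unfolding L.orth_iff L.lin_def
  proof (intro conjI ballI)
    show "eichler_e b \<in> Bij L.V"
      by (rule L.BijI[OF _ cl[OF _ b] cl[OF _ neg_closed[OF b]] inv1 eichler_e_neg[OF _ b]])
         (simp_all add: ext)
    show "eichler_e b \<in> L.V \<rightarrow> L.V" using cl by auto
    fix x y assume "x \<in> L.V" "y \<in> L.V"
    then obtain r s z r' s' z' where [simp]: "r \<in> carrier R" "s \<in> carrier R" "z \<in> V"
        "r' \<in> carrier R" "s' \<in> carrier R" "z' \<in> V" and xy: "x = hv r s z" "y = hv r' s' z'"
      by (metis hv_cases)
    have "(r \<oplus> r') \<ominus> B (z \<boxplus> z') b \<ominus> Q b \<otimes> (s \<oplus> s') =
        (r \<ominus> B z b \<ominus> Q b \<otimes> s) \<oplus> (r' \<ominus> B z' b \<ominus> Q b \<otimes> s')"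
      by (rule ring_eqI) (simp_all add: emb_rules algebra_simps)
    moreover have "(z \<boxplus> z') \<boxplus> (s \<oplus> s') \<boxdot> b = (z \<boxplus> s \<boxdot> b) \<boxplus> (z' \<boxplus> s' \<boxdot> b)"
      by (rule vec_ext, simp, simp, rule ring_eqI) (simp_all add: emb_rules algebra_simps)
    ultimately show "eichler_e b (L.vadd x y) = L.vadd (eichler_e b x) (eichler_e b y)"
      by (simp add: xy)
    show "L.B (eichler_e b x) (eichler_e b y) = L.B x y"
      unfolding xy by (rule ring_eqI)
        (simp_all add: emb_rules emb_bform_self bform_sym[of b z'] algebra_simps)
  next
    fix a x assume "x \<in> L.V" and [simp]: "a \<in> carrier R"
    then obtain r s z where [simp]: "r \<in> carrier R" "s \<in> carrier R" "z \<in> V"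
       and x: "x = hv r s z" by (metis hv_cases)
    have "a \<otimes> r \<ominus> B (a \<boxdot> z) b \<ominus> Q b \<otimes> (a \<otimes> s) = a \<otimes> (r \<ominus> B z b \<ominus> Q b \<otimes> s)"
      by (rule ring_eqI) (simp_all add: emb_rules algebra_simps)
    moreover have "a \<boxdot> z \<boxplus> (a \<otimes> s) \<boxdot> b = a \<boxdot> (z \<boxplus> s \<boxdot> b)"
      by (rule vec_ext, simp, simp, rule ring_eqI) (simp_all add: emb_rules algebra_simps)
    ultimately show "eichler_e b (L.vsmult a x) = L.vsmult a (eichler_e b x)"
      by (simp add: x)
  qed
qed

abbreviation \<tau> where "\<tau> \<equiv> L.refl (e_sub_f \<one>)"

lemma \<tau>_orth [simp]: "\<tau> \<in> L.Og"
  by (rule L.refl_orth) simp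

lemma refl_e_sub_f_orth [simp]: "u \<in> Units R \<Longrightarrow> L.refl (e_sub_f u) \<in> L.Og"
  by (rule L.refl_orth) simp

lemma eichler_e_conj_\<tau>: assumes "b \<in> V" "x \<in> L.V" shows "\<tau> (eichler_e b (\<tau> x)) = eichler_f b x"
  by (rule hv_cases[OF assms(2)]) (use assms(1) in simp)

lemma eichler_f_conj_\<tau>: assumes "b \<in> V" "x \<in> L.V" shows "\<tau> (eichler_f b (\<tau> x)) = eichler_e b x"
  by (rule hv_cases[OF assms(2)]) (use assms(1) in simp)

lemmas Og_Bij = L.orthD(1)

lemma eichler_f_eq: assumes "b \<in> V" shows "eichler_f b = \<tau> \<otimes>\<^bsub>L.M\<^esub> eichler_e b \<otimes>\<^bsub>L.M\<^esub> \<tau>"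
proof (rule extensionalityI[of _ L.V])
  have *: "\<tau> \<otimes>\<^bsub>L.M\<^esub> eichler_e b \<otimes>\<^bsub>L.M\<^esub> \<tau> \<in> L.Og" using assms by (intro L.orth_mult) simp_all
  then show "\<tau> \<otimes>\<^bsub>L.M\<^esub> eichler_e b \<otimes>\<^bsub>L.M\<^esub> \<tau> \<in> extensional L.V"
    using Og_Bij Bij_imp_extensional by blast
  fix x assume "x \<in> L.V"
  then show "eichler_f b x = (\<tau> \<otimes>\<^bsub>L.M\<^esub> eichler_e b \<otimes>\<^bsub>L.M\<^esub> \<tau>) x"
    using assms by (simp add: L.mult_M Og_Bij L.orthD(3) eichler_e_conj_\<tau>)
qed (simp add: eichler_f_def)

lemma eichler_f_orth [simp]: "b \<in> V \<Longrightarrow> eichler_f b \<in> L.Og"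
  by (simp add: eichler_f_eq L.orth_mult)

lemma eichler_f_neg:
  assumes "x \<in> L.V" "b \<in> V" shows "eichler_f (neg b) (eichler_f b x) = x"
  using assms by (simp add: L.orthD(3) L.refl_refl eichler_e_neg flip: eichler_e_conj_\<tau>)

lemma hyp_scale_eq: assumes u: "u \<in> Units R" shows "hyp_scale u = \<tau> \<otimes>\<^bsub>L.M\<^esub> L.refl (e_sub_f u)"
proof (rule extensionalityI[of _ L.V])
  have *: "\<tau> \<otimes>\<^bsub>L.M\<^esub> L.refl (e_sub_f u) \<in> L.Og" using assms by (intro L.orth_mult) simp_all
  then show "\<tau> \<otimes>\<^bsub>L.M\<^esub> L.refl (e_sub_f u) \<in> extensional L.V"
    using Og_Bij Bij_imp_extensional by blast
  fix x assume x: "x \<in> L.V"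
  show "hyp_scale u x = (\<tau> \<otimes>\<^bsub>L.M\<^esub> L.refl (e_sub_f u)) x"
    by (rule hv_cases[OF x]) (use u in \<open>simp add: L.mult_M Og_Bij Units_closed\<close>)
qed (simp add: hyp_scale_def)

lemma hyp_scale_orth [simp]: "u \<in> Units R \<Longrightarrow> hyp_scale u \<in> L.Og"
  by (simp add: hyp_scale_eq L.orth_mult)

text \<open>The map $\psi_0$ negates both isotropic vectors, and so does the product of the reflections in
$e - f$ and $e + f$.\<close>

lemma psi_eq:
  assumes [simp]: "b \<in> V"
  shows "psi R n G b = eichler_e (neg b) \<otimes>\<^bsub>L.M\<^esub> (\<tau> \<otimes>\<^bsub>L.M\<^esub> L.refl (e_sub_f (\<ominus> \<one>)))"
proof (rule extensionalityI[of _ L.V])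
  have o: "\<tau> \<otimes>\<^bsub>L.M\<^esub> L.refl (e_sub_f (\<ominus> \<one>)) \<in> L.Og" by (intro L.orth_mult) simp_all
  then have *: "eichler_e (neg b) \<otimes>\<^bsub>L.M\<^esub> (\<tau> \<otimes>\<^bsub>L.M\<^esub> L.refl (e_sub_f (\<ominus> \<one>))) \<in> L.Og"
    by (intro L.orth_mult) simp_all
  then show "eichler_e (neg b) \<otimes>\<^bsub>L.M\<^esub> (\<tau> \<otimes>\<^bsub>L.M\<^esub> L.refl (e_sub_f (\<ominus> \<one>))) \<in> extensional L.V"
    using Og_Bij Bij_imp_extensional by blast
  fix x assume "x \<in> L.V"
  then obtain r s z where [simp]: "r \<in> carrier R" "s \<in> carrier R" "z \<in> V"
    and x: "x = hv r s z" by (metis hv_cases)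
  have 1: "B b z \<ominus> r \<oplus> Q b \<otimes> s = inv (\<ominus> \<one>) \<otimes> r \<ominus> B z (neg b) \<ominus> Q (neg b) \<otimes> ((\<ominus> \<one>) \<otimes> s)"
    by (rule ring_eqI) (simp_all add: emb_rules emb_one_right inv_uminus bform_sym[of b z] algebra_simps)
  have 2: "z \<boxplus> s \<boxdot> b = z \<boxplus> ((\<ominus> \<one>) \<otimes> s) \<boxdot> neg b"
    by (rule vec_ext, simp, simp, rule ring_eqI) (simp_all add: emb_rules algebra_simps)
  show "psi R n G b x = (eichler_e (neg b) \<otimes>\<^bsub>L.M\<^esub> (\<tau> \<otimes>\<^bsub>L.M\<^esub> L.refl (e_sub_f (\<ominus> \<one>)))) x"
    unfolding x using o
    by (simp add: L.mult_M Og_Bij 1 2 l_minus inv_uminus del: bform_smult_right)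
qed (simp add: psi_def)

lemma psi_orth [simp]: "b \<in> V \<Longrightarrow> psi R n G b \<in> L.Og"
  by (simp add: psi_eq L.orth_mult)

lemma psi_psi_zero:
  assumes [simp]: "b \<in> V" "x \<in> L.V" shows "psi R n G (neg b) (psi R n G vzero x) = eichler_e b x"
proof -
  obtain r s z where [simp]: "r \<in> carrier R" "s \<in> carrier R" "z \<in> V"
    and x: "x = hv r s z" using assms(2) by (metis hv_cases)
  have 0: "B vzero z \<ominus> r \<oplus> Q vzero \<otimes> s = \<ominus> r" "z \<boxplus> s \<boxdot> vzero = z"
    by (rule ring_eqI, simp_all add: emb_rules) (rule vec_ext, simp_all)
  have 1: "B (neg b) z \<ominus> (\<ominus> r) \<oplus> Q b \<otimes> (\<ominus> s) = r \<ominus> B z b \<ominus> Q b \<otimes> s"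
    by (rule ring_eqI) (simp_all add: emb_rules bform_sym[of b z] algebra_simps)
  have 2: "z \<boxplus> (\<ominus> s) \<boxdot> neg b = z \<boxplus> s \<boxdot> b"
    by (rule vec_ext, simp, simp, rule ring_eqI) (simp_all add: emb_rules algebra_simps)
  show ?thesis
    unfolding x by (simp add: 0 del: bform_zero_left qform_zero bform_smult_left)
      (simp only: 1 2 minus_minus \<open>s \<in> carrier R\<close>)
qed

lemma psi_conj_eq:
  "psi_conj R n G b a = L.refl a \<otimes>\<^bsub>L.M\<^esub> psi R n G b \<otimes>\<^bsub>L.M\<^esub> L.refl a"
  by (simp add: psi_conj_def Let_def)

lemma unit_norm_one: "a \<in> L.V \<Longrightarrow> L.Q a = \<one> \<or> L.Q a = \<ominus> \<one> \<Longrightarrow> a \<in> L.anis"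
  by (auto simp: L.anis_iff)

lemma psi_conjs_orth: "g \<in> psi_conjs R n G \<Longrightarrow> g \<in> L.Og"
  unfolding psi_conjs_def psi_conj_eq
  by (auto intro!: L.orth_mult L.refl_orth unit_norm_one)

lemma refl_group_pm_gen_orth:
  assumes "a \<in> L.V" "b \<in> L.V" "L.Q a = \<one> \<and> L.Q b = \<one> \<or> L.Q a = \<ominus> \<one> \<and> L.Q b = \<ominus> \<one>"
  shows "L.refl a \<otimes>\<^bsub>L.M\<^esub> L.refl b \<in> L.Og"
  using assms by (intro L.orth_mult L.refl_orth unit_norm_one) auto

lemma L_group: "group L.M" by (rule L.group_M)

lemma refl_group_pm_orth: "refl_group_pm R (n + 2) (hyp_gram R G) \<subseteq> L.Og"
  unfolding refl_group_pm_def
  by (rule group.generate_subgroup_incl[OF L_group _ L.orth_subgroup])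
     (auto simp: refl_group_pm_gen_orth)

lemma prod_of_orth: "set xs \<subseteq> L.Og \<Longrightarrow> prod_of L.M xs \<in> L.Og"
  by (induction xs) (simp_all add: prod_of_def L.one_orth L.orth_mult)

lemma even_products_orth: "even_products L.M (psi_conjs R n G) \<subseteq> L.Og"
  unfolding even_products_def using psi_conjs_orth by (blast intro: prod_of_orth)

lemma W_pm_gen_orth:
  "refl_group_pm R (n + 2) (hyp_gram R G) \<union> even_products L.M (psi_conjs R n G) \<subseteq> L.Og"
  using refl_group_pm_orth even_products_orth by blast

lemma W_pm_subgroup: "subgroup (W_pm R n G) L.M"
  unfolding W_pm_def Let_def
  by (rule group.generate_is_subgroup[OF L_group]) (use W_pm_gen_orth Og_Bij in auto)

lemma W_pm_orth: "W_pm R n G \<subseteq> L.Og"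
  unfolding W_pm_def Let_def
  by (rule group.generate_subgroup_incl[OF L_group W_pm_gen_orth L.orth_subgroup])

lemma refl_group_orth: "refl_group R (n + 2) (hyp_gram R G) \<subseteq> L.Og"
  unfolding refl_group_def
  by (rule group.generate_subgroup_incl[OF L_group _ L.orth_subgroup]) (auto simp: L.refl_orth)

lemma W_group_subgroup: "subgroup (W_group R n G) L.M"
  unfolding W_group_def
  by (rule group.generate_is_subgroup[OF L_group]) (use refl_group_orth psi_conjs_orth Og_Bij in auto)

lemma refl_refl_W_pm:
  assumes "a \<in> L.V" "b \<in> L.V" "L.Q a = \<one> \<and> L.Q b = \<one> \<or> L.Q a = \<ominus> \<one> \<and> L.Q b = \<ominus> \<one>"
  shows "L.refl a \<otimes>\<^bsub>L.M\<^esub> L.refl b \<in> W_pm R n G"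
  unfolding W_pm_def Let_def refl_group_pm_def
  by (rule generate.incl, rule UnI1, rule generate.incl) (use assms in blast)

text \<open>With $a = e - f$ one has $\psi_{-b,a} \circ \psi_{0,a} = s_a \circ \psi_{-b} \circ \psi_0 \circ s_a$,
where $\psi_{-b} \circ \psi_0$ is the transvection along $e$ and $s_a$ exchanges $e$ and $f$.\<close>

lemma eichler_f_W_pm: assumes [simp]: "b \<in> V" shows "eichler_f b \<in> W_pm R n G"
proof -
  have mem: "psi_conj R n G c (e_sub_f \<one>) \<in> psi_conjs R n G" if "c \<in> V" for c
    unfolding psi_conjs_def using that
    by (intro CollectI exI[of _ c] exI[of _ "e_sub_f \<one>"] conjI) simp_all
  have o: "psi_conj R n G c (e_sub_f \<one>) \<in> L.Og" if "c \<in> V" for c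
    using mem[OF that] by (rule psi_conjs_orth)
  have app: "psi_conj R n G c (e_sub_f \<one>) x = \<tau> (psi R n G c (\<tau> x))" if "c \<in> V" "x \<in> L.V" for c x
    unfolding psi_conj_eq using that
    by (simp add: L.mult_M Og_Bij L.orthD(3) L.orth_mult)
  have "eichler_f b = psi_conj R n G (neg b) (e_sub_f \<one>) \<otimes>\<^bsub>L.M\<^esub> (psi_conj R n G vzero (e_sub_f \<one>) \<otimes>\<^bsub>L.M\<^esub> \<one>\<^bsub>L.M\<^esub>)"
    (is "_ = ?g \<otimes>\<^bsub>L.M\<^esub> (?h \<otimes>\<^bsub>L.M\<^esub> _)")
  proof (rule L.Bij_eqI)
    show "eichler_f b \<in> Bij L.V" by (simp add: Og_Bij)
    show "?g \<otimes>\<^bsub>L.M\<^esub> (?h \<otimes>\<^bsub>L.M\<^esub> \<one>\<^bsub>L.M\<^esub>) \<in> Bij L.V"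
      by (intro Og_Bij L.orth_mult o L.one_orth) simp_all
    fix x assume x: "x \<in> L.V"
    have "(?g \<otimes>\<^bsub>L.M\<^esub> (?h \<otimes>\<^bsub>L.M\<^esub> \<one>\<^bsub>L.M\<^esub>)) x = ?g (?h x)"
      using x by (simp add: L.mult_M Og_Bij o L.one_orth L.orth_mult) (simp add: L.one_M)
    also have "\<dots> = \<tau> (psi R n G (neg b) (psi R n G vzero (\<tau> x)))"
      using x by (simp add: app L.orthD(3) L.refl_refl)
    also have "\<dots> = eichler_f b x"
      using x by (subst psi_psi_zero) (simp_all add: L.orthD(3) eichler_e_conj_\<tau>)
    finally show "eichler_f b x = (?g \<otimes>\<^bsub>L.M\<^esub> (?h \<otimes>\<^bsub>L.M\<^esub> \<one>\<^bsub>L.M\<^esub>)) x" ..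
  qed
  also have "\<dots> = prod_of L.M [?g, ?h]"
    by (simp add: prod_of_def)
  also have "\<dots> \<in> even_products L.M (psi_conjs R n G)"
    unfolding even_products_def using mem by (intro CollectI exI[of _ "[?g, ?h]"]) simp
  finally show ?thesis
    unfolding W_pm_def Let_def by (intro generate.incl UnI2)
qed

text \<open>Conjugating by $s_{e - f}$ turns a transvection $g$ along $f$ into one along $e$, and
$s_{e-f} \circ g \circ s_{e-f} = (s_{e-f} \circ s_{g(e-f)}) \circ g$ lies in the group because both
vectors have norm $-1$.\<close>

lemma eichler_e_W_pm: assumes b [simp]: "b \<in> V" shows "eichler_e b \<in> W_pm R n G"
proof -
  define a where "a = eichler_f b (e_sub_f \<one>)"
  have a [simp]: "a \<in> L.V" "L.Q a = \<ominus> \<one>"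
    by (simp_all add: a_def L.orthD(3,7))
  have an [simp]: "a \<in> L.anis" by (rule unit_norm_one) simp_all
  have "eichler_e b = (\<tau> \<otimes>\<^bsub>L.M\<^esub> L.refl a) \<otimes>\<^bsub>L.M\<^esub> eichler_f b"
  proof (rule L.Bij_eqI)
    show "eichler_e b \<in> Bij L.V" by (simp add: Og_Bij)
    show "(\<tau> \<otimes>\<^bsub>L.M\<^esub> L.refl a) \<otimes>\<^bsub>L.M\<^esub> eichler_f b \<in> Bij L.V"
      by (intro Og_Bij L.orth_mult L.refl_orth) simp_all
    fix x assume x: "x \<in> L.V"
    have "((\<tau> \<otimes>\<^bsub>L.M\<^esub> L.refl a) \<otimes>\<^bsub>L.M\<^esub> eichler_f b) x = \<tau> (L.refl a (eichler_f b x))"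
      using x by (simp add: L.mult_M Og_Bij L.orth_mult L.refl_orth L.orthD(3))
    also have "\<dots> = \<tau> (eichler_f b (\<tau> x))"
      unfolding a_def using x by (subst L.orth_refl[symmetric]) simp_all
    also have "\<dots> = eichler_e b x" using x by (simp add: eichler_f_conj_\<tau>)
    finally show "eichler_e b x = ((\<tau> \<otimes>\<^bsub>L.M\<^esub> L.refl a) \<otimes>\<^bsub>L.M\<^esub> eichler_f b) x" ..
  qed
  moreover have "\<tau> \<otimes>\<^bsub>L.M\<^esub> L.refl a \<in> W_pm R n G"
    by (rule refl_refl_W_pm) simp_all
  ultimately show ?thesis
    using eichler_f_W_pm[OF b] subgroup.m_closed[OF W_pm_subgroup] by simp
qed

text \<open>The rescaling by $t^2$ is $s_{e-f} \circ s_a$ for $a = t^{-1} e - t f$, a multiple of $e - t^2 f$ of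
norm $-1$.\<close>

lemma hyp_scale_square_W_pm: assumes t: "t \<in> Units R" shows "hyp_scale (t \<otimes> t) \<in> W_pm R n G"
proof -
  have [simp]: "t \<in> carrier R" "inv t \<in> Units R" using t by (simp_all add: Units_closed)
  define a where "a = hv (inv t) (\<ominus> t) vzero"
  have a [simp]: "a \<in> L.V" "L.Q a = \<ominus> \<one>"
    using t by (simp_all add: a_def r_minus)
  have an [simp]: "a \<in> L.anis" by (rule unit_norm_one) simp_all
  have inv2: "inv (t \<otimes> t) = inv t \<otimes> inv t"
    using t by (intro comm_inv_char) (simp_all add: m_assoc[symmetric], simp add: m_assoc)
  have "hyp_scale (t \<otimes> t) = \<tau> \<otimes>\<^bsub>L.M\<^esub> L.refl a"
  proof (rule L.Bij_eqI)
    show "hyp_scale (t \<otimes> t) \<in> Bij L.V" using t by (simp add: Og_Bij Units_m_closed)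
    show "\<tau> \<otimes>\<^bsub>L.M\<^esub> L.refl a \<in> Bij L.V"
      by (intro Og_Bij L.orth_mult L.refl_orth) simp_all
    fix x assume xL: "x \<in> L.V"
    then obtain r s z where [simp]: "r \<in> carrier R" "s \<in> carrier R" "z \<in> V"
      and x: "x = hv r s z" by (metis hv_cases)
    define c where "c = \<ominus> (L.B x a \<otimes> inv L.Q a)"
    have cV: "c = s \<otimes> inv t \<ominus> r \<otimes> t"
      using t unfolding c_def x a
      by (intro ring_eqI) (simp_all add: a_def emb_rules inv_uminus bform_sym[of z] algebra_simps emb_one_right)
    have c [simp]: "c \<in> carrier R" using t by (simp add: cV)
    have z: "z \<boxplus> c \<boxdot> vzero = z" by (rule vec_ext) simp_all
    have 1: "r \<oplus> c \<otimes> inv t = inv (t \<otimes> t) \<otimes> s"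
      using t unfolding inv2 by (intro ring_eqI) (simp_all add: cV emb_rules algebra_simps emb_inv emb_one_right)
    have 2: "s \<oplus> c \<otimes> (\<ominus> t) = (t \<otimes> t) \<otimes> r"
      using t by (intro ring_eqI) (simp_all add: cV emb_rules algebra_simps emb_inv emb_one_right)
    have "L.refl a x = L.vadd x (L.vsmult c a)"
      unfolding c_def by (intro L.refl_eq) (simp_all add: x)
    also have "\<dots> = hv (r \<oplus> c \<otimes> inv t) (s \<oplus> c \<otimes> (\<ominus> t)) (z \<boxplus> c \<boxdot> vzero)"
      using t by (simp add: x a_def)
    also have "\<dots> = hv (inv (t \<otimes> t) \<otimes> s) ((t \<otimes> t) \<otimes> r) z" by (simp only: 1 2 z)
    finally have "L.refl a x = hv (inv (t \<otimes> t) \<otimes> s) ((t \<otimes> t) \<otimes> r) z" .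
    then show "hyp_scale (t \<otimes> t) x = (\<tau> \<otimes>\<^bsub>L.M\<^esub> L.refl a) x"
      using t xL by (simp add: L.mult_M Og_Bij L.refl_orth) (simp add: x)
  qed
  then show ?thesis using refl_refl_W_pm[of "e_sub_f \<one>" a] by simp
qed

lemma refl_W_group: "v \<in> L.anis \<Longrightarrow> L.refl v \<in> W_group R n G"
  unfolding W_group_def refl_group_def by (intro generate.incl UnI1) simp

lemma W_pm_gen_W_group:
  "refl_group_pm R (n + 2) (hyp_gram R G) \<union> even_products L.M (psi_conjs R n G) \<subseteq> W_group R n G"
proof -
  note m = subgroup.m_closed[OF W_group_subgroup]
  have "L.refl a \<otimes>\<^bsub>L.M\<^esub> L.refl b \<in> W_group R n G" if
    "a \<in> L.V" "b \<in> L.V" "L.Q a = \<one> \<and> L.Q b = \<one> \<or> L.Q a = \<ominus> \<one> \<and> L.Q b = \<ominus> \<one>" for a b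
    using that by (intro m refl_W_group unit_norm_one) auto
  then have "refl_group_pm R (n + 2) (hyp_gram R G) \<subseteq> W_group R n G"
    unfolding refl_group_pm_def
    by (intro group.generate_subgroup_incl[OF L_group _ W_group_subgroup]) blast
  moreover have "psi_conjs R n G \<subseteq> W_group R n G"
    unfolding W_group_def by (intro subsetI generate.incl UnI2)
  then have "prod_of L.M xs \<in> W_group R n G" if "set xs \<subseteq> psi_conjs R n G" for xs
    using that by (induction xs)
      (auto simp: prod_of_def intro!: m intro: subgroup.one_closed[OF W_group_subgroup])
  then have "even_products L.M (psi_conjs R n G) \<subseteq> W_group R n G"
    unfolding even_products_def by blast
  ultimately show ?thesis by blast
qed

lemma W_pm_subset_W_group: "W_pm R n G \<subseteq> W_group R n G"
  unfolding W_pm_def Let_def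
  by (rule group.generate_subgroup_incl[OF L_group W_pm_gen_W_group W_group_subgroup])

lemma hyp_scale_W_group: "u \<in> Units R \<Longrightarrow> hyp_scale u \<in> W_group R n G"
  using refl_W_group[of "e_sub_f \<one>"] refl_W_group[of "e_sub_f u"]
  by (simp add: hyp_scale_eq subgroup.m_closed[OF W_group_subgroup])

end

context hyp_lattice
begin

lemma add_eq_self:
  assumes "a \<oplus> b = b" "a \<in> carrier R" "b \<in> carrier R" shows "a = \<zero>"
proof (rule ring_eqI)
  have "emb R a + emb R b = emb R b"
    using arg_cong[OF assms(1), of "emb R"] assms(2,3) by (simp add: emb_rules)
  then show "emb R a = emb R \<zero>" by (simp add: emb_rules)
qed (use assms in simp_all)

lemma emb_inv3: "u \<in> Units R \<Longrightarrow> emb R u * (t * emb R (inv u)) = emb R \<one> * t"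
  using emb_inv[of u] by (simp add: mult.left_commute mult.commute)

section \<open>Isometries acting trivially on the discriminant group\<close>

definition eichler_group :: "((nat \<Rightarrow> 'a) \<Rightarrow> nat \<Rightarrow> 'a) set" where
  "eichler_group = generate L.M (eichler_e ` V \<union> eichler_f ` V)"

lemma eichler_group_gen_Bij: "eichler_e ` V \<union> eichler_f ` V \<subseteq> carrier L.M"
  by (auto intro: Og_Bij)

lemma eichler_group_subgroup: "subgroup eichler_group L.M"
  unfolding eichler_group_def by (rule group.generate_is_subgroup[OF L_group eichler_group_gen_Bij])

lemma eichler_e_eichler_group: "b \<in> V \<Longrightarrow> eichler_e b \<in> eichler_group" and eichler_f_eichler_group: "b \<in> V \<Longrightarrow> eichler_f b \<in> eichler_group"
  unfolding eichler_group_def by (auto intro: generate.incl)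

lemma eichler_group_W_pm: "eichler_group \<subseteq> W_pm R n G"
  unfolding eichler_group_def
  by (rule group.generate_subgroup_incl[OF L_group _ W_pm_subgroup]) (auto simp: eichler_e_W_pm eichler_f_W_pm)

lemma eichler_group_orth: "w \<in> eichler_group \<Longrightarrow> w \<in> L.Og"
  using eichler_group_W_pm W_pm_orth by blast

lemma inv_eichler_e: "b \<in> V \<Longrightarrow> inv\<^bsub>L.M\<^esub> (eichler_e b) = eichler_e (neg b)"
  and inv_eichler_f: "b \<in> V \<Longrightarrow> inv\<^bsub>L.M\<^esub> (eichler_f b) = eichler_f (neg b)"
proof -
  assume b: "b \<in> V"
  interpret grp: group L.M by (rule L_group)
  have "eichler_e (neg b) \<otimes>\<^bsub>L.M\<^esub> eichler_e b = \<one>\<^bsub>L.M\<^esub>" "eichler_f (neg b) \<otimes>\<^bsub>L.M\<^esub> eichler_f b = \<one>\<^bsub>L.M\<^esub>"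
    using b by (auto intro!: L.Bij_eqI simp: L.mult_M Og_Bij eichler_e_neg eichler_f_neg L.one_M id_Bij)
  then show "inv\<^bsub>L.M\<^esub> (eichler_e b) = eichler_e (neg b)" "inv\<^bsub>L.M\<^esub> (eichler_f b) = eichler_f (neg b)"
    using b by (auto intro!: grp.inv_equality Og_Bij)
qed

lemma eichler_group_induct [consumes 1, case_names one eichler_e eichler_f mult]:
  assumes "w \<in> eichler_group" and "P \<one>\<^bsub>L.M\<^esub>"
    and "\<And>b. b \<in> V \<Longrightarrow> P (eichler_e b)" and "\<And>b. b \<in> V \<Longrightarrow> P (eichler_f b)"
    and "\<And>g h. g \<in> eichler_group \<Longrightarrow> h \<in> eichler_group \<Longrightarrow> P g \<Longrightarrow> P h \<Longrightarrow> P (g \<otimes>\<^bsub>L.M\<^esub> h)"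
  shows "P w"
  using assms(1) unfolding eichler_group_def
proof (induction rule: generate.induct)
  case one
  then show ?case by (rule assms(2))
next
  case (incl h)
  then show ?case using assms(3,4) by auto
next
  case (inv h)
  then show ?case using assms(3,4) by (auto simp: inv_eichler_e inv_eichler_f)
next
  case (eng h1 h2)
  then show ?case using assms(5) by (simp add: eichler_group_def)
qed

text \<open>The flag selects which of $e$ and $f$ carries the first coordinate, so that arguments symmetric in
the two isotropic vectors are made once.\<close>

definition hv_swap :: "bool \<Rightarrow> 'a \<Rightarrow> 'a \<Rightarrow> (nat \<Rightarrow> 'a) \<Rightarrow> nat \<Rightarrow> 'a" where
  "hv_swap c r s z = (if c then hv r s z else hv s r z)"

definition eichler :: "bool \<Rightarrow> (nat \<Rightarrow> 'a) \<Rightarrow> (nat \<Rightarrow> 'a) \<Rightarrow> (nat \<Rightarrow> 'a)" where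
  "eichler c = (if c then eichler_e else eichler_f)"

lemma eichler_hv_swap [simp]:
  assumes "r \<in> carrier R" "s \<in> carrier R" "z \<in> V" "b \<in> V"
  shows "eichler c b (hv_swap c r s z) = hv_swap c (r \<ominus> B z b \<ominus> Q b \<otimes> s) s (z \<boxplus> s \<boxdot> b)"
    "eichler (\<not> c) b (hv_swap c r s z) = hv_swap c r (s \<ominus> B z b \<ominus> Q b \<otimes> r) (z \<boxplus> r \<boxdot> b)"
  using assms by (simp_all add: eichler_def hv_swap_def)

lemma eichler_eichler_group: "b \<in> V \<Longrightarrow> eichler c b \<in> eichler_group"
  by (simp add: eichler_def eichler_e_eichler_group eichler_f_eichler_group)

lemma eichler_orth [simp]: "b \<in> V \<Longrightarrow> eichler c b \<in> L.Og"
  by (simp add: eichler_def)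

lemma hv_swap_closed [simp]: "r \<in> carrier R \<Longrightarrow> s \<in> carrier R \<Longrightarrow> z \<in> V \<Longrightarrow> hv_swap c r s z \<in> L.V"
  by (simp add: hv_swap_def)

lemma qform_hv_swap [simp]:
  "r \<in> carrier R \<Longrightarrow> s \<in> carrier R \<Longrightarrow> z \<in> V \<Longrightarrow> L.Q (hv_swap c r s z) = r \<otimes> s \<oplus> Q z"
  by (simp add: hv_swap_def m_comm)

lemma unit_left_factor: "a \<otimes> b \<in> Units R \<Longrightarrow> a \<in> carrier R \<Longrightarrow> b \<in> carrier R \<Longrightarrow> a \<in> Units R"
proof -
  assume a: "a \<otimes> b \<in> Units R" "a \<in> carrier R" "b \<in> carrier R"
  have "a \<otimes> (b \<otimes> inv (a \<otimes> b)) = \<one>"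
    using a by (simp add: m_assoc[symmetric])
  moreover from this have "(b \<otimes> inv (a \<otimes> b)) \<otimes> a = \<one>"
    using a by (simp add: m_comm)
  ultimately show "a \<in> Units R"
    unfolding Units_def using a by auto
qed

end

text \<open>For a lattice with Gram matrix $G$ take $d = \det G$ and for $X_k$ the rows of the adjugate of $G$.
The vectors $d^{-1} X_k$ are then the basis dual to the standard basis.\<close>

locale disc_lattice = hyp_lattice R n G for R :: "'a ring" (structure) and n G +
  fixes d :: 'a and X :: "nat \<Rightarrow> nat \<Rightarrow> 'a"
  assumes local_ring: "a \<in> carrier R \<Longrightarrow> b \<in> carrier R \<Longrightarrow> a \<oplus> b \<in> Units R \<Longrightarrow>
      a \<in> Units R \<or> b \<in> Units R"
    and d_closed [simp]: "d \<in> carrier R" and d_nonzero: "d \<noteq> \<zero>"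
    and X_closed [simp]: "k < n \<Longrightarrow> X k \<in> V"
    and X_dual [simp]: "k < n \<Longrightarrow> y \<in> V \<Longrightarrow> B (X k) y = d \<otimes> y k"
begin

abbreviation Xh where "Xh k \<equiv> hv \<zero> \<zero> (X k)"

text \<open>Dividing by $d$ turns this into the condition on the dual basis vectors that acting trivially on
the discriminant group imposes.\<close>

definition fix_dual_mod :: "((nat \<Rightarrow> 'a) \<Rightarrow> nat \<Rightarrow> 'a) set" where
  "fix_dual_mod = {g \<in> L.Og. \<forall>k<n. \<exists>y\<in>L.V. g (Xh k) = L.vadd (Xh k) (L.vsmult d y)}"

lemma d_cancel: "a \<in> carrier R \<Longrightarrow> b \<in> carrier R \<Longrightarrow> d \<otimes> a = d \<otimes> b \<longleftrightarrow> a = b"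
  using m_lcancel[OF d_nonzero d_closed] by blast

lemma eichler_Xh:
  assumes "i < n" "b \<in> V" "b i = \<zero>"
  shows "eichler c b (Xh i) = Xh i"
proof -
  have 1: "\<zero> \<ominus> d \<otimes> b i \<ominus> Q b \<otimes> \<zero> = \<zero>"
    using assms by (intro ring_eqI) (simp_all add: emb_rules)
  have 2: "X i \<boxplus> \<zero> \<boxdot> b = X i"
    using assms by (intro vec_ext) simp_all
  show ?thesis using assms 1 2 by (simp add: eichler_def)
qed

text \<open>If one isotropic coordinate is $d$ times a unit, a transvection clears the component in $d\Sigma$.
The norm then forces the other isotropic coordinate to vanish, and a transvection in the
direction of the $k$-th unit vector removes $ds$, because $(X_k, b) = d b_k$. All directions used
have vanishing coordinates below $k$, so the earlier $X_i$ stay fixed.\<close>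

lemma clear_to_dual:
  assumes k: "k < n" and [simp]: "r \<in> carrier R" "z \<in> V" and s: "s \<in> Units R"
    and z0: "\<And>i. i < k \<Longrightarrow> z i = \<zero>"
    and norm: "L.Q (hv_swap c (d \<otimes> r) (d \<otimes> s) (X k \<boxplus> d \<boxdot> z)) = Q (X k)"
  shows "\<exists>w\<in>eichler_group. (\<forall>i<k. w (Xh i) = Xh i) \<and> w (hv_swap c (d \<otimes> r) (d \<otimes> s) (X k \<boxplus> d \<boxdot> z)) = Xh k"
proof -
  have [simp]: "s \<in> carrier R" "inv s \<in> carrier R" "X k \<in> V" using s k by (simp_all add: Units_closed)
  define x where "x = hv_swap c (d \<otimes> r) (d \<otimes> s) (X k \<boxplus> d \<boxdot> z)"
  have xV: "x \<in> L.V" by (simp add: x_def)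
  \<comment> \<open>This direction clears \<open>d \<boxdot> z\<close>, because the transvection adds \<open>d \<otimes> s\<close> times it.\<close>
  define b1 where "b1 = (\<ominus> (inv s)) \<boxdot> z"
  have b1 [simp]: "b1 \<in> V" by (simp add: b1_def)
  define \<rho> where "\<rho> = d \<otimes> r \<ominus> B (X k \<boxplus> d \<boxdot> z) b1 \<ominus> Q b1 \<otimes> (d \<otimes> s)"
  have \<rho> [simp]: "\<rho> \<in> carrier R" by (simp add: \<rho>_def)
  have "X k \<boxplus> d \<boxdot> z \<boxplus> (d \<otimes> s) \<boxdot> b1 = X k"
    using s by (intro vec_ext, simp_all add: b1_def, intro ring_eqI)
      (simp_all add: emb_rules algebra_simps emb_inv3)
  then have 1: "eichler c b1 x = hv_swap c \<rho> (d \<otimes> s) (X k)"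
    unfolding x_def by (subst eichler_hv_swap(1)) (simp_all add: \<rho>_def)
  have "\<rho> \<otimes> (d \<otimes> s) \<oplus> Q (X k) = L.Q (eichler c b1 x)"
    unfolding 1 by simp
  also have "\<dots> = L.Q x"
    by (rule L.orthD(7)[OF eichler_orth xV]) simp
  also have "\<dots> = Q (X k)"
    unfolding x_def by (rule norm)
  finally have "\<rho> \<otimes> (d \<otimes> s) = \<zero>"
    by (rule add_eq_self) simp_all
  moreover have "d \<otimes> s \<noteq> \<zero>"
  proof
    assume "d \<otimes> s = \<zero>"
    moreover have "d = (d \<otimes> s) \<otimes> inv s" using s by (simp add: m_assoc)
    ultimately show False using d_nonzero s by simp
  qed
  ultimately have "\<rho> = \<zero>" using integral[of \<rho> "d \<otimes> s"] by simp
  note 1 = 1[unfolded this]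
  \<comment> \<open>Its product with \<open>X k\<close> is \<open>d \<otimes> s\<close>, the coordinate still to be removed.\<close>
  define b2 where "b2 = s \<boxdot> uvec k"
  have b2 [simp]: "b2 \<in> V" by (simp add: b2_def)
  have "d \<otimes> s \<ominus> d \<otimes> s \<ominus> Q b2 \<otimes> \<zero> = \<zero>"
    by (rule ring_eqI) (simp_all add: emb_rules)
  moreover have "X k \<boxplus> \<zero> \<boxdot> b2 = X k" by (rule vec_ext) simp_all
  ultimately have 2: "eichler (\<not> c) b2 (hv_swap c \<zero> (d \<otimes> s) (X k)) = Xh k"
    using k by (simp add: b2_def del: bform_smult_right) (simp add: b2_def hv_swap_def)
  define w where "w = eichler (\<not> c) b2 \<otimes>\<^bsub>L.M\<^esub> eichler c b1"
  have w: "w y = eichler (\<not> c) b2 (eichler c b1 y)" if "y \<in> L.V" for y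
    unfolding w_def using that by (simp add: L.mult_M Og_Bij)
  show ?thesis
  proof (intro bexI conjI allI impI)
    show "w \<in> eichler_group"
      unfolding w_def by (intro subgroup.m_closed[OF eichler_group_subgroup] eichler_eichler_group) simp_all
    show "w (hv_swap c (d \<otimes> r) (d \<otimes> s) (X k \<boxplus> d \<boxdot> z)) = Xh k"
      unfolding x_def[symmetric] w[OF xV] 1 by (rule 2)
    fix i assume i: "i < k"
    then have "b1 i = \<zero>" "b2 i = \<zero>" using k z0 by (simp_all add: b1_def b2_def)
    then show "w (Xh i) = Xh i"
      using i k by (simp add: w eichler_Xh)
  qed
qed

text \<open>Write $g X_k = X_k + d(re + sf + z)$. Pairing with the fixed $X_i$ shows that $z_i = 0$ for $i < k$.
If $r$ or $s$ is a unit, \<open>clear_to_dual\<close> applies. Otherwise let $z'$ be the $\Sigma$-component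
of the image of the $k$-th unit vector. That vector pairs with $X_k$ to $d$, and so do the images;
by locality $z'_k + (z, z')$ is a unit, and the transvection along $f$ in the direction $z'$ makes
the coefficient of $f$ a unit multiple of $d$.\<close>

lemma fix_next:
  assumes g: "g \<in> fix_dual_mod" and k: "k < n" and fixed: "\<And>i. i < k \<Longrightarrow> g (Xh i) = Xh i"
  shows "\<exists>w\<in>eichler_group. (\<forall>i<k. w (Xh i) = Xh i) \<and> w (g (Xh k)) = Xh k"
proof -
  have gO: "g \<in> L.Og" using g by (simp add: fix_dual_mod_def)
  note gD = L.orthD[OF gO]
  have [simp]: "X k \<in> V" using k by simp
  obtain y where y: "y \<in> L.V" "g (Xh k) = L.vadd (Xh k) (L.vsmult d y)"
    using g k by (auto simp: fix_dual_mod_def)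
  obtain r s z where [simp]: "r \<in> carrier R" "s \<in> carrier R" "z \<in> V" and yh: "y = hv r s z"
    using hv_cases[OF y(1)] by metis
  have gX: "g (Xh k) = hv (d \<otimes> r) (d \<otimes> s) (X k \<boxplus> d \<boxdot> z)"
    unfolding y(2) yh by simp
  have z0: "z i = \<zero>" if i: "i < k" for i
  proof -
    have [simp]: "i < n" using i k by simp
    have "B (X i) (X k) \<oplus> d \<otimes> (d \<otimes> z i) = L.B (Xh i) (g (Xh k))"
      unfolding gX by (simp del: X_dual) simp
    also have "\<dots> = L.B (g (Xh i)) (g (Xh k))" by (simp only: fixed[OF i])
    also have "\<dots> = B (X i) (X k) \<oplus> \<zero>" by (subst gD(6)) simp_all
    finally have "d \<otimes> (d \<otimes> z i) \<oplus> B (X i) (X k) = B (X i) (X k)"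
      by (simp add: a_comm del: X_dual)
    then have "d \<otimes> (d \<otimes> z i) = \<zero>"
      by (rule add_eq_self) simp_all
    then show "z i = \<zero>" using integral[of d "d \<otimes> z i"] integral[of d "z i"] d_nonzero by simp
  qed
  have normX: "L.Q (g (Xh k)) = Q (X k)"
    by (subst gD(7)) simp_all
  consider "s \<in> Units R" | "r \<in> Units R" | "s \<notin> Units R" "r \<notin> Units R" by blast
  then show ?thesis
  proof cases
    case 1
    show ?thesis using clear_to_dual[of k r z s True] 1 k z0 normX unfolding gX by (simp add: hv_swap_def)
  next
    case 2
    show ?thesis using clear_to_dual[of k s z r False] 2 k z0 normX unfolding gX by (simp add: hv_swap_def)
  next
    case 3
    define e where "e = hv \<zero> \<zero> (uvec k)"
    have e: "e \<in> L.V" by (simp add: e_def)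
    obtain r' s' z' where [simp]: "r' \<in> carrier R" "s' \<in> carrier R" "z' \<in> V" and ge: "g e = hv r' s' z'"
      using hv_cases[OF gD(3)[OF e]] by metis
    have z'0: "z' i = \<zero>" if i: "i < k" for i
    proof -
      have [simp]: "i < n" using i k by simp
      have "d \<otimes> z' i = L.B (Xh i) (g e)" unfolding ge by simp
      also have "\<dots> = L.B (g (Xh i)) (g e)" by (simp only: fixed[OF i])
      also have "\<dots> = \<zero>" using e i k by (subst gD(6)) (simp_all add: e_def)
      finally show "z' i = \<zero>" using integral[of d "z' i"] d_nonzero by simp
    qed
    define t where "t = z' k \<oplus> B z z'"
    have t [simp]: "t \<in> carrier R" using k by (simp add: t_def)
    have "d \<otimes> \<one> = L.B (g (Xh k)) (g e)"
      using e k by (subst gD(6)) (simp_all add: e_def)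
    also have "\<dots> = d \<otimes> (r \<otimes> s' \<oplus> (s \<otimes> r' \<oplus> t))"
      unfolding gX ge using k by (intro ring_eqI) (simp_all add: t_def emb_rules algebra_simps)
    finally have "r \<otimes> s' \<oplus> (s \<otimes> r' \<oplus> t) = \<one>" by (subst (asm) d_cancel) simp_all
    then have tU: "t \<in> Units R"
      using local_ring[of "r \<otimes> s'" "s \<otimes> r' \<oplus> t"] local_ring[of "s \<otimes> r'" t] 3
        unit_left_factor[of r s'] unit_left_factor[of s r'] by auto
    define s1 where "s1 = s \<ominus> t \<ominus> Q z' \<otimes> r"
    define z1 where "z1 = z \<boxplus> r \<boxdot> z'"
    have s1 [simp]: "s1 \<in> carrier R" and z1 [simp]: "z1 \<in> V" by (simp_all add: s1_def z1_def)
    have "s1 \<oplus> (r \<otimes> Q z' \<oplus> (\<ominus> s)) = \<ominus> t"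
      by (rule ring_eqI) (simp_all add: s1_def emb_rules algebra_simps)
    moreover have "\<ominus> s \<notin> Units R" using 3(1) uminus_Units[of "\<ominus> s"] by auto
    ultimately have s1U: "s1 \<in> Units R"
      using tU local_ring[of s1 "r \<otimes> Q z' \<oplus> (\<ominus> s)"] local_ring[of "r \<otimes> Q z'" "\<ominus> s"] 3
        unit_left_factor[of r "Q z'"] by auto
    have eq1: "d \<otimes> s \<ominus> B (X k \<boxplus> d \<boxdot> z) z' \<ominus> Q z' \<otimes> (d \<otimes> r) = d \<otimes> s1"
      using k by (intro ring_eqI) (simp_all add: s1_def t_def emb_rules algebra_simps)
    have eq2: "X k \<boxplus> d \<boxdot> z \<boxplus> (d \<otimes> r) \<boxdot> z' = X k \<boxplus> d \<boxdot> z1"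
      by (rule vec_ext, simp, simp, rule ring_eqI) (simp_all add: z1_def emb_rules algebra_simps)
    have FX: "eichler_f z' (g (Xh k)) = hv_swap True (d \<otimes> r) (d \<otimes> s1) (X k \<boxplus> d \<boxdot> z1)"
      unfolding gX by (subst eichler_f_hv) (simp_all only: eq1 eq2, simp_all add: hv_swap_def)
    have "L.Q (eichler_f z' (g (Xh k))) = Q (X k)"
      using normX by (simp add: L.orthD(7) gD(3))
    then obtain w where w: "w \<in> eichler_group" "\<And>i. i < k \<Longrightarrow> w (Xh i) = Xh i" "w (eichler_f z' (g (Xh k))) = Xh k"
      using clear_to_dual[of k r z1 s1 True] k s1U z0 z'0 unfolding FX by (auto simp: z1_def)
    have wB: "w \<in> Bij L.V" using eichler_group_orth[OF w(1)] by (rule Og_Bij)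
    have app: "(w \<otimes>\<^bsub>L.M\<^esub> eichler_f z') x = w (eichler_f z' x)" if "x \<in> L.V" for x
      using that by (simp add: L.mult_M wB Og_Bij)
    show ?thesis
    proof (intro bexI conjI allI impI)
      show "w \<otimes>\<^bsub>L.M\<^esub> eichler_f z' \<in> eichler_group"
        by (intro subgroup.m_closed[OF eichler_group_subgroup] w eichler_f_eichler_group) simp
      show "(w \<otimes>\<^bsub>L.M\<^esub> eichler_f z') (g (Xh k)) = Xh k"
        using w(3) by (simp add: app gD(3))
      fix i assume i: "i < k"
      then have "eichler_f z' (Xh i) = Xh i"
        using eichler_Xh[of i z' False] z'0 k by (simp add: eichler_def)
      then show "(w \<otimes>\<^bsub>L.M\<^esub> eichler_f z') (Xh i) = Xh i"
        using w(2)[OF i] i k by (simp add: app)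
    qed
  qed
qed

lemma fix_dual_mod_orth: "g \<in> fix_dual_mod \<Longrightarrow> g \<in> L.Og"
  by (simp add: fix_dual_mod_def)

lemma fix_dual_mod_mult: assumes "g \<in> fix_dual_mod" "h \<in> fix_dual_mod" shows "g \<otimes>\<^bsub>L.M\<^esub> h \<in> fix_dual_mod"
  unfolding fix_dual_mod_def mem_Collect_eq
proof (intro conjI allI impI)
  note o = assms[THEN fix_dual_mod_orth]
  show "g \<otimes>\<^bsub>L.M\<^esub> h \<in> L.Og" using o by (rule L.orth_mult)
  fix k assume k: "k < n"
  obtain y y' where y: "y \<in> L.V" "g (Xh k) = L.vadd (Xh k) (L.vsmult d y)"
    and y': "y' \<in> L.V" "h (Xh k) = L.vadd (Xh k) (L.vsmult d y')"
    using assms k by (force simp: fix_dual_mod_def)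
  have "(g \<otimes>\<^bsub>L.M\<^esub> h) (Xh k) = L.vadd (L.vadd (Xh k) (L.vsmult d y)) (L.vsmult d (g y'))"
    using o y y' k by (simp add: L.mult_M Og_Bij L.orthD(3-5) del: hv_add hv_smult)
  also have "\<dots> = L.vadd (Xh k) (L.vsmult d (L.vadd y (g y')))"
    using o y y' k by (intro L.vec_ext, simp add: L.orthD(3), simp add: L.orthD(3), intro ring_eqI)
      (simp_all add: L.orthD(3) L.vec_comp_closed[OF L.orthD(3)] emb_rules algebra_simps)
  finally show "\<exists>y\<in>L.V. (g \<otimes>\<^bsub>L.M\<^esub> h) (Xh k) = L.vadd (Xh k) (L.vsmult d y)"
    using o y y' by (intro bexI[of _ "L.vadd y (g y')"]) (simp_all add: L.orthD(3))
qed

lemma eichler_group_fix_dual_mod: "w \<in> eichler_group \<Longrightarrow> w \<in> fix_dual_mod"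
proof (induction rule: eichler_group_induct)
  case one
  have "Xh k = L.vadd (Xh k) (L.vsmult d (hv \<zero> \<zero> vzero))" if "k < n" for k
  proof -
    have "X k = X k \<boxplus> d \<boxdot> vzero" using that by (intro vec_ext) simp_all
    then show ?thesis using that by simp
  qed
  then have "\<exists>y\<in>L.V. \<one>\<^bsub>L.M\<^esub> (Xh k) = L.vadd (Xh k) (L.vsmult d y)" if "k < n" for k
    using that unfolding L.one_M by (intro bexI[of _ "hv \<zero> \<zero> vzero"]) (simp_all del: hv_add hv_smult)
  then show ?case
    unfolding fix_dual_mod_def using L.one_orth by blast
next
  case (eichler_e b)
  have *: "eichler_e b (Xh k) = L.vadd (Xh k) (L.vsmult d (hv (\<ominus> (b k)) \<zero> vzero))" if k: "k < n" for k
  proof -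
    have "\<zero> \<ominus> d \<otimes> b k \<ominus> Q b \<otimes> \<zero> = \<zero> \<oplus> d \<otimes> (\<ominus> (b k))"
      using eichler_e k by (intro ring_eqI) (simp_all add: emb_rules)
    moreover have "X k \<boxplus> \<zero> \<boxdot> b = X k \<boxplus> d \<boxdot> vzero" using k eichler_e by (intro vec_ext) simp_all
    ultimately show ?thesis using k eichler_e by simp
  qed
  then show ?case
    unfolding fix_dual_mod_def mem_Collect_eq
  proof (intro conjI allI impI)
    fix k assume k: "k < n"
    show "\<exists>y\<in>L.V. eichler_e b (Xh k) = L.vadd (Xh k) (L.vsmult d y)"
      by (rule bexI[where x = "hv (\<ominus> (b k)) \<zero> vzero"], rule *[OF k]) (use eichler_e k in simp_all)
  qed (use eichler_e in simp)
next
  case (eichler_f b)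
  have *: "eichler_f b (Xh k) = L.vadd (Xh k) (L.vsmult d (hv \<zero> (\<ominus> (b k)) vzero))" if k: "k < n" for k
  proof -
    have "\<zero> \<ominus> d \<otimes> b k \<ominus> Q b \<otimes> \<zero> = \<zero> \<oplus> d \<otimes> (\<ominus> (b k))"
      using eichler_f k by (intro ring_eqI) (simp_all add: emb_rules)
    moreover have "X k \<boxplus> \<zero> \<boxdot> b = X k \<boxplus> d \<boxdot> vzero" using k eichler_f by (intro vec_ext) simp_all
    ultimately show ?thesis using k eichler_f by simp
  qed
  then show ?case
    unfolding fix_dual_mod_def mem_Collect_eq
  proof (intro conjI allI impI)
    fix k assume k: "k < n"
    show "\<exists>y\<in>L.V. eichler_f b (Xh k) = L.vadd (Xh k) (L.vsmult d y)"
      by (rule bexI[where x = "hv \<zero> (\<ominus> (b k)) vzero"], rule *[OF k]) (use eichler_f k in simp_all)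
  qed (use eichler_f in simp)
next
  case (mult g h)
  then show ?case by (simp add: fix_dual_mod_mult)
qed

lemma eichler_group_fix_all:
  assumes g: "g \<in> fix_dual_mod"
  shows "k \<le> n \<Longrightarrow> \<exists>w\<in>eichler_group. \<forall>i<k. w (g (Xh i)) = Xh i"
proof (induction k)
  case 0
  then show ?case using subgroup.one_closed[OF eichler_group_subgroup] by blast
next
  case (Suc k)
  then obtain w where w: "w \<in> eichler_group" "\<And>i. i < k \<Longrightarrow> w (g (Xh i)) = Xh i" by auto
  have o: "w \<in> L.Og" "g \<in> L.Og" using eichler_group_orth[OF w(1)] fix_dual_mod_orth[OF g] .
  have app: "(w \<otimes>\<^bsub>L.M\<^esub> g) x = w (g x)" if "x \<in> L.V" for x
    using that o by (simp add: L.mult_M Og_Bij)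
  have wg: "w \<otimes>\<^bsub>L.M\<^esub> g \<in> fix_dual_mod" by (intro fix_dual_mod_mult eichler_group_fix_dual_mod w g)
  have k: "k < n" using Suc.prems by simp
  obtain w' where w': "w' \<in> eichler_group" "\<And>i. i < k \<Longrightarrow> w' (Xh i) = Xh i" "w' ((w \<otimes>\<^bsub>L.M\<^esub> g) (Xh k)) = Xh k"
    using fix_next[OF wg k] w(2) k by (auto simp: app)
  show ?case
  proof (intro bexI allI impI)
    show "w' \<otimes>\<^bsub>L.M\<^esub> w \<in> eichler_group" using w w' by (intro subgroup.m_closed[OF eichler_group_subgroup])
    fix i assume "i < Suc k"
    then show "(w' \<otimes>\<^bsub>L.M\<^esub> w) (g (Xh i)) = Xh i"
      using w w' k eichler_group_orth[OF w(1)] eichler_group_orth[OF w'(1)] o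
      by (auto simp: L.mult_M Og_Bij L.orthD(3) app less_Suc_eq)
  qed
qed

text \<open>Pairing with the $X_k$ recovers the $\Sigma$-component, which $g$ therefore preserves. The images of
$e$ and $f$ are isotropic vectors of $\mathrm{U}$ with product one, so each is a unit multiple of $e$
or $f$.\<close>

lemma fix_dual_imp_scale:
  assumes g: "g \<in> L.Og" and fixed: "\<And>i. i < n \<Longrightarrow> g (Xh i) = Xh i"
  shows "\<exists>u\<in>Units R. g = hyp_scale u \<or> g = L.refl (e_sub_f u)"
proof -
  note gD = L.orthD[OF g]
  have zpart: "sig (g x) i = sig x i" if x: "x \<in> L.V" and i: "i < n" for x i
  proof -
    obtain r s z where [simp]: "r \<in> carrier R" "s \<in> carrier R" "z \<in> V" and xh: "x = hv r s z"
      using hv_cases[OF x] by metis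
    obtain r' s' z' where [simp]: "r' \<in> carrier R" "s' \<in> carrier R" "z' \<in> V" and gx: "g x = hv r' s' z'"
      using hv_cases[OF gD(3)[OF x]] by metis
    have "d \<otimes> z' i = L.B (Xh i) (g x)" using i by (simp add: gx)
    also have "\<dots> = L.B (g (Xh i)) (g x)" by (simp only: fixed[OF i])
    also have "\<dots> = d \<otimes> z i" using i x by (subst gD(6)) (simp_all add: xh)
    finally have "z' i = z i" using i by (simp add: d_cancel)
    moreover have "sig (g x) i = z' i" by (simp add: gx)
    moreover have "sig x i = z i" by (simp add: xh)
    ultimately show ?thesis by simp
  qed
  have sg: "sig (g x) = sig x" if "x \<in> L.V" for x
    using that by (intro vec_ext) (simp_all add: zpart gD(3))
  define e f where "e = hv \<one> \<zero> vzero" "f = hv \<zero> \<one> vzero"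
  have ef [simp]: "e \<in> L.V" "f \<in> L.V" by (simp_all add: e_f_def)
  obtain r s where [simp]: "r \<in> carrier R" "s \<in> carrier R" and ge: "g e = hv r s vzero"
    using hv_cases[OF gD(3)[OF ef(1)]] sg[OF ef(1)] by (metis e_f_def(1) one_closed sig_hv vzero_closed zero_closed)
  obtain r' s' where [simp]: "r' \<in> carrier R" "s' \<in> carrier R" and gf: "g f = hv r' s' vzero"
    using hv_cases[OF gD(3)[OF ef(2)]] sg[OF ef(2)] by (metis e_f_def(2) one_closed sig_hv vzero_closed zero_closed)
  have "r \<otimes> s = \<zero>" using gD(7)[OF ef(1)] unfolding ge by (simp add: e_f_def)
  then have rs: "r = \<zero> \<or> s = \<zero>" by (simp add: integral)
  have "r' \<otimes> s' = \<zero>" using gD(7)[OF ef(2)] unfolding gf by (simp add: e_f_def)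
  then have rs': "r' = \<zero> \<or> s' = \<zero>" by (simp add: integral)
  have one: "r \<otimes> s' \<oplus> s \<otimes> r' = \<one>" using gD(6)[OF ef] unfolding ge gf by (simp add: e_f_def)
  have gz: "g (hv \<zero> \<zero> z) = hv \<zero> \<zero> z" if zV [simp]: "z \<in> V" for z
  proof -
    obtain a b z2 where [simp]: "a \<in> carrier R" "b \<in> carrier R" "z2 \<in> V"
      and h: "g (hv \<zero> \<zero> z) = hv a b z2"
      using hv_cases[OF gD(3)[OF hv_closed[OF zero_closed zero_closed zV]]] by metis
    have "z2 = z" using sg[of "hv \<zero> \<zero> z"] h by simp
    have 1: "a \<otimes> s \<oplus> b \<otimes> r = \<zero>"
      using gD(6)[of "hv \<zero> \<zero> z" e] unfolding h ge by (simp add: e_f_def bform_sym[of _ vzero])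
    have 2: "a \<otimes> s' \<oplus> b \<otimes> r' = \<zero>"
      using gD(6)[of "hv \<zero> \<zero> z" f] unfolding h gf by (simp add: e_f_def bform_sym[of _ vzero])
    have "a = a \<otimes> (r \<otimes> s' \<oplus> s \<otimes> r')" by (simp add: one)
    also have "\<dots> = r \<otimes> (a \<otimes> s' \<oplus> b \<otimes> r') \<oplus> r' \<otimes> (a \<otimes> s \<oplus> b \<otimes> r) \<ominus> (b \<otimes> (r \<otimes> r') \<oplus> b \<otimes> (r \<otimes> r'))"
      by (rule ring_eqI) (simp_all add: emb_rules algebra_simps)
    finally have a: "a = \<ominus> (b \<otimes> (r \<otimes> r') \<oplus> b \<otimes> (r \<otimes> r'))" unfolding 1 2 by (simp add: a_minus_def)
    have "b = b \<otimes> (r \<otimes> s' \<oplus> s \<otimes> r')" by (simp add: one)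
    also have "\<dots> = s' \<otimes> (a \<otimes> s \<oplus> b \<otimes> r) \<oplus> s \<otimes> (a \<otimes> s' \<oplus> b \<otimes> r') \<ominus> (a \<otimes> (s \<otimes> s') \<oplus> a \<otimes> (s \<otimes> s'))"
      by (rule ring_eqI) (simp_all add: emb_rules algebra_simps)
    finally have b: "b = \<ominus> (a \<otimes> (s \<otimes> s') \<oplus> a \<otimes> (s \<otimes> s'))" unfolding 1 2 by (simp add: a_minus_def)
    have rr: "r \<otimes> r' = \<zero>" and ss: "s \<otimes> s' = \<zero>" using rs rs' one by auto
    \<comment> \<open>The isotropic part of the image is orthogonal to the images of \<open>e\<close> and \<open>f\<close>,
      and these span the hyperbolic plane.\<close>
    have a0: "a = \<zero>" by (subst a) (simp add: rr)
    have b0: "b = \<zero>" by (subst b) (simp add: ss)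
    show ?thesis unfolding h a0 b0 \<open>z2 = z\<close> ..
  qed
  have gen: "g (hv x y z) = hv (x \<otimes> r \<oplus> y \<otimes> r') (x \<otimes> s \<oplus> y \<otimes> s') z"
    if [simp]: "x \<in> carrier R" "y \<in> carrier R" "z \<in> V" for x y z
  proof -
    have v1: "vzero \<boxplus> vzero \<boxplus> z = z" by (rule vec_ext) simp_all
    have v2: "a \<boxdot> vzero = vzero" if "a \<in> carrier R" for a
      using that by (intro vec_ext) simp_all
    note v = v1 v2
    have "L.vadd (L.vadd (L.vsmult x e) (L.vsmult y f)) (hv \<zero> \<zero> z) = hv x y z"
      by (simp add: e_f_def v)
    then have "g (hv x y z) = g (L.vadd (L.vadd (L.vsmult x e) (L.vsmult y f)) (hv \<zero> \<zero> z))"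
      by (rule arg_cong[OF sym])
    also have "\<dots> = L.vadd (L.vadd (L.vsmult x (g e)) (L.vsmult y (g f))) (g (hv \<zero> \<zero> z))"
      by (simp add: gD(4,5))
    also have "\<dots> = hv (x \<otimes> r \<oplus> y \<otimes> r') (x \<otimes> s \<oplus> y \<otimes> s') z"
      unfolding ge gf gz[OF that(3)] by (simp add: v)
    finally show ?thesis .
  qed
  show ?thesis
  proof (cases "s = \<zero>")
    case True
    then have rs1: "r \<otimes> s' = \<one>" using one by simp
    then have rU: "r \<in> Units R" using unit_left_factor[of r s'] by simp
    have s': "s' = inv r" using rs1 by (intro comm_inv_char[symmetric]) simp_all
    have "s' \<noteq> \<zero>" using rs1 by auto
    then have r': "r' = \<zero>" using rs' by simp
    have "g = hyp_scale r"
    proof (rule L.Bij_eqI)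
      show "g \<in> Bij L.V" "hyp_scale r \<in> Bij L.V" using g rU by (simp_all add: Og_Bij)
      fix x assume x: "x \<in> L.V"
      obtain a b c where abc: "a \<in> carrier R" "b \<in> carrier R" "c \<in> V" "x = hv a b c"
        using hv_cases[OF x] by metis
      have "a \<otimes> r \<oplus> b \<otimes> r' = r \<otimes> a" "a \<otimes> s \<oplus> b \<otimes> s' = inv r \<otimes> b"
        using abc rU unfolding True r' s' by (simp_all add: m_comm Units_closed)
      then show "g x = hyp_scale r x"
        using abc by (simp add: gen)
    qed
    then show ?thesis using rU by blast
  next
    case False
    then have r0: "r = \<zero>" using rs by simp
    then have rs1: "s \<otimes> r' = \<one>" using one by simp
    then have sU: "s \<in> Units R" using unit_left_factor[of s r'] by simp
    have r': "r' = inv s" using rs1 by (intro comm_inv_char[symmetric]) simp_all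
    have "r' \<noteq> \<zero>" using rs1 by auto
    then have s': "s' = \<zero>" using rs' by simp
    have "g = L.refl (e_sub_f s)"
    proof (rule L.Bij_eqI)
      show "g \<in> Bij L.V" "L.refl (e_sub_f s) \<in> Bij L.V" using g sU by (simp_all add: Og_Bij)
      fix x assume x: "x \<in> L.V"
      obtain a b c where abc: "a \<in> carrier R" "b \<in> carrier R" "c \<in> V" "x = hv a b c"
        using hv_cases[OF x] by metis
      have "a \<otimes> r \<oplus> b \<otimes> r' = inv s \<otimes> b" "a \<otimes> s \<oplus> b \<otimes> s' = s \<otimes> a"
        using abc sU unfolding r0 r' s' by (simp_all add: m_comm Units_closed)
      then show "g x = L.refl (e_sub_f s) x"
        using abc sU by (simp add: gen)
    qed
    then show ?thesis using sU by blast
  qed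
qed

theorem fix_dual_mod_decompose:
  assumes g: "g \<in> fix_dual_mod"
  shows "\<exists>w\<in>eichler_group. \<exists>u\<in>Units R. g = w \<otimes>\<^bsub>L.M\<^esub> hyp_scale u \<or> g = w \<otimes>\<^bsub>L.M\<^esub> L.refl (e_sub_f u)"
proof -
  interpret grp: group L.M by (rule L_group)
  obtain w where w: "w \<in> eichler_group" "\<And>i. i < n \<Longrightarrow> w (g (Xh i)) = Xh i"
    using eichler_group_fix_all[OF g order_refl] by blast
  have o: "w \<in> L.Og" "g \<in> L.Og" using eichler_group_orth[OF w(1)] fix_dual_mod_orth[OF g] .
  have "\<exists>u\<in>Units R. w \<otimes>\<^bsub>L.M\<^esub> g = hyp_scale u \<or> w \<otimes>\<^bsub>L.M\<^esub> g = L.refl (e_sub_f u)"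
    by (rule fix_dual_imp_scale) (use o w in \<open>simp_all add: L.orth_mult L.mult_M Og_Bij\<close>)
  moreover have wc: "w \<in> carrier L.M" "g \<in> carrier L.M" using o by (auto intro: Og_Bij)
  have "g = inv\<^bsub>L.M\<^esub> w \<otimes>\<^bsub>L.M\<^esub> (w \<otimes>\<^bsub>L.M\<^esub> g)"
    using wc by (metis grp.inv_closed grp.l_inv grp.l_one grp.m_assoc)
  ultimately show ?thesis
    using subgroup.m_inv_closed[OF eichler_group_subgroup w(1)] by metis
qed

lemma fix_dual_mod_subset_W_group: "fix_dual_mod \<subseteq> W_group R n G"
proof
  fix g assume "g \<in> fix_dual_mod"
  then obtain w u where "w \<in> eichler_group" "u \<in> Units R" "g = w \<otimes>\<^bsub>L.M\<^esub> hyp_scale u \<or> g = w \<otimes>\<^bsub>L.M\<^esub> L.refl (e_sub_f u)"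
    using fix_dual_mod_decompose by blast
  then show "g \<in> W_group R n G"
    using eichler_group_W_pm W_pm_subset_W_group subgroup.m_closed[OF W_group_subgroup] hyp_scale_W_group refl_W_group e_sub_f_anis
    by blast
qed

end

section \<open>The ring of p-adic integers\<close>

context
  fixes p :: nat
  assumes p: "prime p"
begin

abbreviation (input) Zp where "Zp \<equiv> padic_int p"
abbreviation (input) \<iota>p where "\<iota>p \<equiv> padic_of_int p"

lemma p_pow_pos [simp]: "0 < int p ^ k"
  using p prime_gt_0_nat by simp

lemma padic_carrier_iff:
  "x \<in> carrier Zp \<longleftrightarrow> (\<forall>k. 0 \<le> x k \<and> x k < int p ^ k \<and> x (Suc k) mod int p ^ k = x k)"
  by (auto simp: padic_int_def)

lemma padic_bounds: "x \<in> carrier Zp \<Longrightarrow> 0 \<le> x k \<and> x k < int p ^ k"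
  by (simp add: padic_carrier_iff)

lemma padic_self_mod: "x \<in> carrier Zp \<Longrightarrow> x k mod int p ^ k = x k"
  using padic_bounds[of x k] by simp

lemma padic_mod: "x \<in> carrier Zp \<Longrightarrow> k \<le> l \<Longrightarrow> x l mod int p ^ k = x k"
proof (induction l)
  case 0
  then show ?case using padic_self_mod[of x 0] by simp
next
  case (Suc l)
  show ?case
  proof (cases "k = Suc l")
    case True
    then show ?thesis using padic_self_mod[OF Suc.prems(1), of k] by simp
  next
    case False
    then have kl: "k \<le> l" using Suc.prems by simp
    have "x (Suc l) mod int p ^ k = x (Suc l) mod int p ^ l mod int p ^ k"
      using kl by (simp add: mod_mod_cancel le_imp_power_dvd)
    also have "x (Suc l) mod int p ^ l = x l"
      using Suc.prems by (simp add: padic_carrier_iff)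
    finally show ?thesis using Suc kl by simp
  qed
qed

lemma padic_carrierI:
  assumes "\<And>k. x k mod int p ^ k = x k" "\<And>k. x (Suc k) mod int p ^ k = x k"
  shows "x \<in> carrier Zp"
  unfolding padic_carrier_iff
proof (intro allI conjI)
  fix k
  have "0 \<le> x k mod int p ^ k" "x k mod int p ^ k < int p ^ k"
    using p_pow_pos[of k] by (simp_all add: pos_mod_sign pos_mod_bound)
  then show "0 \<le> x k" "x k < int p ^ k" using assms(1) by simp_all
qed (rule assms(2))

lemma padic_add: "(x \<oplus>\<^bsub>Zp\<^esub> y) k = (x k + y k) mod int p ^ k"
  and padic_mult: "(x \<otimes>\<^bsub>Zp\<^esub> y) k = (x k * y k) mod int p ^ k"
  and padic_zero: "\<zero>\<^bsub>Zp\<^esub> k = 0"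
  and padic_one: "\<one>\<^bsub>Zp\<^esub> k = 1 mod int p ^ k"
  by (simp_all add: padic_int_def)

lemma pow_mod_Suc: "a mod int p ^ Suc k mod int p ^ k = a mod int p ^ k"
  "a mod (int p ^ k * int p) mod int p ^ k = a mod int p ^ k"
  by (simp_all add: mod_mod_cancel)

lemma p_nonzero [simp]: "p \<noteq> 0"
  using p by auto

lemma padic_coherent:
  assumes "x \<in> carrier Zp" shows "x (Suc k) mod int p ^ k = x k mod int p ^ k"
  using assms by (simp add: padic_mod)

lemma padic_of_int_closed: "\<iota>p m \<in> carrier Zp"
  by (rule padic_carrierI) (simp_all add: padic_of_int_def pow_mod_Suc del: power_Suc)

lemma padic_cring: "cring Zp"
proof (rule cringI)
  have add_closed: "x \<oplus>\<^bsub>Zp\<^esub> y \<in> carrier Zp" if "x \<in> carrier Zp" "y \<in> carrier Zp" for x y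
    by (rule padic_carrierI)
       (use mod_add_cong[OF padic_coherent[OF that(1)] padic_coherent[OF that(2)]] in
         \<open>simp_all add: padic_add pow_mod_Suc del: power_Suc\<close>)
  have mult_closed: "x \<otimes>\<^bsub>Zp\<^esub> y \<in> carrier Zp" if "x \<in> carrier Zp" "y \<in> carrier Zp" for x y
    by (rule padic_carrierI)
       (use mod_mult_cong[OF padic_coherent[OF that(1)] padic_coherent[OF that(2)]] in
         \<open>simp_all add: padic_mult pow_mod_Suc del: power_Suc\<close>)
  have zero: "\<zero>\<^bsub>Zp\<^esub> \<in> carrier Zp" by (rule padic_carrierI) (simp_all add: padic_zero)
  have one: "\<one>\<^bsub>Zp\<^esub> \<in> carrier Zp"
    by (rule padic_carrierI) (simp_all add: padic_one pow_mod_Suc del: power_Suc)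
  show "abelian_group Zp"
  proof (rule abelian_groupI)
    fix x assume x: "x \<in> carrier Zp"
    have "(\<lambda>k. (- x k) mod int p ^ k) \<in> carrier Zp"
      by (rule padic_carrierI)
         (use mod_minus_cong[OF padic_coherent[OF x]] in \<open>simp_all add: pow_mod_Suc del: power_Suc\<close>)
    moreover have "(\<lambda>k. (- x k) mod int p ^ k) \<oplus>\<^bsub>Zp\<^esub> x = \<zero>\<^bsub>Zp\<^esub>"
      by (rule ext) (simp add: padic_add padic_zero mod_simps)
    ultimately show "\<exists>y\<in>carrier Zp. y \<oplus>\<^bsub>Zp\<^esub> x = \<zero>\<^bsub>Zp\<^esub>" by blast
    show "\<zero>\<^bsub>Zp\<^esub> \<oplus>\<^bsub>Zp\<^esub> x = x"
      by (rule ext) (simp add: padic_add padic_zero padic_self_mod[OF x])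
  next
    fix x y z
    show "x \<oplus>\<^bsub>Zp\<^esub> y \<oplus>\<^bsub>Zp\<^esub> z = x \<oplus>\<^bsub>Zp\<^esub> (y \<oplus>\<^bsub>Zp\<^esub> z)"
      by (rule ext) (simp add: padic_add mod_simps add.assoc)
    show "x \<oplus>\<^bsub>Zp\<^esub> y = y \<oplus>\<^bsub>Zp\<^esub> x"
      by (rule ext) (simp add: padic_add add.commute)
  qed (use add_closed zero in auto)
  show "comm_monoid Zp"
  proof (rule comm_monoidI)
    fix x assume x: "x \<in> carrier Zp"
    show "\<one>\<^bsub>Zp\<^esub> \<otimes>\<^bsub>Zp\<^esub> x = x"
      by (rule ext) (simp add: padic_mult padic_one mod_simps padic_self_mod[OF x])
  next
    fix x y z
    show "x \<otimes>\<^bsub>Zp\<^esub> y \<otimes>\<^bsub>Zp\<^esub> z = x \<otimes>\<^bsub>Zp\<^esub> (y \<otimes>\<^bsub>Zp\<^esub> z)"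
      by (rule ext) (simp add: padic_mult mod_simps mult.assoc)
    show "x \<otimes>\<^bsub>Zp\<^esub> y = y \<otimes>\<^bsub>Zp\<^esub> x"
      by (rule ext) (simp add: padic_mult mult.commute)
  qed (use mult_closed one in auto)
  fix x y z
  show "(x \<oplus>\<^bsub>Zp\<^esub> y) \<otimes>\<^bsub>Zp\<^esub> z = x \<otimes>\<^bsub>Zp\<^esub> z \<oplus>\<^bsub>Zp\<^esub> y \<otimes>\<^bsub>Zp\<^esub> z"
    by (rule ext) (simp add: padic_add padic_mult mod_simps distrib_right)
qed

interpretation Z: cring Zp by (rule padic_cring)

lemma padic_of_int_hom: "\<iota>p \<in> Ring.ring_hom \<Z> Zp"
proof (rule Ring.ring_hom_memI)
  show "\<iota>p x \<in> carrier Zp" for x by (rule padic_of_int_closed)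
qed (auto intro!: ext simp: padic_of_int_def padic_add padic_mult padic_one mod_simps)

lemma padic_of_int_eq_iff: "\<iota>p a = \<iota>p b \<longleftrightarrow> a = b"
proof
  assume eq: "\<iota>p a = \<iota>p b"
  define k where "k = nat \<bar>a - b\<bar>"
  have "int k < int p ^ k"
    using p prime_gt_1_nat[OF p] less_exp[of k] power_mono[of 2 p k]
    by (metis (mono_tags) Suc_1 Suc_leI less_le_trans of_nat_less_iff of_nat_power zero_le)
  have "a mod int p ^ k = b mod int p ^ k"
    using fun_cong[OF eq, of k] by (simp add: padic_of_int_def)
  then have "int p ^ k dvd a - b" by (simp add: mod_eq_dvd_iff)
  then show "a = b"
    using \<open>int k < int p ^ k\<close> dvd_imp_le_int[of "a - b" "int p ^ k"] by (auto simp: k_def)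
qed simp

text \<open>An element whose residue modulo $p$ is non-zero has an inverse modulo every power of $p$, and the
inverses are unique, hence compatible.\<close>

lemma padic_unit_iff: "x \<in> Units Zp \<longleftrightarrow> x \<in> carrier Zp \<and> x 1 \<noteq> 0"
proof
  assume x: "x \<in> Units Zp"
  then obtain y where y: "y \<in> carrier Zp" "x \<otimes>\<^bsub>Zp\<^esub> y = \<one>\<^bsub>Zp\<^esub>"
    by (auto simp: Units_def)
  have "(x 1 * y 1) mod int p = 1 mod int p"
    using fun_cong[OF y(2), of 1] by (simp add: padic_mult padic_one)
  moreover have "1 mod int p = 1" using prime_gt_1_nat[OF p] by simp
  ultimately show "x \<in> carrier Zp \<and> x 1 \<noteq> 0" using Z.Units_closed[OF x] by auto
next
  assume x: "x \<in> carrier Zp \<and> x 1 \<noteq> 0"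
  then have xc: "x \<in> carrier Zp" by simp
  have cop: "coprime (x k) (int p ^ k)" for k
  proof (cases "k = 0")
    case False
    then have "x k mod int p = x 1" using padic_mod[OF xc, of 1 k] by simp
    then have "\<not> int p dvd x k" using x by (simp add: dvd_eq_mod_eq_0)
    then have "coprime (int p) (x k)"
      using p by (simp add: prime_imp_coprime)
    then show ?thesis by (simp add: coprime_commute)
  qed simp
  have "\<exists>y. (x k * y) mod int p ^ k = 1 mod int p ^ k" for k
    using cong_solve_coprime_int[OF cop[of k]] by (auto simp: cong_def)
  then obtain y0 where y0: "\<And>k. (x k * y0 k) mod int p ^ k = 1 mod int p ^ k" by metis
  define y where "y k = y0 k mod int p ^ k" for k
  have xy: "(x k * y k) mod int p ^ k = 1 mod int p ^ k" for k
    using y0[of k] by (simp add: y_def mod_simps)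
  have yc: "y \<in> carrier Zp"
  proof (rule padic_carrierI)
    fix k
    show "y k mod int p ^ k = y k" by (simp add: y_def)
    have "(x (Suc k) * y (Suc k)) mod int p ^ Suc k mod int p ^ k = 1 mod int p ^ Suc k mod int p ^ k"
      by (simp only: xy)
    then have "(x (Suc k) * y (Suc k)) mod int p ^ k = 1 mod int p ^ k"
      by (simp only: pow_mod_Suc)
    then have "(x k * y (Suc k)) mod int p ^ k = (x k * y k) mod int p ^ k"
      using mod_mult_cong[OF padic_coherent[OF xc, of k] refl, of "y (Suc k)"] xy[of k] by simp
    then have "[x k * y (Suc k) = x k * y k] (mod int p ^ k)" by (simp add: cong_def)
    then have "[y (Suc k) = y k] (mod int p ^ k)"
      using cop[of k] by (simp add: cong_mult_lcancel)
    then show "y (Suc k) mod int p ^ k = y k" by (simp add: cong_def y_def)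
  qed
  have "x \<otimes>\<^bsub>Zp\<^esub> y = \<one>\<^bsub>Zp\<^esub>"
    by (rule ext) (simp add: padic_mult padic_one xy)
  then show "x \<in> Units Zp"
    unfolding Units_def using xc yc by (auto simp: Z.m_comm intro!: bexI[of _ y])
qed

text \<open>If the first non-zero component of $x$ has index $v + 1$, then $x$ is divisible by $p^v$, and the
quotient is obtained by shifting the sequence by $v$ places and dividing.\<close>

lemma padic_valuation:
  assumes x: "x \<in> carrier Zp" and nz: "x \<noteq> \<zero>\<^bsub>Zp\<^esub>"
  shows "\<exists>v. \<exists>u\<in>Units Zp. x = \<iota>p (int p ^ v) \<otimes>\<^bsub>Zp\<^esub> u"
proof -
  have "\<exists>k. x k \<noteq> 0" using nz by (auto simp: padic_zero fun_eq_iff)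
  define m where "m = (LEAST k. x k \<noteq> 0)"
  have m: "x m \<noteq> 0" unfolding m_def by (rule LeastI_ex) fact
  have below: "x k = 0" if "k < m" for k using not_less_Least[of k "\<lambda>k. x k \<noteq> 0"] that by (auto simp: m_def)
  have "m \<noteq> 0" using m padic_bounds[OF x, of 0] by (auto intro: ccontr)
  then obtain v where v: "m = Suc v" by (metis not0_implies_Suc)
  define u where "u k = x (k + v) div int p ^ v" for k
  have xu: "x (k + v) = int p ^ v * u k" for k
  proof -
    have "x (k + v) mod int p ^ v = 0" using padic_mod[OF x, of v "k + v"] below[of v] v by simp
    then have "int p ^ v dvd x (k + v)" by (simp add: dvd_eq_mod_eq_0)
    then show ?thesis by (simp add: u_def)
  qed
  have uc: "u \<in> carrier Zp"
  proof (rule padic_carrierI)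
    fix k
    have cancel: "a mod int p ^ k = b" if "(int p ^ v * a) mod (int p ^ v * int p ^ k) = int p ^ v * b" for a b
    proof -
      have "int p ^ v * (a mod int p ^ k) = int p ^ v * b"
        unfolding mult_mod_right by (rule that)
      then show ?thesis using p_pow_pos[of v] by simp
    qed
    show "u k mod int p ^ k = u k"
      by (rule cancel) (use padic_self_mod[OF x, of "k + v"] in \<open>simp add: xu power_add mult.commute\<close>)
    show "u (Suc k) mod int p ^ k = u k"
      by (rule cancel) (use padic_mod[OF x, of "k + v" "Suc k + v"] in
          \<open>simp add: xu[of k] xu[of "Suc k", simplified] power_add mult.commute\<close>)
  qed
  have "u 1 \<noteq> 0" using xu[of 1] m v by auto
  then have uU: "u \<in> Units Zp" using uc by (simp add: padic_unit_iff)
  have "x = \<iota>p (int p ^ v) \<otimes>\<^bsub>Zp\<^esub> u"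
  proof
    fix k
    have "(int p ^ v * u k) mod int p ^ k = x (k + v) mod int p ^ k" by (simp add: xu)
    also have "\<dots> = x k" using padic_mod[OF x, of k "k + v"] by simp
    finally show "x k = (\<iota>p (int p ^ v) \<otimes>\<^bsub>Zp\<^esub> u) k"
      by (simp add: padic_mult padic_of_int_def mod_simps)
  qed
  then show ?thesis using uU by blast
qed

lemma padic_domain: "domain Zp"
proof (rule domain.intro[OF padic_cring], unfold_locales)
  show "\<one>\<^bsub>Zp\<^esub> \<noteq> \<zero>\<^bsub>Zp\<^esub>"
  proof
    assume "\<one>\<^bsub>Zp\<^esub> = \<zero>\<^bsub>Zp\<^esub>"
    from fun_cong[OF this, of 1] show False
      using prime_gt_1_nat[OF p] by (simp add: padic_one padic_zero)
  qed
  fix a b assume ab: "a \<otimes>\<^bsub>Zp\<^esub> b = \<zero>\<^bsub>Zp\<^esub>" and c: "a \<in> carrier Zp" "b \<in> carrier Zp"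
  show "a = \<zero>\<^bsub>Zp\<^esub> \<or> b = \<zero>\<^bsub>Zp\<^esub>"
  proof (rule ccontr)
    assume "\<not> ?thesis"
    then obtain v u w t where u: "u \<in> Units Zp" "a = \<iota>p (int p ^ v) \<otimes>\<^bsub>Zp\<^esub> u"
      and t: "t \<in> Units Zp" "b = \<iota>p (int p ^ w) \<otimes>\<^bsub>Zp\<^esub> t"
      using padic_valuation[OF c(1)] padic_valuation[OF c(2)] by blast
    define s where "s = u \<otimes>\<^bsub>Zp\<^esub> t"
    have s: "s \<in> Units Zp" using u t by (simp add: s_def)
    then have s1: "s \<in> carrier Zp" "s 1 \<noteq> 0" by (simp_all add: padic_unit_iff)
    define k where "k = Suc (v + w)"
    have "0 = (a \<otimes>\<^bsub>Zp\<^esub> b) k" by (simp add: ab padic_zero)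
    also have "\<dots> = (int p ^ (v + w) * s k) mod int p ^ k"
      unfolding u(2) t(2) s_def padic_mult padic_of_int_def
      by (simp only: mod_mult_left_eq mod_mult_right_eq) (simp only: power_add mult_ac)
    finally have "int p ^ (v + w) * int p dvd int p ^ (v + w) * s k"
      by (simp add: k_def mod_eq_0_iff_dvd mult.commute)
    then have "int p dvd s k" using p_pow_pos[of "v + w"] by simp
    moreover have "s k mod int p = s 1" using padic_mod[OF s1(1), of 1 k] by (simp add: k_def)
    ultimately show False using s1 by (simp add: dvd_eq_mod_eq_0)
  qed
qed

interpretation Z: "domain" Zp by (rule padic_domain)

lemma padic_local:
  assumes "a \<in> carrier Zp" "b \<in> carrier Zp" "a \<oplus>\<^bsub>Zp\<^esub> b \<in> Units Zp"
  shows "a \<in> Units Zp \<or> b \<in> Units Zp"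
  using assms by (auto simp: padic_unit_iff padic_add)

lemma padic_divides_total:
  assumes "a \<in> carrier Zp" "b \<in> carrier Zp"
  shows "\<exists>t\<in>carrier Zp. a = b \<otimes>\<^bsub>Zp\<^esub> t \<or> b = a \<otimes>\<^bsub>Zp\<^esub> t"
proof -
  have main: "\<exists>t\<in>carrier Zp. b = a \<otimes>\<^bsub>Zp\<^esub> t"
    if a: "a = \<iota>p (int p ^ v) \<otimes>\<^bsub>Zp\<^esub> u" "u \<in> Units Zp"
      and b: "b = \<iota>p (int p ^ w) \<otimes>\<^bsub>Zp\<^esub> s" "s \<in> Units Zp" and vw: "v \<le> w" for a b v w u s
  proof -
    let ?t = "\<iota>p (int p ^ (w - v)) \<otimes>\<^bsub>Zp\<^esub> (inv\<^bsub>Zp\<^esub> u \<otimes>\<^bsub>Zp\<^esub> s)"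
    have c [simp]: "u \<in> carrier Zp" "s \<in> carrier Zp" "inv\<^bsub>Zp\<^esub> u \<in> carrier Zp" "\<iota>p m \<in> carrier Zp" for m
      using a b by (simp_all add: padic_of_int_closed Z.Units_closed)
    have "\<iota>p (int p ^ w) = \<iota>p (int p ^ v) \<otimes>\<^bsub>Zp\<^esub> \<iota>p (int p ^ (w - v))"
      using ring_hom_mult[OF padic_of_int_hom, of "int p ^ v" "int p ^ (w - v)"] vw
      by (simp flip: power_add)
    then have "b = a \<otimes>\<^bsub>Zp\<^esub> ?t"
      unfolding a(1) b(1) using a(2) by (simp add: Z.m_ac) (simp add: Z.m_assoc[symmetric])
    then show ?thesis using c by blast
  qed
  show ?thesis
  proof (cases "a = \<zero>\<^bsub>Zp\<^esub> \<or> b = \<zero>\<^bsub>Zp\<^esub>")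
    case True
    then show ?thesis using assms by (auto intro!: bexI[of _ "\<zero>\<^bsub>Zp\<^esub>"])
  next
    case False
    then obtain v u w s where "u \<in> Units Zp" "a = \<iota>p (int p ^ v) \<otimes>\<^bsub>Zp\<^esub> u"
      and "s \<in> Units Zp" "b = \<iota>p (int p ^ w) \<otimes>\<^bsub>Zp\<^esub> s"
      using padic_valuation[OF assms(1)] padic_valuation[OF assms(2)] by blast
    then show ?thesis using main[of a v u b w s] main[of b w s a v u] by (meson nat_le_linear)
  qed
qed

lemma padic_two_torsion_free:
  assumes "x \<in> carrier Zp" "x \<oplus>\<^bsub>Zp\<^esub> x = \<zero>\<^bsub>Zp\<^esub>" shows "x = \<zero>\<^bsub>Zp\<^esub>"
proof -
  have "\<iota>p 2 = \<one>\<^bsub>Zp\<^esub> \<oplus>\<^bsub>Zp\<^esub> \<one>\<^bsub>Zp\<^esub>"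
    using ring_hom_add[OF padic_of_int_hom, of 1 1] ring_hom_one[OF padic_of_int_hom] by simp
  then have "\<iota>p 2 \<otimes>\<^bsub>Zp\<^esub> x = \<zero>\<^bsub>Zp\<^esub>" using assms by (simp add: Z.l_distr)
  moreover have "\<iota>p 2 \<noteq> \<iota>p 0" unfolding padic_of_int_eq_iff by simp
  then have "\<iota>p 2 \<noteq> \<zero>\<^bsub>Zp\<^esub>" by (simp add: padic_of_int_def padic_int_def)
  ultimately show ?thesis using Z.integral[of "\<iota>p 2" x] assms padic_of_int_closed by blast
qed

end

section \<open>The field of fractions\<close>

locale fraction_domain = "domain" R for R :: "'a ring" (structure)
begin

abbreviation K where "K \<equiv> fraction_field R"
abbreviation C where "C \<equiv> carrier R"
abbreviation C' where "C' \<equiv> carrier R - {\<zero>}"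

lemma req: "emb R x = emb R y \<Longrightarrow> x \<in> C \<Longrightarrow> y \<in> C \<Longrightarrow> x = y"
  by (rule emb_eqD[OF is_cring])

lemmas emb_r = emb_simps[OF is_cring]

declare integral_iff [simp]

lemma C'_mult [simp]: "b \<in> C' \<Longrightarrow> d \<in> C' \<Longrightarrow> b \<otimes> d \<in> C'"
  using integral by auto

lemma frac_rel_iff:
  "((a, b), (c, d)) \<in> frac_rel R \<longleftrightarrow> a \<in> C \<and> b \<in> C' \<and> c \<in> C \<and> d \<in> C' \<and> a \<otimes> d = c \<otimes> b"
  by (simp add: frac_rel_def)

lemma equiv_frac_rel: "equiv (C \<times> C') (frac_rel R)"
proof (rule equivI)
  show "frac_rel R \<subseteq> (C \<times> C') \<times> (C \<times> C')" by (auto simp: frac_rel_def)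
  show "refl_on (C \<times> C') (frac_rel R)" by (auto simp: refl_on_def frac_rel_iff)
  show "sym (frac_rel R)" by (auto simp: sym_def frac_rel_iff)
  show "trans (frac_rel R)"
  proof (rule transI)
    fix x y z assume xy: "(x, y) \<in> frac_rel R" and yz: "(y, z) \<in> frac_rel R"
    obtain a b c d e f where [simp]: "x = (a, b)" "y = (c, d)" "z = (e, f)" by (metis surj_pair)
    have m: "a \<in> C" "b \<in> C" "c \<in> C" "d \<in> C" "d \<noteq> \<zero>" "e \<in> C" "f \<in> C"
      and eqs: "a \<otimes> d = c \<otimes> b" "c \<otimes> f = e \<otimes> d"
      using xy yz by (simp_all add: frac_rel_iff)
    have "d \<otimes> (a \<otimes> f) = (a \<otimes> d) \<otimes> f" using m by (simp add: m_ac)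
    also have "\<dots> = (c \<otimes> f) \<otimes> b" using m unfolding eqs(1) by (simp add: m_ac)
    also have "\<dots> = d \<otimes> (e \<otimes> b)" using m unfolding eqs(2) by (simp add: m_ac)
    finally have "a \<otimes> f = e \<otimes> b" using m by (simp add: m_lcancel)
    then show "(x, z) \<in> frac_rel R" using xy yz by (simp add: frac_rel_iff)
  qed
qed

lemma frac_eq_iff:
  assumes "a \<in> C" "b \<in> C'" "c \<in> C" "d \<in> C'"
  shows "Defs.frac R a b = Defs.frac R c d \<longleftrightarrow> a \<otimes> d = c \<otimes> b"
  unfolding Defs.frac_def using assms
  by (subst eq_equiv_class_iff[OF equiv_frac_rel]) (auto simp: frac_rel_iff)

lemma frac_in_K [simp]: "a \<in> C \<Longrightarrow> b \<in> C' \<Longrightarrow> Defs.frac R a b \<in> carrier K"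
  by (auto simp: fraction_field_def Defs.frac_def intro: quotientI)

lemma K_cases:
  assumes "x \<in> carrier K"
  obtains a b where "a \<in> C" "b \<in> C'" "x = Defs.frac R a b"
  using assms by (auto simp: fraction_field_def Defs.frac_def elim!: quotientE)

lemma mem_frac: "a \<in> C \<Longrightarrow> b \<in> C' \<Longrightarrow> (c, d) \<in> Defs.frac R a b \<longleftrightarrow> c \<in> C \<and> d \<in> C' \<and> a \<otimes> d = c \<otimes> b"
  by (auto simp: Defs.frac_def frac_rel_iff)

lemma UN_const: "(c, d) \<in> A \<Longrightarrow> (\<And>x y. (x, y) \<in> A \<Longrightarrow> f x y = T) \<Longrightarrow> (\<Union>(x, y)\<in>A. f x y) = T"
  by force

lemma frac_mult [simp]:
  assumes "a \<in> C" "b \<in> C'" "c \<in> C" "d \<in> C'"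
  shows "Defs.frac R a b \<otimes>\<^bsub>K\<^esub> Defs.frac R c d = Defs.frac R (a \<otimes> c) (b \<otimes> d)"
proof -
  have main: "Defs.frac R (x \<otimes> z) (y \<otimes> w) = Defs.frac R (a \<otimes> c) (b \<otimes> d)"
    if "(x, y) \<in> Defs.frac R a b" "(z, w) \<in> Defs.frac R c d" for x y z w
  proof -
    from that assms have m: "x \<in> C" "y \<in> C'" "z \<in> C" "w \<in> C'" "a \<otimes> y = x \<otimes> b" "c \<otimes> w = z \<otimes> d"
      by (simp_all add: mem_frac)
    have "(x \<otimes> z) \<otimes> (b \<otimes> d) = (x \<otimes> b) \<otimes> (z \<otimes> d)"
      using m assms by (simp add: m_ac)
    also have "\<dots> = (a \<otimes> c) \<otimes> (y \<otimes> w)"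
      unfolding m(5,6)[symmetric] using m(1-4) assms by (simp add: m_ac)
    finally show ?thesis
      using m(1-4) assms by (subst frac_eq_iff) auto
  qed
  have ab: "(a, b) \<in> Defs.frac R a b" "(c, d) \<in> Defs.frac R c d"
    using assms by (simp_all add: mem_frac)
  have "(\<Union>(x, y)\<in>Defs.frac R a b. \<Union>(z, w)\<in>Defs.frac R c d. Defs.frac R (x \<otimes> z) (y \<otimes> w)) = Defs.frac R (a \<otimes> c) (b \<otimes> d)"
    by (rule UN_const[OF ab(1)], rule UN_const[OF ab(2)], rule main)
  then show ?thesis
    by (simp add: fraction_field_def)
qed

lemma frac_add [simp]:
  assumes "a \<in> C" "b \<in> C'" "c \<in> C" "d \<in> C'"
  shows "Defs.frac R a b \<oplus>\<^bsub>K\<^esub> Defs.frac R c d = Defs.frac R (a \<otimes> d \<oplus> c \<otimes> b) (b \<otimes> d)"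
proof -
  have main: "Defs.frac R (x \<otimes> w \<oplus> z \<otimes> y) (y \<otimes> w) = Defs.frac R (a \<otimes> d \<oplus> c \<otimes> b) (b \<otimes> d)"
    if "(x, y) \<in> Defs.frac R a b" "(z, w) \<in> Defs.frac R c d" for x y z w
  proof -
    from that assms have m: "x \<in> C" "y \<in> C'" "z \<in> C" "w \<in> C'" "a \<otimes> y = x \<otimes> b" "c \<otimes> w = z \<otimes> d"
      by (simp_all add: mem_frac)
    have "(x \<otimes> w \<oplus> z \<otimes> y) \<otimes> (b \<otimes> d) = (x \<otimes> b) \<otimes> (w \<otimes> d) \<oplus> (z \<otimes> d) \<otimes> (y \<otimes> b)"
      using m(1-4) assms by (intro req) (simp_all add: emb_r algebra_simps)
    also have "\<dots> = (a \<otimes> d \<oplus> c \<otimes> b) \<otimes> (y \<otimes> w)"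
      unfolding m(5,6)[symmetric] using m(1-4) assms by (intro req) (simp_all add: emb_r algebra_simps)
    finally show ?thesis
      using m(1-4) assms by (subst frac_eq_iff) auto
  qed
  have ab: "(a, b) \<in> Defs.frac R a b" "(c, d) \<in> Defs.frac R c d"
    using assms by (simp_all add: mem_frac)
  have "(\<Union>(x, y)\<in>Defs.frac R a b. \<Union>(z, w)\<in>Defs.frac R c d. Defs.frac R (x \<otimes> w \<oplus> z \<otimes> y) (y \<otimes> w)) = Defs.frac R (a \<otimes> d \<oplus> c \<otimes> b) (b \<otimes> d)"
    by (rule UN_const[OF ab(1)], rule UN_const[OF ab(2)], rule main)
  then show ?thesis
    by (simp add: fraction_field_def)
qed

lemma K_zero: "\<zero>\<^bsub>K\<^esub> = Defs.frac R \<zero> \<one>" and K_one: "\<one>\<^bsub>K\<^esub> = Defs.frac R \<one> \<one>"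
  by (simp_all add: fraction_field_def)

lemma one_C' [simp]: "\<one> \<in> C'" by simp

lemma frac_zero_iff: "a \<in> C \<Longrightarrow> b \<in> C' \<Longrightarrow> Defs.frac R a b = \<zero>\<^bsub>K\<^esub> \<longleftrightarrow> a = \<zero>"
  unfolding K_zero by (subst frac_eq_iff) auto

lemma K_cring: "cring K"
proof (rule cringI)
  show "abelian_group K"
  proof (rule abelian_groupI)
    fix x y assume "x \<in> carrier K" "y \<in> carrier K"
    then show "x \<oplus>\<^bsub>K\<^esub> y \<in> carrier K" by (elim K_cases) simp
    from \<open>x \<in> carrier K\<close> \<open>y \<in> carrier K\<close> show "x \<oplus>\<^bsub>K\<^esub> y = y \<oplus>\<^bsub>K\<^esub> x"
    proof (elim K_cases)
      fix a b c d assume m: "a \<in> C" "b \<in> C'" "c \<in> C" "d \<in> C'" "x = Defs.frac R a b" "y = Defs.frac R c d"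
      have "a \<otimes> d \<oplus> c \<otimes> b = c \<otimes> b \<oplus> a \<otimes> d" "b \<otimes> d = d \<otimes> b"
        using m(1-4) by (simp_all add: a_comm m_comm)
      then show ?thesis unfolding m(5,6) using m(1-4) by (simp)
    qed
  next
    fix x y z assume "x \<in> carrier K" "y \<in> carrier K" "z \<in> carrier K"
    then show "x \<oplus>\<^bsub>K\<^esub> y \<oplus>\<^bsub>K\<^esub> z = x \<oplus>\<^bsub>K\<^esub> (y \<oplus>\<^bsub>K\<^esub> z)"
    proof (elim K_cases)
      fix a b c d e f assume m: "a \<in> C" "b \<in> C'" "c \<in> C" "d \<in> C'" "e \<in> C" "f \<in> C'"
        "x = Defs.frac R a b" "y = Defs.frac R c d" "z = Defs.frac R e f"
      have [simp]: "b \<in> C" "d \<in> C" "f \<in> C" using m by auto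
      have "(a \<otimes> d \<oplus> c \<otimes> b) \<otimes> f \<oplus> e \<otimes> (b \<otimes> d) = a \<otimes> (d \<otimes> f) \<oplus> (c \<otimes> f \<oplus> e \<otimes> d) \<otimes> b"
        using m(1,3,5) by (intro req) (simp_all add: emb_r algebra_simps)
      then show ?thesis unfolding m(7-9) using m(1-6) by (simp add: m_assoc)
    qed
  next
    fix x assume "x \<in> carrier K"
    then show "\<zero>\<^bsub>K\<^esub> \<oplus>\<^bsub>K\<^esub> x = x"
    proof (elim K_cases)
      fix a b assume m: "a \<in> C" "b \<in> C'" "x = Defs.frac R a b"
      then have [simp]: "b \<in> C" by auto
      show ?thesis unfolding m(3) K_zero using m(1,2) by (simp)
    qed
    from \<open>x \<in> carrier K\<close> show "\<exists>y\<in>carrier K. y \<oplus>\<^bsub>K\<^esub> x = \<zero>\<^bsub>K\<^esub>"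
    proof (elim K_cases)
      fix a b assume m: "a \<in> C" "b \<in> C'" "x = Defs.frac R a b"
      then have [simp]: "b \<in> C" by auto
      have "Defs.frac R (\<ominus> a) b \<oplus>\<^bsub>K\<^esub> x = Defs.frac R ((\<ominus> a) \<otimes> b \<oplus> a \<otimes> b) (b \<otimes> b)"
        unfolding m(3) using m(1,2) by (simp)
      also have "(\<ominus> a) \<otimes> b \<oplus> a \<otimes> b = \<zero>" using m(1) by (simp add: l_minus l_neg)
      also have "Defs.frac R \<zero> (b \<otimes> b) = \<zero>\<^bsub>K\<^esub>"
        using m(2) by (subst frac_zero_iff) (simp_all)
      finally show ?thesis using m(1,2) by (intro bexI[of _ "Defs.frac R (\<ominus> a) b"]) auto
    qed
  qed (simp add: K_zero)
  show "comm_monoid K"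
  proof (rule comm_monoidI)
    fix x y assume "x \<in> carrier K" "y \<in> carrier K"
    then show "x \<otimes>\<^bsub>K\<^esub> y \<in> carrier K" by (elim K_cases) simp
    from \<open>x \<in> carrier K\<close> \<open>y \<in> carrier K\<close> show "x \<otimes>\<^bsub>K\<^esub> y = y \<otimes>\<^bsub>K\<^esub> x"
    proof (elim K_cases)
      fix a b c d assume m: "a \<in> C" "b \<in> C'" "c \<in> C" "d \<in> C'" "x = Defs.frac R a b" "y = Defs.frac R c d"
      have "a \<otimes> c = c \<otimes> a" "b \<otimes> d = d \<otimes> b" using m(1-4) by (simp_all add: m_comm)
      then show ?thesis unfolding m(5,6) using m(1-4) by (simp)
    qed
  next
    fix x y z assume "x \<in> carrier K" "y \<in> carrier K" "z \<in> carrier K"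
    then show "x \<otimes>\<^bsub>K\<^esub> y \<otimes>\<^bsub>K\<^esub> z = x \<otimes>\<^bsub>K\<^esub> (y \<otimes>\<^bsub>K\<^esub> z)"
    proof (elim K_cases)
      fix a b c d e f assume m: "a \<in> C" "b \<in> C'" "c \<in> C" "d \<in> C'" "e \<in> C" "f \<in> C'"
        "x = Defs.frac R a b" "y = Defs.frac R c d" "z = Defs.frac R e f"
      have [simp]: "b \<in> C" "d \<in> C" "f \<in> C" using m by auto
      show ?thesis unfolding m(7-9) using m(1-6) by (simp add: m_assoc)
    qed
  next
    fix x assume "x \<in> carrier K"
    then show "\<one>\<^bsub>K\<^esub> \<otimes>\<^bsub>K\<^esub> x = x"
    proof (elim K_cases)
      fix a b assume m: "a \<in> C" "b \<in> C'" "x = Defs.frac R a b"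
      then have [simp]: "b \<in> C" by auto
      show ?thesis unfolding m(3) K_one using m(1,2) by (simp)
    qed
  qed (simp add: K_one)
  fix x y z assume "x \<in> carrier K" "y \<in> carrier K" "z \<in> carrier K"
  then show "(x \<oplus>\<^bsub>K\<^esub> y) \<otimes>\<^bsub>K\<^esub> z = x \<otimes>\<^bsub>K\<^esub> z \<oplus>\<^bsub>K\<^esub> y \<otimes>\<^bsub>K\<^esub> z"
  proof (elim K_cases)
    fix a b c d e f assume m: "a \<in> C" "b \<in> C'" "c \<in> C" "d \<in> C'" "e \<in> C" "f \<in> C'"
      "x = Defs.frac R a b" "y = Defs.frac R c d" "z = Defs.frac R e f"
    have [simp]: "b \<in> C" "d \<in> C" "f \<in> C" using m by auto
    have "((a \<otimes> d \<oplus> c \<otimes> b) \<otimes> e) \<otimes> ((b \<otimes> f) \<otimes> (d \<otimes> f)) =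
        ((a \<otimes> e) \<otimes> (d \<otimes> f) \<oplus> (c \<otimes> e) \<otimes> (b \<otimes> f)) \<otimes> ((b \<otimes> d) \<otimes> f)"
      using m(1,3,5) by (intro req) (simp_all add: emb_r algebra_simps)
    then show ?thesis unfolding m(7-9) using m(1-6)
      by (simp add: frac_eq_iff)
  qed
qed

lemma K_field: "field K"
proof (rule cring.cring_fieldI[OF K_cring])
  interpret K: cring K by (rule K_cring)
  show "Units K = carrier K - {\<zero>\<^bsub>K\<^esub>}"
  proof (intro equalityI subsetI)
    fix x assume x: "x \<in> Units K"
    then obtain y where y: "y \<in> carrier K" "x \<otimes>\<^bsub>K\<^esub> y = \<one>\<^bsub>K\<^esub>" by (auto simp: Units_def)
    have "\<one>\<^bsub>K\<^esub> \<noteq> \<zero>\<^bsub>K\<^esub>" unfolding K_one by (subst frac_zero_iff) auto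
    then have "x \<noteq> \<zero>\<^bsub>K\<^esub>" using y K.l_null by metis
    then show "x \<in> carrier K - {\<zero>\<^bsub>K\<^esub>}" using K.Units_closed[OF x] by simp
  next
    fix x assume xK: "x \<in> carrier K - {\<zero>\<^bsub>K\<^esub>}"
    then have "x \<in> carrier K" by simp
    then obtain a b where m: "a \<in> C" "b \<in> C'" "x = Defs.frac R a b"
      by (rule K_cases)
    then have "a \<noteq> \<zero>" using xK frac_zero_iff[of a b] by simp
    then have a: "a \<in> C'" using m by simp
    have "Defs.frac R a b \<otimes>\<^bsub>K\<^esub> Defs.frac R b a = Defs.frac R (a \<otimes> b) (b \<otimes> a)" using m a by simp
    also have "\<dots> = \<one>\<^bsub>K\<^esub>"
      unfolding K_one using m a by (subst frac_eq_iff) (simp_all add: m_comm)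
    finally have "Defs.frac R a b \<otimes>\<^bsub>K\<^esub> Defs.frac R b a = \<one>\<^bsub>K\<^esub>" .
    moreover have c: "Defs.frac R b a \<in> carrier K" "x \<in> carrier K" using m a by simp_all
    ultimately show "x \<in> Units K"
      unfolding Units_def mem_Collect_eq m(3)[symmetric]
      by (intro conjI bexI[of _ "Defs.frac R b a"]) (simp_all add: K.m_comm)
  qed
qed

lemma to_frac_hom: "to_frac R \<in> Ring.ring_hom R K"
  by (rule Ring.ring_hom_memI) (simp_all add: to_frac_def K_one)

lemma to_frac_closed [simp]: "a \<in> C \<Longrightarrow> to_frac R a \<in> carrier K"
  by (simp add: to_frac_def)

lemma to_frac_eq_iff: "a \<in> C \<Longrightarrow> b \<in> C \<Longrightarrow> to_frac R a = to_frac R b \<longleftrightarrow> a = b"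
  unfolding to_frac_def by (subst frac_eq_iff) auto

lemma to_frac_zero: "to_frac R \<zero> = \<zero>\<^bsub>K\<^esub>"
  by (simp add: to_frac_def K_zero)

lemma K_two_torsion_free:
  assumes "\<And>x. x \<in> C \<Longrightarrow> x \<oplus> x = \<zero> \<Longrightarrow> x = \<zero>"
    and "x \<in> carrier K" "x \<oplus>\<^bsub>K\<^esub> x = \<zero>\<^bsub>K\<^esub>"
  shows "x = \<zero>\<^bsub>K\<^esub>"
proof -
  obtain a b where m: "a \<in> C" "b \<in> C'" "x = Defs.frac R a b" using K_cases assms(2) by metis
  then have [simp]: "b \<in> C" by auto
  have "Defs.frac R (a \<otimes> b \<oplus> a \<otimes> b) (b \<otimes> b) = \<zero>\<^bsub>K\<^esub>"
    using assms(3) m(1,2) unfolding m(3) by (simp)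
  then have "a \<otimes> b \<oplus> a \<otimes> b = \<zero>" using m(1,2) by (subst (asm) frac_zero_iff) (simp_all)
  then have "a \<otimes> b = \<zero>" by (rule assms(1)[rotated]) (use m in simp)
  then have "a = \<zero>" using m by simp
  then show ?thesis using m by (simp add: frac_zero_iff)
qed

end

section \<open>Determinants, products of reflections and base change\<close>

lemma prod_of_simps [simp]: "prod_of S [] = \<one>\<^bsub>S\<^esub>" "prod_of S (x # xs) = x \<otimes>\<^bsub>S\<^esub> prod_of S xs"
  by (simp_all add: prod_of_def)

context quadratic_lattice
begin

abbreviation emat :: "((nat \<Rightarrow> 'a) \<Rightarrow> nat \<Rightarrow> 'a) \<Rightarrow> 'a cring_product mat" where
  "emat g \<equiv> mat N N (\<lambda>(i, j). emb R (g (uvec j) i))"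

lemma det_endo_closed: assumes "lin g" shows "det_endo R N g \<in> carrier R"
  unfolding det_endo_def matrix_of_def
proof (intro finsum_closed Pi_I)
  fix \<sigma> assume "\<sigma> \<in> {\<sigma>. \<sigma> permutes {..<N}}"
  then have "\<sigma> i < N" if "i < N" for i using that permutes_in_image[of \<sigma> "{..<N}" i] by simp
  then have "(\<Otimes>i\<in>{..<N}. g (uvec (\<sigma> i)) i) \<in> carrier R"
    using lin_closed[OF assms] by (intro finprod_closed) auto
  then show "[sign \<sigma>] \<cdot> (\<Otimes>i\<in>{..<N}. g (uvec (\<sigma> i)) i) \<in> carrier R"
    by (rule add.int_pow_closed)
qed

text \<open>The factor \<open>emb R \<one>\<close> corrects the case of rank zero, where the determinant of the empty matrix is
the unit of the ambient ring.\<close>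

lemma emb_det_endo:
  assumes "lin g" shows "emb R (det_endo R N g) = emb R \<one> * det (emat g)"
proof -
  have fin: "finite {\<sigma>. \<sigma> permutes {..<N}}" by (simp add: finite_permutations)
  have cl: "g (uvec (\<sigma> i)) i \<in> carrier R" if "i < N" for i \<sigma>
    using lin_closed[OF assms] that by simp
  have pc: "(\<Otimes>i\<in>{..<N}. g (uvec (\<sigma> i)) i) \<in> carrier R" for \<sigma>
    using cl by (intro finprod_closed) auto
  have "emb R (det_endo R N g) =
      (\<Sum>\<sigma> | \<sigma> permutes {..<N}. emb R ([sign \<sigma>] \<cdot> (\<Otimes>i\<in>{..<N}. g (uvec (\<sigma> i)) i)))"
    unfolding det_endo_def matrix_of_def
    by (rule emb_finsum[OF is_cring fin]) (intro add.int_pow_closed pc)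
  also have "\<dots> = (\<Sum>\<sigma> | \<sigma> permutes {..<N}. emb R \<one> *
      (of_int (sign \<sigma>) * (\<Prod>i<N. emb R (g (uvec (\<sigma> i)) i))))"
  proof (intro sum.cong refl)
    fix \<sigma>
    have "emb R (\<Otimes>i\<in>{..<N}. g (uvec (\<sigma> i)) i) = emb R \<one> * (\<Prod>i<N. emb R (g (uvec (\<sigma> i)) i))"
      using cl by (intro emb_finprod[OF is_cring]) auto
    then show "emb R ([sign \<sigma>] \<cdot> (\<Otimes>i\<in>{..<N}. g (uvec (\<sigma> i)) i)) =
        emb R \<one> * (of_int (sign \<sigma>) * (\<Prod>i<N. emb R (g (uvec (\<sigma> i)) i)))"
      by (simp add: emb_add_pow[OF is_cring pc] mult.left_commute)
  qed
  also have "\<dots> = emb R \<one> * det (emat g)"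
    unfolding det_def'[of "emat g" N, simplified] sum_distrib_left[symmetric]
    by (intro arg_cong[where f = "\<lambda>x. emb R \<one> * x"] sum.cong)
       (auto simp: atLeast0LessThan permutes_in_image intro!: prod.cong)
  finally show ?thesis .
qed

lemma det_endo_mult:
  assumes g: "g \<in> Og" and h: "h \<in> Og"
  shows "det_endo R N (g \<otimes>\<^bsub>M\<^esub> h) = det_endo R N g \<otimes> det_endo R N h"
proof (rule ring_eqI)
  note lin = orthD(2)[OF g] orthD(2)[OF h] orthD(2)[OF orth_mult[OF g h]]
  have "emat (g \<otimes>\<^bsub>M\<^esub> h) = emat g * emat h"
  proof (rule eq_matI)
    fix i j assume "i < dim_row (emat g * emat h)" "j < dim_col (emat g * emat h)"
    then have ij: "i < N" "j < N" by simp_all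
    have "emb R ((g \<otimes>\<^bsub>M\<^esub> h) (uvec j) i) = emb R (g (h (uvec j)) i)"
      using g h by (simp add: mult_M orthD)
    also have "\<dots> = (\<Sum>l<N. emb R (g (uvec l) i) * emb R (h (uvec j) l))"
      using ij orthD(3)[OF h] by (intro lin_expand[OF lin(1)]) auto
    finally show "emat (g \<otimes>\<^bsub>M\<^esub> h) $$ (i, j) = (emat g * emat h) $$ (i, j)"
      using ij by (simp add: scalar_prod_def atLeast0LessThan)
  qed auto
  then have "emb R \<one> * det (emat (g \<otimes>\<^bsub>M\<^esub> h)) = (emb R \<one> * emb R \<one>) * (det (emat g) * det (emat h))"
    by (simp add: det_mult[of _ N] emb_rules)
  then show "emb R (det_endo R N (g \<otimes>\<^bsub>M\<^esub> h)) = emb R (det_endo R N g \<otimes> det_endo R N h)"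
    by (simp add: emb_det_endo lin det_endo_closed emb_rules mult_ac)
qed (use assms orth_mult in \<open>auto intro!: det_endo_closed orthD(2) m_closed\<close>)

lemma bform_expand: "x \<in> V \<Longrightarrow> y \<in> V \<Longrightarrow> emb R (B x y) = (\<Sum>i<N. emb R (x i) * emb R (B (uvec i) y))"
proof (induction rule: vec_induct)
  case zero
  then show ?case by (simp add: emb_rules)
next
  case (step z a j)
  have "emb R (B (z \<boxplus> a \<boxdot> uvec j) y) = emb R (B z y) + emb R a * emb R (B (uvec j) y)"
    using step by (simp add: emb_rules)
  also have "emb R a * emb R (B (uvec j) y) =
      (\<Sum>i<N. if i = j then emb R a * emb R (B (uvec i) y) else 0)"
    using step by simp
  also have "emb R (B z y) + \<dots> = (\<Sum>i<N. emb R ((z \<boxplus> a \<boxdot> uvec j) i) * emb R (B (uvec i) y))"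
    unfolding step.IH[OF step.prems] sum.distrib[symmetric] using step
    by (intro sum.cong refl) (auto simp: emb_rules algebra_simps)
  finally show ?case .
qed

text \<open>A reflection is a rank one perturbation of the identity, with trace $-(v,v) q(v)^{-1} = -2$.\<close>

lemma det_refl:
  assumes v: "v \<in> anis" shows "det_endo R N (refl v) = \<ominus> \<one>"
proof (rule ring_eqI)
  note v' = v[unfolded anis_iff]
  define u w where "u i = emb R (v i)" "w j = - (emb R (B (uvec j) v) * emb R (inv Q v))" for i j
  let ?A = "mat N N (\<lambda>(i, j). (if i = j then 1 else 0) + u i * w j)"
  have "emat (refl v) = emb R \<one> \<cdot>\<^sub>m ?A"
    by (rule eq_matI)
       (use v v' in \<open>auto simp: refl_eq u_w_def emb_rules distrib_left right_diff_distrib mult_ac\<close>)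
  then have "det (emat (refl v)) = emb R \<one> ^ N * (1 + (\<Sum>i<N. u i * w i))"
    using det_one_plus_rank_one[of N u w] by simp
  moreover have "(\<Sum>i<N. u i * w i) = - (emb R (B v v) * emb R (inv Q v))"
    using v' by (simp add: u_w_def bform_expand[of v v] sum_negf sum_distrib_right mult.assoc)
  moreover have "emb R (B v v) * emb R (inv Q v) = emb R \<one> + emb R \<one>"
    using v' by (simp add: emb_bform_self emb_inv mult.assoc)
  moreover have "emb R \<one> * emb R \<one> ^ k = emb R \<one>" for k
    by (induction k) (simp_all add: emb_rules)
  ultimately have "emb R \<one> * det (emat (refl v)) = emb R \<one> * (1 - (emb R \<one> + emb R \<one>))"
    by (simp add: mult.assoc[symmetric])
  then show "emb R (det_endo R N (refl v)) = emb R (\<ominus> \<one>)"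
    using refl_orth[OF v] by (simp add: emb_det_endo orthD emb_rules algebra_simps)
qed (use refl_orth[OF v] in \<open>auto intro: det_endo_closed orthD(2)\<close>)

abbreviation refls :: "(nat \<Rightarrow> 'a) list \<Rightarrow> (nat \<Rightarrow> 'a) \<Rightarrow> nat \<Rightarrow> 'a" where
  "refls vs \<equiv> prod_of M (map refl vs)"

lemma refls_orth: "set vs \<subseteq> anis \<Longrightarrow> refls vs \<in> Og"
  by (induction vs) (auto simp: prod_of_def one_orth intro!: orth_mult refl_orth)

lemma refls_append:
  "set vs \<subseteq> anis \<Longrightarrow> set ws \<subseteq> anis \<Longrightarrow> refls (vs @ ws) = refls vs \<otimes>\<^bsub>M\<^esub> refls ws"
proof (induction vs)
  interpret grp: group M by (rule group_M)
  case Nil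
  then show ?case using orthD(1)[OF refls_orth, of ws] by (simp add: prod_of_def)
next
  interpret grp: group M by (rule group_M)
  case (Cons v vs)
  have "refl v \<in> carrier M" "refls vs \<in> carrier M" "refls ws \<in> carrier M"
    using Cons.prems by (auto intro!: orthD(1) refls_orth refl_orth)
  from grp.m_assoc[OF this] Cons show ?case
    by (simp add: prod_of_def)
qed

lemma refls_apply:
  "set vs \<subseteq> anis \<Longrightarrow> x \<in> V \<Longrightarrow> refls vs x = foldr refl vs x"
proof (induction vs)
  case Nil
  then show ?case by (simp add: prod_of_def one_M)
next
  case (Cons v vs)
  have "refls (v # vs) x = (refl v \<otimes>\<^bsub>M\<^esub> refls vs) x" by (simp add: prod_of_def)
  also have "\<dots> = refl v (refls vs x)"
    using Cons.prems by (intro mult_M orthD(1) refl_orth refls_orth) auto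
  finally show ?case using Cons by simp
qed

lemma refls_rev: "set vs \<subseteq> anis \<Longrightarrow> refls (vs @ rev vs) = \<one>\<^bsub>M\<^esub>"
proof (induction vs)
  interpret grp: group M by (rule group_M)
  case Nil
  then show ?case by (simp add: prod_of_def)
next
  interpret grp: group M by (rule group_M)
  case (Cons v vs)
  have v: "v \<in> anis" and o: "refl v \<in> Og" using Cons.prems by (auto intro: refl_orth)
  have "refls ((v # vs) @ rev (v # vs)) = refls ([v] @ (vs @ rev vs) @ [v])" by simp
  also have "\<dots> = refls [v] \<otimes>\<^bsub>M\<^esub> (refls (vs @ rev vs) \<otimes>\<^bsub>M\<^esub> refls [v])"
  proof -
    have "refls ([v] @ ((vs @ rev vs) @ [v])) = refls [v] \<otimes>\<^bsub>M\<^esub> refls ((vs @ rev vs) @ [v])"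
      by (rule refls_append) (use Cons.prems in auto)
    also have "refls ((vs @ rev vs) @ [v]) = refls (vs @ rev vs) \<otimes>\<^bsub>M\<^esub> refls [v]"
      by (rule refls_append) (use Cons.prems in auto)
    finally show ?thesis .
  qed
  also have "\<dots> = refl v \<otimes>\<^bsub>M\<^esub> refl v"
    using Cons o by (simp add: prod_of_def orthD)
  also have "\<dots> = \<one>\<^bsub>M\<^esub>"
    using o v by (intro Bij_eqI) (auto simp: mult_M orthD refl_refl one_M id_Bij)
  finally show ?case .
qed

lemma det_refls: "set vs \<subseteq> anis \<Longrightarrow> det_endo R N (refls vs) = (if even (length vs) then \<one> else \<ominus> \<one>)"
proof (induction vs)
  case Nil
  have "emat \<one>\<^bsub>M\<^esub> = emb R \<one> \<cdot>\<^sub>m 1\<^sub>m N"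
    by (rule eq_matI) (auto simp: one_M emb_rules)
  moreover have "emb R \<one> * emb R \<one> ^ k = emb R \<one>" for k
    by (induction k) (simp_all add: emb_rules)
  ultimately have "emb R (det_endo R N \<one>\<^bsub>M\<^esub>) = emb R \<one>"
    by (simp add: emb_det_endo orthD one_orth)
  then have "det_endo R N \<one>\<^bsub>M\<^esub> = \<one>"
    by (rule ring_eqI) (auto intro: det_endo_closed orthD one_orth)
  then show ?case by (simp add: prod_of_def)
next
  case (Cons v vs)
  have "refls (v # vs) = refl v \<otimes>\<^bsub>M\<^esub> refls vs" by (simp add: prod_of_def)
  then show ?case
    using Cons by (simp add: det_endo_mult refl_orth refls_orth det_refl l_minus)
qed

abbreviation qprod :: "(nat \<Rightarrow> 'a) list \<Rightarrow> 'a" where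
  "qprod vs \<equiv> prod_of R (map Q vs)"

lemma qprod_Units: "set vs \<subseteq> anis \<Longrightarrow> qprod vs \<in> Units R"
  by (induction vs) (auto simp: anis_iff)

lemma qprod_append: "set vs \<subseteq> anis \<Longrightarrow> set ws \<subseteq> anis \<Longrightarrow> qprod (vs @ ws) = qprod vs \<otimes> qprod ws"
proof (induction vs)
  case Nil
  then show ?case using qprod_Units[of ws] by (simp add: Units_closed)
next
  case (Cons v vs)
  then have "qprod vs \<in> carrier R" "qprod ws \<in> carrier R" "Q v \<in> carrier R"
    using qprod_Units[of vs] qprod_Units[of ws] by (auto simp: anis_iff Units_closed)
  then show ?case using Cons by (simp add: m_assoc)
qed

lemma qprod_rev: "set vs \<subseteq> anis \<Longrightarrow> qprod (rev vs) = qprod vs"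
proof (induction vs)
  case (Cons v vs)
  then have c: "qprod vs \<in> carrier R" "Q v \<in> carrier R"
    using qprod_Units[of vs] by (auto simp: anis_iff Units_closed)
  have "qprod (rev (v # vs)) = qprod (rev vs @ [v])" by simp
  also have "\<dots> = qprod (rev vs) \<otimes> qprod [v]"
    by (rule qprod_append) (use Cons.prems in auto)
  also have "\<dots> = qprod (v # vs)" using Cons c by (simp add: m_comm)
  finally show ?case .
qed simp

lemma emb_qprod: "set vs \<subseteq> V \<Longrightarrow> qprod vs \<in> carrier R \<and> emb R (qprod vs) = emb R \<one> * prod_list (map (\<lambda>v. emb R (Q v)) vs)"
  by (induction vs) (auto simp: emb_rules mult_ac)

text \<open>This is \<open>reflections_identity_square\<close> transported along \<open>emb\<close>. Vectors are extended by zero, because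
that lemma speaks of total functions.\<close>

lemma refls_identity_square:
  assumes field: "Units R = carrier R - {\<zero>}" and vs: "set vs \<subseteq> anis" and id: "refls vs = \<one>\<^bsub>M\<^esub>"
  shows "even (length vs) \<and> (\<exists>r\<in>carrier R. qprod vs = r \<otimes> r)"
proof (cases "vs = []")
  case True
  then show ?thesis by (auto intro!: bexI[of _ \<one>])
next
  case False
  define k where "k = length vs"
  have k: "0 < k" using False by (simp add: k_def)
  \<comment> \<open>Indices beyond the list repeat its first entry, so that every \<open>w m\<close> is anisotropic.\<close>
  define w where "w m = (if m < k then vs ! m else vs ! 0)" for m
  have w: "w m \<in> anis" for m
    using vs k by (auto simp: w_def k_def)
  then have wV [simp]: "w m \<in> V" and wQ: "Q (w m) \<in> Units R" for m by (auto simp: anis_iff)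
  define hat where "hat x = (\<lambda>t. if t < N then emb R (x t) else 0)" for x
  define BB where "BB x y = (\<Sum>i<N. \<Sum>j<N. x i * emb R (G i j) * y j)" for x y
  define c q where "c m = emb R (inv Q (w m))" "q m = emb R (Q (w m))" for m
  have BB_hat: "BB (hat x) (hat y) = emb R (B x y)" if "x \<in> V" "y \<in> V" for x y
    using that by (simp add: BB_def hat_def emb_bform)
  have BB_sym: "BB x y = BB y x" for x y
    unfolding BB_def by (subst sum.swap) (auto intro!: sum.cong simp: gram_sym mult_ac)
  have hat_refl: "hat (refl (w m) x) = (\<lambda>t. hat x t - BB (hat x) (hat (w m)) * c m * hat (w m) t)"
    if x: "x \<in> V" for x m
    unfolding BB_hat[OF x wV] using x w[of m] wQ[of m]
    by (intro ext) (simp add: hat_def refl_eq c_q_def emb_rules)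
  have fold_hat: "foldr (\<lambda>m x t. x t - BB x (hat (w m)) * c m * hat (w m) t) ms (hat x) =
      hat (foldr (\<lambda>m. refl (w m)) ms x) \<and> foldr (\<lambda>m. refl (w m)) ms x \<in> V" if x: "x \<in> V" for ms x
  proof (induction ms)
    case Nil
    then show ?case using x by simp
  next
    case (Cons m ms)
    then show ?case using hat_refl w by (simp add: refl_orth orthD)
  qed
  have vs_eq: "vs = map w [0..<k]"
    by (rule nth_equalityI) (auto simp: k_def w_def)
  have fold_id: "foldr (\<lambda>m. refl (w m)) [0..<k] x = x" if x: "x \<in> V" for x
  proof -
    have "foldr refl vs x = x"
      using refls_apply[OF vs x] x by (simp add: id one_M)
    then show ?thesis by (subst (asm) vs_eq) (simp add: foldr_map o_def)
  qed
  let ?four = "(\<one> \<oplus> \<one>) \<otimes> (\<one> \<oplus> \<one>)"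
  have "?four \<noteq> \<zero>"
    using two_torsion_free[of \<one>] integral[of "\<one> \<oplus> \<one>" "\<one> \<oplus> \<one>"] by auto
  then have four: "?four \<in> Units R" using field by simp
  define h where "h = emb R (inv ?four)"
  have "emb R ?four = 4 * emb R \<one>" by (simp add: emb_rules algebra_simps)
  then have "4 * (emb R \<one> * h) = emb R \<one>"
    using emb_inv[OF four] by (simp add: h_def mult.assoc)
  moreover have eh: "emb R \<one> * h = h" unfolding h_def using four by (simp add: emb_rules)
  ultimately have h4: "4 * h = emb R \<one>" by simp
  have main: "even k \<and> (\<exists>r. emb R \<one> * r = r \<and> emb R \<one> * (\<Prod>j<k. q j) = r * r)"
  proof (rule reflections_identity_square[where B = BB and v = "\<lambda>m. hat (w m)" and c = c and h = h])
    show "emb R \<one> * emb R \<one> = emb R \<one>" by (simp add: emb_rules)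
    show "emb R \<one> \<noteq> 0"
      using emb_eq_iff[OF is_cring, of \<one> \<zero>] by (simp add: emb_rules)
    show "\<exists>b. emb R \<one> * b = b \<and> a * b = emb R \<one>" if a: "emb R \<one> * a = a" "a \<noteq> 0" for a
    proof -
      define a0 where "a0 = comp_at R a"
      have a0: "a0 \<in> carrier R" "a = emb R a0"
        using a(1) by (simp_all add: a0_def is_cring emb_one_mult[OF is_cring])
      then have "a0 \<noteq> \<zero>" using a(2) by (auto simp: emb_rules)
      then have "a0 \<in> Units R" using a0 field by simp
      then show ?thesis using emb_inv[of a0] a0 by (intro exI[of _ "emb R (inv a0)"]) (simp add: emb_rules)
    qed
    show "BB (\<lambda>t. x t - a * y t) z = BB x z - a * BB y z" for x y z a
      by (simp add: BB_def algebra_simps sum_subtractf sum_distrib_left)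
    show "emb R \<one> * BB x y = BB x y" for x y
      unfolding BB_def sum_distrib_left
      by (intro sum.cong refl) (simp add: emb_rules mult.left_commute[of "emb R \<one>" "x _"] mult.assoc)
    show "c i * q i = emb R \<one>" for i
      using emb_inv[OF wQ] by (simp add: c_q_def mult.commute)
    show "BB (hat (w i)) (hat (w i)) = q i + q i" for i
      by (simp add: BB_hat c_q_def emb_bform_self)
    show "foldr (\<lambda>m x t. x t - BB x (hat (w m)) * c m * hat (w m) t) [0..<k] (hat (w m)) = hat (w m)"
      for m
      using fold_hat[OF wV, of "[0..<k]" m] fold_id[OF wV, of m] by simp
  qed (use wQ eh h4 BB_sym in \<open>simp_all add: c_q_def emb_rules BB_def\<close>)
  then obtain r where r: "emb R \<one> * r = r" "emb R \<one> * (\<Prod>j<k. q j) = r * r" by blast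
  define r0 where "r0 = comp_at R r"
  have r0: "r0 \<in> carrier R" "r = emb R r0"
    using r(1) by (simp_all add: r0_def is_cring emb_one_mult[OF is_cring])
  have vsV: "set vs \<subseteq> V" using vs by (auto simp: anis_iff)
  have "emb R (qprod vs) = emb R \<one> * prod_list (map q [0..<k])"
  proof -
    have "q = (\<lambda>m. emb R (Q (w m)))" by (rule ext) (simp add: c_q_def)
    then have "map (\<lambda>v. emb R (Q v)) vs = map q [0..<k]" by (subst vs_eq) simp
    then show ?thesis using emb_qprod[OF vsV] by simp
  qed
  also have "prod_list (map q [0..<k]) = (\<Prod>j<k. q j)"
    by (simp add: prod.list_conv_set_nth atLeast0LessThan)
  also have "emb R \<one> * \<dots> = emb R (r0 \<otimes> r0)"
    unfolding r(2) r0(2) using r0(1) by (simp add: emb_rules)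
  finally have "qprod vs = r0 \<otimes> r0"
    by (rule ring_eqI) (use emb_qprod[OF vsV] r0 in auto)
  then show ?thesis using main r0 by (auto simp: k_def)
qed

text \<open>Two factorizations of the same isometry combine to a relation, by reversing the second one.\<close>

lemma refls_eq_norm:
  assumes field: "Units R = carrier R - {\<zero>}" and vs: "set vs \<subseteq> anis" and ws: "set ws \<subseteq> anis"
    and eq: "refls vs = refls ws"
  shows "even (length vs) = even (length ws) \<and> (\<exists>r\<in>Units R. qprod vs = r \<otimes> r \<otimes> qprod ws)"
proof -
  have s: "set (vs @ rev ws) \<subseteq> anis" using vs ws by simp
  have "refls (vs @ rev ws) = refls (ws @ rev ws)"
    using vs ws by (simp add: refls_append eq del: map_append)
  then have id: "refls (vs @ rev ws) = \<one>\<^bsub>M\<^esub>" using refls_rev[OF ws] by simp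
  from refls_identity_square[OF field s id] obtain r where ev: "even (length vs + length ws)"
    and r: "r \<in> carrier R" "qprod (vs @ rev ws) = r \<otimes> r" by auto
  define a b where "a = qprod vs" "b = qprod ws"
  have ab: "a \<in> Units R" "b \<in> Units R" using qprod_Units vs ws by (simp_all add: a_b_def)
  then have [simp]: "a \<in> carrier R" "b \<in> carrier R" "inv b \<in> carrier R" by (simp_all add: Units_closed)
  have eqr: "a \<otimes> b = r \<otimes> r"
    using r(2) vs ws by (simp add: qprod_append qprod_rev a_b_def del: map_append rev_map)
  have "r \<noteq> \<zero>"
  proof
    assume "r = \<zero>"
    then have "a \<otimes> b = \<zero>" using eqr by simp
    moreover have "a \<otimes> b \<in> Units R" using ab by simp
    ultimately show False using field by simp
  qed
  then have rU: "r \<in> Units R" using r field by simp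
  have "(r \<otimes> inv b) \<otimes> (r \<otimes> inv b) \<otimes> b = (r \<otimes> r) \<otimes> inv b \<otimes> (inv b \<otimes> b)"
    using r(1) by (simp add: m_ac)
  also have "\<dots> = a \<otimes> (b \<otimes> inv b)" unfolding eqr[symmetric] using ab by (simp add: m_ac)
  finally have "a = (r \<otimes> inv b) \<otimes> (r \<otimes> inv b) \<otimes> b" using ab by simp
  then show ?thesis
    using ev rU ab unfolding a_b_def by (auto intro!: bexI[of _ "r \<otimes> inv (qprod ws)"] simp: even_add)
qed

end

locale lattice_hom = src: quadratic_lattice R N G + dst: quadratic_lattice S N G'
  for R :: "'a ring" and S :: "'b ring" and N G G' +
  fixes \<iota> :: "'a \<Rightarrow> 'b"
  assumes hom: "\<iota> \<in> Ring.ring_hom R S"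
    and gram_eq: "i < N \<Longrightarrow> j < N \<Longrightarrow> G' i j = \<iota> (G i j)"
begin

sublocale h: ring_hom_cring R S \<iota>
  by unfold_locales (rule hom)

abbreviation vm where "vm \<equiv> Defs.map_vec \<iota> N"
abbreviation bc where "bc \<equiv> base_change R S \<iota> N"

lemma vm_closed [simp]: "x \<in> src.V \<Longrightarrow> vm x \<in> dst.V"
  unfolding Defs.map_vec_def by (intro dst.restrict_vec) simp

lemma vm_comp [simp]: "i < N \<Longrightarrow> vm x i = \<iota> (x i)"
  by (simp add: Defs.map_vec_def)

lemma vm_add: "x \<in> src.V \<Longrightarrow> y \<in> src.V \<Longrightarrow> vm (src.vadd x y) = dst.vadd (vm x) (vm y)"
  by (rule dst.vec_ext) simp_all

lemma vm_smult: "a \<in> carrier R \<Longrightarrow> x \<in> src.V \<Longrightarrow> vm (src.vsmult a x) = dst.vsmult (\<iota> a) (vm x)"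
  by (rule dst.vec_ext) simp_all

lemma vm_uvec: "vm (src.uvec j) = dst.uvec j"
  by (rule dst.vec_ext) simp_all

lemma vm_zero: "vm src.vzero = dst.vzero"
  by (rule dst.vec_ext) simp_all

lemma bform_vm: "x \<in> src.V \<Longrightarrow> y \<in> src.V \<Longrightarrow> dst.B (vm x) (vm y) = \<iota> (src.B x y)"
proof -
  assume xy: "x \<in> src.V" "y \<in> src.V"
  have "\<iota> (src.B x y) = (\<Oplus>\<^bsub>S\<^esub>i\<in>{..<N}. \<iota> (\<Oplus>\<^bsub>R\<^esub>j\<in>{..<N}. x i \<otimes>\<^bsub>R\<^esub> G i j \<otimes>\<^bsub>R\<^esub> y j))"
    unfolding bform_def using xy by (subst h.hom_finsum) (auto intro!: src.finsum_closed simp: o_def)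
  also have "\<dots> = (\<Oplus>\<^bsub>S\<^esub>i\<in>{..<N}. \<Oplus>\<^bsub>S\<^esub>j\<in>{..<N}. vm x i \<otimes>\<^bsub>S\<^esub> G' i j \<otimes>\<^bsub>S\<^esub> vm y j)"
    using xy
    by (intro dst.finsum_cong' refl)
       (auto intro!: dst.finsum_closed dst.finsum_cong' simp: o_def gram_eq src.finsum_closed)
  finally show ?thesis by (simp add: bform_def)
qed

lemma qform_vm: "x \<in> src.V \<Longrightarrow> dst.Q (vm x) = \<iota> (src.Q x)"
  by (rule dst.qform_unique) (simp_all add: bform_vm flip: src.qform_double)

lemma unit_image: "u \<in> Units R \<Longrightarrow> \<iota> u \<in> Units S \<and> \<iota> (inv\<^bsub>R\<^esub> u) = inv\<^bsub>S\<^esub> (\<iota> u)"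
proof -
  assume u: "u \<in> Units R"
  then have c: "u \<in> carrier R" "inv\<^bsub>R\<^esub> u \<in> carrier R" by (simp_all add: src.Units_closed)
  have "\<iota> u \<otimes>\<^bsub>S\<^esub> \<iota> (inv\<^bsub>R\<^esub> u) = \<one>\<^bsub>S\<^esub>" using u c by (simp flip: h.hom_mult)
  moreover from this have "\<iota> (inv\<^bsub>R\<^esub> u) \<otimes>\<^bsub>S\<^esub> \<iota> u = \<one>\<^bsub>S\<^esub>" using c by (simp add: dst.m_comm)
  ultimately show ?thesis
    using c by (auto simp: Units_def intro!: bexI[of _ "\<iota> (inv\<^bsub>R\<^esub> u)"] dst.comm_inv_char[symmetric])
qed

lemma vm_anis: "v \<in> src.anis \<Longrightarrow> vm v \<in> dst.anis"
  by (simp add: src.anis_iff dst.anis_iff qform_vm unit_image)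

lemma vm_refl: "v \<in> src.anis \<Longrightarrow> x \<in> src.V \<Longrightarrow> vm (src.refl v x) = dst.refl (vm v) (vm x)"
  by (simp add: src.refl_eq dst.refl_eq vm_anis src.anis_iff vm_add vm_smult bform_vm qform_vm unit_image)

lemma bc_closed:
  assumes "src.lin g" "x \<in> dst.V" shows "bc g x \<in> dst.V"
  unfolding base_change_def matrix_of_def using assms src.lin_closed[OF assms(1)]
  by (auto intro!: dst.restrict_vec dst.finsum_closed)

lemma emb_bc:
  assumes "src.lin g" "x \<in> dst.V" "i < N"
  shows "emb S (bc g x i) = (\<Sum>j<N. emb S (\<iota> (g (src.uvec j) i)) * emb S (x j))"
proof -
  have c: "g (src.uvec j) i \<in> carrier R" for j using src.lin_closed[OF assms(1)] assms(3) by simp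
  have "emb S (bc g x i) = (\<Sum>j<N. emb S (\<iota> (g (src.uvec j) i) \<otimes>\<^bsub>S\<^esub> x j))"
    unfolding base_change_def matrix_of_def using assms c
    by (simp, subst emb_finsum[OF dst.is_cring]) auto
  then show ?thesis using assms c by (simp add: dst.emb_rules)
qed

lemma bc_ext: "bc g \<in> extensional dst.V"
  by (simp add: base_change_def)

lemma bc_lin: assumes g: "src.lin g" shows "dst.lin (bc g)"
  unfolding dst.lin_def
proof (intro conjI ballI)
  show "bc g \<in> dst.V \<rightarrow> dst.V" using bc_closed[OF g] by auto
  have c: "g (src.uvec j) i \<in> carrier R" if "i < N" for i j using src.lin_closed[OF g] that by simp
  fix x y assume xy: "x \<in> dst.V" "y \<in> dst.V"
  show "bc g (dst.vadd x y) = dst.vadd (bc g x) (bc g y)"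
  proof (rule dst.vec_ext)
    fix i assume i: "i < N"
    show "bc g (dst.vadd x y) i = dst.vadd (bc g x) (bc g y) i"
      by (rule dst.ring_eqI)
         (use i xy c bc_closed[OF g] in \<open>simp_all add: emb_bc g dst.emb_rules distrib_left sum.distrib\<close>)
  qed (use xy bc_closed[OF g] in simp_all)
next
  have c: "g (src.uvec j) i \<in> carrier R" if "i < N" for i j using src.lin_closed[OF g] that by simp
  fix a x assume ax: "a \<in> carrier S" "x \<in> dst.V"
  show "bc g (dst.vsmult a x) = dst.vsmult a (bc g x)"
  proof (rule dst.vec_ext)
    fix i assume i: "i < N"
    show "bc g (dst.vsmult a x) i = dst.vsmult a (bc g x) i"
      by (rule dst.ring_eqI)
         (use i ax c bc_closed[OF g] in \<open>simp_all add: emb_bc g dst.emb_rules sum_distrib_left mult_ac\<close>)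
  qed (use ax bc_closed[OF g] in simp_all)
qed

lemma bc_uvec: assumes g: "src.lin g" and j: "j < N" shows "bc g (dst.uvec j) = vm (g (src.uvec j))"
proof (rule dst.vec_ext)
  have c: "g (src.uvec j) i \<in> carrier R" if "i < N" for i j using src.lin_closed[OF g] that by simp
  fix i assume i: "i < N"
  have "emb S (bc g (dst.uvec j) i) =
      (\<Sum>l<N. if l = j then emb S (\<iota> (g (src.uvec j) i)) else 0)"
    unfolding emb_bc[OF g dst.uvec_closed i] using i c
    by (intro sum.cong refl) (auto simp: dst.emb_rules mult.commute[of _ "emb S \<one>\<^bsub>S\<^esub>"])
  also have "\<dots> = emb S (vm (g (src.uvec j)) i)" using i j by simp
  finally show "bc g (dst.uvec j) i = vm (g (src.uvec j)) i"
    by (rule dst.ring_eqI) (use i c bc_closed[OF g] in simp_all)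
qed (use bc_closed[OF g] src.lin_closed[OF g] in simp_all)

lemma bc_vm: assumes g: "src.lin g" shows "x \<in> src.V \<Longrightarrow> bc g (vm x) = vm (g x)"
proof (induction rule: src.vec_induct)
  case zero
  then show ?case by (simp add: vm_zero src.lin_zero[OF g] dst.lin_zero[OF bc_lin[OF g]])
next
  case (step y a j)
  have "bc g (vm (src.vadd y (src.vsmult a (src.uvec j)))) =
      bc g (dst.vadd (vm y) (dst.vsmult (\<iota> a) (dst.uvec j)))"
    using step.hyps by (simp add: vm_add vm_smult vm_uvec)
  also have "\<dots> = dst.vadd (bc g (vm y)) (dst.vsmult (\<iota> a) (bc g (dst.uvec j)))"
    using bc_lin[OF g] step.hyps by (simp add: dst.lin_def)
  also have "\<dots> = vm (src.vadd (g y) (src.vsmult a (g (src.uvec j))))"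
    unfolding step.IH bc_uvec[OF g step.hyps(3)]
    using step.hyps src.lin_closed[OF g] by (simp add: vm_add vm_smult)
  also have "\<dots> = vm (g (src.vadd y (src.vsmult a (src.uvec j))))"
    using g step.hyps by (simp add: src.lin_def)
  finally show ?case .
qed

lemma bc_eqI:
  assumes g: "src.lin g" and h: "dst.lin h" "h \<in> extensional dst.V"
    and "\<And>x. x \<in> src.V \<Longrightarrow> h (vm x) = vm (g x)"
  shows "bc g = h"
proof (rule extensionalityI[OF bc_ext h(2)])
  fix x assume "x \<in> dst.V"
  then show "bc g x = h x"
  proof (rule dst.lin_eqI[OF bc_lin[OF g] h(1) _, rotated])
    fix j assume "j < N"
    then show "bc g (dst.uvec j) = h (dst.uvec j)"
      using assms(4)[OF src.uvec_closed, of j] by (simp add: bc_uvec[OF g] vm_uvec)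
  qed
qed

lemma bc_orth: assumes g: "g \<in> src.Og" shows "bc g \<in> dst.Og"
  unfolding dst.orth_iff
proof (intro conjI ballI)
  note gl = src.orthD(2)[OF g] and il = src.orthD(2)[OF src.inv_orth[OF g]]
  note gB = src.orthD(1)[OF g]
  show "dst.lin (bc g)" by (rule bc_lin[OF gl])
  have id: "dst.lin (\<lambda>x. x)" by (simp add: dst.lin_def)
  let ?i = "inv\<^bsub>src.M\<^esub> g"
  have gu: "g x \<in> src.V" "?i x \<in> src.V" if "x \<in> src.V" for x
    using that src.orthD(3) g src.inv_orth by blast+
  show "bc g \<in> Bij dst.V"
  proof (rule dst.BijI[of _ "bc ?i"])
    show "bc g (bc ?i x) = x" if "x \<in> dst.V" for x
      by (rule dst.lin_eqI[OF dst.lin_comp[OF bc_lin[OF gl] bc_lin[OF il]] id _ that])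
         (simp add: bc_uvec il bc_vm gl gu src.inv_M(3)[OF gB] vm_uvec)
    show "bc ?i (bc g x) = x" if "x \<in> dst.V" for x
      by (rule dst.lin_eqI[OF dst.lin_comp[OF bc_lin[OF il] bc_lin[OF gl]] id _ that])
         (simp add: bc_uvec gl bc_vm il gu src.inv_M(2)[OF gB] vm_uvec)
  qed (use bc_closed[OF gl] bc_closed[OF il] bc_ext in auto)
  have lD: "bc g (dst.vadd x y) = dst.vadd (bc g x) (bc g y)"
    "a \<in> carrier S \<Longrightarrow> bc g (dst.vsmult a x) = dst.vsmult a (bc g x)"
    if "x \<in> dst.V" "y \<in> dst.V" for x y a
    using bc_lin[OF gl] that by (simp_all add: dst.lin_def)
  have 1: "dst.B (bc g (dst.uvec i)) (bc g y) = dst.B (dst.uvec i) y" if i: "i < N" and y: "y \<in> dst.V" for i y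
    using y
  proof (induction rule: dst.vec_induct)
    case zero
    then show ?case
      using i bc_closed[OF gl] dst.bform_sym[of _ dst.vzero] by (simp add: dst.lin_zero[OF bc_lin[OF gl]])
  next
    case (step y a j)
    have "dst.B (bc g (dst.uvec i)) (bc g (dst.uvec j)) = dst.B (dst.uvec i) (dst.uvec j)"
      using i step by (simp add: bc_vm[OF gl] bform_vm gu src.orthD(6)[OF g] flip: vm_uvec)
    then show ?case using step i bc_closed[OF gl] by (simp add: lD del: dst.uvec_comp)
  qed
  fix x y assume x: "x \<in> dst.V" and y: "y \<in> dst.V"
  show "dst.B (bc g x) (bc g y) = dst.B x y"
    using x
  proof (induction rule: dst.vec_induct)
    case zero
    then show ?case using bc_closed[OF gl] y by (simp add: dst.lin_zero[OF bc_lin[OF gl]])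
  next
    case (step x a j)
    then show ?case using 1 y bc_closed[OF gl] by (simp add: lD)
  qed
qed

lemma bc_mult: assumes g: "g \<in> src.Og" and h: "h \<in> src.Og"
  shows "bc (g \<otimes>\<^bsub>src.M\<^esub> h) = bc g \<otimes>\<^bsub>dst.M\<^esub> bc h"
proof (rule bc_eqI)
  note o = bc_orth[OF g] bc_orth[OF h]
  show "src.lin (g \<otimes>\<^bsub>src.M\<^esub> h)" by (intro src.orthD(2) src.orth_mult g h)
  show "dst.lin (bc g \<otimes>\<^bsub>dst.M\<^esub> bc h)" by (intro dst.orthD(2) dst.orth_mult o)
  show "bc g \<otimes>\<^bsub>dst.M\<^esub> bc h \<in> extensional dst.V"
    using dst.orthD(1)[OF dst.orth_mult[OF o]] by (rule Bij_imp_extensional)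
  show "(bc g \<otimes>\<^bsub>dst.M\<^esub> bc h) (vm x) = vm ((g \<otimes>\<^bsub>src.M\<^esub> h) x)" if "x \<in> src.V" for x
    using that g h o by (simp add: dst.mult_M dst.orthD(1) src.mult_M src.orthD(1-3) bc_vm)
qed

lemma bc_one: "bc \<one>\<^bsub>src.M\<^esub> = \<one>\<^bsub>dst.M\<^esub>"
proof (rule bc_eqI)
  show "src.lin \<one>\<^bsub>src.M\<^esub>" by (rule src.orthD(2)[OF src.one_orth])
  show "dst.lin \<one>\<^bsub>dst.M\<^esub>" by (rule dst.orthD(2)[OF dst.one_orth])
  show "\<one>\<^bsub>dst.M\<^esub> \<in> extensional dst.V"
    using dst.orthD(1)[OF dst.one_orth] by (rule Bij_imp_extensional)
qed (simp add: src.one_M dst.one_M)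

lemma bc_refl: "v \<in> src.anis \<Longrightarrow> bc (src.refl v) = dst.refl (vm v)"
  by (rule bc_eqI) (auto simp: src.orthD src.refl_orth dst.orthD dst.refl_orth vm_anis vm_refl
      intro: Bij_imp_extensional)

lemma bc_inv: assumes g: "g \<in> src.Og" shows "bc (inv\<^bsub>src.M\<^esub> g) = inv\<^bsub>dst.M\<^esub> (bc g)"
proof -
  interpret A: group src.M by (rule src.group_M)
  interpret B: group dst.M by (rule dst.group_M)
  have c: "g \<in> carrier src.M" using src.orthD(1)[OF g] by simp
  have "bc (inv\<^bsub>src.M\<^esub> g) \<otimes>\<^bsub>dst.M\<^esub> bc g = \<one>\<^bsub>dst.M\<^esub>"
    using A.l_inv[OF c] by (simp add: bc_mult[symmetric] src.inv_orth g bc_one)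
  then show ?thesis
    by (intro B.inv_equality[symmetric]) (simp_all add: dst.orthD(1) bc_orth src.inv_orth g)
qed

lemma det_bc: assumes g: "src.lin g" shows "\<iota> (det_endo R N g) = det_endo S N (bc g)"
proof -
  have c: "g (src.uvec j) i \<in> carrier R" if "i < N" for i j using src.lin_closed[OF g] that by simp
  have pc: "(\<Otimes>\<^bsub>R\<^esub>i\<in>{..<N}. g (src.uvec (\<sigma> i)) i) \<in> carrier R" for \<sigma>
    using c by (intro src.finprod_closed) auto
  have sgn: "\<iota> ([sign \<sigma>] \<cdot>\<^bsub>R\<^esub> x) = [sign \<sigma>] \<cdot>\<^bsub>S\<^esub> \<iota> x" if "x \<in> carrier R" for x \<sigma>
    using that by (cases "evenperm \<sigma>") (simp_all add: sign_def add_pow_int_lt)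
  have "\<iota> (det_endo R N g) = (\<Oplus>\<^bsub>S\<^esub>\<sigma>\<in>{\<sigma>. \<sigma> permutes {..<N}}.
      \<iota> ([sign \<sigma>] \<cdot>\<^bsub>R\<^esub> (\<Otimes>\<^bsub>R\<^esub>i\<in>{..<N}. g (src.uvec (\<sigma> i)) i)))"
    unfolding det_endo_def matrix_of_def
    by (subst h.hom_finsum) (auto intro!: src.add.int_pow_closed pc simp: o_def)
  also have "\<dots> = det_endo S N (bc g)"
    unfolding det_endo_def matrix_of_def
  proof (intro dst.finsum_cong' refl)
    fix \<sigma> assume "\<sigma> \<in> {\<sigma>. \<sigma> permutes {..<N}}"
    then have \<sigma>: "\<sigma> i < N" if "i < N" for i using that permutes_in_image[of \<sigma> "{..<N}" i] by simp
    have "\<iota> (\<Otimes>\<^bsub>R\<^esub>i\<in>{..<N}. g (src.uvec (\<sigma> i)) i) = (\<Otimes>\<^bsub>S\<^esub>i\<in>{..<N}. \<iota> (g (src.uvec (\<sigma> i)) i))"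
      by (subst h.hom_finprod) (auto simp: c o_def)
    also have "\<dots> = (\<Otimes>\<^bsub>S\<^esub>i\<in>{..<N}. bc g (dst.uvec (\<sigma> i)) i)"
      by (intro dst.finprod_cong' refl) (auto simp: bc_uvec[OF g] \<sigma> c src.lin_closed[OF g])
    finally show "\<iota> ([sign \<sigma>] \<cdot>\<^bsub>R\<^esub> (\<Otimes>\<^bsub>R\<^esub>i\<in>{..<N}. g (src.uvec (\<sigma> i)) i)) =
        [sign \<sigma>] \<cdot>\<^bsub>S\<^esub> (\<Otimes>\<^bsub>S\<^esub>i\<in>{..<N}. bc g (dst.uvec (\<sigma> i)) i)"
      by (simp add: sgn pc)
  next
    show "(\<lambda>\<sigma>. [sign \<sigma>] \<cdot>\<^bsub>S\<^esub> (\<Otimes>\<^bsub>S\<^esub>i\<in>{..<N}. bc g (dst.uvec (\<sigma> i)) i))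
        \<in> {\<sigma>. \<sigma> permutes {..<N}} \<rightarrow> carrier S"
      using bc_closed[OF g] by (intro Pi_I dst.add.int_pow_closed dst.finprod_closed) auto
  qed
  finally show ?thesis .
qed

end

context hyp_lattice
begin

text \<open>If two is a unit, a transvection is a commutator: with $D = s_{e-f} \circ s_{e-2f}$ one has
$D \circ E_c \circ D^{-1} = E_{2c}$, hence $E_c = E_{-c} \circ D \circ E_c \circ D^{-1}$. Its
reflections come in conjugate pairs, which makes the product of their norms the square $4$.\<close>

lemma eichler_e_refls:
  assumes two: "\<one> \<oplus> \<one> \<in> Units R" and c [simp]: "c \<in> V"
  defines "vs \<equiv> [eichler_e (neg c) (e_sub_f \<one>), eichler_e (neg c) (e_sub_f (\<one> \<oplus> \<one>)), e_sub_f (\<one> \<oplus> \<one>), e_sub_f \<one>]"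
  shows "set vs \<subseteq> L.anis" "eichler_e c = L.refls vs"
    "L.qprod vs = (\<one> \<oplus> \<one>) \<otimes> (\<one> \<oplus> \<one>)"
proof -
  let ?t = "\<one> \<oplus> \<one>"
  have a [simp]: "e_sub_f \<one> \<in> L.anis" "e_sub_f ?t \<in> L.anis" using two by simp_all
  have aV [simp]: "e_sub_f \<one> \<in> L.V" "e_sub_f ?t \<in> L.V" by simp_all
  show vs: "set vs \<subseteq> L.anis" unfolding vs_def by (simp add: L.orth_anis)
  show "L.qprod vs = ?t \<otimes> ?t"
    unfolding vs_def by (simp add: L.orthD(7), intro ring_eqI) (simp_all add: emb_rules algebra_simps)
  show "eichler_e c = L.refls vs"
  proof (rule L.Bij_eqI)
    show "eichler_e c \<in> Bij L.V" by (simp add: Og_Bij)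
    show "L.refls vs \<in> Bij L.V" by (rule Og_Bij[OF L.refls_orth[OF vs]])
    fix x assume x: "x \<in> L.V"
    define y where "y = L.refl (e_sub_f ?t) (\<tau> x)"
    have y: "y \<in> L.V" using x two by (simp add: y_def L.orthD(3))
    have cy: "eichler_e c y \<in> L.V" using y by (simp add: L.orthD(3))
    have y_eq: "eichler_e (neg c) (eichler_e c y) = y" using y by (simp add: eichler_e_neg)
    have "L.refls vs x = L.refl (eichler_e (neg c) (e_sub_f \<one>)) (L.refl (eichler_e (neg c) (e_sub_f ?t)) y)"
      unfolding L.refls_apply[OF vs x] by (simp add: vs_def y_def)
    also have "\<dots> = eichler_e (neg c) (\<tau> (L.refl (e_sub_f ?t) (eichler_e c y)))"
    proof -
      have "eichler_e (neg c) (\<tau> (L.refl (e_sub_f ?t) (eichler_e c y))) =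
          L.refl (eichler_e (neg c) (e_sub_f \<one>)) (eichler_e (neg c) (L.refl (e_sub_f ?t) (eichler_e c y)))"
        using cy two by (intro L.orth_refl) (simp_all add: L.orthD(3) L.refl_orth)
      also have "eichler_e (neg c) (L.refl (e_sub_f ?t) (eichler_e c y)) = L.refl (eichler_e (neg c) (e_sub_f ?t)) (eichler_e (neg c) (eichler_e c y))"
        using cy by (intro L.orth_refl) simp_all
      finally show ?thesis unfolding y_eq ..
    qed
    also have "\<dots> = eichler_e c x"
    proof -
      obtain r s z where [simp]: "r \<in> carrier R" "s \<in> carrier R" "z \<in> V" and xh: "x = hv r s z"
        using hv_cases[OF x] by metis
      have [simp]: "inv ?t \<in> carrier R" using two by simp
      have i: "inv ?t \<otimes> (?t \<otimes> w) = w" "?t \<otimes> (inv ?t \<otimes> w) = w" if "w \<in> carrier R" for w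
        using that two by (simp_all add: m_assoc[symmetric])
      define r1 where "r1 = inv ?t \<otimes> r \<ominus> B z c \<ominus> Q c \<otimes> (?t \<otimes> s)"
      define z1 where "z1 = z \<boxplus> (?t \<otimes> s) \<boxdot> c"
      have [simp]: "r1 \<in> carrier R" "z1 \<in> V" by (simp_all add: r1_def z1_def)
      have "eichler_e c y = hv r1 (?t \<otimes> s) z1"
        using two by (simp add: y_def xh r1_def z1_def del: bform_smult_left)
      then have 1: "eichler_e (neg c) (\<tau> (L.refl (e_sub_f ?t) (eichler_e c y))) = eichler_e (neg c) (hv (?t \<otimes> r1) s z1)"
        using two by (simp add: i)
      have e1: "?t \<otimes> r1 = r \<ominus> ?t \<otimes> B z c \<ominus> Q c \<otimes> (?t \<otimes> (?t \<otimes> s))"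
      proof -
        have "?t \<otimes> r1 = ?t \<otimes> (inv ?t \<otimes> r) \<ominus> ?t \<otimes> B z c \<ominus> Q c \<otimes> (?t \<otimes> (?t \<otimes> s))"
          unfolding r1_def by (rule ring_eqI) (simp_all add: emb_rules algebra_simps)
        then show ?thesis by (simp add: i)
      qed
      have e2: "?t \<otimes> r1 \<ominus> B z1 (neg c) \<ominus> Q (neg c) \<otimes> s = r \<ominus> B z c \<ominus> Q c \<otimes> s"
        unfolding e1 z1_def by (rule ring_eqI) (simp_all add: emb_rules emb_bform_self algebra_simps)
      have e3: "z1 \<boxplus> s \<boxdot> neg c = z \<boxplus> s \<boxdot> c"
        unfolding z1_def by (rule vec_ext, simp, simp, rule ring_eqI) (simp_all add: emb_rules algebra_simps)
      show ?thesis unfolding 1 unfolding xh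
        by (simp only: eichler_e_hv e2 e3 m_closed a_closed one_closed \<open>r1 \<in> carrier R\<close> \<open>s \<in> carrier R\<close>
            \<open>z1 \<in> V\<close> neg_closed c \<open>r \<in> carrier R\<close> \<open>z \<in> V\<close>)
    qed
    finally show "eichler_e c x = L.refls vs x" ..
  qed
qed

end

locale hyp_hom = lattice_hom R S n G G' \<iota>
  for R :: "'a ring" and S :: "'b ring" and n G G' \<iota>

sublocale hyp_hom \<subseteq> hs: hyp_lattice R n G
  by unfold_locales

sublocale hyp_hom \<subseteq> hd: hyp_lattice S n G'
  by unfold_locales

sublocale hyp_hom \<subseteq> LL: lattice_hom R S "n + 2" "hyp_gram R G" "hyp_gram S G'" \<iota>
proof unfold_locales
  show "\<iota> \<in> Ring.ring_hom R S" by (rule hom)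
  fix i j assume "i < n + 2" "j < n + 2"
  then show "hyp_gram S G' i j = \<iota> (hyp_gram R G i j)"
    by (auto simp: hyp_gram_def gram_eq)
qed

context hyp_hom
begin

lemma vm_hv:
  assumes "r \<in> carrier R" "s \<in> carrier R" "z \<in> src.V"
  shows "LL.vm (hs.hv r s z) = hd.hv (\<iota> r) (\<iota> s) (vm z)"
proof (rule hd.L.vec_ext)
  fix i assume "i < n + 2"
  then consider "i = 0" | "i = 1" | j where "i = Suc (Suc j)" "j < n"
    by (metis One_nat_def add_2_eq_Suc' not0_implies_Suc not_less_eq)
  then show "LL.vm (hs.hv r s z) i = hd.hv (\<iota> r) (\<iota> s) (vm z) i"
    by cases simp_all
qed (use assms in simp_all)

lemma vm_e_sub_f: "u \<in> carrier R \<Longrightarrow> LL.vm (hs.e_sub_f u) = hd.e_sub_f (\<iota> u)"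
  by (simp add: hs.e_sub_f_def hd.e_sub_f_def vm_hv vm_zero)

lemma bc_psi: assumes b: "b \<in> src.V" shows "LL.bc (psi R n G b) = psi S n G' (vm b)"
proof (rule LL.bc_eqI)
  show "hs.L.lin (psi R n G b)" using b by (intro hs.L.orthD(2)) simp
  show "hd.L.lin (psi S n G' (vm b))" using b by (intro hd.L.orthD(2)) simp
  show "psi S n G' (vm b) \<in> extensional hd.L.V" by (simp add: psi_def)
  fix x assume "x \<in> hs.L.V"
  then obtain r s z where m: "r \<in> carrier R" "s \<in> carrier R" "z \<in> src.V" "x = hs.hv r s z"
    using hs.hv_cases by metis
  then show "psi S n G' (vm b) (LL.vm x) = LL.vm (psi R n G b x)"
    using b by (simp add: vm_hv vm_add vm_smult bform_vm qform_vm a_minus_def)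
qed

lemma bc_eichler_e: assumes b: "b \<in> src.V" shows "LL.bc (hs.eichler_e b) = hd.eichler_e (vm b)"
proof (rule LL.bc_eqI)
  show "hs.L.lin (hs.eichler_e b)" using b by (intro hs.L.orthD(2)) simp
  show "hd.L.lin (hd.eichler_e (vm b))" using b by (intro hd.L.orthD(2)) simp
  show "hd.eichler_e (vm b) \<in> extensional hd.L.V" by (simp add: hd.eichler_e_def)
  fix x assume "x \<in> hs.L.V"
  then obtain r s z where m: "r \<in> carrier R" "s \<in> carrier R" "z \<in> src.V" "x = hs.hv r s z"
    using hs.hv_cases by metis
  then show "hd.eichler_e (vm b) (LL.vm x) = LL.vm (hs.eichler_e b x)"
    using b by (simp add: vm_hv vm_add vm_smult bform_vm qform_vm a_minus_def)
qed

lemma bc_prod_of: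
  "set xs \<subseteq> hs.L.Og \<Longrightarrow> LL.bc (prod_of hs.L.M xs) = prod_of hd.L.M (map LL.bc xs)"
  by (induction xs) (simp_all add: LL.bc_one LL.bc_mult hs.prod_of_orth)

lemma unit_norm_vm:
  assumes "a \<in> hs.L.V" "hs.L.Q a = \<one>\<^bsub>R\<^esub> \<or> hs.L.Q a = \<ominus>\<^bsub>R\<^esub> \<one>\<^bsub>R\<^esub>"
  shows "LL.vm a \<in> hd.L.V" "hs.L.Q a = \<one>\<^bsub>R\<^esub> \<Longrightarrow> hd.L.Q (LL.vm a) = \<one>\<^bsub>S\<^esub>"
    "hs.L.Q a = \<ominus>\<^bsub>R\<^esub> \<one>\<^bsub>R\<^esub> \<Longrightarrow> hd.L.Q (LL.vm a) = \<ominus>\<^bsub>S\<^esub> \<one>\<^bsub>S\<^esub>"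
  using assms by (simp_all add: LL.qform_vm)

lemma bc_psi_conjs: assumes "g \<in> psi_conjs R n G" shows "LL.bc g \<in> psi_conjs S n G'"
proof -
  obtain b a where ba: "b \<in> src.V" "a \<in> hs.L.V" "hs.L.Q a = \<one>\<^bsub>R\<^esub> \<or> hs.L.Q a = \<ominus>\<^bsub>R\<^esub> \<one>\<^bsub>R\<^esub>"
    and g: "g = psi_conj R n G b a" using assms by (auto simp: psi_conjs_def)
  have an: "a \<in> hs.L.anis" using ba by (intro hs.unit_norm_one)
  have "LL.bc g = psi_conj S n G' (vm b) (LL.vm a)"
    unfolding g hs.psi_conj_eq hd.psi_conj_eq using ba an
    by (simp add: LL.bc_mult hs.L.orth_mult hs.L.refl_orth LL.bc_refl bc_psi)
  then show ?thesis
    unfolding psi_conjs_def using ba unit_norm_vm[OF ba(2,3)]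
    by (intro CollectI exI[of _ "vm b"] exI[of _ "LL.vm a"]) auto
qed

lemma bc_generate:
  assumes sub: "A \<subseteq> hs.L.Og" and gen: "\<And>g. g \<in> A \<Longrightarrow> LL.bc g \<in> H" and H: "subgroup H hd.L.M"
    and g: "g \<in> generate hs.L.M A"
  shows "LL.bc g \<in> H"
proof -
  have "g \<in> hs.L.Og \<and> LL.bc g \<in> H" using g
  proof (induction rule: generate.induct)
    case one
    then show ?case using subgroup.one_closed[OF H] by (simp add: hs.L.one_orth LL.bc_one)
  next
    case (incl h)
    then show ?case using sub gen by blast
  next
    case (inv h)
    then have "h \<in> hs.L.Og" "LL.bc h \<in> H" using sub gen by auto
    then show ?case using subgroup.m_inv_closed[OF H] by (simp add: hs.L.inv_orth LL.bc_inv)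
  next
    case (eng h1 h2)
    then show ?case using subgroup.m_closed[OF H] by (simp add: hs.L.orth_mult LL.bc_mult)
  qed
  then show ?thesis ..
qed

lemma bc_W_pm: assumes "g \<in> W_pm R n G" shows "LL.bc g \<in> W_pm S n G'"
proof (rule bc_generate[OF hs.W_pm_gen_orth _ hd.W_pm_subgroup])
  show "g \<in> generate hs.L.M (refl_group_pm R (n + 2) (hyp_gram R G) \<union> even_products hs.L.M (psi_conjs R n G))"
    using assms by (simp add: W_pm_def Let_def)
  fix h assume "h \<in> refl_group_pm R (n + 2) (hyp_gram R G) \<union> even_products hs.L.M (psi_conjs R n G)"
  then show "LL.bc h \<in> W_pm S n G'"
  proof
    assume h: "h \<in> refl_group_pm R (n + 2) (hyp_gram R G)"
    show ?thesis
    proof (rule bc_generate[OF _ _ hd.W_pm_subgroup h[unfolded refl_group_pm_def]])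
      fix k assume "k \<in> {hs.L.refl a \<otimes>\<^bsub>hs.L.M\<^esub> hs.L.refl b | a b. a \<in> hs.L.V \<and> b \<in> hs.L.V \<and>
          (hs.L.Q a = \<one>\<^bsub>R\<^esub> \<and> hs.L.Q b = \<one>\<^bsub>R\<^esub> \<or> hs.L.Q a = \<ominus>\<^bsub>R\<^esub> \<one>\<^bsub>R\<^esub> \<and> hs.L.Q b = \<ominus>\<^bsub>R\<^esub> \<one>\<^bsub>R\<^esub>)}"
      then obtain a b where ab: "a \<in> hs.L.V" "b \<in> hs.L.V"
          "hs.L.Q a = \<one>\<^bsub>R\<^esub> \<and> hs.L.Q b = \<one>\<^bsub>R\<^esub> \<or> hs.L.Q a = \<ominus>\<^bsub>R\<^esub> \<one>\<^bsub>R\<^esub> \<and> hs.L.Q b = \<ominus>\<^bsub>R\<^esub> \<one>\<^bsub>R\<^esub>"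
        and k: "k = hs.L.refl a \<otimes>\<^bsub>hs.L.M\<^esub> hs.L.refl b" by auto
      have an: "a \<in> hs.L.anis" "b \<in> hs.L.anis" using ab by (auto intro: hs.unit_norm_one)
      have "LL.bc k = hd.L.refl (LL.vm a) \<otimes>\<^bsub>hd.L.M\<^esub> hd.L.refl (LL.vm b)"
        unfolding k using an by (simp add: LL.bc_mult hs.L.refl_orth LL.bc_refl)
      also have "\<dots> \<in> W_pm S n G'"
        by (rule hd.refl_refl_W_pm) (use ab in \<open>auto simp: LL.qform_vm\<close>)
      finally show "LL.bc k \<in> W_pm S n G'" .
    qed (auto simp: hs.refl_group_pm_gen_orth)
  next
    assume "h \<in> even_products hs.L.M (psi_conjs R n G)"
    then obtain xs where xs: "set xs \<subseteq> psi_conjs R n G" "even (length xs)" "h = prod_of hs.L.M xs"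
      by (auto simp: even_products_def)
    have "LL.bc h = prod_of hd.L.M (map LL.bc xs)"
      unfolding xs(3) using xs(1) hs.psi_conjs_orth by (intro bc_prod_of) auto
    also have "\<dots> \<in> even_products hd.L.M (psi_conjs S n G')"
      unfolding even_products_def using xs(1,2) bc_psi_conjs
      by (intro CollectI exI[of _ "map LL.bc xs"]) auto
    finally show ?thesis unfolding W_pm_def Let_def by (intro generate.incl UnI2)
  qed
qed

end

section \<open>The discriminant action and the spinor norm\<close>

locale hyp_frac = hyp_lattice R n G for R :: "'a ring" (structure) and n G
begin

abbreviation K where "K \<equiv> fraction_field R"
abbreviation \<phi> where "\<phi> \<equiv> to_frac R"
abbreviation GK where "GK \<equiv> map_gram (to_frac R) G"

sublocale fd: fraction_domain R by unfold_locales

lemma K_quadratic_lattice: "quadratic_lattice K n GK"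
proof -
  interpret K: field K by (rule fd.K_field)
  have two: "x = \<zero>\<^bsub>K\<^esub>" if "x \<in> carrier K" "x \<oplus>\<^bsub>K\<^esub> x = \<zero>\<^bsub>K\<^esub>" for x
    by (rule fd.K_two_torsion_free[OF _ that]) (rule two_torsion_free)
  show ?thesis
  proof unfold_locales
    show "x = \<zero>\<^bsub>K\<^esub>" if "x \<in> carrier K" "x \<oplus>\<^bsub>K\<^esub> x = \<zero>\<^bsub>K\<^esub>" for x using that by (rule two)
    show "GK i j \<in> carrier K" if "i < n" "j < n" for i j using that by (simp add: map_gram_def)
    show "GK i j = GK j i" if "i < n" "j < n" for i j using that by (simp add: map_gram_def gram_sym)
    show "\<exists>h\<in>carrier K. GK i i = h \<oplus>\<^bsub>K\<^esub> h" if i: "i < n" for i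
    proof -
      obtain h where "h \<in> carrier R" "G i i = h \<oplus> h" using gram_even[OF i] by blast
      then show ?thesis
        using Ring.ring_hom_add[OF fd.to_frac_hom] by (intro bexI[of _ "\<phi> h"]) (simp_all add: map_gram_def)
    qed
  qed
qed

end

sublocale hyp_frac \<subseteq> F: hyp_hom R "fraction_field R" n G "map_gram (to_frac R) G" "to_frac R"
proof -
  interpret K: quadratic_lattice "fraction_field R" n "map_gram (to_frac R) G" by (rule K_quadratic_lattice)
  show "hyp_hom R K n G GK \<phi>"
    by unfold_locales (simp_all add: fd.to_frac_hom map_gram_def)
qed

context hyp_frac
begin

lemma map_hyp_gram: "map_gram \<phi> (hyp_gram R G) = hyp_gram K GK"
  by (intro ext) (auto simp: map_gram_def hyp_gram_def F.h.hom_zero F.h.hom_one)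

abbreviation VK where "VK \<equiv> F.hd.L.V"

lemma K_Units: "Units K = carrier K - {\<zero>\<^bsub>K\<^esub>}"
  by (rule field.field_Units[OF fd.K_field])

lemma dual_iff:
  "x \<in> dual_lattice R (n + 2) (hyp_gram R G) \<longleftrightarrow>
     x \<in> VK \<and> (\<forall>y\<in>L.V. F.hd.L.B x (F.LL.vm y) \<in> \<phi> ` carrier R)"
  by (auto simp: dual_lattice_def Let_def map_hyp_gram)

lemma discr_iff:
  "g \<in> discr_orth R (n + 2) (hyp_gram R G) \<longleftrightarrow> g \<in> L.Og \<and>
     (\<forall>x\<in>dual_lattice R (n + 2) (hyp_gram R G). \<exists>y\<in>L.V. F.LL.bc g x = F.hd.L.vadd x (F.LL.vm y))"
  by (auto simp: discr_orth_def Let_def)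

abbreviation D where "D \<equiv> discr_orth R (n + 2) (hyp_gram R G)"
abbreviation dual where "dual \<equiv> dual_lattice R (n + 2) (hyp_gram R G)"

lemma discr_mult: assumes g: "g \<in> D" and h: "h \<in> D" shows "g \<otimes>\<^bsub>L.M\<^esub> h \<in> D"
  unfolding discr_iff
proof (intro conjI ballI)
  have o: "g \<in> L.Og" "h \<in> L.Og" using assms by (auto simp: discr_iff)
  then show "g \<otimes>\<^bsub>L.M\<^esub> h \<in> L.Og" by (rule L.orth_mult)
  fix x assume x: "x \<in> dual"
  then have xV: "x \<in> VK" by (simp add: dual_iff)
  obtain y where y: "y \<in> L.V" "F.LL.bc h x = F.hd.L.vadd x (F.LL.vm y)"
    using h x unfolding discr_iff by blast
  obtain y' where y': "y' \<in> L.V" "F.LL.bc g x = F.hd.L.vadd x (F.LL.vm y')"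
    using g x unfolding discr_iff by blast
  note bo = F.LL.bc_orth[OF o(1)] F.LL.bc_orth[OF o(2)]
  have gy: "g y \<in> L.V" using L.orthD(3)[OF o(1)] y by simp
  have "F.LL.bc (g \<otimes>\<^bsub>L.M\<^esub> h) x = F.LL.bc g (F.LL.bc h x)"
    using bo xV by (simp add: F.LL.bc_mult o F.hd.L.mult_M F.hd.L.orthD(1))
  also have "\<dots> = F.hd.L.vadd (F.LL.bc g x) (F.LL.bc g (F.LL.vm y))"
    unfolding y(2) using xV y by (intro F.hd.L.orthD(4)[OF bo(1)]) simp_all
  also have "\<dots> = F.hd.L.vadd (F.hd.L.vadd x (F.LL.vm y')) (F.LL.vm (g y))"
    using y y' by (simp add: F.LL.bc_vm L.orthD(2)[OF o(1)])
  also have "\<dots> = F.hd.L.vadd x (F.LL.vm (L.vadd y' (g y)))"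
    using xV y y' gy by (intro F.hd.L.vec_ext) (simp_all add: F.dst.a_assoc)
  finally show "\<exists>y\<in>L.V. F.LL.bc (g \<otimes>\<^bsub>L.M\<^esub> h) x = F.hd.L.vadd x (F.LL.vm y)"
    using y' gy by (intro bexI[of _ "L.vadd y' (g y)"]) simp_all
qed

lemma discr_one: "\<one>\<^bsub>L.M\<^esub> \<in> D"
  unfolding discr_iff
proof (intro conjI ballI)
  fix x assume "x \<in> dual"
  then have xV: "x \<in> VK" by (simp add: dual_iff)
  have "x = F.hd.L.vadd x (F.LL.vm L.vzero)"
    using xV by (intro F.hd.L.vec_ext) simp_all
  then show "\<exists>y\<in>L.V. F.LL.bc \<one>\<^bsub>L.M\<^esub> x = F.hd.L.vadd x (F.LL.vm y)"
    using xV by (intro bexI[of _ L.vzero]) (simp_all add: F.LL.bc_one F.hd.L.one_M)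
qed (rule L.one_orth)

lemma discr_inv: assumes g: "g \<in> D" shows "inv\<^bsub>L.M\<^esub> g \<in> D"
  unfolding discr_iff
proof (intro conjI ballI)
  have o: "g \<in> L.Og" using assms by (auto simp: discr_iff)
  let ?i = "inv\<^bsub>L.M\<^esub> g"
  show io: "?i \<in> L.Og" by (rule L.inv_orth[OF o])
  note bo = F.LL.bc_orth[OF o] F.LL.bc_orth[OF io]
  fix x assume x: "x \<in> dual"
  then have xV: "x \<in> VK" by (simp add: dual_iff)
  obtain y where y: "y \<in> L.V" "F.LL.bc g x = F.hd.L.vadd x (F.LL.vm y)"
    using assms x by (auto simp: discr_iff)
  have iy: "?i y \<in> L.V" using L.orthD(3)[OF io] y by simp
  have "x = F.LL.bc ?i (F.LL.bc g x)"
    using F.hd.L.inv_M(2)[OF F.hd.L.orthD(1)[OF bo(1)] xV] by (simp add: F.LL.bc_inv[OF o])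
  also have "\<dots> = F.hd.L.vadd (F.LL.bc ?i x) (F.LL.bc ?i (F.LL.vm y))"
    unfolding y(2) using xV y by (intro F.hd.L.orthD(4)[OF bo(2)]) simp_all
  also have "\<dots> = F.hd.L.vadd (F.LL.bc ?i x) (F.LL.vm (?i y))"
    using y by (simp add: F.LL.bc_vm L.orthD(2)[OF io])
  finally have eq: "x = F.hd.L.vadd (F.LL.bc ?i x) (F.LL.vm (?i y))" .
  have bx: "F.LL.bc ?i x \<in> VK" using F.hd.L.orthD(3)[OF bo(2) xV] .
  have "F.LL.bc ?i x = F.hd.L.vadd x (F.LL.vm (L.vsmult (\<ominus> \<one>) (?i y)))"
  proof (rule F.hd.L.vec_ext)
    fix i assume i: "i < n + 2"
    define a b where "a = F.LL.bc ?i x i" "b = ?i y i"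
    have ab [simp]: "a \<in> carrier K" "b \<in> carrier R" using i bx iy by (simp_all add: a_b_def)
    have "x i = a \<oplus>\<^bsub>K\<^esub> \<phi> b" using arg_cong[OF eq, of "\<lambda>f. f i"] i by (simp add: a_b_def)
    then have "F.hd.L.vadd x (F.LL.vm (L.vsmult (\<ominus> \<one>) (?i y))) i = (a \<oplus>\<^bsub>K\<^esub> \<phi> b) \<oplus>\<^bsub>K\<^esub> \<phi> (\<ominus> \<one> \<otimes> b)"
      using i by (simp add: a_b_def)
    also have "\<dots> = a"
      by (rule F.dst.ring_eqI) (simp_all add: F.dst.emb_rules)
    finally show "F.LL.bc ?i x i = F.hd.L.vadd x (F.LL.vm (L.vsmult (\<ominus> \<one>) (?i y))) i"
      by (simp add: a_b_def)
  qed (use xV bx iy in simp_all)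
  then show "\<exists>y\<in>L.V. F.LL.bc ?i x = F.hd.L.vadd x (F.LL.vm y)"
    using iy by (intro bexI[of _ "L.vsmult (\<ominus> \<one>) (?i y)"]) simp_all
qed

lemma discr_subgroup: "subgroup D L.M"
  by (rule subgroup.intro) (auto simp: discr_mult discr_one discr_inv, auto simp: discr_iff L.orthD(1))

text \<open>A dual vector has integral product with $v$, and $q(v)$ is a unit, so the displacement under the
reflection is an integral multiple of $v$.\<close>

lemma discr_refl: assumes v: "v \<in> L.anis" shows "L.refl v \<in> D"
  unfolding discr_iff
proof (intro conjI ballI)
  show "L.refl v \<in> L.Og" by (rule L.refl_orth[OF v])
  note v' = v[unfolded L.anis_iff]
  fix x assume x: "x \<in> dual"
  then have xV: "x \<in> VK" by (simp add: dual_iff)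
  obtain a where a: "a \<in> carrier R" "F.hd.L.B x (F.LL.vm v) = \<phi> a"
    using x v' by (auto simp: dual_iff)
  have eq: "F.LL.bc (L.refl v) x = F.hd.L.vadd x (F.LL.vm (L.vsmult (\<ominus> (a \<otimes> inv L.Q v)) v))"
    using v v' xV a F.LL.unit_image[of "L.Q v"]
    by (simp add: F.LL.bc_refl F.hd.L.refl_eq F.LL.vm_anis F.LL.qform_vm F.LL.vm_smult)
  have cl: "L.vsmult (\<ominus> (a \<otimes> inv L.Q v)) v \<in> L.V"
    using v' a Units_inv_closed[of "L.Q v"] L.vsmult_closed a_inv_closed m_closed by blast
  show "\<exists>y\<in>L.V. F.LL.bc (L.refl v) x = F.hd.L.vadd x (F.LL.vm y)"
    using eq cl by blast
qed

text \<open>A vector of the dual lattice has integral coordinates along $e$ and $f$ and an integral product with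
$b$, and the displacement involves only these numbers.\<close>

lemma discr_psi: assumes b: "b \<in> V" shows "psi R n G b \<in> D"
  unfolding discr_iff
proof (intro conjI ballI)
  show "psi R n G b \<in> L.Og" using b by simp
  fix x assume x: "x \<in> dual"
  then have xV: "x \<in> VK" by (simp add: dual_iff)
  obtain r s z where [simp]: "r \<in> carrier K" "s \<in> carrier K" "z \<in> F.dst.V" and xh: "x = F.hd.hv r s z"
    using F.hd.hv_cases[OF xV] by metis
  have mem: "F.hd.L.B x (F.LL.vm y) \<in> \<phi> ` carrier R" if "y \<in> L.V" for y
    using x that by (simp add: dual_iff)
  obtain r' where r': "r' \<in> carrier R" "r = \<phi> r'"
    using mem[of "hv \<zero> \<one> vzero"] by (auto simp: F.vm_hv F.vm_zero xh F.dst.bform_sym[of z F.dst.vzero])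
  obtain s' where s': "s' \<in> carrier R" "s = \<phi> s'"
    using mem[of "hv \<one> \<zero> vzero"] by (auto simp: F.vm_hv F.vm_zero xh F.dst.bform_sym[of z F.dst.vzero])
  obtain t where t: "t \<in> carrier R" "F.dst.B z (F.vm b) = \<phi> t"
    using mem[of "hv \<zero> \<zero> b"] b by (auto simp: F.vm_hv F.vm_zero xh)
  define y where "y = hv (t \<ominus> (r' \<oplus> r') \<oplus> Q b \<otimes> s') (\<ominus> (s' \<oplus> s')) (s' \<boxdot> b)"
  have y: "y \<in> L.V" using r' s' t b by (simp add: y_def)
  have "F.LL.vm y = F.hd.hv (\<phi> t \<ominus>\<^bsub>K\<^esub> (r \<oplus>\<^bsub>K\<^esub> r) \<oplus>\<^bsub>K\<^esub> \<phi> (Q b) \<otimes>\<^bsub>K\<^esub> s)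
      (\<ominus>\<^bsub>K\<^esub> (s \<oplus>\<^bsub>K\<^esub> s)) (F.dst.vsmult s (F.vm b))"
    using r' s' t b by (simp add: y_def F.vm_hv F.vm_smult a_minus_def)
  moreover have "\<phi> t \<ominus>\<^bsub>K\<^esub> r \<oplus>\<^bsub>K\<^esub> \<phi> (Q b) \<otimes>\<^bsub>K\<^esub> s =
      r \<oplus>\<^bsub>K\<^esub> (\<phi> t \<ominus>\<^bsub>K\<^esub> (r \<oplus>\<^bsub>K\<^esub> r) \<oplus>\<^bsub>K\<^esub> \<phi> (Q b) \<otimes>\<^bsub>K\<^esub> s)"
    using t b by (intro F.dst.ring_eqI) (simp_all add: F.dst.emb_rules)
  moreover have "\<ominus>\<^bsub>K\<^esub> s = s \<oplus>\<^bsub>K\<^esub> \<ominus>\<^bsub>K\<^esub> (s \<oplus>\<^bsub>K\<^esub> s)"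
    by (intro F.dst.ring_eqI) (simp_all add: F.dst.emb_rules)
  ultimately have "F.LL.bc (psi R n G b) x = F.hd.L.vadd x (F.LL.vm y)"
    unfolding F.bc_psi[OF b] xh using b t
    by (simp add: F.qform_vm F.dst.bform_sym[of "F.vm b" z])
  then show "\<exists>y\<in>L.V. F.LL.bc (psi R n G b) x = F.hd.L.vadd x (F.LL.vm y)"
    using y by blast
qed

lemma W_group_discr: "W_group R n G \<subseteq> D"
proof -
  have r: "refl_group R (n + 2) (hyp_gram R G) \<subseteq> D"
    unfolding refl_group_def
    by (rule group.generate_subgroup_incl[OF L_group _ discr_subgroup]) (auto simp: discr_refl)
  have "psi_conjs R n G \<subseteq> D"
    unfolding psi_conjs_def psi_conj_eq
    by (auto intro!: discr_mult discr_refl discr_psi unit_norm_one)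
  with r show ?thesis
    unfolding W_group_def
    by (intro group.generate_subgroup_incl[OF L_group _ discr_subgroup]) blast
qed

definition spin :: "((nat \<Rightarrow> 'a) \<Rightarrow> nat \<Rightarrow> 'a) \<Rightarrow> (nat \<Rightarrow> ('a \<times> 'a) set) list \<Rightarrow> bool" where
  "spin g vs \<longleftrightarrow> g \<in> L.Og \<and> set vs \<subseteq> F.hd.L.anis \<and> F.LL.bc g = F.hd.L.refls vs"

lemma square_class_mem: "a \<in> Units K \<Longrightarrow> x \<in> square_class K a \<longleftrightarrow> (\<exists>c\<in>Units K. x = c \<otimes>\<^bsub>K\<^esub> c \<otimes>\<^bsub>K\<^esub> a)"
  by (auto simp: square_class_def r_coset_def units_of_def)

lemma square_class_eq_iff:
  assumes a: "a \<in> Units K" and b: "b \<in> Units K"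
  shows "square_class K a = square_class K b \<longleftrightarrow> (\<exists>r\<in>Units K. a = r \<otimes>\<^bsub>K\<^esub> r \<otimes>\<^bsub>K\<^esub> b)"
proof
  assume eq: "square_class K a = square_class K b"
  have "a \<in> square_class K a"
    unfolding square_class_mem[OF a] using a by (intro bexI[of _ "\<one>\<^bsub>K\<^esub>"]) (simp_all add: F.dst.Units_closed)
  then show "\<exists>r\<in>Units K. a = r \<otimes>\<^bsub>K\<^esub> r \<otimes>\<^bsub>K\<^esub> b" by (simp add: eq square_class_mem[OF b])
next
  assume "\<exists>r\<in>Units K. a = r \<otimes>\<^bsub>K\<^esub> r \<otimes>\<^bsub>K\<^esub> b"
  then obtain r where r: "r \<in> Units K" "a = r \<otimes>\<^bsub>K\<^esub> r \<otimes>\<^bsub>K\<^esub> b" by blast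
  have c: "r \<in> carrier K" "b \<in> carrier K" "inv\<^bsub>K\<^esub> r \<in> carrier K"
    using r b by (simp_all add: F.dst.Units_closed)
  show "square_class K a = square_class K b"
  proof (intro equalityI subsetI)
    fix x assume "x \<in> square_class K a"
    then obtain s where s: "s \<in> Units K" "x = s \<otimes>\<^bsub>K\<^esub> s \<otimes>\<^bsub>K\<^esub> a" by (auto simp: square_class_mem[OF a])
    have sc: "s \<in> carrier K" using s by (simp add: F.dst.Units_closed)
    have "x = (s \<otimes>\<^bsub>K\<^esub> r) \<otimes>\<^bsub>K\<^esub> (s \<otimes>\<^bsub>K\<^esub> r) \<otimes>\<^bsub>K\<^esub> b" unfolding s(2) r(2) using c sc by (simp add: F.dst.m_ac)
    then show "x \<in> square_class K b"
      unfolding square_class_mem[OF b] using s r by (intro bexI[of _ "s \<otimes>\<^bsub>K\<^esub> r"]) simp_all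
  next
    fix x assume "x \<in> square_class K b"
    then obtain s where s: "s \<in> Units K" "x = s \<otimes>\<^bsub>K\<^esub> s \<otimes>\<^bsub>K\<^esub> b" by (auto simp: square_class_mem[OF b])
    have sc: "s \<in> carrier K" using s by (simp add: F.dst.Units_closed)
    have "(s \<otimes>\<^bsub>K\<^esub> inv\<^bsub>K\<^esub> r) \<otimes>\<^bsub>K\<^esub> (s \<otimes>\<^bsub>K\<^esub> inv\<^bsub>K\<^esub> r) \<otimes>\<^bsub>K\<^esub> a =
        s \<otimes>\<^bsub>K\<^esub> s \<otimes>\<^bsub>K\<^esub> b \<otimes>\<^bsub>K\<^esub> (r \<otimes>\<^bsub>K\<^esub> inv\<^bsub>K\<^esub> r) \<otimes>\<^bsub>K\<^esub> (r \<otimes>\<^bsub>K\<^esub> inv\<^bsub>K\<^esub> r)"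
      unfolding r(2) using c sc by (simp add: F.dst.m_ac)
    also have "\<dots> = x" using r c sc s by simp
    finally show "x \<in> square_class K a"
      unfolding square_class_mem[OF a] using s r by (intro bexI[of _ "s \<otimes>\<^bsub>K\<^esub> inv\<^bsub>K\<^esub> r"]) simp_all
  qed
qed

text \<open>By \<open>refls_eq_norm\<close> over the field of fractions, the class is the same for all factorizations.\<close>

lemma spinor_norm_eq:
  assumes "spin g vs"
  shows "spinor_norm R (n + 2) (hyp_gram R G) g = square_class K (F.hd.L.qprod vs)"
  unfolding spinor_norm_def Let_def map_hyp_gram
proof (rule the_equality)
  note s = assms[unfolded spin_def]
  show "\<exists>vs'. set vs' \<subseteq> F.hd.L.anis \<and> F.LL.bc g = F.hd.L.refls vs' \<and>
      square_class K (F.hd.L.qprod vs) = square_class K (F.hd.L.qprod vs')"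
    using s by blast
  fix c assume "\<exists>vs'. set vs' \<subseteq> F.hd.L.anis \<and> F.LL.bc g = F.hd.L.refls vs' \<and>
      c = square_class K (F.hd.L.qprod vs')"
  then obtain ws where ws: "set ws \<subseteq> F.hd.L.anis" "F.hd.L.refls ws = F.hd.L.refls vs"
    and c: "c = square_class K (F.hd.L.qprod ws)" using s by auto
  show "c = square_class K (F.hd.L.qprod vs)"
    unfolding c using F.hd.L.refls_eq_norm[OF K_Units ws(1) _ ws(2)] s ws
    by (subst square_class_eq_iff) (auto intro: F.hd.L.qprod_Units)
qed

text \<open>The isometries of determinant one and spinor norm $c$, in terms of factorizations. Membership is
stable under products, which the definite description in \<open>spinor_norm\<close> does not show.\<close>

definition even_spin :: "'a \<Rightarrow> ((nat \<Rightarrow> 'a) \<Rightarrow> nat \<Rightarrow> 'a) set" where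
  "even_spin c = {g. \<exists>vs. spin g vs \<and> even (length vs) \<and>
      (\<exists>r\<in>Units K. F.hd.L.qprod vs = r \<otimes>\<^bsub>K\<^esub> r \<otimes>\<^bsub>K\<^esub> \<phi> c)}"

lemma even_spin_I: "spin g vs \<Longrightarrow> even (length vs) \<Longrightarrow> r \<in> Units K \<Longrightarrow>
    F.hd.L.qprod vs = r \<otimes>\<^bsub>K\<^esub> r \<otimes>\<^bsub>K\<^esub> \<phi> c \<Longrightarrow> g \<in> even_spin c"
  unfolding even_spin_def by blast

lemma even_spin_E:
  assumes "g \<in> even_spin c"
  obtains vs r where "spin g vs" "even (length vs)" "r \<in> Units K"
    "F.hd.L.qprod vs = r \<otimes>\<^bsub>K\<^esub> r \<otimes>\<^bsub>K\<^esub> \<phi> c"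
  using assms unfolding even_spin_def by blast

lemma spin_mult: assumes "spin g vs" "spin h ws" shows "spin (g \<otimes>\<^bsub>L.M\<^esub> h) (vs @ ws)"
  using assms unfolding spin_def by (simp add: L.orth_mult F.LL.bc_mult F.hd.L.refls_append del: map_append)

lemma even_spin_orth: "g \<in> even_spin c \<Longrightarrow> g \<in> L.Og"
  by (auto elim!: even_spin_E simp: spin_def)

lemma even_spin_mult:
  assumes "g \<in> even_spin c" "h \<in> even_spin c'" and [simp]: "c \<in> carrier R" "c' \<in> carrier R"
  shows "g \<otimes>\<^bsub>L.M\<^esub> h \<in> even_spin (c \<otimes> c')"
proof -
  obtain vs r where g: "spin g vs" "even (length vs)" "r \<in> Units K"
    "F.hd.L.qprod vs = r \<otimes>\<^bsub>K\<^esub> r \<otimes>\<^bsub>K\<^esub> \<phi> c" using assms(1) by (rule even_spin_E)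
  obtain ws s where h: "spin h ws" "even (length ws)" "s \<in> Units K"
    "F.hd.L.qprod ws = s \<otimes>\<^bsub>K\<^esub> s \<otimes>\<^bsub>K\<^esub> \<phi> c'" using assms(2) by (rule even_spin_E)
  have [simp]: "r \<in> carrier K" "s \<in> carrier K" using g h by (simp_all add: F.dst.Units_closed)
  show ?thesis
  proof (rule even_spin_I[OF spin_mult[OF g(1) h(1)]])
    show "r \<otimes>\<^bsub>K\<^esub> s \<in> Units K" using g h by simp
    have "F.hd.L.qprod (vs @ ws) = F.hd.L.qprod vs \<otimes>\<^bsub>K\<^esub> F.hd.L.qprod ws"
      using g h by (intro F.hd.L.qprod_append) (simp_all add: spin_def)
    also have "\<dots> = (r \<otimes>\<^bsub>K\<^esub> s) \<otimes>\<^bsub>K\<^esub> (r \<otimes>\<^bsub>K\<^esub> s) \<otimes>\<^bsub>K\<^esub> \<phi> (c \<otimes> c')"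
      unfolding g(4) h(4) by (simp add: F.dst.m_ac)
    finally show "F.hd.L.qprod (vs @ ws) = (r \<otimes>\<^bsub>K\<^esub> s) \<otimes>\<^bsub>K\<^esub> (r \<otimes>\<^bsub>K\<^esub> s) \<otimes>\<^bsub>K\<^esub> \<phi> (c \<otimes> c')" .
  qed (use g h in simp)
qed

lemma even_spin_one: "\<one>\<^bsub>L.M\<^esub> \<in> even_spin \<one>"
  by (rule even_spin_I[of _ "[]" "\<one>\<^bsub>K\<^esub>"]) (simp_all add: spin_def L.one_orth F.LL.bc_one)

lemma even_spin_inv: assumes "g \<in> even_spin \<one>" shows "inv\<^bsub>L.M\<^esub> g \<in> even_spin \<one>"
proof -
  obtain vs r where g: "spin g vs" "even (length vs)" "r \<in> Units K"
    "F.hd.L.qprod vs = r \<otimes>\<^bsub>K\<^esub> r \<otimes>\<^bsub>K\<^esub> \<phi> \<one>" using assms by (rule even_spin_E)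
  note s = g(1)[unfolded spin_def]
  interpret grp: group F.hd.L.M by (rule F.hd.L.group_M)
  have "F.hd.L.refls (rev vs) \<otimes>\<^bsub>F.hd.L.M\<^esub> F.hd.L.refls vs = F.hd.L.refls (rev vs @ rev (rev vs))"
    using s by (subst F.hd.L.refls_append) simp_all
  also have "\<dots> = \<one>\<^bsub>F.hd.L.M\<^esub>" using s by (intro F.hd.L.refls_rev) simp
  finally have "F.hd.L.refls (rev vs) \<otimes>\<^bsub>F.hd.L.M\<^esub> F.hd.L.refls vs = \<one>\<^bsub>F.hd.L.M\<^esub>" .
  then have "inv\<^bsub>F.hd.L.M\<^esub> (F.hd.L.refls vs) = F.hd.L.refls (rev vs)"
    using s by (intro grp.inv_equality) (simp_all add: F.hd.L.orthD(1) F.hd.L.refls_orth del: rev_map)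
  then have "spin (inv\<^bsub>L.M\<^esub> g) (rev vs)"
    using s by (simp add: spin_def L.inv_orth F.LL.bc_inv del: rev_map)
  then show ?thesis
    by (rule even_spin_I[OF _ _ g(3)]) (use g s in \<open>simp_all add: F.hd.L.qprod_rev del: rev_map\<close>)
qed

lemma even_spin_subgroup: "subgroup (even_spin \<one>) L.M"
proof (rule subgroup.intro)
  show "even_spin \<one> \<subseteq> carrier L.M" using even_spin_orth Og_Bij by auto
  show "x \<otimes>\<^bsub>L.M\<^esub> y \<in> even_spin \<one>" if "x \<in> even_spin \<one>" "y \<in> even_spin \<one>" for x y
    using even_spin_mult[OF that] by simp
qed (auto simp: even_spin_one even_spin_inv)

lemma two_unit: "\<one>\<^bsub>K\<^esub> \<oplus>\<^bsub>K\<^esub> \<one>\<^bsub>K\<^esub> \<in> Units K"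
  using F.dst.two_torsion_free[of "\<one>\<^bsub>K\<^esub>"] by (auto simp: K_Units)

lemma spin_refl: "v \<in> L.anis \<Longrightarrow> spin (L.refl v) [F.LL.vm v]"
  unfolding spin_def using F.LL.vm_anis[of v] F.hd.L.refl_orth[of "F.LL.vm v"]
  by (simp add: L.refl_orth F.LL.bc_refl F.hd.L.orthD(1) monoid.r_one[OF group.is_monoid[OF F.hd.L.group_M]])

lemma eichler_e_even_spin: assumes b: "b \<in> V" shows "eichler_e b \<in> even_spin \<one>"
proof -
  have vb: "F.vm b \<in> F.dst.V" using b by simp
  note e = F.hd.eichler_e_refls[OF two_unit vb]
  have "spin (eichler_e b) [F.hd.eichler_e (F.hd.neg (F.vm b)) (F.hd.e_sub_f \<one>\<^bsub>K\<^esub>),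
      F.hd.eichler_e (F.hd.neg (F.vm b)) (F.hd.e_sub_f (\<one>\<^bsub>K\<^esub> \<oplus>\<^bsub>K\<^esub> \<one>\<^bsub>K\<^esub>)), F.hd.e_sub_f (\<one>\<^bsub>K\<^esub> \<oplus>\<^bsub>K\<^esub> \<one>\<^bsub>K\<^esub>), F.hd.e_sub_f \<one>\<^bsub>K\<^esub>]"
    unfolding spin_def using e(1,2) b by (simp only: eichler_e_orth F.bc_eichler_e simp_thms)
  then show ?thesis
    by (rule even_spin_I[OF _ _ two_unit]) (use e(3) two_unit in \<open>simp_all only:\<close>, use two_unit in \<open>simp_all add: F.dst.Units_closed\<close>)
qed

lemma refl_refl_even_spin:
  assumes a: "a \<in> L.anis" and b: "b \<in> L.anis"
  shows "L.refl a \<otimes>\<^bsub>L.M\<^esub> L.refl b \<in> even_spin (L.Q a \<otimes> L.Q b)"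
proof (rule even_spin_I[OF spin_mult[OF spin_refl[OF a] spin_refl[OF b]], of "\<one>\<^bsub>K\<^esub>"])
  have "a \<in> L.V" "b \<in> L.V" "L.Q a \<in> carrier R" "L.Q b \<in> carrier R"
    using a b by (simp_all add: L.anis_iff)
  then show "F.hd.L.qprod ([F.LL.vm a] @ [F.LL.vm b]) = \<one>\<^bsub>K\<^esub> \<otimes>\<^bsub>K\<^esub> \<one>\<^bsub>K\<^esub> \<otimes>\<^bsub>K\<^esub> \<phi> (L.Q a \<otimes> L.Q b)"
    by (simp add: F.LL.qform_vm)
qed simp_all

text \<open>A transvection has trivial spinor norm, and $\psi_0$ is the product of reflections in vectors of
norms $-1$ and $1$.\<close>

lemma psi_even_spin: assumes b: "b \<in> V" shows "psi R n G b \<in> even_spin (\<ominus> \<one>)"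
proof -
  have "\<tau> \<otimes>\<^bsub>L.M\<^esub> L.refl (e_sub_f (\<ominus> \<one>)) \<in> even_spin (L.Q (e_sub_f \<one>) \<otimes> L.Q (e_sub_f (\<ominus> \<one>)))"
    by (rule refl_refl_even_spin) simp_all
  then have "\<tau> \<otimes>\<^bsub>L.M\<^esub> L.refl (e_sub_f (\<ominus> \<one>)) \<in> even_spin (\<ominus> \<one>)" by simp
  then have "eichler_e (neg b) \<otimes>\<^bsub>L.M\<^esub> (\<tau> \<otimes>\<^bsub>L.M\<^esub> L.refl (e_sub_f (\<ominus> \<one>))) \<in> even_spin (\<one> \<otimes> (\<ominus> \<one>))"
    using b by (intro even_spin_mult eichler_e_even_spin) simp_all
  then show ?thesis using b by (simp add: psi_eq)
qed

lemma psi_conjs_even_spin: assumes "g \<in> psi_conjs R n G" shows "g \<in> even_spin (\<ominus> \<one>)"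
proof -
  obtain b a where ba: "b \<in> V" "a \<in> L.V" "L.Q a = \<one> \<or> L.Q a = \<ominus> \<one>"
    and g: "g = psi_conj R n G b a" using assms by (auto simp: psi_conjs_def)
  have an: "a \<in> L.anis" using ba by (intro unit_norm_one)
  obtain vs r where p: "spin (psi R n G b) vs" "even (length vs)" "r \<in> Units K"
    "F.hd.L.qprod vs = r \<otimes>\<^bsub>K\<^esub> r \<otimes>\<^bsub>K\<^esub> \<phi> (\<ominus> \<one>)" using psi_even_spin[OF ba(1)] by (rule even_spin_E)
  have rc: "r \<in> carrier K" using p by (simp add: F.dst.Units_closed)
  have QQ: "\<phi> (L.Q a) \<otimes>\<^bsub>K\<^esub> \<phi> (L.Q a) = \<one>\<^bsub>K\<^esub>"
  proof -
    have "L.Q a \<otimes> L.Q a = \<one>" using ba(3) by (auto simp: l_minus r_minus)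
    then show ?thesis using ba(2) by (simp flip: F.h.hom_mult)
  qed
  have "spin g (([F.LL.vm a] @ vs) @ [F.LL.vm a])"
    unfolding g psi_conj_eq by (intro spin_mult spin_refl an p)
  then show ?thesis
  proof (rule even_spin_I[OF _ _ p(3)])
    have s: "set vs \<subseteq> F.hd.L.anis" "F.LL.vm a \<in> F.hd.L.anis" using p an by (auto simp: spin_def F.LL.vm_anis)
    have "F.hd.L.qprod (([F.LL.vm a] @ vs) @ [F.LL.vm a]) =
        (\<phi> (L.Q a) \<otimes>\<^bsub>K\<^esub> F.hd.L.qprod vs) \<otimes>\<^bsub>K\<^esub> \<phi> (L.Q a)"
      using s ba by (subst F.hd.L.qprod_append) (simp_all add: F.LL.qform_vm)
    also have "\<dots> = (\<phi> (L.Q a) \<otimes>\<^bsub>K\<^esub> \<phi> (L.Q a)) \<otimes>\<^bsub>K\<^esub> (r \<otimes>\<^bsub>K\<^esub> r \<otimes>\<^bsub>K\<^esub> \<phi> (\<ominus> \<one>))"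
      unfolding p(4) using rc ba by (simp add: F.dst.m_ac del: F.h.hom_a_inv)
    also have "\<dots> = r \<otimes>\<^bsub>K\<^esub> r \<otimes>\<^bsub>K\<^esub> \<phi> (\<ominus> \<one>)"
      unfolding QQ using rc by simp
    finally show "F.hd.L.qprod (([F.LL.vm a] @ vs) @ [F.LL.vm a]) = r \<otimes>\<^bsub>K\<^esub> r \<otimes>\<^bsub>K\<^esub> \<phi> (\<ominus> \<one>)" .
  qed (use p in simp)
qed

lemma W_pm_even_spin: "W_pm R n G \<subseteq> even_spin \<one>"
proof -
  have r: "refl_group_pm R (n + 2) (hyp_gram R G) \<subseteq> even_spin \<one>"
    unfolding refl_group_pm_def
  proof (rule group.generate_subgroup_incl[OF L_group _ even_spin_subgroup], safe)
    fix a b assume "a \<in> L.V" "b \<in> L.V" "L.Q a = \<one>" "L.Q b = \<one>"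
    then show "L.refl a \<otimes>\<^bsub>L.M\<^esub> L.refl b \<in> even_spin \<one>"
      using refl_refl_even_spin[of a b] by (simp add: unit_norm_one)
  next
    fix a b assume "a \<in> L.V" "b \<in> L.V" "L.Q a = \<ominus> \<one>" "L.Q b = \<ominus> \<one>"
    then show "L.refl a \<otimes>\<^bsub>L.M\<^esub> L.refl b \<in> even_spin \<one>"
      using refl_refl_even_spin[of a b] by (simp add: unit_norm_one l_minus)
  qed
  have "prod_of L.M xs \<in> even_spin (if even (length xs) then \<one> else \<ominus> \<one>)"
    if "set xs \<subseteq> psi_conjs R n G" for xs
    using that
  proof (induction xs)
    case Nil
    then show ?case by (simp add: even_spin_one)
  next
    case (Cons x xs)
    then have "x \<otimes>\<^bsub>L.M\<^esub> prod_of L.M xs \<in> even_spin (\<ominus> \<one> \<otimes> (if even (length xs) then \<one> else \<ominus> \<one>))"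
      by (intro even_spin_mult psi_conjs_even_spin) simp_all
    also have "\<ominus> \<one> \<otimes> (if even (length xs) then \<one> else \<ominus> \<one>) = (if even (length (x # xs)) then \<one> else \<ominus> \<one>)"
      by (simp add: l_minus)
    finally show ?case by simp
  qed
  then have "even_products L.M (psi_conjs R n G) \<subseteq> even_spin \<one>"
    unfolding even_products_def by fastforce
  with r show ?thesis
    unfolding W_pm_def Let_def
    by (intro group.generate_subgroup_incl[OF L_group _ even_spin_subgroup]) blast
qed

lemma spin_det:
  assumes "spin g vs"
  shows "det_endo R (n + 2) g = (if even (length vs) then \<one> else \<ominus> \<one>)"
proof -
  note s = assms[unfolded spin_def]
  have "\<phi> (det_endo R (n + 2) g) = det_endo K (n + 2) (F.LL.bc g)"
    using s by (intro F.LL.det_bc L.orthD(2)) simp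
  also have "\<dots> = \<phi> (if even (length vs) then \<one> else \<ominus> \<one>)"
    using s by (simp add: F.hd.L.det_refls)
  finally show ?thesis
    using s by (subst (asm) fd.to_frac_eq_iff) (auto intro: L.det_endo_closed L.orthD(2))
qed

lemma one_not_minus_one: "\<one> \<noteq> \<ominus> \<one>"
proof
  assume "\<one> = \<ominus> \<one>"
  then have "\<one> \<oplus> \<one> = \<one> \<oplus> \<ominus> \<one>" by simp
  then have "\<one> \<oplus> \<one> = \<zero>" by (simp add: r_neg)
  then show False using two_torsion_free[of \<one>] by simp
qed

lemma even_spin_dagger: assumes "g \<in> even_spin \<one>"
  shows "g \<in> special_orth R (n + 2) (hyp_gram R G)" "g \<in> orth_dagger R (n + 2) (hyp_gram R G)"
proof -
  obtain vs r where g: "spin g vs" "even (length vs)" "r \<in> Units K"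
    "F.hd.L.qprod vs = r \<otimes>\<^bsub>K\<^esub> r \<otimes>\<^bsub>K\<^esub> \<phi> \<one>" using assms by (rule even_spin_E)
  have o: "g \<in> L.Og" using g by (simp add: spin_def)
  show "g \<in> special_orth R (n + 2) (hyp_gram R G)"
    using o g(2) spin_det[OF g(1)] by (simp add: special_orth_def)
  have U: "F.hd.L.qprod vs \<in> Units K" using g by (intro F.hd.L.qprod_Units) (simp add: spin_def)
  have "square_class K (F.hd.L.qprod vs) = square_class K \<one>\<^bsub>K\<^esub>"
    using g by (subst square_class_eq_iff[OF U]) auto
  then show "g \<in> orth_dagger R (n + 2) (hyp_gram R G)"
    using o spinor_norm_eq[OF g(1)] by (simp add: orth_dagger_def)
qed

lemma W_pm_dagger: "W_pm R n G \<subseteq> discr_special_orth_dagger R (n + 2) (hyp_gram R G)"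
  using W_pm_even_spin even_spin_dagger W_pm_subset_W_group W_group_discr
  unfolding discr_special_orth_dagger_def by blast

end

section \<open>Lattices over a valuation ring\<close>

locale local_lattice = disc_lattice R n G d X for R :: "'a ring" (structure) and n G d X +
  assumes divides_total: "a \<in> carrier R \<Longrightarrow> b \<in> carrier R \<Longrightarrow>
    \<exists>t\<in>carrier R. a = b \<otimes> t \<or> b = a \<otimes> t"

sublocale local_lattice \<subseteq> hyp_frac R n G
  by unfold_locales

context local_lattice
begin

lemma vm_inj: "x \<in> L.V \<Longrightarrow> y \<in> L.V \<Longrightarrow> F.LL.vm x = F.LL.vm y \<Longrightarrow> x = y"
proof (rule L.vec_ext)
  fix i assume xy: "x \<in> L.V" "y \<in> L.V" "F.LL.vm x = F.LL.vm y" "i < n + 2"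
  then have "\<phi> (x i) = \<phi> (y i)" by (metis F.LL.vm_comp)
  then show "x i = y i" using xy by (simp add: fd.to_frac_eq_iff)
qed

text \<open>The vector $d^{-1} X_k$ lies in the dual lattice. Its displacement under an isometry that acts
trivially on the discriminant group is integral, and multiplication by $d$ gives the claim.\<close>

lemma discr_fix_dual_mod: "D \<subseteq> fix_dual_mod"
proof
  fix g assume g: "g \<in> D"
  then have o: "g \<in> L.Og" by (simp add: discr_iff)
  note bo = F.LL.bc_orth[OF o]
  have dU: "\<phi> d \<in> Units K"
    using d_nonzero fd.to_frac_eq_iff[of d \<zero>] by (simp add: K_Units fd.to_frac_zero)
  then have di [simp]: "inv\<^bsub>K\<^esub> (\<phi> d) \<in> carrier K" by simp
  show "g \<in> fix_dual_mod"
    unfolding fix_dual_mod_def mem_Collect_eq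
  proof (intro conjI allI impI o)
    fix k assume k: "k < n"
    have XV: "Xh k \<in> L.V" using k by simp
    define x where "x = F.hd.L.vsmult (inv\<^bsub>K\<^esub> (\<phi> d)) (F.LL.vm (Xh k))"
    have xV: "x \<in> VK" using XV by (simp add: x_def)
    have "x \<in> dual"
      unfolding dual_iff
    proof (intro conjI ballI xV)
      fix y assume y: "y \<in> L.V"
      then obtain r s z where [simp]: "r \<in> carrier R" "s \<in> carrier R" "z \<in> V" and yh: "y = hv r s z"
        by (metis hv_cases)
      have "F.hd.L.B x (F.LL.vm y) = inv\<^bsub>K\<^esub> (\<phi> d) \<otimes>\<^bsub>K\<^esub> \<phi> (L.B (Xh k) y)"
        unfolding x_def using XV y by (simp add: F.LL.bform_vm)
      also have "L.B (Xh k) y = d \<otimes> z k" using k by (simp add: yh)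
      also have "inv\<^bsub>K\<^esub> (\<phi> d) \<otimes>\<^bsub>K\<^esub> \<phi> (d \<otimes> z k) = \<phi> (z k)"
        using k dU by (simp add: F.dst.m_assoc[symmetric])
      finally show "F.hd.L.B x (F.LL.vm y) \<in> \<phi> ` carrier R" using k by simp
    qed
    then obtain y where y: "y \<in> L.V" "F.LL.bc g x = F.hd.L.vadd x (F.LL.vm y)"
      using g by (auto simp: discr_iff)
    have dx: "F.hd.L.vsmult (\<phi> d) x = F.LL.vm (Xh k)"
    proof (rule F.hd.L.vec_ext)
      fix i assume i: "i < n + 2"
      then show "F.hd.L.vsmult (\<phi> d) x i = F.LL.vm (Xh k) i"
        using XV dU L.vec_comp_closed[OF XV i] by (simp add: x_def F.dst.m_assoc[symmetric])
    qed (use xV XV in simp_all)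
    have "F.LL.vm (g (Xh k)) = F.LL.bc g (F.LL.vm (Xh k))"
      using F.LL.bc_vm[OF L.orthD(2)[OF o] XV] by simp
    also have "\<dots> = F.hd.L.vsmult (\<phi> d) (F.LL.bc g x)"
      unfolding dx[symmetric] using xV by (intro F.hd.L.orthD(5)[OF bo]) simp_all
    also have "\<dots> = F.hd.L.vadd (F.hd.L.vsmult (\<phi> d) x) (F.hd.L.vsmult (\<phi> d) (F.LL.vm y))"
      unfolding y(2) using xV y(1) by (intro F.hd.L.vec_ext) (simp_all add: F.dst.r_distr)
    also have "\<dots> = F.LL.vm (L.vadd (Xh k) (L.vsmult d y))"
      unfolding dx using XV y(1) by (simp only: F.LL.vm_add F.LL.vm_smult L.vsmult_closed d_closed)
    finally have "g (Xh k) = L.vadd (Xh k) (L.vsmult d y)"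
      using XV y(1) L.orthD(3)[OF o XV] by (intro vm_inj) (simp_all del: hv_add hv_smult)
    then show "\<exists>y\<in>L.V. g (Xh k) = L.vadd (Xh k) (L.vsmult d y)" using y(1) by blast
  qed
qed

theorem W_group_eq: "W_group R n G = discr_orth R (n + 2) (hyp_gram R G)"
  using W_group_discr discr_fix_dual_mod fix_dual_mod_subset_W_group by blast

text \<open>If $u = (a/b)^2$, then one of $a$, $b$ divides the other, and the quotient is a unit whose square is
$u$ or $u^{-1}$.\<close>

lemma unit_square:
  assumes u: "u \<in> Units R" and r: "r \<in> Units K" and eq: "\<phi> u = r \<otimes>\<^bsub>K\<^esub> r"
  shows "\<exists>t\<in>Units R. u = t \<otimes> t"
proof -
  have [simp]: "u \<in> carrier R" using u by (rule Units_closed)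
  obtain a b where ab: "a \<in> carrier R" "b \<in> carrier R - {\<zero>}" "r = Defs.frac R a b"
    using F.dst.Units_closed[OF r] by (rule fd.K_cases)
  have b: "b \<in> carrier R" "b \<noteq> \<zero>" using ab by auto
  have "to_frac R u = Defs.frac R (a \<otimes> a) (b \<otimes> b)"
    using eq ab b by simp
  then have ub: "u \<otimes> (b \<otimes> b) = a \<otimes> a"
    unfolding to_frac_def using ab b by (subst (asm) fd.frac_eq_iff) simp_all
  have a0: "a \<noteq> \<zero>"
  proof
    assume "a = \<zero>"
    then have "r = \<zero>\<^bsub>K\<^esub>" using ab fd.frac_zero_iff[of a b] by simp
    then show False using r by (simp add: K_Units)
  qed
  obtain t where t: "t \<in> carrier R" "a = b \<otimes> t \<or> b = a \<otimes> t" using divides_total[OF ab(1) b(1)] by blast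
  from t(2) show ?thesis
  proof
    assume at: "a = b \<otimes> t"
    have "(b \<otimes> b) \<otimes> u = (b \<otimes> b) \<otimes> (t \<otimes> t)"
      using ub t b unfolding at by (simp add: m_ac)
    then have "u = t \<otimes> t" using b t by (subst (asm) m_lcancel) simp_all
    then show ?thesis using u t unit_left_factor[of t t] by auto
  next
    assume bt: "b = a \<otimes> t"
    have "(a \<otimes> a) \<otimes> (u \<otimes> (t \<otimes> t)) = (a \<otimes> a) \<otimes> \<one>"
      using ub t ab(1) unfolding bt by (simp add: m_ac)
    then have ut: "u \<otimes> (t \<otimes> t) = \<one>" using a0 ab(1) t by (subst (asm) m_lcancel) simp_all
    then have "t \<otimes> (t \<otimes> u) \<in> Units R" using t by (simp add: m_ac)
    then have tU: "t \<in> Units R" using t unit_left_factor[of t "t \<otimes> u"] by simp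
    have "u = u \<otimes> (t \<otimes> t) \<otimes> (inv t \<otimes> inv t)"
      using tU t by (simp add: m_assoc) (simp add: m_assoc[symmetric])
    then have "u = inv t \<otimes> inv t" unfolding ut using tU by simp
    then show ?thesis using tU by (intro bexI[of _ "inv t"]) simp_all
  qed
qed

text \<open>In the decomposition \<open>fix_dual_mod_decompose\<close> the transvections have trivial spinor norm and
determinant one. Hence the determinant of $g$ excludes the reflection, and its spinor norm is the
class of $u$ in the field of fractions.\<close>

lemma dagger_decompose:
  assumes "g \<in> discr_special_orth_dagger R (n + 2) (hyp_gram R G)"
  shows "\<exists>w\<in>eichler_group. \<exists>t\<in>Units R. g = w \<otimes>\<^bsub>L.M\<^esub> hyp_scale (t \<otimes> t)"
proof -
  have g: "g \<in> D" "det_endo R (n + 2) g = \<one>"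
    "spinor_norm R (n + 2) (hyp_gram R G) g = square_class K \<one>\<^bsub>K\<^esub>"
    using assms by (simp_all add: discr_special_orth_dagger_def special_orth_def orth_dagger_def)
  obtain w u where w: "w \<in> eichler_group" and u: "u \<in> Units R"
    and cases: "g = w \<otimes>\<^bsub>L.M\<^esub> hyp_scale u \<or> g = w \<otimes>\<^bsub>L.M\<^esub> L.refl (e_sub_f u)"
    using fix_dual_mod_decompose discr_fix_dual_mod g(1) by blast
  have [simp]: "u \<in> carrier R" using u by (rule Units_closed)
  have "w \<in> even_spin \<one>" using w eichler_group_W_pm W_pm_even_spin by blast
  then obtain vs r where sw: "spin w vs" "even (length vs)" "r \<in> Units K"
    "F.hd.L.qprod vs = r \<otimes>\<^bsub>K\<^esub> r \<otimes>\<^bsub>K\<^esub> \<phi> \<one>" by (rule even_spin_E)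
  have rc [simp]: "r \<in> carrier K" "inv\<^bsub>K\<^esub> r \<in> carrier K" using sw by (simp_all add: F.dst.Units_closed)
  show ?thesis
  proof (cases "g = w \<otimes>\<^bsub>L.M\<^esub> hyp_scale u")
    case False
    then have "spin g (vs @ [F.LL.vm (e_sub_f u)])"
      using cases spin_mult[OF sw(1) spin_refl[OF e_sub_f_anis[OF u]]] by simp
    from spin_det[OF this] show ?thesis using sw(2) g(2) one_not_minus_one by simp
  next
    case True
    have "spin (hyp_scale u) ([F.LL.vm (e_sub_f \<one>)] @ [F.LL.vm (e_sub_f u)])"
      unfolding hyp_scale_eq[OF u] using u by (intro spin_mult spin_refl) simp_all
    from spin_mult[OF sw(1) this]
    have sg: "spin g (vs @ [F.LL.vm (e_sub_f \<one>)] @ [F.LL.vm (e_sub_f u)])" unfolding True .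
    have s: "set vs \<subseteq> F.hd.L.anis" "set ([F.LL.vm (e_sub_f \<one>)] @ [F.LL.vm (e_sub_f u)]) \<subseteq> F.hd.L.anis"
      using sw(1) u by (simp_all add: spin_def F.LL.vm_anis)
    have "F.hd.L.qprod (vs @ [F.LL.vm (e_sub_f \<one>)] @ [F.LL.vm (e_sub_f u)]) =
        F.hd.L.qprod vs \<otimes>\<^bsub>K\<^esub> F.hd.L.qprod ([F.LL.vm (e_sub_f \<one>)] @ [F.LL.vm (e_sub_f u)])"
      by (rule F.hd.L.qprod_append[OF s])
    also have "\<dots> = r \<otimes>\<^bsub>K\<^esub> r \<otimes>\<^bsub>K\<^esub> \<phi> u"
      unfolding sw(4) by (simp add: F.LL.qform_vm, intro F.dst.ring_eqI) (simp_all add: F.dst.emb_rules)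
    finally have q: "F.hd.L.qprod (vs @ [F.LL.vm (e_sub_f \<one>)] @ [F.LL.vm (e_sub_f u)]) = r \<otimes>\<^bsub>K\<^esub> r \<otimes>\<^bsub>K\<^esub> \<phi> u" .
    have U: "r \<otimes>\<^bsub>K\<^esub> r \<otimes>\<^bsub>K\<^esub> \<phi> u \<in> Units K"
      using sw u F.LL.unit_image[OF u] by simp
    have "square_class K (r \<otimes>\<^bsub>K\<^esub> r \<otimes>\<^bsub>K\<^esub> \<phi> u) = square_class K \<one>\<^bsub>K\<^esub>"
      using spinor_norm_eq[OF sg] g(3) unfolding q by simp
    then obtain s where s: "s \<in> Units K" "r \<otimes>\<^bsub>K\<^esub> r \<otimes>\<^bsub>K\<^esub> \<phi> u = s \<otimes>\<^bsub>K\<^esub> s \<otimes>\<^bsub>K\<^esub> \<one>\<^bsub>K\<^esub>"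
      by (subst (asm) square_class_eq_iff[OF U]) auto
    have sc [simp]: "s \<in> carrier K" using s by (simp add: F.dst.Units_closed)
    have ir: "inv\<^bsub>K\<^esub> r \<otimes>\<^bsub>K\<^esub> r = \<one>\<^bsub>K\<^esub>" using sw by simp
    have "\<phi> u = (inv\<^bsub>K\<^esub> r \<otimes>\<^bsub>K\<^esub> r) \<otimes>\<^bsub>K\<^esub> (inv\<^bsub>K\<^esub> r \<otimes>\<^bsub>K\<^esub> r) \<otimes>\<^bsub>K\<^esub> \<phi> u"
      unfolding ir by simp
    also have "\<dots> = (inv\<^bsub>K\<^esub> r \<otimes>\<^bsub>K\<^esub> inv\<^bsub>K\<^esub> r) \<otimes>\<^bsub>K\<^esub> (r \<otimes>\<^bsub>K\<^esub> r \<otimes>\<^bsub>K\<^esub> \<phi> u)"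
      by (simp add: F.dst.m_ac)
    also have "\<dots> = (s \<otimes>\<^bsub>K\<^esub> inv\<^bsub>K\<^esub> r) \<otimes>\<^bsub>K\<^esub> (s \<otimes>\<^bsub>K\<^esub> inv\<^bsub>K\<^esub> r)"
      unfolding s(2) by (simp add: F.dst.m_ac)
    finally obtain t where "t \<in> Units R" "u = t \<otimes> t"
      using unit_square[OF u, of "s \<otimes>\<^bsub>K\<^esub> inv\<^bsub>K\<^esub> r"] s sw by auto
    then show ?thesis using w True by blast
  qed
qed

theorem W_pm_eq: "W_pm R n G = discr_special_orth_dagger R (n + 2) (hyp_gram R G)"
proof (intro equalityI W_pm_dagger subsetI)
  fix g assume "g \<in> discr_special_orth_dagger R (n + 2) (hyp_gram R G)"
  then obtain w t where "w \<in> eichler_group" "t \<in> Units R" "g = w \<otimes>\<^bsub>L.M\<^esub> hyp_scale (t \<otimes> t)"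
    using dagger_decompose by blast
  then show "g \<in> W_pm R n G"
    using eichler_group_W_pm hyp_scale_square_W_pm subgroup.m_closed[OF W_pm_subgroup] by blast
qed

lemma W_pm_decompose: "g \<in> W_pm R n G \<Longrightarrow> \<exists>w\<in>eichler_group. \<exists>t\<in>Units R. g = w \<otimes>\<^bsub>L.M\<^esub> hyp_scale (t \<otimes> t)"
  using dagger_decompose W_pm_eq by blast

end

context quadratic_lattice
begin

section \<open>Congruences between vectors\<close>

definition vcong :: "'a \<Rightarrow> (nat \<Rightarrow> 'a) \<Rightarrow> (nat \<Rightarrow> 'a) \<Rightarrow> bool" where
  "vcong P x y \<longleftrightarrow> x \<in> V \<and> y \<in> V \<and> (\<exists>z\<in>V. x = y \<boxplus> P \<boxdot> z)"

lemma vcongI: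
  assumes "x \<in> V" "y \<in> V" "\<And>i. i < N \<Longrightarrow> \<exists>c\<in>carrier R. x i = y i \<oplus> P \<otimes> c" "P \<in> carrier R"
  shows "vcong P x y"
proof -
  obtain c where c: "\<And>i. i < N \<Longrightarrow> c i \<in> carrier R \<and> x i = y i \<oplus> P \<otimes> c i"
    using assms(3) by metis
  have z: "(\<lambda>i\<in>{..<N}. c i) \<in> V" using c by (intro restrict_vec) simp
  have "x = y \<boxplus> P \<boxdot> (\<lambda>i\<in>{..<N}. c i)"
    by (rule vec_ext) (use assms z c in auto)
  then show ?thesis unfolding vcong_def using assms(1,2) z by blast
qed

lemma vcong_closed: "vcong P x y \<Longrightarrow> x \<in> V" "vcong P x y \<Longrightarrow> y \<in> V"
  by (auto simp: vcong_def)

lemma vcong_refl: "x \<in> V \<Longrightarrow> P \<in> carrier R \<Longrightarrow> vcong P x x"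
  by (intro vcongI bexI[of _ \<zero>]) simp_all

lemma vcong_sym: assumes "vcong P x y" "P \<in> carrier R" shows "vcong P y x"
proof -
  obtain z where z: "x \<in> V" "y \<in> V" "z \<in> V" "x = y \<boxplus> P \<boxdot> z" using assms by (auto simp: vcong_def)
  show ?thesis
  proof (rule vcongI)
    fix i assume i: "i < N"
    have "y i = y i \<oplus> P \<otimes> z i \<oplus> P \<otimes> (\<ominus> (z i))"
      using z i assms(2) by (intro ring_eqI) (simp_all add: emb_rules)
    then show "\<exists>c\<in>carrier R. y i = x i \<oplus> P \<otimes> c"
      using z i by (intro bexI[of _ "\<ominus> (z i)"]) simp_all
  qed (use z assms in auto)
qed

lemma vcong_trans: assumes "vcong P x y" "vcong P y z" "P \<in> carrier R" shows "vcong P x z"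
proof -
  obtain v where v: "x \<in> V" "y \<in> V" "v \<in> V" "x = y \<boxplus> P \<boxdot> v" using assms by (auto simp: vcong_def)
  obtain w where w: "z \<in> V" "w \<in> V" "y = z \<boxplus> P \<boxdot> w" using assms by (auto simp: vcong_def)
  have "x = z \<boxplus> P \<boxdot> (v \<boxplus> w)"
    unfolding v(4) w(3)
    by (rule vec_ext; (rule ring_eqI)?) (use v(3) w assms(3) in \<open>simp_all add: emb_rules algebra_simps\<close>)
  then show ?thesis unfolding vcong_def using v w by (intro conjI bexI[of _ "v \<boxplus> w"]) auto
qed

lemma vcong_lin: assumes g: "lin g" and xy: "vcong P x y" and P: "P \<in> carrier R"
  shows "vcong P (g x) (g y)"
proof -
  obtain z where z: "x \<in> V" "y \<in> V" "z \<in> V" "x = y \<boxplus> P \<boxdot> z" using xy by (auto simp: vcong_def)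
  have "g x = g y \<boxplus> P \<boxdot> g z" unfolding z(4) using g z P by (simp add: lin_def)
  moreover have "g x \<in> V" "g y \<in> V" "g z \<in> V" using lin_closed[OF g] z by blast+
  ultimately show ?thesis unfolding vcong_def by blast
qed

lemma vcong_factor: assumes "vcong (P \<otimes> P') x y" "P \<in> carrier R" "P' \<in> carrier R" shows "vcong P x y"
proof -
  obtain z where z: "x \<in> V" "y \<in> V" "z \<in> V" "x = y \<boxplus> (P \<otimes> P') \<boxdot> z" using assms by (auto simp: vcong_def)
  have "x = y \<boxplus> P \<boxdot> (P' \<boxdot> z)"
    unfolding z(4) by (rule vec_ext) (use z(2,3) assms(2,3) in \<open>simp_all add: m_assoc\<close>)
  then show ?thesis unfolding vcong_def using z assms by (intro conjI bexI[of _ "P' \<boxdot> z"]) auto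
qed

lemma vcong_mult:
  assumes "g \<in> Og" "h \<in> Og" "P \<in> carrier R" "x \<in> V"
    and "vcong P (h x) y" "vcong P (g y) z"
  shows "vcong P ((g \<otimes>\<^bsub>M\<^esub> h) x) z"
  using vcong_trans[OF vcong_lin[OF orthD(2)[OF assms(1)] assms(5,3)] assms(6,3)] assms(1,2,4)
  by (simp add: mult_M orthD(1))

end

context hyp_lattice
begin

lemma hv_vcong:
  assumes "r \<in> carrier R" "s \<in> carrier R" "vcong P z z'" "P \<in> carrier R"
    "r' \<in> carrier R" "s' \<in> carrier R"
    "\<exists>c\<in>carrier R. r = r' \<oplus> P \<otimes> c" "\<exists>c\<in>carrier R. s = s' \<oplus> P \<otimes> c"
  shows "L.vcong P (hv r s z) (hv r' s' z')"
proof -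
  obtain v where v: "z \<in> V" "z' \<in> V" "v \<in> V" "z = z' \<boxplus> P \<boxdot> v" using assms by (auto simp: vcong_def)
  obtain c c' where c: "c \<in> carrier R" "r = r' \<oplus> P \<otimes> c" "c' \<in> carrier R" "s = s' \<oplus> P \<otimes> c'"
    using assms by blast
  have "hv r s z = L.vadd (hv r' s' z') (L.vsmult P (hv c c' v))"
    unfolding v(4) c(2,4) using v(1-3) c(1,3) assms by simp
  then show ?thesis unfolding L.vcong_def using v(1-3) c(1,3) assms by (intro conjI bexI[of _ "hv c c' v"]) auto
qed

lemma eichler_e_vcong:
  assumes b: "vcong P b b'" and y: "y \<in> L.V" and P [simp]: "P \<in> carrier R"
  shows "L.vcong P (eichler_e b y) (eichler_e b' y)"
proof -
  obtain c where c [simp]: "b' \<in> V" "c \<in> V" and bc: "b = b' \<boxplus> P \<boxdot> c" using b by (auto simp: vcong_def)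
  have bV [simp]: "b \<in> V" by (rule vcong_closed[OF b])
  obtain r s z where [simp]: "r \<in> carrier R" "s \<in> carrier R" "z \<in> V" and yh: "y = hv r s z"
    using hv_cases[OF y] by metis
  have "L.vcong P (hv (r \<ominus> B z b \<ominus> Q b \<otimes> s) s (z \<boxplus> s \<boxdot> b)) (hv (r \<ominus> B z b' \<ominus> Q b' \<otimes> s) s (z \<boxplus> s \<boxdot> b'))"
  proof (rule hv_vcong)
    have "r \<ominus> B z b \<ominus> Q b \<otimes> s = (r \<ominus> B z b' \<ominus> Q b' \<otimes> s) \<oplus>
        P \<otimes> (\<ominus> (B z c) \<ominus> (P \<otimes> Q c \<oplus> B b' c) \<otimes> s)"
      unfolding bc by (rule ring_eqI) (simp_all add: qform_add qform_smult emb_rules algebra_simps)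
    then show "\<exists>e\<in>carrier R. r \<ominus> B z b \<ominus> Q b \<otimes> s = (r \<ominus> B z b' \<ominus> Q b' \<otimes> s) \<oplus> P \<otimes> e"
      by (intro bexI[of _ "\<ominus> (B z c) \<ominus> (P \<otimes> Q c \<oplus> B b' c) \<otimes> s"]) simp_all
    show "\<exists>c\<in>carrier R. s = s \<oplus> P \<otimes> c" by (intro bexI[of _ \<zero>]) simp_all
    have "z \<boxplus> s \<boxdot> b = (z \<boxplus> s \<boxdot> b') \<boxplus> P \<boxdot> (s \<boxdot> c)"
      unfolding bc by (rule vec_ext; (rule ring_eqI)?) (simp_all add: emb_rules algebra_simps)
    then show "vcong P (z \<boxplus> s \<boxdot> b) (z \<boxplus> s \<boxdot> b')"
      unfolding vcong_def by (intro conjI bexI[of _ "s \<boxdot> c"]) simp_all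
  qed simp_all
  then show ?thesis by (simp add: yh)
qed

lemma eichler_f_vcong:
  assumes b: "vcong P b b'" and y: "y \<in> L.V" and P [simp]: "P \<in> carrier R"
  shows "L.vcong P (eichler_f b y) (eichler_f b' y)"
proof -
  note bV = vcong_closed[OF b]
  have t: "\<tau> y \<in> L.V" using y by (simp add: L.orthD(3))
  have "L.vcong P (\<tau> (eichler_e b (\<tau> y))) (\<tau> (eichler_e b' (\<tau> y)))"
    by (rule L.vcong_lin[OF L.orthD(2)[OF \<tau>_orth] eichler_e_vcong[OF b t P] P])
  then show ?thesis using y bV by (simp add: eichler_e_conj_\<tau>)
qed

lemma eichler_e_zero: "y \<in> L.V \<Longrightarrow> eichler_e vzero y = y"
  by (elim hv_cases) (simp add: a_minus_def bform_sym[of _ vzero], intro arg_cong3[of _ _ _ _ _ _ hv] refl vec_ext, simp_all)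

lemma eichler_f_zero: assumes "y \<in> L.V" shows "eichler_f vzero y = y"
proof -
  have "eichler_f vzero y = \<tau> (eichler_e vzero (\<tau> y))" using assms by (simp add: eichler_e_conj_\<tau>)
  also have "\<dots> = y" using assms L.refl_refl[of "e_sub_f \<one>" y] by (simp add: eichler_e_zero L.orthD(3))
  finally show ?thesis .
qed

text \<open>The vector $a = le + \beta f + mz$ has norm one and is congruent to $le + \beta f$. Modulo $m$, where
$l\beta \equiv 1$, its reflection sends $re + sf$ to $-l^2 s e - \beta^2 r f$; the reflection in
$e + f$ sends it to $-se - rf$. The product is the rescaling by $l^2$.\<close>

lemma hyp_scale_square_approx:
  assumes [simp]: "l \<in> carrier R" "\<beta> \<in> carrier R" "m \<in> carrier R" "z \<in> V"
    and eq: "l \<otimes> \<beta> \<oplus> m \<otimes> (m \<otimes> Q z) = \<one>"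
  shows "\<exists>w\<in>W_pm R n G. \<forall>r\<in>carrier R. \<forall>s\<in>carrier R. \<forall>y\<in>V.
    L.vcong m (w (hv r s y)) (hv (l \<otimes> l \<otimes> r) (\<beta> \<otimes> \<beta> \<otimes> s) y)"
proof -
  define a where "a = hv l \<beta> (m \<boxdot> z)"
  define b where "b = e_sub_f (\<ominus> \<one>)"
  have Qa: "L.Q a = \<one>" unfolding a_def eq[symmetric] by (simp add: qform_smult m_assoc)
  have Qb: "L.Q b = \<one>" by (simp add: b_def)
  have ab [simp]: "a \<in> L.V" "b \<in> L.V" by (simp_all add: a_def b_def)
  have an: "a \<in> L.anis" "b \<in> L.anis" using Qa Qb by (auto intro!: unit_norm_one)
  let ?w = "L.refl a \<otimes>\<^bsub>L.M\<^esub> L.refl b"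
  have "?w \<in> W_pm R n G" using Qa Qb by (intro refl_refl_W_pm) simp_all
  moreover have "L.vcong m (?w (hv r s y)) (hv (l \<otimes> l \<otimes> r) (\<beta> \<otimes> \<beta> \<otimes> s) y)"
    if [simp]: "r \<in> carrier R" "s \<in> carrier R" "y \<in> V" for r s y
  proof -
    define k where "k = (\<ominus> s) \<otimes> \<beta> \<oplus> (\<ominus> r) \<otimes> l \<oplus> m \<otimes> B y z"
    have [simp]: "k \<in> carrier R" by (simp add: k_def)
    have i: "inv (\<ominus> \<one>) = \<ominus> \<one>" by (simp add: inv_uminus)
    have "?w (hv r s y) = L.refl a (L.refl b (hv r s y))"
      by (intro L.mult_M) (simp_all add: an L.refl_orth Og_Bij)
    also have "L.refl b (hv r s y) = hv (\<ominus> s) (\<ominus> r) y"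
      unfolding b_def by (simp add: i l_minus)
    also have "L.refl a (hv (\<ominus> s) (\<ominus> r) y) =
        hv (\<ominus> s \<ominus> k \<otimes> l) (\<ominus> r \<ominus> k \<otimes> \<beta>) (y \<boxplus> (\<ominus> k) \<boxdot> (m \<boxdot> z))"
      using Qa an by (simp add: L.refl_eq) (simp add: a_def k_def a_minus_def l_minus)
    finally have w: "?w (hv r s y) = hv (\<ominus> s \<ominus> k \<otimes> l) (\<ominus> r \<ominus> k \<otimes> \<beta>) (y \<boxplus> (\<ominus> k) \<boxdot> (m \<boxdot> z))" .
    have e: "x = l \<otimes> \<beta> \<otimes> x \<oplus> m \<otimes> (m \<otimes> Q z) \<otimes> x" if "x \<in> carrier R" for x
      using that arg_cong[OF eq, of "\<lambda>t. t \<otimes> x"] by (simp add: l_distr)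
    show ?thesis unfolding w
    proof (rule hv_vcong)
      have "\<ominus> s \<ominus> k \<otimes> l = \<ominus> (l \<otimes> \<beta> \<otimes> s \<oplus> m \<otimes> (m \<otimes> Q z) \<otimes> s) \<ominus> k \<otimes> l"
        using e[of s] by simp
      also have "\<dots> = l \<otimes> l \<otimes> r \<oplus> m \<otimes> (\<ominus> (m \<otimes> Q z \<otimes> s) \<ominus> B y z \<otimes> l)"
        unfolding k_def by (rule ring_eqI) (simp_all add: emb_rules algebra_simps)
      finally show "\<exists>c\<in>carrier R. \<ominus> s \<ominus> k \<otimes> l = l \<otimes> l \<otimes> r \<oplus> m \<otimes> c"
        by (rule bexI) simp
      have "\<ominus> r \<ominus> k \<otimes> \<beta> = \<ominus> (l \<otimes> \<beta> \<otimes> r \<oplus> m \<otimes> (m \<otimes> Q z) \<otimes> r) \<ominus> k \<otimes> \<beta>"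
        using e[of r] by simp
      also have "\<dots> = \<beta> \<otimes> \<beta> \<otimes> s \<oplus> m \<otimes> (\<ominus> (m \<otimes> Q z \<otimes> r) \<ominus> B y z \<otimes> \<beta>)"
        unfolding k_def by (rule ring_eqI) (simp_all add: emb_rules algebra_simps)
      finally show "\<exists>c\<in>carrier R. \<ominus> r \<ominus> k \<otimes> \<beta> = \<beta> \<otimes> \<beta> \<otimes> s \<oplus> m \<otimes> c"
        by (rule bexI) simp
      show "vcong m (y \<boxplus> (\<ominus> k) \<boxdot> (m \<boxdot> z)) y"
      proof (rule vcongI)
        fix i assume i: "i < n"
        have "y i \<oplus> (\<ominus> k) \<otimes> (m \<otimes> z i) = y i \<oplus> m \<otimes> ((\<ominus> k) \<otimes> z i)"
          using i by (intro ring_eqI) (simp_all add: emb_rules)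
        then show "\<exists>c\<in>carrier R. (y \<boxplus> (\<ominus> k) \<boxdot> (m \<boxdot> z)) i = y i \<oplus> m \<otimes> c"
          using i by (intro bexI[of _ "(\<ominus> k) \<otimes> z i"]) simp_all
      qed simp_all
    qed simp_all
  qed
  ultimately show ?thesis by blast
qed

end

context lattice_hom
begin

section \<open>Approximation along base change\<close>

lemma vm_vcong:
  assumes "src.vcong c x y" and c: "c \<in> carrier R"
  shows "dst.vcong (\<iota> c) (vm x) (vm y)"
proof -
  obtain z where z: "x \<in> src.V" "y \<in> src.V" "z \<in> src.V" "x = src.vadd y (src.vsmult c z)"
    using assms by (auto simp: src.vcong_def)
  have "vm x = dst.vadd (vm y) (dst.vsmult (\<iota> c) (vm z))"
    unfolding z(4) using z(1-3) c by (simp add: vm_add vm_smult)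
  moreover have "vm x \<in> dst.V" "vm y \<in> dst.V" "vm z \<in> dst.V" using vm_closed z(1-3) by blast+
  ultimately show ?thesis unfolding dst.vcong_def by blast
qed

end

context hyp_hom
begin

text \<open>The isometry \<open>w\<close> of the lattice over \<open>R\<close> represents the isometry \<open>g\<close> of its base change modulo \<open>c\<close>. It
suffices to compare the two on vectors coming from \<open>R\<close>.\<close>

definition approx where
  "approx c g w \<longleftrightarrow> g \<in> hd.L.Og \<and> w \<in> hs.L.Og \<and>
     (\<forall>y\<in>hs.L.V. hd.L.vcong c (g (LL.vm y)) (LL.vm (w y)))"

lemma approx_mult:
  assumes g: "approx c g w" and g': "approx c g' w'" and c: "c \<in> carrier S"
  shows "approx c (g \<otimes>\<^bsub>hd.L.M\<^esub> g') (w \<otimes>\<^bsub>hs.L.M\<^esub> w')"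
  unfolding approx_def
proof (intro conjI ballI)
  have o: "g \<in> hd.L.Og" "g' \<in> hd.L.Og" "w \<in> hs.L.Og" "w' \<in> hs.L.Og"
    using assms by (auto simp: approx_def)
  then show "g \<otimes>\<^bsub>hd.L.M\<^esub> g' \<in> hd.L.Og" "w \<otimes>\<^bsub>hs.L.M\<^esub> w' \<in> hs.L.Og"
    by (auto intro: hd.L.orth_mult hs.L.orth_mult)
  fix y assume y: "y \<in> hs.L.V"
  then have y': "w' y \<in> hs.L.V" using o by (auto intro: hs.L.orthD(3))
  have "hd.L.vcong c ((g \<otimes>\<^bsub>hd.L.M\<^esub> g') (LL.vm y)) (LL.vm (w (w' y)))"
    by (rule hd.L.vcong_mult[OF o(1,2) c, of _ "LL.vm (w' y)"])
       (use g g' y y' in \<open>auto simp: approx_def\<close>)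
  then show "hd.L.vcong c ((g \<otimes>\<^bsub>hd.L.M\<^esub> g') (LL.vm y)) (LL.vm ((w \<otimes>\<^bsub>hs.L.M\<^esub> w') y))"
    using o y by (simp add: hs.L.mult_M hs.Og_Bij)
qed

lemma approx_one: "c \<in> carrier S \<Longrightarrow> approx c \<one>\<^bsub>hd.L.M\<^esub> \<one>\<^bsub>hs.L.M\<^esub>"
  unfolding approx_def
  by (simp add: hd.L.one_orth hs.L.one_orth) (simp add: hd.L.one_M hs.L.one_M hd.L.vcong_refl)

lemma approx_eichler_e:
  assumes b: "dst.vcong c b (vm b')" and b' [simp]: "b' \<in> src.V" and c: "c \<in> carrier S"
  shows "approx c (hd.eichler_e b) (hs.eichler_e b')"
  unfolding approx_def
proof (intro conjI ballI)
  show "hd.eichler_e b \<in> hd.L.Og" using dst.vcong_closed[OF b] by simp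
  fix y assume y: "y \<in> hs.L.V"
  have "hd.eichler_e (vm b') (LL.vm y) = LL.vm (hs.eichler_e b' y)"
    using LL.bc_vm[of "hs.eichler_e b'" y] y by (simp add: bc_eichler_e hs.L.orthD(2))
  then show "hd.L.vcong c (hd.eichler_e b (LL.vm y)) (LL.vm (hs.eichler_e b' y))"
    using hd.eichler_e_vcong[OF b _ c, of "LL.vm y"] y by simp
qed simp

lemma bc_eichler_f: assumes b: "b \<in> src.V" shows "LL.bc (hs.eichler_f b) = hd.eichler_f (vm b)"
proof -
  have "LL.bc hs.\<tau> = hd.\<tau>" by (simp add: LL.bc_refl vm_e_sub_f)
  then show ?thesis
    using b unfolding hs.eichler_f_eq[OF b] hd.eichler_f_eq[OF vm_closed[OF b]]
    by (simp add: LL.bc_mult hs.L.orth_mult bc_eichler_e)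
qed

lemma approx_eichler_f:
  assumes b: "dst.vcong c b (vm b')" and b' [simp]: "b' \<in> src.V" and c: "c \<in> carrier S"
  shows "approx c (hd.eichler_f b) (hs.eichler_f b')"
  unfolding approx_def
proof (intro conjI ballI)
  show "hd.eichler_f b \<in> hd.L.Og" using dst.vcong_closed[OF b] by simp
  fix y assume y: "y \<in> hs.L.V"
  have "hd.eichler_f (vm b') (LL.vm y) = LL.vm (hs.eichler_f b' y)"
    using LL.bc_vm[of "hs.eichler_f b'" y] y by (simp add: bc_eichler_f hs.L.orthD(2))
  then show "hd.L.vcong c (hd.eichler_f b (LL.vm y)) (LL.vm (hs.eichler_f b' y))"
    using hd.eichler_f_vcong[OF b _ c, of "LL.vm y"] y by simp
qed simp

text \<open>The ring \<open>R\<close> need not contain a unit close to \<open>t\<close>; elements \<open>a\<close>, \<open>b\<close> that are mutually inverse modulo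
\<open>c\<close> suffice, and then \<open>b\<close> is close to the inverse of \<open>t\<close>.\<close>

lemma approx_hyp_scale_square:
  assumes c [simp]: "c \<in> carrier R" and t: "t \<in> Units S" and [simp]: "a \<in> carrier R" "b \<in> carrier R"
    and ta: "\<exists>e\<in>carrier S. t = \<iota> a \<oplus>\<^bsub>S\<^esub> \<iota> c \<otimes>\<^bsub>S\<^esub> e"
    and ab: "\<exists>e\<in>carrier R. a \<otimes>\<^bsub>R\<^esub> b = \<one>\<^bsub>R\<^esub> \<oplus>\<^bsub>R\<^esub> c \<otimes>\<^bsub>R\<^esub> e"
    and w: "w \<in> hs.L.Og" "\<And>r s y. r \<in> carrier R \<Longrightarrow> s \<in> carrier R \<Longrightarrow> y \<in> src.V \<Longrightarrow>
      hs.L.vcong c (w (hs.hv r s y)) (hs.hv (a \<otimes>\<^bsub>R\<^esub> a \<otimes>\<^bsub>R\<^esub> r) (b \<otimes>\<^bsub>R\<^esub> b \<otimes>\<^bsub>R\<^esub> s) y)"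
  shows "approx (\<iota> c) (hd.hyp_scale (t \<otimes>\<^bsub>S\<^esub> t)) w"
  unfolding approx_def
proof (intro conjI ballI)
  have tc [simp]: "t \<in> carrier S" "inv\<^bsub>S\<^esub> t \<in> carrier S" "t \<otimes>\<^bsub>S\<^esub> t \<in> Units S"
    using t by (simp_all add: dst.Units_closed)
  have itt: "inv\<^bsub>S\<^esub> (t \<otimes>\<^bsub>S\<^esub> t) = inv\<^bsub>S\<^esub> t \<otimes>\<^bsub>S\<^esub> inv\<^bsub>S\<^esub> t"
    by (rule dst.comm_inv_char) (use t in \<open>simp_all add: dst.Units_closed\<close>,
        use t in \<open>simp add: dst.m_assoc\<close>, use t in \<open>simp add: dst.m_assoc[symmetric]\<close>)
  obtain e where e [simp]: "e \<in> carrier S" and te: "t = \<iota> a \<oplus>\<^bsub>S\<^esub> \<iota> c \<otimes>\<^bsub>S\<^esub> e" using ta by blast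
  obtain f where f [simp]: "f \<in> carrier R" and abf: "a \<otimes>\<^bsub>R\<^esub> b = \<one>\<^bsub>R\<^esub> \<oplus>\<^bsub>R\<^esub> c \<otimes>\<^bsub>R\<^esub> f" using ab by blast
  have abf': "\<iota> a \<otimes>\<^bsub>S\<^esub> \<iota> b = \<one>\<^bsub>S\<^esub> \<oplus>\<^bsub>S\<^esub> \<iota> c \<otimes>\<^bsub>S\<^esub> \<iota> f"
    using arg_cong[OF abf, of \<iota>] by simp
  define i where "i = inv\<^bsub>S\<^esub> t"
  have i [simp]: "i \<in> carrier S" and it: "i \<otimes>\<^bsub>S\<^esub> t = \<one>\<^bsub>S\<^esub>" using t by (simp_all add: i_def)
  have "i = i \<otimes>\<^bsub>S\<^esub> (\<iota> a \<otimes>\<^bsub>S\<^esub> \<iota> b \<ominus>\<^bsub>S\<^esub> \<iota> c \<otimes>\<^bsub>S\<^esub> \<iota> f)"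
    unfolding abf' by (rule dst.ring_eqI) (simp_all add: dst.emb_rules algebra_simps dst.emb_one_right)
  also have "\<dots> = (i \<otimes>\<^bsub>S\<^esub> t) \<otimes>\<^bsub>S\<^esub> \<iota> b \<ominus>\<^bsub>S\<^esub> \<iota> c \<otimes>\<^bsub>S\<^esub> (i \<otimes>\<^bsub>S\<^esub> (e \<otimes>\<^bsub>S\<^esub> \<iota> b \<oplus>\<^bsub>S\<^esub> \<iota> f))"
    unfolding te by (rule dst.ring_eqI) (simp_all add: dst.emb_rules algebra_simps)
  also have "\<dots> = \<iota> b \<oplus>\<^bsub>S\<^esub> \<iota> c \<otimes>\<^bsub>S\<^esub> (\<ominus>\<^bsub>S\<^esub> (i \<otimes>\<^bsub>S\<^esub> (e \<otimes>\<^bsub>S\<^esub> \<iota> b \<oplus>\<^bsub>S\<^esub> \<iota> f)))"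
    unfolding it by (rule dst.ring_eqI) (simp_all add: dst.emb_rules algebra_simps)
  finally have i_eq: "i = \<iota> b \<oplus>\<^bsub>S\<^esub> \<iota> c \<otimes>\<^bsub>S\<^esub> (\<ominus>\<^bsub>S\<^esub> (i \<otimes>\<^bsub>S\<^esub> (e \<otimes>\<^bsub>S\<^esub> \<iota> b \<oplus>\<^bsub>S\<^esub> \<iota> f)))" .
  obtain g where g [simp]: "g \<in> carrier S" and ig: "i = \<iota> b \<oplus>\<^bsub>S\<^esub> \<iota> c \<otimes>\<^bsub>S\<^esub> g"
    by (rule that[OF _ i_eq]) simp
  show "hd.hyp_scale (t \<otimes>\<^bsub>S\<^esub> t) \<in> hd.L.Og" by simp
  show "w \<in> hs.L.Og" by (rule w)
  fix x assume "x \<in> hs.L.V"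
  then obtain r s y where [simp]: "r \<in> carrier R" "s \<in> carrier R" "y \<in> src.V" and xh: "x = hs.hv r s y"
    using hs.hv_cases by metis
  have "hd.L.vcong (\<iota> c) (hd.hyp_scale (t \<otimes>\<^bsub>S\<^esub> t) (LL.vm x))
      (LL.vm (hs.hv (a \<otimes>\<^bsub>R\<^esub> a \<otimes>\<^bsub>R\<^esub> r) (b \<otimes>\<^bsub>R\<^esub> b \<otimes>\<^bsub>R\<^esub> s) y))"
    unfolding xh
  proof (simp add: vm_hv itt, fold i_def, rule hd.hv_vcong)
    have "t \<otimes>\<^bsub>S\<^esub> t \<otimes>\<^bsub>S\<^esub> \<iota> r = \<iota> a \<otimes>\<^bsub>S\<^esub> \<iota> a \<otimes>\<^bsub>S\<^esub> \<iota> r \<oplus>\<^bsub>S\<^esub>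
        \<iota> c \<otimes>\<^bsub>S\<^esub> ((e \<otimes>\<^bsub>S\<^esub> \<iota> a \<oplus>\<^bsub>S\<^esub> \<iota> a \<otimes>\<^bsub>S\<^esub> e \<oplus>\<^bsub>S\<^esub> \<iota> c \<otimes>\<^bsub>S\<^esub> e \<otimes>\<^bsub>S\<^esub> e) \<otimes>\<^bsub>S\<^esub> \<iota> r)"
      unfolding te by (rule dst.ring_eqI) (simp_all add: dst.emb_rules algebra_simps)
    then show "\<exists>d\<in>carrier S. t \<otimes>\<^bsub>S\<^esub> t \<otimes>\<^bsub>S\<^esub> \<iota> r = \<iota> a \<otimes>\<^bsub>S\<^esub> \<iota> a \<otimes>\<^bsub>S\<^esub> \<iota> r \<oplus>\<^bsub>S\<^esub> \<iota> c \<otimes>\<^bsub>S\<^esub> d"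
      by (rule bexI) simp
    have "i \<otimes>\<^bsub>S\<^esub> i \<otimes>\<^bsub>S\<^esub> \<iota> s = \<iota> b \<otimes>\<^bsub>S\<^esub> \<iota> b \<otimes>\<^bsub>S\<^esub> \<iota> s \<oplus>\<^bsub>S\<^esub>
        \<iota> c \<otimes>\<^bsub>S\<^esub> ((g \<otimes>\<^bsub>S\<^esub> \<iota> b \<oplus>\<^bsub>S\<^esub> \<iota> b \<otimes>\<^bsub>S\<^esub> g \<oplus>\<^bsub>S\<^esub> \<iota> c \<otimes>\<^bsub>S\<^esub> g \<otimes>\<^bsub>S\<^esub> g) \<otimes>\<^bsub>S\<^esub> \<iota> s)"
      unfolding ig by (rule dst.ring_eqI) (simp_all add: dst.emb_rules algebra_simps)
    then show "\<exists>d\<in>carrier S. i \<otimes>\<^bsub>S\<^esub> i \<otimes>\<^bsub>S\<^esub> \<iota> s = \<iota> b \<otimes>\<^bsub>S\<^esub> \<iota> b \<otimes>\<^bsub>S\<^esub> \<iota> s \<oplus>\<^bsub>S\<^esub> \<iota> c \<otimes>\<^bsub>S\<^esub> d"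
      by (rule bexI) simp
    show "dst.vcong (\<iota> c) (vm y) (vm y)" by (simp add: dst.vcong_refl)
  qed simp_all
  moreover have "hd.L.vcong (\<iota> c) (LL.vm (hs.hv (a \<otimes>\<^bsub>R\<^esub> a \<otimes>\<^bsub>R\<^esub> r) (b \<otimes>\<^bsub>R\<^esub> b \<otimes>\<^bsub>R\<^esub> s) y)) (LL.vm (w x))"
    unfolding xh by (rule hd.L.vcong_sym[OF LL.vm_vcong[OF w(2) c]]) simp_all
  ultimately show "hd.L.vcong (\<iota> c) (hd.hyp_scale (t \<otimes>\<^bsub>S\<^esub> t) (LL.vm x)) (LL.vm (w x))"
    by (rule hd.L.vcong_trans) simp
qed

end

context
  fixes p :: nat
  assumes p: "prime p"
begin

lemma padic_cong_component:
  assumes "y \<in> carrier (padic_int p)" "c \<in> carrier (padic_int p)"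
    "x = y \<oplus>\<^bsub>padic_int p\<^esub> padic_of_int p (int p ^ k) \<otimes>\<^bsub>padic_int p\<^esub> c"
  shows "x k = y k"
  unfolding assms(3) using padic_self_mod[OF p assms(1)]
  by (simp add: padic_add[OF p] padic_mult[OF p] padic_of_int_def)

text \<open>Elements with the same $k$-th component differ by a multiple of $p^k$, because the valuation of the
difference is at least $k$.\<close>

lemma padic_component_cong:
  assumes x: "x \<in> carrier (padic_int p)" and y: "y \<in> carrier (padic_int p)" and eq: "x k = y k"
  shows "\<exists>c\<in>carrier (padic_int p). x = y \<oplus>\<^bsub>padic_int p\<^esub> padic_of_int p (int p ^ k) \<otimes>\<^bsub>padic_int p\<^esub> c"
proof -
  let ?S = "padic_int p"
  interpret S: "domain" ?S by (rule padic_domain[OF p])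
  note emb_rules = emb_simps[OF S.is_cring]
  define d where "d = x \<ominus>\<^bsub>?S\<^esub> y"
  have d [simp]: "d \<in> carrier ?S" using x y by (simp add: d_def)
  have xd: "x = y \<oplus>\<^bsub>?S\<^esub> d"
    unfolding d_def by (rule emb_eqD[OF S.is_cring]) (use x y in \<open>simp_all add: emb_rules\<close>)
  have dk: "d k = 0"
  proof -
    have "(y k + d k) mod int p ^ k = y k mod int p ^ k"
      using arg_cong[OF xd, of "\<lambda>t. t k"] eq padic_self_mod[OF p y, of k] by (simp add: padic_add[OF p])
    then have "int p ^ k dvd d k" by (metis add_diff_cancel_left' mod_eq_dvd_iff)
    then show ?thesis using padic_self_mod[OF p d, of k] by (metis mod_0_imp_dvd dvd_imp_mod_0)
  qed
  have "\<exists>c\<in>carrier ?S. d = padic_of_int p (int p ^ k) \<otimes>\<^bsub>?S\<^esub> c"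
  proof (cases "d = \<zero>\<^bsub>?S\<^esub>")
    case True
    then show ?thesis using padic_of_int_closed[OF p] by (intro bexI[of _ "\<zero>\<^bsub>?S\<^esub>"]) simp_all
  next
    case False
    then obtain v u where u: "u \<in> Units ?S" and dv: "d = padic_of_int p (int p ^ v) \<otimes>\<^bsub>?S\<^esub> u"
      using padic_valuation[OF p d] by blast
    have uc: "u \<in> carrier ?S" "u 1 \<noteq> 0" using u padic_unit_iff[OF p] by auto
    have "k \<le> v"
    proof (rule ccontr)
      assume "\<not> k \<le> v"
      then obtain j where j: "k = Suc j + v" by (metis add.commute add_Suc_right less_imp_Suc_add not_le)
      have "int p ^ k dvd int p ^ v * u k"
        using dk unfolding dv by (simp add: padic_mult[OF p] padic_of_int_def mod_mult_left_eq mod_eq_0_iff_dvd)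
      then have "int p ^ Suc j dvd u k" using p by (simp add: j power_add prime_gt_0_nat)
      then have "int p dvd u k" by (metis dvd_mult_left power_Suc)
      then show False using padic_mod[OF p uc(1), of 1 k] uc(2) j by simp
    qed
    then obtain j where j: "v = k + j" using le_Suc_ex by blast
    have "padic_of_int p (int p ^ v) = padic_of_int p (int p ^ k) \<otimes>\<^bsub>?S\<^esub> padic_of_int p (int p ^ j)"
      using Ring.ring_hom_mult[OF padic_of_int_hom[OF p], of "int p ^ k" "int p ^ j"] by (simp add: j power_add)
    then have "d = padic_of_int p (int p ^ k) \<otimes>\<^bsub>?S\<^esub> (padic_of_int p (int p ^ j) \<otimes>\<^bsub>?S\<^esub> u)"
      unfolding dv using uc padic_of_int_closed[OF p] by (simp add: S.m_assoc)
    moreover have "padic_of_int p (int p ^ j) \<otimes>\<^bsub>?S\<^esub> u \<in> carrier ?S"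
      using uc padic_of_int_closed[OF p] by simp
    ultimately show ?thesis by blast
  qed
  then show ?thesis using xd by blast
qed

end

section \<open>Integral lattices and their completions\<close>

lemma int_bform: "bform \<Z> n G x y = (\<Sum>i<n. \<Sum>j<n. x i * G i j * y j)"
  by (simp add: bform_def int_finsum_eq)

lemma int_vec_iff: "x \<in> carrier (coord_module \<Z> n) \<longleftrightarrow> x \<in> extensional {..<n}"
  by (simp add: coord_module_def PiE_def)

locale int_lattice =
  fixes n :: nat and G :: "nat \<Rightarrow> nat \<Rightarrow> int"
  assumes even: "even_lattice \<Z> n G" and nondeg: "nondegenerate \<Z> n G"
begin

lemma int_quadratic_lattice: "quadratic_lattice \<Z> n G"
proof (intro quadratic_lattice.intro quadratic_lattice_axioms.intro)
  show "domain \<Z>" by (rule int.domain_axioms)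
  show "G i j = G j i" if "i < n" "j < n" for i j
    using even that by (simp add: even_lattice_def)
  show "\<exists>h\<in>carrier \<Z>. G i i = h \<oplus>\<^bsub>\<Z>\<^esub> h" if i: "i < n" for i
  proof -
    let ?e = "\<lambda>k\<in>{..<n}. if k = i then 1 else (0::int)"
    have "bform \<Z> n G ?e ?e = (\<Sum>k<n. \<Sum>l<n. if k = i then if l = i then G i i else 0 else 0)"
      unfolding int_bform by (intro sum.cong refl) auto
    also have "\<dots> = (\<Sum>k<n. if k = i then G i i else 0)"
      using i by (intro sum.cong refl) simp
    also have "\<dots> = G i i" using i by simp
    finally have "bform \<Z> n G ?e ?e = G i i" .
    moreover have "?e \<in> carrier (coord_module \<Z> n)" unfolding int_vec_iff by (rule restrict_extensional)
    then have "\<exists>h\<in>carrier \<Z>. bform \<Z> n G ?e ?e = h \<oplus>\<^bsub>\<Z>\<^esub> h"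
      using even unfolding even_lattice_def by blast
    ultimately show ?thesis by simp
  qed
qed simp_all

end

sublocale int_lattice \<subseteq> Z: quadratic_lattice \<Z> n G
  by (rule int_quadratic_lattice)

sublocale int_lattice \<subseteq> Z: hyp_lattice \<Z> n G
  by unfold_locales

context int_lattice
begin

text \<open>Rows of the adjugate of the Gram matrix; its determinant is non-zero because a vector in its kernel
is orthogonal to the whole lattice.\<close>

lemma dual_basis:
  "\<exists>d X. d \<noteq> 0 \<and> (\<forall>k<n. X k \<in> Z.V \<and> (\<forall>y\<in>Z.V. Z.B (X k) y = d * y k))"
proof -
  define A where "A = mat n n (\<lambda>(i, j). G i j)"
  have A: "A \<in> carrier_mat n n" by (simp add: A_def)
  define X where "X k = (\<lambda>i\<in>{..<n}. adj_mat A $$ (k, i))" for k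
  have "det A \<noteq> 0"
  proof
    assume "det A = 0"
    then obtain v where v: "v \<in> carrier_vec n" "v \<noteq> 0\<^sub>v n" "A *\<^sub>v v = 0\<^sub>v n"
      using det_0_iff_vec_prod_zero[OF A] by blast
    define x where "x = (\<lambda>i\<in>{..<n}. v $ i)"
    have x: "x \<in> Z.V" by (simp add: int_vec_iff x_def)
    have "Z.B x y = 0" if "y \<in> Z.V" for y
    proof -
      have "Z.B x y = Z.B y x" using Z.bform_sym[OF x that] .
      also have "\<dots> = (\<Sum>i<n. y i * (\<Sum>j<n. G i j * v $ j))"
        unfolding int_bform by (simp add: x_def sum_distrib_left mult.assoc)
      also have "\<dots> = (\<Sum>i<n. y i * (A *\<^sub>v v) $ i)"
        using v(1) by (intro sum.cong refl) (simp add: A_def scalar_prod_def atLeast0LessThan)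
      also have "\<dots> = 0" unfolding v(3) by simp
      finally show ?thesis .
    qed
    then have x0: "x = \<zero>\<^bsub>coord_module \<Z> n\<^esub>" using nondeg x by (simp add: nondegenerate_def)
    have "v $ i = 0" if "i < n" for i
      using arg_cong[OF x0, of "\<lambda>f. f i"] that by (simp add: x_def)
    then have "v = 0\<^sub>v n" using v(1) by (intro eq_vecI) simp_all
    then show False using v(2) by simp
  qed
  moreover have "X k \<in> Z.V \<and> (\<forall>y\<in>Z.V. Z.B (X k) y = det A * y k)" if k: "k < n" for k
  proof (intro conjI ballI)
    show "X k \<in> Z.V" by (simp add: X_def int_vec_iff)
    fix y
    have adj: "(\<Sum>i<n. adj_mat A $$ (k, i) * G i j) = (if k = j then det A else 0)" if j: "j < n" for j
    proof -
      have "(adj_mat A * A) $$ (k, j) = (\<Sum>i<n. adj_mat A $$ (k, i) * G i j)"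
        using k j adj_mat(1)[OF A] by (simp add: A_def scalar_prod_def atLeast0LessThan)
      from this[symmetric] show ?thesis using adj_mat(3)[OF A] k j by (cases "k = j") simp_all
    qed
    have "Z.B (X k) y = (\<Sum>j<n. \<Sum>i<n. adj_mat A $$ (k, i) * G i j * y j)"
      unfolding int_bform by (subst sum.swap) (simp add: X_def)
    also have "\<dots> = (\<Sum>j<n. (\<Sum>i<n. adj_mat A $$ (k, i) * G i j) * y j)"
      by (simp add: sum_distrib_right)
    also have "\<dots> = (\<Sum>j<n. if k = j then det A * y j else 0)"
      using adj by (intro sum.cong refl) auto
    also have "\<dots> = det A * y k" using k by simp
    finally show "Z.B (X k) y = det A * y k" .
  qed
  ultimately show ?thesis by blast
qed

lemma padic_hyp_hom:
  assumes p: "prime p"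
  shows "hyp_hom \<Z> (padic_int p) n G (map_gram (padic_of_int p) G) (padic_of_int p)"
proof -
  have q: "quadratic_lattice (padic_int p) n (map_gram (padic_of_int p) G)"
  proof (intro quadratic_lattice.intro quadratic_lattice_axioms.intro)
    show "domain (padic_int p)" by (rule padic_domain[OF p])
    fix i j
    show "x = \<zero>\<^bsub>padic_int p\<^esub>" if "x \<in> carrier (padic_int p)" "x \<oplus>\<^bsub>padic_int p\<^esub> x = \<zero>\<^bsub>padic_int p\<^esub>" for x
      by (rule padic_two_torsion_free[OF p that])
    show "map_gram (padic_of_int p) G i j \<in> carrier (padic_int p)"
      by (simp add: map_gram_def padic_of_int_closed[OF p])
    show "map_gram (padic_of_int p) G i j = map_gram (padic_of_int p) G j i" if "i < n" "j < n"
      using Z.gram_sym[OF that] by (simp add: map_gram_def)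
    show "\<exists>h\<in>carrier (padic_int p). map_gram (padic_of_int p) G i i = h \<oplus>\<^bsub>padic_int p\<^esub> h" if i: "i < n"
    proof -
      obtain h where "G i i = h + h" using Z.gram_even[OF i] by auto
      then show ?thesis
        using Ring.ring_hom_add[OF padic_of_int_hom[OF p], of h h] padic_of_int_closed[OF p]
        by (intro bexI[of _ "padic_of_int p h"]) (simp_all add: map_gram_def)
    qed
  qed
  then interpret q: quadratic_lattice "padic_int p" n "map_gram (padic_of_int p) G" .
  show ?thesis
    by unfold_locales (simp_all add: padic_of_int_hom[OF p] map_gram_def)
qed

text \<open>The dual vectors are the images of the integral ones. Their defining property is linear in \<open>y\<close> and
so needs to be checked on the unit vectors only, which also come from the integral lattice.\<close>

lemma padic_local_lattice:
  assumes p: "prime p"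
  shows "\<exists>d X. local_lattice (padic_int p) n (map_gram (padic_of_int p) G) d X"
proof -
  interpret H: hyp_hom \<Z> "padic_int p" n G "map_gram (padic_of_int p) G" "padic_of_int p"
    by (rule padic_hyp_hom[OF p])
  let ?S = "padic_int p"
  obtain d X where d: "d \<noteq> 0" and X: "\<And>k. k < n \<Longrightarrow> X k \<in> Z.V"
    "\<And>k y. k < n \<Longrightarrow> y \<in> Z.V \<Longrightarrow> Z.B (X k) y = d * y k"
    using dual_basis by blast
  have dc: "padic_of_int p d \<in> carrier ?S" by (rule padic_of_int_closed[OF p])
  have "local_lattice ?S n (map_gram (padic_of_int p) G) (padic_of_int p d) (\<lambda>k. H.vm (X k))"
  proof unfold_locales
    show "a \<in> Units ?S \<or> b \<in> Units ?S"
      if "a \<in> carrier ?S" "b \<in> carrier ?S" "a \<oplus>\<^bsub>?S\<^esub> b \<in> Units ?S" for a b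
      using that by (rule padic_local[OF p])
    show "\<exists>t\<in>carrier ?S. a = b \<otimes>\<^bsub>?S\<^esub> t \<or> b = a \<otimes>\<^bsub>?S\<^esub> t"
      if "a \<in> carrier ?S" "b \<in> carrier ?S" for a b
      using that by (rule padic_divides_total[OF p])
    show "padic_of_int p d \<noteq> \<zero>\<^bsub>?S\<^esub>"
    proof -
      have "\<zero>\<^bsub>?S\<^esub> = padic_of_int p 0" by (simp add: padic_int_def padic_of_int_def)
      then show ?thesis using d padic_of_int_eq_iff[OF p, of d 0] by simp
    qed
    show "padic_of_int p d \<in> carrier ?S" by (rule dc)
    fix k assume k: "k < n"
    show Xk: "H.vm (X k) \<in> H.dst.V" using X(1)[OF k] by simp
    fix y assume "y \<in> H.dst.V"
    then show "H.dst.B (H.vm (X k)) y = padic_of_int p d \<otimes>\<^bsub>?S\<^esub> y k"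
    proof (induction rule: H.dst.vec_induct)
      case zero
      show ?case using k Xk dc H.dst.bform_sym[OF Xk H.dst.vzero_closed] by simp
    next
      case (step y a j)
      have "H.dst.B (H.vm (X k)) (H.dst.uvec j) = padic_of_int p (Z.B (X k) (Z.uvec j))"
        unfolding H.vm_uvec[symmetric] using X(1)[OF k] by (intro H.bform_vm) simp_all
      also have "\<dots> = padic_of_int p d \<otimes>\<^bsub>?S\<^esub> H.dst.uvec j k"
        using X(2)[OF k Z.uvec_closed] k H.h.hom_zero dc by auto
      finally have u: "H.dst.B (H.vm (X k)) (H.dst.uvec j) = padic_of_int p d \<otimes>\<^bsub>?S\<^esub> H.dst.uvec j k" .
      have uk: "H.dst.uvec j k \<in> carrier ?S" using k by simp
      show ?case
        using step k Xk dc uk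
        by (simp add: u H.dst.r_distr del: H.dst.uvec_comp)
           (intro H.dst.ring_eqI, simp_all add: H.dst.emb_rules del: H.dst.uvec_comp)
    qed
  qed
  then show ?thesis by blast
qed

end

section \<open>Rescalings of the hyperbolic plane modulo m\<close>

text \<open>With $l = 2h + 1$, each of $ax^2$ and $c - by^2$ takes $h + 1$ values modulo $l$ on $0, \dots, h$, and
two sets of $h + 1$ residues cannot be disjoint.\<close>

lemma two_squares_mod_prime:
  fixes a b c :: int and l :: nat
  assumes l: "prime l" "odd l" and a: "\<not> int l dvd a" and b: "\<not> int l dvd b"
  shows "\<exists>x y. [a * x ^ 2 + b * y ^ 2 = c] (mod int l)"
proof -
  define h where "h = (int l - 1) div 2"
  have h: "int l = 2 * h + 1" using l(2) by (auto simp: h_def elim!: oddE)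
  have pl: "prime (int l)" using l by simp
  have hpos: "h \<ge> 0" using prime_gt_1_nat[OF l(1)] h by simp
  have inj: "x = y"
    if xy: "x \<in> {0..h}" "y \<in> {0..h}" and d: "\<not> int l dvd d" and eq: "[d * x ^ 2 = d * y ^ 2] (mod int l)" for x y d :: int
  proof -
    have "int l dvd d * ((x - y) * (x + y))"
      using eq by (simp add: cong_iff_dvd_diff power2_eq_square algebra_simps)
    then have "int l dvd x - y \<or> int l dvd x + y"
      using d pl by (simp add: prime_dvd_mult_iff)
    then show "x = y"
    proof
      assume "int l dvd x - y"
      moreover have "\<bar>x - y\<bar> < int l" using xy h by auto
      ultimately have "x - y = 0" using dvd_imp_le_int[of "x - y" "int l"] by linarith
      then show ?thesis by simp
    next
      assume "int l dvd x + y"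
      moreover have "\<bar>x + y\<bar> < int l" using xy h by auto
      ultimately have "x + y = 0" using dvd_imp_le_int[of "x + y" "int l"] by linarith
      then show ?thesis using xy by simp
    qed
  qed
  let ?f = "\<lambda>x. (a * x ^ 2) mod int l" and ?g = "\<lambda>y. (c - b * y ^ 2) mod int l"
  have f: "inj_on ?f {0..h}" 
  proof (intro inj_onI inj[OF _ _ a])
    fix x y assume "?f x = ?f y"
    then show "[a * x ^ 2 = a * y ^ 2] (mod int l)" by (simp only: cong_def)
  qed
  have g: "inj_on ?g {0..h}"
  proof (intro inj_onI inj[OF _ _ b])
    fix x y assume "?g x = ?g y"
    then have "[c - b * x ^ 2 = c - b * y ^ 2] (mod int l)" by (simp only: cong_def)
    from cong_diff[OF cong_refl[of c] this]
    show "[b * x ^ 2 = b * y ^ 2] (mod int l)" by simp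
  qed
  have "?f ` {0..h} \<inter> ?g ` {0..h} \<noteq> {}"
  proof
    assume disj: "?f ` {0..h} \<inter> ?g ` {0..h} = {}"
    have "card (?f ` {0..h} \<union> ?g ` {0..h}) = card (?f ` {0..h}) + card (?g ` {0..h})"
      by (rule card_Un_disjoint) (use disj in simp_all)
    also have "\<dots> = 2 * nat (h + 1)" using f g hpos by (simp add: card_image)
    finally have c: "card (?f ` {0..h} \<union> ?g ` {0..h}) = 2 * nat (h + 1)" .
    have "?f ` {0..h} \<union> ?g ` {0..h} \<subseteq> {0..<int l}" using prime_gt_0_nat[OF l(1)] by auto
    from card_mono[OF _ this] have "2 * nat (h + 1) \<le> l" unfolding c by simp
    then show False using h hpos by linarith
  qed
  then obtain x y where "(a * x ^ 2) mod int l = (c - b * y ^ 2) mod int l" by auto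
  then have "[a * x ^ 2 + b * y ^ 2 = c - b * y ^ 2 + b * y ^ 2] (mod int l)"
    by (intro cong_add) (simp_all add: cong_def)
  then show ?thesis by auto
qed

lemma int_vcong_iff:
  assumes "quadratic_lattice \<Z> N H"
  shows "quadratic_lattice.vcong \<Z> N m x y \<longleftrightarrow>
    x \<in> carrier (coord_module \<Z> N) \<and> y \<in> carrier (coord_module \<Z> N) \<and> (\<forall>i<N. [x i = y i] (mod m))"
proof -
  interpret Z: quadratic_lattice \<Z> N H by (rule assms)
  show ?thesis
  proof (intro iffI conjI allI impI)
    assume c: "Z.vcong m x y"
    show "x \<in> Z.V" "y \<in> Z.V" using Z.vcong_closed[OF c] by auto
    obtain z where z: "x = y \<oplus>\<^bsub>coord_module \<Z> N\<^esub> (m \<odot>\<^bsub>coord_module \<Z> N\<^esub> z)"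
      using c unfolding Z.vcong_def by blast
    fix i assume "i < N"
    then have "x i = y i + m * z i" using arg_cong[OF z, of "\<lambda>f. f i"] by simp
    then show "[x i = y i] (mod m)" by (simp add: cong_def)
  next
    assume c: "x \<in> Z.V \<and> y \<in> Z.V \<and> (\<forall>i<N. [x i = y i] (mod m))"
    have e: "\<exists>c. x i = y i + m * c" if "i < N" for i
    proof -
      have "[y i = x i] (mod m)" using c that by (blast intro: cong_sym)
      then show ?thesis unfolding cong_iff_lin .
    qed
    show "Z.vcong m x y" by (rule Z.vcongI) (use c e in simp_all)
  qed
qed

context int_lattice
begin

lemmas vcong_iff = int_vcong_iff[OF Z.quadratic_lattice_axioms]
lemmas L_vcong_iff = int_vcong_iff[OF Z.L.quadratic_lattice_axioms]

text \<open>Modulo \<open>m\<close>, some element of $\mathrm{W}^\pm$ is the rescaling by $t^2$. The inverse of \<open>t\<close> modulo \<open>m\<close>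
is part of the data, as \<open>t\<close> is not a unit of the integers.\<close>

definition diag_approx :: "int \<Rightarrow> int \<Rightarrow> bool" where
  "diag_approx m t \<longleftrightarrow> (\<exists>w\<in>W_pm \<Z> n G. \<exists>t'. [t * t' = 1] (mod m) \<and>
     (\<forall>r s. \<forall>y\<in>Z.V. Z.L.vcong m (w (Z.hv r s y)) (Z.hv (t * t * r) (t' * t' * s) y)))"

lemma diag_approx_one: "diag_approx m 1"
  unfolding diag_approx_def using subgroup.one_closed[OF Z.W_pm_subgroup]
  by (intro bexI[of _ "\<one>\<^bsub>Z.L.M\<^esub>"] exI[of _ 1]) (simp_all add: Z.L.one_M Z.L.vcong_refl)

lemma diag_approx_mult:
  assumes "diag_approx m s" "diag_approx m t"
  shows "diag_approx m (s * t)"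
proof -
  obtain v s' where v: "v \<in> W_pm \<Z> n G" "[s * s' = 1] (mod m)"
    "\<And>a b y. y \<in> Z.V \<Longrightarrow> Z.L.vcong m (v (Z.hv a b y)) (Z.hv (s * s * a) (s' * s' * b) y)"
    using assms(1) unfolding diag_approx_def by blast
  obtain w t' where w: "w \<in> W_pm \<Z> n G" "[t * t' = 1] (mod m)"
    "\<And>a b y. y \<in> Z.V \<Longrightarrow> Z.L.vcong m (w (Z.hv a b y)) (Z.hv (t * t * a) (t' * t' * b) y)"
    using assms(2) unfolding diag_approx_def by blast
  have o: "v \<in> Z.L.Og" "w \<in> Z.L.Og" using v(1) w(1) Z.W_pm_orth by auto
  show ?thesis unfolding diag_approx_def
  proof (intro bexI exI conjI allI ballI)
    show "v \<otimes>\<^bsub>Z.L.M\<^esub> w \<in> W_pm \<Z> n G" by (rule subgroup.m_closed[OF Z.W_pm_subgroup v(1) w(1)])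
    show "[s * t * (s' * t') = 1] (mod m)" using cong_mult[OF v(2) w(2)] by (simp add: mult_ac)
    fix a b y assume y: "y \<in> Z.V"
    have "Z.L.vcong m ((v \<otimes>\<^bsub>Z.L.M\<^esub> w) (Z.hv a b y)) (Z.hv (s * s * (t * t * a)) (s' * s' * (t' * t' * b)) y)"
      by (rule Z.L.vcong_mult[OF o _ _ w(3)[OF y] v(3)[OF y]]) (use y in simp_all)
    then show "Z.L.vcong m ((v \<otimes>\<^bsub>Z.L.M\<^esub> w) (Z.hv a b y)) (Z.hv (s * t * (s * t) * a) (s' * t' * (s' * t') * b) y)"
      by (simp add: mult_ac)
  qed
qed

text \<open>Some $z$ in the span of $u$ and $v$ satisfies $m^2 q(z) \equiv 1$ modulo $l$, since
$m^2 q(u)$ and $m^2 q(v)$ are prime to $l$. This yields $\beta$ with $l\beta + m^2 q(z) = 1$, as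
\<open>hyp_scale_square_approx\<close> requires.\<close>

lemma diag_approx_prime:
  fixes l :: nat
  assumes uv: "u \<in> Z.V" "v \<in> Z.V" "Z.B u v = 0"
    and m: "even m" "Z.Q u dvd m" "Z.Q v dvd m" and l: "prime l" "\<not> int l dvd m"
  shows "diag_approx m (int l)"
proof -
  have odd: "odd l"
  proof
    assume "even l"
    then have "l = 2" using l(1) by (metis primes_dvd_imp_eq two_is_prime_nat)
    then show False using l(2) m(1) by simp
  qed
  have pl: "prime (int l)" using l by simp
  have nd: "\<not> int l dvd m * m * Z.Q w" if "Z.Q w dvd m" for w
    using l(2) that pl by (auto simp: prime_dvd_mult_iff dest: dvd_trans)
  obtain x y where xy: "[m * m * Z.Q u * x ^ 2 + m * m * Z.Q v * y ^ 2 = 1] (mod int l)"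
    using two_squares_mod_prime[OF l(1) odd nd[OF m(2)] nd[OF m(3)]] by blast
  define z where "z = x \<odot>\<^bsub>coord_module \<Z> n\<^esub> u \<oplus>\<^bsub>coord_module \<Z> n\<^esub> (y \<odot>\<^bsub>coord_module \<Z> n\<^esub> v)"
  have z: "z \<in> Z.V" unfolding z_def by (intro Z.vadd_closed Z.vsmult_closed uv) simp_all
  have xu: "x \<odot>\<^bsub>coord_module \<Z> n\<^esub> u \<in> Z.V" "y \<odot>\<^bsub>coord_module \<Z> n\<^esub> v \<in> Z.V"
    by (intro Z.vsmult_closed uv; simp)+
  have "Z.Q z = Z.Q u * x ^ 2 + Z.Q v * y ^ 2"
    unfolding z_def using uv xu
    by (simp add: Z.qform_add Z.qform_smult power2_eq_square mult_ac)
  then have "[m * (m * Z.Q z) = 1] (mod int l)" using xy by (simp add: algebra_simps)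
  then obtain \<beta> where \<beta>: "1 = m * (m * Z.Q z) + int l * \<beta>" unfolding cong_iff_lin by blast
  then have eq: "int l * \<beta> + m * (m * Z.Q z) = 1" by simp
  have "\<exists>w\<in>W_pm \<Z> n G. \<forall>r\<in>carrier \<Z>. \<forall>s\<in>carrier \<Z>. \<forall>y\<in>Z.V.
      Z.L.vcong m (w (Z.hv r s y)) (Z.hv (int l \<otimes>\<^bsub>\<Z>\<^esub> int l \<otimes>\<^bsub>\<Z>\<^esub> r) (\<beta> \<otimes>\<^bsub>\<Z>\<^esub> \<beta> \<otimes>\<^bsub>\<Z>\<^esub> s) y)"
    by (rule Z.hyp_scale_square_approx[OF _ _ _ z]) (use eq in simp_all)
  moreover have "[int l * \<beta> = 1] (mod m)"
    using eq by (metis cong_iff_lin)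
  ultimately show ?thesis unfolding diag_approx_def by auto
qed

lemma diag_approx_coprime:
  fixes t :: nat
  assumes uv: "u \<in> Z.V" "v \<in> Z.V" "Z.B u v = 0"
    and m: "even m" "Z.Q u dvd m" "Z.Q v dvd m"
  shows "t > 0 \<Longrightarrow> coprime (int t) m \<Longrightarrow> diag_approx m (int t)"
proof (induction t rule: prime_divisors_induct)
  case (unit x)
  then show ?case by (simp add: diag_approx_one)
next
  case (factor l x)
  have c: "coprime (int l) m" "coprime (int x) m" using factor.prems by simp_all
  have "\<not> int l dvd m"
  proof
    assume "int l dvd m"
    then have "is_unit (int l)" using c(1) coprime_absorb_left by blast
    then show False using prime_gt_1_nat[OF factor.hyps(1)] by simp
  qed
  then have "diag_approx m (int l)" using factor.hyps by (intro diag_approx_prime[OF uv m])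
  moreover have "diag_approx m (int x)" using factor c by simp
  ultimately show ?case using diag_approx_mult by simp
qed simp

text \<open>Orthogonalize a vector of negative norm against one of positive norm.\<close>

lemma indefinite_orthogonal_pair:
  assumes "indefinite n G"
  shows "\<exists>u\<in>Z.V. \<exists>v\<in>Z.V. Z.B u v = 0 \<and> Z.Q u \<noteq> 0 \<and> Z.Q v \<noteq> 0"
proof -
  obtain u v where uv: "u \<in> Z.V" "v \<in> Z.V" "Z.B u u > 0" "Z.B v v < 0"
    using assms unfolding indefinite_def by blast
  have Q: "Z.B x x = 2 * Z.Q x" if "x \<in> Z.V" for x
    using Z.qform_double[OF that] by simp
  define w where "w = Z.B u u \<odot>\<^bsub>coord_module \<Z> n\<^esub> v \<oplus>\<^bsub>coord_module \<Z> n\<^esub> ((- Z.B u v) \<odot>\<^bsub>coord_module \<Z> n\<^esub> u)"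
  have s: "a \<odot>\<^bsub>coord_module \<Z> n\<^esub> x \<in> Z.V" if "x \<in> Z.V" for a x by (intro Z.vsmult_closed that) simp
  have w: "w \<in> Z.V" unfolding w_def by (intro Z.vadd_closed s uv)
  have "Z.B u w = 0" unfolding w_def using uv s by (simp add: mult.commute)
  moreover have "Z.B w w = Z.B u u * (Z.B u u * Z.B v v - Z.B u v * Z.B u v)"
  proof -
    have "Z.B w w = Z.B u u * Z.B w v" using uv s w calculation Z.bform_sym[OF w uv(1)]
      by (subst (2) w_def) simp
    also have "Z.B w v = Z.B u u * Z.B v v - Z.B u v * Z.B u v" unfolding w_def using uv s by simp
    finally show ?thesis .
  qed
  moreover have "Z.B u u * Z.B v v - Z.B u v * Z.B u v < 0"
    using mult_pos_neg[OF uv(3,4)] zero_le_square[of "Z.B u v"] by linarith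
  ultimately have "Z.B u w = 0" "Z.B w w \<noteq> 0" using uv(3) by auto
  then show ?thesis using uv w Q by (metis less_irrefl mult_zero_right)
qed

end

context int_lattice
begin

section \<open>From local to global\<close>

lemma approx_imp_vcong:
  assumes p: "prime p" and g: "g \<in> Z.L.Og" and y: "y \<in> Z.L.V"
    and approx: "hyp_hom.approx \<Z> (padic_int p) n G (map_gram (padic_of_int p) G) (padic_of_int p)
      (padic_of_int p (int p ^ k)) (base_change \<Z> (padic_int p) (padic_of_int p) (n + 2) g) w"
  shows "Z.L.vcong (int p ^ k) (g y) (w y)"
proof -
  interpret H: hyp_hom \<Z> "padic_int p" n G "map_gram (padic_of_int p) G" "padic_of_int p"
    by (rule padic_hyp_hom[OF p])
  have w: "w \<in> Z.L.Og" and c: "H.hd.L.vcong (padic_of_int p (int p ^ k)) (H.LL.vm (g y)) (H.LL.vm (w y))"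
    using approx y H.LL.bc_vm[OF Z.L.orthD(2)[OF g] y] by (auto simp: H.approx_def)
  obtain z where z: "z \<in> H.hd.L.V"
    "H.LL.vm (g y) = H.hd.L.vadd (H.LL.vm (w y)) (H.hd.L.vsmult (padic_of_int p (int p ^ k)) z)"
    using c unfolding H.hd.L.vcong_def by blast
  show ?thesis unfolding L_vcong_iff
  proof (intro conjI allI impI)
    show "g y \<in> Z.L.V" "w y \<in> Z.L.V" using g w y by (auto intro: Z.L.orthD(3))
    fix i assume i: "i < n + 2"
    have "padic_of_int p (g y i) = padic_of_int p (w y i) \<oplus>\<^bsub>padic_int p\<^esub>
        padic_of_int p (int p ^ k) \<otimes>\<^bsub>padic_int p\<^esub> z i"
      using arg_cong[OF z(2), of "\<lambda>f. f i"] i by simp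
    from padic_cong_component[OF p _ _ this] have "padic_of_int p (g y i) k = padic_of_int p (w y i) k"
      using z(1) i padic_of_int_closed[OF p] by simp
    then show "[g y i = w y i] (mod int p ^ k)" by (simp add: padic_of_int_def cong_def)
  qed
qed

text \<open>The property is stable under products, so it suffices to treat the factors of the decomposition
\<open>W_pm_decompose\<close>. For a transvection the direction is lifted to an integral vector divisible by
$m$; for a rescaling the unit is lifted to a positive integer congruent to one modulo $m$.\<close>

lemma local_approx:
  fixes p :: nat and m :: int
  assumes p: "prime p" and k: "k \<ge> 1" and cop: "coprime (int p ^ k) m" and m: "m > 0"
    and diag: "\<And>t :: nat. t > 0 \<Longrightarrow> coprime (int t) (int p ^ k * m) \<Longrightarrow> diag_approx (int p ^ k * m) (int t)"
    and g: "g \<in> W_pm (padic_int p) n (map_gram (padic_of_int p) G)"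
  shows "\<exists>w\<in>W_pm \<Z> n G.
    hyp_hom.approx \<Z> (padic_int p) n G (map_gram (padic_of_int p) G) (padic_of_int p)
      (padic_of_int p (int p ^ k)) g w \<and> (\<forall>y\<in>Z.L.V. Z.L.vcong m (w y) y)"
proof -
  let ?S = "padic_int p" and ?i = "padic_of_int p"
  interpret H: hyp_hom \<Z> ?S n G "map_gram ?i G" ?i
    by (rule padic_hyp_hom[OF p])
  obtain d X where "local_lattice ?S n (map_gram ?i G) d X" using padic_local_lattice[OF p] by blast
  then interpret P: local_lattice ?S n "map_gram ?i G" d X .
  let ?c = "?i (int p ^ k)"
  have c: "?c \<in> carrier ?S" by (rule padic_of_int_closed[OF p])
  define good where "good g \<longleftrightarrow> (\<exists>w\<in>W_pm \<Z> n G. H.approx ?c g w \<and> (\<forall>y\<in>Z.L.V. Z.L.vcong m (w y) y))" for g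
  have one: "good \<one>\<^bsub>H.hd.L.M\<^esub>"
    unfolding good_def using subgroup.one_closed[OF Z.W_pm_subgroup] H.approx_one[OF c]
    by (intro bexI[of _ "\<one>\<^bsub>Z.L.M\<^esub>"]) (simp_all add: Z.L.one_M Z.L.vcong_refl)
  have mult: "good (g \<otimes>\<^bsub>H.hd.L.M\<^esub> h)" if gh: "good g" "good h" for g h
  proof -
    obtain v w where v: "v \<in> W_pm \<Z> n G" "H.approx ?c g v" "\<And>y. y \<in> Z.L.V \<Longrightarrow> Z.L.vcong m (v y) y"
      and w: "w \<in> W_pm \<Z> n G" "H.approx ?c h w" "\<And>y. y \<in> Z.L.V \<Longrightarrow> Z.L.vcong m (w y) y"
      using gh unfolding good_def by blast
    have o: "v \<in> Z.L.Og" "w \<in> Z.L.Og" using v(1) w(1) Z.W_pm_orth by auto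
    have "Z.L.vcong m ((v \<otimes>\<^bsub>Z.L.M\<^esub> w) y) y" if y: "y \<in> Z.L.V" for y
      by (rule Z.L.vcong_mult[OF o _ y w(3)[OF y] v(3)[OF y]]) simp
    then show ?thesis unfolding good_def
      using H.approx_mult[OF v(2) w(2) c] subgroup.m_closed[OF Z.W_pm_subgroup v(1) w(1)] by blast
  qed
  have lift: "\<exists>b'\<in>Z.V. H.dst.vcong ?c b (H.vm b') \<and> Z.vcong m b' Z.vzero"
    if b: "b \<in> H.dst.V" for b
  proof -
    have "\<forall>i. \<exists>x. [x = b i k] (mod int p ^ k) \<and> [x = 0] (mod m)"
      using binary_chinese_remainder_int[OF cop] by blast
    then obtain f where f: "\<And>i. [f i = b i k] (mod int p ^ k)" "\<And>i. [f i = 0] (mod m)" by metis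
    define b' where "b' = (\<lambda>i\<in>{..<n}. f i)"
    have b': "b' \<in> Z.V" unfolding b'_def int_vec_iff by (rule restrict_extensional)
    have "H.dst.vcong ?c b (H.vm b')"
    proof (rule H.dst.vcongI[OF b _ _ c])
      show "H.vm b' \<in> H.dst.V" by (rule H.vm_closed[OF b'])
      fix i assume i: "i < n"
      have bi: "b i \<in> carrier ?S" using b i by simp
      have "b i k = ?i (f i) k"
        using f(1)[of i] padic_self_mod[OF p bi, of k] by (simp add: padic_of_int_def cong_def)
      from padic_component_cong[OF p bi padic_of_int_closed[OF p] this]
      show "\<exists>e\<in>carrier ?S. b i = H.vm b' i \<oplus>\<^bsub>?S\<^esub> ?c \<otimes>\<^bsub>?S\<^esub> e"
        using i by (simp add: b'_def)
    qed
    moreover have "Z.vcong m b' Z.vzero"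
      unfolding vcong_iff using b' f(2) Z.vzero_closed by (auto simp: b'_def)
    ultimately show ?thesis using b' by blast
  qed
  have eichler_e: "good (H.hd.eichler_e b)" if b: "b \<in> H.dst.V" for b
  proof -
    obtain b' where b': "b' \<in> Z.V" "H.dst.vcong ?c b (H.vm b')" "Z.vcong m b' Z.vzero"
      using lift[OF b] by blast
    have "Z.L.vcong m (Z.eichler_e b' y) y" if "y \<in> Z.L.V" for y
      using Z.eichler_e_vcong[OF b'(3) that] Z.eichler_e_zero[OF that] by simp
    then show ?thesis
      unfolding good_def using H.approx_eichler_e[OF b'(2,1) c] Z.eichler_e_W_pm[OF b'(1)] by blast
  qed
  have eichler_f: "good (H.hd.eichler_f b)" if b: "b \<in> H.dst.V" for b
  proof -
    obtain b' where b': "b' \<in> Z.V" "H.dst.vcong ?c b (H.vm b')" "Z.vcong m b' Z.vzero"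
      using lift[OF b] by blast
    have "Z.L.vcong m (Z.eichler_f b' y) y" if "y \<in> Z.L.V" for y
      using Z.eichler_f_vcong[OF b'(3) that] Z.eichler_f_zero[OF that] by simp
    then show ?thesis
      unfolding good_def using H.approx_eichler_f[OF b'(2,1) c] Z.eichler_f_W_pm[OF b'(1)] by blast
  qed
  have eichler_group: "good e" if "e \<in> H.hd.eichler_group" for e
    using that by (induction rule: H.hd.eichler_group_induct) (auto intro: one mult eichler_e eichler_f)
  have hyp_scale: "good (H.hd.hyp_scale (t \<otimes>\<^bsub>?S\<^esub> t))" if t: "t \<in> Units ?S" for t
  proof -
    let ?M = "int p ^ k * m"
    have tc: "t \<in> carrier ?S" "t 1 \<noteq> 0" using t padic_unit_iff[OF p] by auto
    have M: "?M > 0" using m prime_gt_0_nat[OF p] by simp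
    obtain x where x: "[x = t k] (mod int p ^ k)" "[x = 1] (mod m)"
      using binary_chinese_remainder_int[OF cop] by blast
    \<comment> \<open>Adding the modulus makes the representative positive.\<close>
    define s where "s = nat (x mod ?M + ?M)"
    have s: "int s = x mod ?M + ?M" using M pos_mod_sign[of ?M x] by (simp add: s_def)
    have spos: "s > 0" using s M pos_mod_sign[of ?M x] by linarith
    have sM: "[int s = x] (mod ?M)" unfolding s by (simp add: cong_def)
    have s1: "[int s = t k] (mod int p ^ k)" using sM x(1) by (meson cong_modulus_mult cong_trans)
    have s2: "[int s = 1] (mod m)" using sM x(2) by (metis cong_modulus_mult cong_trans mult.commute)
    have "coprime (int s) (int p ^ k)"
    proof -
      have "\<not> int p dvd t k"
        using padic_mod[OF p tc(1) k] tc(2) by (auto simp: mod_eq_0_iff_dvd)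
      then have "coprime (t k) (int p ^ k)"
        using p by (metis coprime_commute coprime_power_left_iff prime_imp_coprime prime_nat_int_transfer)
      then show ?thesis using s1 cong_imp_coprime cong_sym by blast
    qed
    moreover have "coprime (int s) m"
      using s2 cong_imp_coprime[OF cong_sym[OF s2]] by simp
    ultimately have "coprime (int s) ?M" by simp
    from diag[OF spos this] obtain w s' where w: "w \<in> W_pm \<Z> n G" and s': "[int s * s' = 1] (mod ?M)"
      and wv: "\<And>a b y. y \<in> Z.V \<Longrightarrow> Z.L.vcong ?M (w (Z.hv a b y)) (Z.hv (int s * int s * a) (s' * s' * b) y)"
      unfolding diag_approx_def by blast
    have s'm: "[s' = 1] (mod m)"
    proof -
      have "[int s * s' = 1] (mod m)" using s' by (metis cong_modulus_mult mult.commute)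
      moreover have "[int s * s' = 1 * s'] (mod m)" by (rule cong_mult[OF s2 cong_refl])
      ultimately show ?thesis by (metis cong_sym cong_trans mult_1)
    qed
    have "t k = ?i (int s) k"
      using s1 padic_self_mod[OF p tc(1), of k] by (simp add: padic_of_int_def cong_def)
    from padic_component_cong[OF p tc(1) padic_of_int_closed[OF p] this]
    have ts: "\<exists>e\<in>carrier ?S. t = ?i (int s) \<oplus>\<^bsub>?S\<^esub> ?c \<otimes>\<^bsub>?S\<^esub> e" .
    have "[1 = int s * s'] (mod int p ^ k)" using s' by (metis cong_modulus_mult cong_sym)
    then have ss: "\<exists>e. int s * s' = 1 + int p ^ k * e" unfolding cong_iff_lin .
    have wO: "w \<in> Z.L.Og" using w Z.W_pm_orth by blast
    have wk: "Z.L.vcong (int p ^ k) (w (Z.hv a b y)) (Z.hv (int s * int s * a) (s' * s' * b) y)"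
      if "y \<in> Z.V" for a b y
      using Z.L.vcong_factor[of "int p ^ k" m] wv[OF that] by simp
    have "H.approx ?c (H.hd.hyp_scale (t \<otimes>\<^bsub>?S\<^esub> t)) w"
      by (rule H.approx_hyp_scale_square[OF _ t _ _ ts, of s']) (use ss wO wk in simp_all)
    moreover have "Z.L.vcong m (w y) y" if y: "y \<in> Z.L.V" for y
    proof -
      obtain a b z where z: "z \<in> Z.V" and yh: "y = Z.hv a b z" using Z.hv_cases[OF y] by metis
      have "Z.L.vcong m (w y) (Z.hv (int s * int s * a) (s' * s' * b) z)"
        using Z.L.vcong_factor[of m "int p ^ k"] wv[OF z] unfolding yh by (simp add: mult.commute)
      moreover have "Z.L.vcong m (Z.hv (int s * int s * a) (s' * s' * b) z) (Z.hv a b z)"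
      proof -
        have *: "\<exists>c. u * u * v = v + m * c" if "[u = 1] (mod m)" for u v
        proof -
          have "[u * u * v = 1 * 1 * v] (mod m)" by (intro cong_mult that cong_refl)
          then have "[v = u * u * v] (mod m)" by (simp add: cong_sym)
          then show ?thesis unfolding cong_iff_lin .
        qed
        show ?thesis
          by (rule Z.hv_vcong) (use z *[OF s2] *[OF s'm] in \<open>simp_all add: Z.vcong_refl\<close>)
      qed
      ultimately show ?thesis unfolding yh by (rule Z.L.vcong_trans) simp
    qed
    ultimately show ?thesis unfolding good_def using w by blast
  qed
  obtain e t where "e \<in> H.hd.eichler_group" "t \<in> Units ?S" "g = e \<otimes>\<^bsub>H.hd.L.M\<^esub> H.hd.hyp_scale (t \<otimes>\<^bsub>?S\<^esub> t)"
    using P.W_pm_decompose[OF g] by blast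
  then have "good g" using mult eichler_group hyp_scale by blast
  then show ?thesis unfolding good_def .
qed

text \<open>Induction on $D$, splitting off the full power $p^k$ of one prime. If $w$ approximates $g$ modulo
$D' = D / p^k$, then $w^{-1} g$ is still locally in $\mathrm{W}^\pm$, and \<open>local_approx\<close> provides
an element close to it modulo $p^k$ and close to the identity modulo $m / p^k$. The complementary
factor $E$ keeps track of the latter modulus.\<close>

lemma global_approx:
  fixes D E :: nat
  assumes g: "g \<in> Z.L.Og"
    and loc: "\<And>p. prime p \<Longrightarrow> base_change \<Z> (padic_int p) (padic_of_int p) (n + 2) g
      \<in> W_pm (padic_int p) n (map_gram (padic_of_int p) G)"
    and diag: "\<And>t :: nat. t > 0 \<Longrightarrow> coprime (int t) (int m) \<Longrightarrow> diag_approx (int m) (int t)"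
    and m: "m > 0"
  shows "m = D * E \<Longrightarrow> coprime D E \<Longrightarrow> \<exists>w\<in>W_pm \<Z> n G. \<forall>y\<in>Z.L.V. Z.L.vcong (int D) (w y) (g y)"
proof (induction D arbitrary: E rule: less_induct)
  case (less D)
  have D: "D > 0" "E > 0" using less.prems m by auto
  show ?case
  proof (cases "D = 1")
    case True
    then show ?thesis
      using subgroup.one_closed[OF Z.W_pm_subgroup] g
      by (intro bexI[of _ "\<one>\<^bsub>Z.L.M\<^esub>"]) (simp_all add: L_vcong_iff Z.L.one_M Z.L.orthD(3))
  next
    case False
    then obtain p where p: "prime p" "p dvd D" using prime_factor_nat by blast
    obtain k D' where D': "D = p ^ k * D'" "\<not> p dvd D'"
      using multiplicity_decompose'[of D p] D p(1) by (metis not_prime_unit less_irrefl)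
    have k: "k \<ge> 1" using D' p(2) by (cases k) auto
    have "D' < D" using D'(1) k D prime_gt_1_nat[OF p(1)] one_less_power[of p k] by simp
    moreover have "coprime D' (p ^ k)"
      using D'(2) p(1) by (metis coprime_commute coprime_power_left_iff prime_imp_coprime)
    moreover have "coprime D' E" "coprime (p ^ k) E" using less.prems(2) D'(1) by simp_all
    ultimately obtain w where w: "w \<in> W_pm \<Z> n G" "\<And>y. y \<in> Z.L.V \<Longrightarrow> Z.L.vcong (int D') (w y) (g y)"
      using less.IH[of D' "p ^ k * E"] less.prems(1) D'(1) by (auto simp: mult_ac)
    interpret H: hyp_hom \<Z> "padic_int p" n G "map_gram (padic_of_int p) G" "padic_of_int p"
      by (rule padic_hyp_hom[OF p(1)])
    have wO: "w \<in> Z.L.Og" using w Z.W_pm_orth by blast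
    have iw: "inv\<^bsub>Z.L.M\<^esub> w \<in> W_pm \<Z> n G" "inv\<^bsub>Z.L.M\<^esub> w \<in> Z.L.Og"
      using subgroup.m_inv_closed[OF Z.W_pm_subgroup w(1)] Z.L.inv_orth[OF wO] by auto
    define h where "h = inv\<^bsub>Z.L.M\<^esub> w \<otimes>\<^bsub>Z.L.M\<^esub> g"
    have hO: "h \<in> Z.L.Og" unfolding h_def by (rule Z.L.orth_mult[OF iw(2) g])
    have wh: "w (h y) = g y" if y: "y \<in> Z.L.V" for y
      using y wO iw g by (simp add: h_def Z.L.mult_M Z.Og_Bij Z.L.inv_M Z.L.orthD(3))
    have hW: "H.LL.bc h \<in> W_pm (padic_int p) n (map_gram (padic_of_int p) G)"
      unfolding h_def H.LL.bc_mult[OF iw(2) g]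
      by (rule subgroup.m_closed[OF H.hd.W_pm_subgroup H.bc_W_pm[OF iw(1)] loc[OF p(1)]])
    have "coprime (int p ^ k) (int (D' * E))"
    proof -
      have "coprime (p ^ k) (D' * E)"
        using \<open>coprime D' (p ^ k)\<close> \<open>coprime (p ^ k) E\<close> coprime_mult_right_iff coprime_commute by blast
      then show ?thesis by (metis coprime_int_iff of_nat_power)
    qed
    moreover have "int (D' * E) > 0" using D D'(1) by simp
    moreover have "int p ^ k * int (D' * E) = int m" using less.prems(1) D'(1) by (simp add: mult_ac)
    ultimately obtain v where v: "v \<in> W_pm \<Z> n G"
      "H.approx (padic_of_int p (int p ^ k)) (H.LL.bc h) v"
      "\<And>y. y \<in> Z.L.V \<Longrightarrow> Z.L.vcong (int (D' * E)) (v y) y"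
      using local_approx[OF p(1) k _ _ _ hW, of "int (D' * E)"] diag by metis
    have vO: "v \<in> Z.L.Og" using v Z.W_pm_orth by blast
    show ?thesis
    proof (intro bexI ballI)
      show "w \<otimes>\<^bsub>Z.L.M\<^esub> v \<in> W_pm \<Z> n G" by (rule subgroup.m_closed[OF Z.W_pm_subgroup w(1) v(1)])
      fix y assume y: "y \<in> Z.L.V"
      have 1: "Z.L.vcong (int D') ((w \<otimes>\<^bsub>Z.L.M\<^esub> v) y) (g y)"
      proof (rule Z.L.vcong_mult[OF wO vO _ y _ w(2)[OF y]])
        show "Z.L.vcong (int D') (v y) y"
          using Z.L.vcong_factor[of "int D'" "int E"] v(3)[OF y] by simp
      qed simp
      have "Z.L.vcong (int p ^ k) (h y) (v y)" by (rule approx_imp_vcong[OF p(1) hO y v(2)])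
      then have vh: "Z.L.vcong (int p ^ k) (v y) (h y)" by (rule Z.L.vcong_sym) simp
      have "Z.L.vcong (int p ^ k) (w (h y)) (g y)"
        unfolding wh[OF y] by (rule Z.L.vcong_refl[OF Z.L.orthD(3)[OF g y]]) simp
      then have 2: "Z.L.vcong (int p ^ k) ((w \<otimes>\<^bsub>Z.L.M\<^esub> v) y) (g y)"
        by (rule Z.L.vcong_mult[OF wO vO _ y vh, rotated]) simp
      have "coprime (int p ^ k) (int D')"
        using \<open>coprime D' (p ^ k)\<close> by (metis coprime_commute coprime_int_iff of_nat_power)
      then show "Z.L.vcong (int D) ((w \<otimes>\<^bsub>Z.L.M\<^esub> v) y) (g y)"
        using 1 2 unfolding L_vcong_iff D'(1) by (auto intro: coprime_cong_mult)
    qed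
  qed
qed

text \<open>The level of the congruence subgroup is enlarged to a multiple $m$ of $2 q(u) q(v)$ for an orthogonal
pair $u$, $v$, as the lifting of rescalings requires.\<close>

theorem W_pm_eq_local:
  assumes indef: "indefinite n G"
    and congr: "congruence_subgroup (n + 2) (hyp_gram \<Z> G) (W_pm \<Z> n G)"
  shows "W_pm \<Z> n G =
    (\<Inter>p\<in>{p. prime p}.
       {g \<in> special_orth \<Z> (n + 2) (hyp_gram \<Z> G).
          base_change \<Z> (padic_int p) (padic_of_int p) (n + 2) g
            \<in> W_pm (padic_int p) n (map_gram (padic_of_int p) G)})" (is "_ = ?I")
proof (intro equalityI subsetI)
  have SO: "W_pm \<Z> n G \<subseteq> special_orth \<Z> (n + 2) (hyp_gram \<Z> G)"
    using congr by (simp add: congruence_subgroup_def)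
  fix g assume "g \<in> W_pm \<Z> n G"
  then show "g \<in> ?I" using SO hyp_hom.bc_W_pm[OF padic_hyp_hom] by blast
next
  have SO: "W_pm \<Z> n G \<subseteq> special_orth \<Z> (n + 2) (hyp_gram \<Z> G)"
    using congr by (simp add: congruence_subgroup_def)
  obtain m0 where m0: "m0 \<ge> 1" "principal_congruence (n + 2) (hyp_gram \<Z> G) m0 \<subseteq> W_pm \<Z> n G"
    using congr by (auto simp: congruence_subgroup_def)
  obtain u v where uv: "u \<in> Z.V" "v \<in> Z.V" "Z.B u v = 0" "Z.Q u \<noteq> 0" "Z.Q v \<noteq> 0"
    using indefinite_orthogonal_pair[OF indef] by blast
  \<comment> \<open>A multiple of the level that makes \<open>diag_approx_coprime\<close> applicable.\<close>
  define m where "m = 2 * nat \<bar>Z.Q u\<bar> * nat \<bar>Z.Q v\<bar> * m0"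
  have m: "m > 0" using uv m0 by (simp add: m_def)
  have mi: "int m = 2 * \<bar>Z.Q u\<bar> * \<bar>Z.Q v\<bar> * int m0" by (simp add: m_def)
  have diag: "diag_approx (int m) (int t)" if "t > 0" "coprime (int t) (int m)" for t
    by (rule diag_approx_coprime[OF uv(1-3) _ _ _ that]) (simp_all add: mi)
  fix g assume "g \<in> ?I"
  then have g: "g \<in> special_orth \<Z> (n + 2) (hyp_gram \<Z> G)"
    and loc: "\<And>p. prime p \<Longrightarrow> base_change \<Z> (padic_int p) (padic_of_int p) (n + 2) g
      \<in> W_pm (padic_int p) n (map_gram (padic_of_int p) G)"
    using two_is_prime_nat by blast+
  have gO: "g \<in> Z.L.Og" and gd: "det_endo \<Z> (n + 2) g = 1" using g by (simp_all add: special_orth_def)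
  obtain w where w: "w \<in> W_pm \<Z> n G" "\<And>y. y \<in> Z.L.V \<Longrightarrow> Z.L.vcong (int m) (w y) (g y)"
    using global_approx[OF gO loc diag m, of m 1] by auto
  have wO: "w \<in> Z.L.Og" using w Z.W_pm_orth by blast
  let ?i = "inv\<^bsub>Z.L.M\<^esub> w"
  have iw: "?i \<in> W_pm \<Z> n G" "?i \<in> Z.L.Og"
    using subgroup.m_inv_closed[OF Z.W_pm_subgroup w(1)] Z.L.inv_orth[OF wO] by auto
  have id: "det_endo \<Z> (n + 2) ?i = 1" using iw(1) SO by (auto simp: special_orth_def)
  have "?i \<otimes>\<^bsub>Z.L.M\<^esub> g \<in> principal_congruence (n + 2) (hyp_gram \<Z> G) m0"
    unfolding principal_congruence_def
  proof (intro CollectI conjI ballI allI impI)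
    show "?i \<otimes>\<^bsub>Z.L.M\<^esub> g \<in> special_orth \<Z> (n + 2) (hyp_gram \<Z> G)"
      using Z.L.det_endo_mult[OF iw(2) gO] Z.L.orth_mult[OF iw(2) gO] id gd by (simp add: special_orth_def)
    fix x i assume x: "x \<in> Z.L.V" and i: "i < n + 2"
    have "Z.L.vcong (int m) (?i (g x)) (?i (w x))"
      by (rule Z.L.vcong_lin[OF Z.L.orthD(2)[OF iw(2)] Z.L.vcong_sym[OF w(2)[OF x]]]) simp_all
    moreover have "?i (w x) = x" using x wO by (simp add: Z.L.inv_M Z.Og_Bij)
    moreover have "(?i \<otimes>\<^bsub>Z.L.M\<^esub> g) x = ?i (g x)"
      using x iw gO by (simp add: Z.L.mult_M Z.Og_Bij)
    ultimately have "[(?i \<otimes>\<^bsub>Z.L.M\<^esub> g) x i = x i] (mod int m)"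
      using i unfolding L_vcong_iff by simp
    then have "[(?i \<otimes>\<^bsub>Z.L.M\<^esub> g) x i = x i] (mod int m0)"
      unfolding mi by (metis cong_modulus_mult mult.commute)
    then show "(?i \<otimes>\<^bsub>Z.L.M\<^esub> g) x i mod int m0 = x i mod int m0" by (simp add: cong_def)
  qed
  then have ig: "?i \<otimes>\<^bsub>Z.L.M\<^esub> g \<in> W_pm \<Z> n G" using m0 by blast
  have "g = w \<otimes>\<^bsub>Z.L.M\<^esub> (?i \<otimes>\<^bsub>Z.L.M\<^esub> g)"
  proof (rule Z.L.Bij_eqI)
    show "g \<in> Bij Z.L.V" "w \<otimes>\<^bsub>Z.L.M\<^esub> (?i \<otimes>\<^bsub>Z.L.M\<^esub> g) \<in> Bij Z.L.V"
      using gO wO iw by (simp_all add: Z.Og_Bij)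
    show "g x = (w \<otimes>\<^bsub>Z.L.M\<^esub> (?i \<otimes>\<^bsub>Z.L.M\<^esub> g)) x" if "x \<in> Z.L.V" for x
      using that gO wO iw by (simp add: Z.L.mult_M Z.Og_Bij Z.L.inv_M Z.L.orthD(3))
  qed
  then show "g \<in> W_pm \<Z> n G" using subgroup.m_closed[OF Z.W_pm_subgroup w(1) ig] by simp
qed

end

theorem theorem6p9:
  fixes n :: nat and G :: "nat \<Rightarrow> nat \<Rightarrow> int"
  assumes "even_lattice \<Z> n G" and "nondegenerate \<Z> n G"
  shows
    "(indefinite n G \<longrightarrow>
        congruence_subgroup (n + 2) (hyp_gram \<Z> G) (W_pm \<Z> n G) \<longrightarrow>
        W_pm \<Z> n G =
          (\<Inter>p\<in>{p. prime p}.
             {g \<in> special_orth \<Z> (n + 2) (hyp_gram \<Z> G).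
                base_change \<Z> (padic_int p) (padic_of_int p) (n + 2) g
                  \<in> W_pm (padic_int p) n (map_gram (padic_of_int p) G)})) \<and>
     (\<forall>p. prime p \<longrightarrow>
        W_group (padic_int p) n (map_gram (padic_of_int p) G) =
          discr_orth (padic_int p) (n + 2)
            (hyp_gram (padic_int p) (map_gram (padic_of_int p) G))) \<and>
     (\<forall>p. prime p \<longrightarrow>
        W_pm (padic_int p) n (map_gram (padic_of_int p) G) =
          discr_special_orth_dagger (padic_int p) (n + 2)
            (hyp_gram (padic_int p) (map_gram (padic_of_int p) G)))"
proof -
  interpret int_lattice n G by (rule int_lattice.intro[OF assms])
  show ?thesis
  proof (intro conjI allI impI)
    show "W_pm \<Z> n G =
          (\<Inter>p\<in>{p. prime p}.
             {g \<in> special_orth \<Z> (n + 2) (hyp_gram \<Z> G).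
                base_change \<Z> (padic_int p) (padic_of_int p) (n + 2) g
                  \<in> W_pm (padic_int p) n (map_gram (padic_of_int p) G)})"
      if "indefinite n G" "congruence_subgroup (n + 2) (hyp_gram \<Z> G) (W_pm \<Z> n G)"
      by (rule W_pm_eq_local[OF that])
    fix p :: nat assume p: "prime p"
    obtain d X where "local_lattice (padic_int p) n (map_gram (padic_of_int p) G) d X"
      using padic_local_lattice[OF p] by blast
    then interpret local_lattice "padic_int p" n "map_gram (padic_of_int p) G" d X .
    show "W_group (padic_int p) n (map_gram (padic_of_int p) G) =
        discr_orth (padic_int p) (n + 2) (hyp_gram (padic_int p) (map_gram (padic_of_int p) G))"
      by (rule W_group_eq)
    show "W_pm (padic_int p) n (map_gram (padic_of_int p) G) =
        discr_special_orth_dagger (padic_int p) (n + 2) (hyp_gram (padic_int p) (map_gram (padic_of_int p) G))"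
      by (rule W_pm_eq)
  qed
qed

end
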